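(* Let $V\subseteq L^2(\mathbb{R}^d)$ be a nonzero finitely generated shift-invariant space and $L:V\to V$ a bounded shift-preserving operator. If $L$ is normal, then $L$ is $s$-diagonalizable, and for every $s$-diagonalization $(a_1,\dots,a_m)$ of $L$ we have $$L=\sum_{j=1}^m\Lambda_{a_j}P_{V_{a_j}},$$ where $P_{V_{a_j}}$ denotes the orthogonal projection of $V$ onto $V_{a_j}$, $j=1,\dots,m$.
   Context: For $k\in\mathbb{Z}^d$, $T_kf(x)=f(x-k)$. A closed subspace $V\subseteq L^2(\mathbb{R}^d)$ is shift invariant if $T_kf\in V$ for all $f\in V$, $k\in\mathbb{Z}^d$; it is finitely generated if $V=\overline{\mathrm{span}}\{T_k\varphi:\varphi\in\Phi,\ k\in\mathbb{Z}^d\}$ for some finite $\Phi\subset L^2(\mathbb{R}^d)$. An operator $L:V\to V$ is shift preserving if it is bounded, linear and $LT_k=T_kL$ for all $k\in\mathbb{Z}^d$. Let $\hat f(\omega)=\int f(x)e^{-2\pi i\langle\omega,x\rangle}dx$, and let $\mathcal{T}:L^2(\mathbb{R}^d)\to L^2([0,1)^d,\ell^2(\mathbb{Z}^d))$ be the isometric isomorphism $\mathcal{T}f(\omega)=\{\hat f(\omega+k)\}_{k\in\mathbb{Z}^d}$. A sequence $a\in\ell^2(\mathbb{Z}^d)$ is of bounded spectrum if $\hat a\in L^\infty([0,1)^d)$, where $\hat a(\omega)=\sum_k a_ke^{-2\pi i\langle\omega,k\rangle}$. Then $\Lambda_a$ is the bounded operator on $L^2(\mathbb{R}^d)$ with $\mathcal{T}(\Lambda_af)(\omega)=\hat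 a(\omega)\mathcal{T}f(\omega)$ for a.e. $\omega$. $\Lambda_a$ is an $s$-eigenvalue of $L$ if $V_a:=\ker(L-\Lambda_a)=\{f\in V:Lf=\Lambda_af\}\ne\{0\}$. $L$ is $s$-diagonalizable if there are finitely many ($m\ge1$) sequences of bounded spectrum $a_1,\dots,a_m$ such that $\Lambda_{a_1},\dots,\Lambda_{a_m}$ are $s$-eigenvalues of $L$ and $V=V_{a_1}\oplus\dots\oplus V_{a_m}$ (direct sum, not a priori orthogonal); then $(a_1,\dots,a_m)$ is called an $s$-diagonalization of $L$. *)

theory Defs
  imports "HOL-Analysis.Analysis"
begin

section \<open>The Hilbert space of square-integrable complex functions\<close>

definition square_integrable :: "('a::euclidean_space \<Rightarrow> complex) \<Rightarrow> bool" where
  "square_integrable f \<longleftrightarrow>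
     f \<in> borel_measurable lborel \<and> integrable lborel (\<lambda>x. (cmod (f x))\<^sup>2)"

definition L2_rel :: "('a::euclidean_space \<Rightarrow> complex) \<Rightarrow> ('a \<Rightarrow> complex) \<Rightarrow> bool" where
  "L2_rel f g \<longleftrightarrow> square_integrable f \<and> square_integrable g \<and> (AE x in lborel. f x = g x)"

lemma square_integrable_zero: "square_integrable (\<lambda>x. 0)"
  by (simp add: square_integrable_def)

lemma square_integrable_mult_cnj:
  assumes "square_integrable f" "square_integrable g"
  shows "integrable lborel (\<lambda>x. f x * cnj (g x))"
proof (rule Bochner_Integration.integrable_bound)
  show "integrable lborel (\<lambda>x. (cmod (f x))\<^sup>2 + (cmod (g x))\<^sup>2)"
    using assms by (auto simp: square_integrable_def)
  show "(\<lambda>x. f x * cnj (g x)) \<in> borel_measurable lborel"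
    using assms
    by (auto simp: square_integrable_def
        intro!: borel_measurable_times borel_measurable_continuous_on[of cnj] continuous_intros)
  show "AE x in lborel. norm (f x * cnj (g x)) \<le> norm ((cmod (f x))\<^sup>2 + (cmod (g x))\<^sup>2)"
  proof (rule AE_I2)
    fix x
    have "2 * (cmod (f x) * cmod (g x)) \<le> (cmod (f x))\<^sup>2 + (cmod (g x))\<^sup>2"
      using sum_squares_bound[of "cmod (f x)" "cmod (g x)"] by (simp add: mult.assoc)
    moreover have "0 \<le> cmod (f x) * cmod (g x)" by simp
    ultimately have "cmod (f x) * cmod (g x) \<le> (cmod (f x))\<^sup>2 + (cmod (g x))\<^sup>2"
      by linarith
    then show "norm (f x * cnj (g x)) \<le> norm ((cmod (f x))\<^sup>2 + (cmod (g x))\<^sup>2)"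
      by (simp add: norm_mult)
  qed
qed

lemma square_integrable_add:
  assumes "square_integrable f" "square_integrable g"
  shows "square_integrable (\<lambda>x. f x + g x)"
proof -
  have "integrable lborel (\<lambda>x. (cmod (f x + g x))\<^sup>2)"
  proof (rule Bochner_Integration.integrable_bound)
    show "integrable lborel (\<lambda>x. 2 * (cmod (f x))\<^sup>2 + 2 * (cmod (g x))\<^sup>2)"
      using assms by (auto simp: square_integrable_def)
    show "(\<lambda>x. (cmod (f x + g x))\<^sup>2) \<in> borel_measurable lborel"
      using assms by (auto simp: square_integrable_def)
    show "AE x in lborel. norm ((cmod (f x + g x))\<^sup>2)
            \<le> norm (2 * (cmod (f x))\<^sup>2 + 2 * (cmod (g x))\<^sup>2)"
    proof (rule AE_I2)
      fix x
      have "(cmod (f x + g x))\<^sup>2 \<le> (cmod (f x) + cmod (g x))\<^sup>2"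
        by (intro power_mono norm_triangle_ineq) auto
      also have "\<dots> \<le> 2 * (cmod (f x))\<^sup>2 + 2 * (cmod (g x))\<^sup>2"
        using sum_squares_bound[of "cmod (f x)" "cmod (g x)"] by (simp add: power2_sum)
      finally show "norm ((cmod (f x + g x))\<^sup>2)
            \<le> norm (2 * (cmod (f x))\<^sup>2 + 2 * (cmod (g x))\<^sup>2)" by simp
    qed
  qed
  with assms show ?thesis by (auto simp: square_integrable_def)
qed

lemma square_integrable_cmult:
  assumes "square_integrable f"
  shows "square_integrable (\<lambda>x. c * f x)"
  using assms by (auto simp: square_integrable_def norm_mult power_mult_distrib)

lemma square_integrable_translate:
  fixes f :: "'a::euclidean_space \<Rightarrow> complex"
  assumes "square_integrable f"
  shows "square_integrable (\<lambda>x. f (x - t))"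
proof -
  have 1: "(\<lambda>x. f (x - t)) \<in> borel_measurable lborel"
    using assms by (auto simp: square_integrable_def intro: measurable_compose)
  have "integrable (distr lborel borel ((+) (-t))) (\<lambda>x. (cmod (f x))\<^sup>2)"
    unfolding lborel_distr_plus using assms by (simp add: square_integrable_def)
  then have "integrable lborel (\<lambda>x. (cmod (f (- t + x)))\<^sup>2)"
    using assms by (subst (asm) integrable_distr_eq) (auto simp: square_integrable_def)
  with 1 show ?thesis by (simp add: square_integrable_def)
qed

lemma AE_lborel_translate:
  fixes t :: "'a::euclidean_space"
  assumes "AE x in lborel. P x"
  shows "AE x in lborel. P (x - t)"
proof -
  have "AE x in distr lborel borel ((+) (-t)). P x"
    unfolding lborel_distr_plus by (rule assms)
  then have "AE x in lborel. P (- t + x)"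
    by (rule AE_distrD[rotated]) simp
  then show ?thesis by simp
qed

quotient_type (overloaded) 'a L2 = "'a::euclidean_space \<Rightarrow> complex" / partial: L2_rel
proof (rule part_equivpI)
  show "\<exists>x. L2_rel x (x :: 'a \<Rightarrow> complex)"
    using square_integrable_zero by (auto simp: L2_rel_def)
  show "symp (L2_rel :: ('a \<Rightarrow> complex) \<Rightarrow> _)"
    by (auto simp: symp_def L2_rel_def elim: eventually_mono)
  show "transp (L2_rel :: ('a \<Rightarrow> complex) \<Rightarrow> _)"
    unfolding transp_def L2_rel_def by (auto elim: eventually_elim2)
qed

text \<open>\<open>rep_L2 f\<close> is an arbitrary representative of the class \<open>f\<close>.\<close>

lift_definition cinner :: "'a::euclidean_space L2 \<Rightarrow> 'a L2 \<Rightarrow> complex" is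
  "\<lambda>f g. \<integral>x. f x * cnj (g x) \<partial>lborel"
  unfolding L2_rel_def square_integrable_def
  by (intro integral_cong_AE)
     (auto intro!: borel_measurable_times borel_measurable_continuous_on[of cnj] continuous_intros
       elim: eventually_elim2)

lift_definition scaleC :: "complex \<Rightarrow> 'a::euclidean_space L2 \<Rightarrow> 'a L2" (infixr "*\<^sub>C" 75) is
  "\<lambda>c f x. c * f x"
  by (auto simp: L2_rel_def square_integrable_cmult elim: eventually_mono)

instantiation L2 :: (euclidean_space) ab_group_add
begin

lift_definition zero_L2 :: "'a L2" is "\<lambda>x. 0"
  by (simp add: L2_rel_def square_integrable_zero)

lift_definition plus_L2 :: "'a L2 \<Rightarrow> 'a L2 \<Rightarrow> 'a L2" is "\<lambda>f g x. f x + g x"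
  by (auto simp: L2_rel_def square_integrable_add elim: eventually_elim2)

definition uminus_L2 :: "'a L2 \<Rightarrow> 'a L2" where "- f = (-1) *\<^sub>C f"

definition minus_L2 :: "'a L2 \<Rightarrow> 'a L2 \<Rightarrow> 'a L2" where "f - g = f + (- g :: 'a L2)"

instance
proof
  fix f g h :: "'a L2"
  show "f + g + h = f + (g + h)"
    by transfer (auto simp: L2_rel_def square_integrable_add add.assoc)
  show "f + g = g + f"
    by transfer (auto simp: L2_rel_def square_integrable_add add.commute)
  show "0 + f = f"
    by transfer (auto simp: L2_rel_def)
  show "- f + f = 0"
    unfolding uminus_L2_def
    by transfer (auto simp: L2_rel_def square_integrable_zero)
  show "f - g = f + - g" by (rule minus_L2_def)
qed

end

lemma scaleC_add_right: "c *\<^sub>C (f + g) = c *\<^sub>C f + c *\<^sub>C (g :: 'a::euclidean_space L2)"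
  by transfer (auto simp: L2_rel_def square_integrable_add square_integrable_cmult distrib_left)

lemma scaleC_add_left: "(c + d) *\<^sub>C f = c *\<^sub>C f + d *\<^sub>C (f :: 'a::euclidean_space L2)"
  by transfer (auto simp: L2_rel_def square_integrable_add square_integrable_cmult distrib_right)

lemma scaleC_scaleC: "c *\<^sub>C d *\<^sub>C f = (c * d) *\<^sub>C (f :: 'a::euclidean_space L2)"
  by transfer (auto simp: L2_rel_def square_integrable_cmult mult.assoc)

lemma scaleC_one: "1 *\<^sub>C f = (f :: 'a::euclidean_space L2)"
  by transfer (auto simp: L2_rel_def)

interpretation L2: vector_space "scaleC :: complex \<Rightarrow> 'a::euclidean_space L2 \<Rightarrow> 'a L2"
  by unfold_locales (simp_all add: scaleC_add_right scaleC_add_left scaleC_scaleC scaleC_one)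

lemma cinner_commute: "cinner f g = cnj (cinner g (f :: 'a::euclidean_space L2))"
  by transfer (simp add: mult.commute flip: Bochner_Integration.integral_cnj)

lemma cinner_add_left: "cinner (f + g) h = cinner f h + cinner g (h :: 'a::euclidean_space L2)"
  by transfer (simp add: L2_rel_def distrib_right square_integrable_mult_cnj)

lemma cinner_scaleC_left: "cinner (c *\<^sub>C f) g = c * cinner f (g :: 'a::euclidean_space L2)"
  by transfer (simp add: mult.assoc)

lemma Re_cinner_self:
  "square_integrable f \<Longrightarrow>
    Re (\<integral>x. f x * cnj (f x) \<partial>lborel) = (\<integral>x. (cmod (f x))\<^sup>2 \<partial>lborel)"
proof -
  have "(\<integral>x. f x * cnj (f x) \<partial>lborel) = (\<integral>x. complex_of_real ((cmod (f x))\<^sup>2) \<partial>lborel)"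
    by (simp only: complex_norm_square)
  then show ?thesis by (simp only: integral_complex_of_real Re_complex_of_real)
qed

instantiation L2 :: (euclidean_space) real_inner
begin

definition scaleR_L2 :: "real \<Rightarrow> 'a L2 \<Rightarrow> 'a L2" where "r *\<^sub>R f = complex_of_real r *\<^sub>C f"
definition inner_L2 :: "'a L2 \<Rightarrow> 'a L2 \<Rightarrow> real" where "inner f g = Re (cinner f g)"
definition norm_L2 :: "'a L2 \<Rightarrow> real" where "norm f = sqrt (inner f (f :: 'a L2))"
definition dist_L2 :: "'a L2 \<Rightarrow> 'a L2 \<Rightarrow> real" where "dist f g = norm (f - g :: 'a L2)"
definition sgn_L2 :: "'a L2 \<Rightarrow> 'a L2" where "sgn f = inverse (norm f) *\<^sub>R (f :: 'a L2)"
definition uniformity_L2 :: "('a L2 \<times> 'a L2) filter" where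
  "uniformity_L2 = (INF e\<in>{0<..}. principal {(f, g). dist f (g :: 'a L2) < e})"
definition open_L2 :: "'a L2 set \<Rightarrow> bool" where
  "open_L2 U \<longleftrightarrow> (\<forall>f\<in>U. \<forall>\<^sub>F (f', g) in uniformity. f' = f \<longrightarrow> g \<in> U)"

instance
proof
  fix f g h :: "'a L2" and r s :: real and U :: "'a L2 set"
  show "r *\<^sub>R (f + g) = r *\<^sub>R f + r *\<^sub>R g" by (simp add: scaleR_L2_def scaleC_add_right)
  show "(r + s) *\<^sub>R f = r *\<^sub>R f + s *\<^sub>R f" by (simp add: scaleR_L2_def scaleC_add_left)
  show "r *\<^sub>R s *\<^sub>R f = (r * s) *\<^sub>R f" by (simp add: scaleR_L2_def scaleC_scaleC)
  show "1 *\<^sub>R f = f" by (simp add: scaleR_L2_def scaleC_one)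
  show "sgn f = inverse (norm f) *\<^sub>R f" by (rule sgn_L2_def)
  show "dist f g = norm (f - g)" by (rule dist_L2_def)
  show "uniformity = (INF e\<in>{0<..}. principal {(f, g). dist f (g :: 'a L2) < e})"
    by (rule uniformity_L2_def)
  show "open U \<longleftrightarrow> (\<forall>f\<in>U. \<forall>\<^sub>F (f', g) in uniformity. f' = f \<longrightarrow> g \<in> U)"
    by (rule open_L2_def)
  show "inner f g = inner g f"
    by (subst inner_L2_def, subst cinner_commute) (simp add: inner_L2_def)
  show "inner (f + g) h = inner f h + inner g h"
    by (simp add: inner_L2_def cinner_add_left)
  show "inner (r *\<^sub>R f) g = r * inner f g"
    by (simp add: inner_L2_def scaleR_L2_def cinner_scaleC_left)
  show "0 \<le> inner f f"
    unfolding inner_L2_def by transfer (simp add: L2_rel_def Re_cinner_self)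
  show "inner f f = 0 \<longleftrightarrow> f = 0"
    unfolding inner_L2_def
  proof transfer
    fix f :: "'a \<Rightarrow> complex" assume "L2_rel f f"
    then have f: "square_integrable f" by (simp add: L2_rel_def)
    then have "Re (\<integral>x. f x * cnj (f x) \<partial>lborel) = 0 \<longleftrightarrow> (AE x in lborel. (cmod (f x))\<^sup>2 = 0)"
      by (simp only: Re_cinner_self)
         (rule integral_nonneg_eq_0_iff_AE, auto simp: square_integrable_def)
    with f show "Re (\<integral>x. f x * cnj (f x) \<partial>lborel) = 0 \<longleftrightarrow> L2_rel f (\<lambda>x. 0)"
      by (simp add: L2_rel_def square_integrable_zero)
  qed
  show "norm f = sqrt (inner f f)" by (rule norm_L2_def)
qed

end

definition orth_proj :: "'a::euclidean_space L2 set \<Rightarrow> 'a L2 \<Rightarrow> 'a L2" where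
  "orth_proj W f = (THE g. g \<in> W \<and> (\<forall>h\<in>W. cinner (f - g) h = 0))"

section \<open>Fourier transform\<close>

definition fourier_integral :: "('a::euclidean_space \<Rightarrow> complex) \<Rightarrow> 'a \<Rightarrow> complex" where
  "fourier_integral f \<omega> = (\<integral>x. f x * exp (- 2 * of_real pi * \<i> * of_real (\<omega> \<bullet> x)) \<partial>lborel)"

text \<open>The Fourier transform on \<open>L\<^sup>2\<close>: the unique continuous extension of the integral
  transform on \<open>L\<^sup>1 \<inter> L\<^sup>2\<close> (Plancherel).\<close>

definition fourier :: "'a::euclidean_space L2 \<Rightarrow> 'a L2" where
  "fourier = (THE F. continuous_on UNIV F \<and>
     (\<forall>f. integrable lborel (rep_L2 f) \<longrightarrow>
        (AE \<omega> in lborel. rep_L2 (F f) \<omega> = fourier_integral (rep_L2 f) \<omega>)))"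

section \<open>Shift-invariant spaces and shift-preserving operators\<close>

definition of_int_vec :: "int ^ 'd \<Rightarrow> real ^ 'd" where
  "of_int_vec k = (\<chi> i. real_of_int (k $ i))"

definition unit_cube :: "(real ^ 'd) set" where
  "unit_cube = {x. \<forall>i. 0 \<le> x $ i \<and> x $ i < 1}"

lift_definition shift :: "int ^ 'd \<Rightarrow> (real ^ 'd) L2 \<Rightarrow> (real ^ 'd) L2" is
  "\<lambda>k f x. f (x - of_int_vec k)"
  unfolding L2_rel_def
  by (intro conjI square_integrable_translate AE_lborel_translate[where P = "\<lambda>x. _ x = _ x"]) auto

definition shift_invariant :: "(real ^ 'd) L2 set \<Rightarrow> bool" where
  "shift_invariant V \<longleftrightarrow> L2.subspace V \<and> closed V \<and> (\<forall>f\<in>V. \<forall>k. shift k f \<in> V)"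

definition finitely_generated :: "(real ^ 'd) L2 set \<Rightarrow> bool" where
  "finitely_generated V \<longleftrightarrow>
     (\<exists>\<Phi>. finite \<Phi> \<and> V = closure (L2.span {shift k \<phi> | k \<phi>. \<phi> \<in> \<Phi>}))"

text \<open>Operators \<open>V \<rightarrow> V\<close> are total functions of which only the values on \<open>V\<close> matter.\<close>

definition bounded_operator_on :: "'a::euclidean_space L2 set \<Rightarrow> ('a L2 \<Rightarrow> 'a L2) \<Rightarrow> bool" where
  "bounded_operator_on V L \<longleftrightarrow>
     (\<forall>f\<in>V. L f \<in> V) \<and>
     (\<forall>f\<in>V. \<forall>g\<in>V. L (f + g) = L f + L g) \<and>
     (\<forall>c. \<forall>f\<in>V. L (c *\<^sub>C f) = c *\<^sub>C L f) \<and>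
     (\<exists>K. \<forall>f\<in>V. norm (L f) \<le> K * norm f)"

definition shift_preserving :: "(real ^ 'd) L2 set \<Rightarrow> ((real ^ 'd) L2 \<Rightarrow> (real ^ 'd) L2) \<Rightarrow> bool" where
  "shift_preserving V L \<longleftrightarrow>
     bounded_operator_on V L \<and> (\<forall>f\<in>V. \<forall>k. L (shift k f) = shift k (L f))"

definition is_adjoint_on ::
    "'a::euclidean_space L2 set \<Rightarrow> ('a L2 \<Rightarrow> 'a L2) \<Rightarrow> ('a L2 \<Rightarrow> 'a L2) \<Rightarrow> bool" where
  "is_adjoint_on V L M \<longleftrightarrow>
     bounded_operator_on V M \<and> (\<forall>f\<in>V. \<forall>g\<in>V. cinner (L f) g = cinner f (M g))"

definition normal_on :: "'a::euclidean_space L2 set \<Rightarrow> ('a L2 \<Rightarrow> 'a L2) \<Rightarrow> bool" where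
  "normal_on V L \<longleftrightarrow> (\<exists>M. is_adjoint_on V L M \<and> (\<forall>f\<in>V. L (M f) = M (L f)))"

section \<open>s-diagonalization\<close>

text \<open>The fibre map, \<open>fiber f \<omega> = (fhat (\<omega> + k))\<^sub>k\<close>; as a function of \<open>\<omega>\<close> in the unit cube it is
  determined by \<open>f\<close> up to null sets only.\<close>

definition fiber :: "(real ^ 'd) L2 \<Rightarrow> real ^ 'd \<Rightarrow> int ^ 'd \<Rightarrow> complex" where
  "fiber f \<omega> k = rep_L2 (fourier f) (\<omega> + of_int_vec k)"

lemma square_integrable_trig:
  "square_integrable (\<lambda>\<omega> :: real ^ 'd. if \<omega> \<in> unit_cube
     then exp (- 2 * of_real pi * \<i> * of_real (\<omega> \<bullet> of_int_vec k)) else 0)"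
proof -
  have cube: "unit_cube \<in> sets (borel :: (real ^ 'd) measure)"
    unfolding unit_cube_def by measurable
  have fin: "emeasure lborel (unit_cube :: (real ^ 'd) set) < \<infinity>"
  proof (rule emeasure_bounded_finite)
    show "bounded (unit_cube :: (real ^ 'd) set)"
      by (rule bounded_subset[of "cbox 0 1"]) (auto simp: unit_cube_def mem_box_cart less_imp_le)
  qed
  have meas: "(\<lambda>\<omega> :: real ^ 'd. if \<omega> \<in> unit_cube
     then exp (- 2 * of_real pi * \<i> * of_real (\<omega> \<bullet> of_int_vec k)) else 0) \<in> borel_measurable borel"
  proof (rule measurable_If_set)
    show "(\<lambda>\<omega> :: real ^ 'd. exp (- 2 * complex_of_real pi * \<i> * complex_of_real (\<omega> \<bullet> of_int_vec k)))
        \<in> borel_measurable borel"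
      by (intro borel_measurable_continuous_onI continuous_intros)
  qed (use cube in auto)
  have "(\<lambda>\<omega> :: real ^ 'd. (cmod (if \<omega> \<in> unit_cube
     then exp (- 2 * of_real pi * \<i> * of_real (\<omega> \<bullet> of_int_vec k)) else 0))\<^sup>2)
     = indicat_real unit_cube"
    by (auto simp: fun_eq_iff indicator_def)
  with meas cube fin show ?thesis
    by (simp add: square_integrable_def)
qed

text \<open>\<open>L\<^sup>2\<close> of the unit cube is identified with the functions in \<open>L\<^sup>2\<close> vanishing outside the cube.\<close>

lift_definition trig :: "int ^ 'd \<Rightarrow> (real ^ 'd) L2" is
  "\<lambda>k \<omega>. if \<omega> \<in> unit_cube then exp (- 2 * of_real pi * \<i> * of_real (\<omega> \<bullet> of_int_vec k)) else 0"
  using square_integrable_trig by (auto simp: L2_rel_def)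

definition l2_sequence :: "(int ^ 'd \<Rightarrow> complex) \<Rightarrow> bool" where
  "l2_sequence a \<longleftrightarrow> (\<lambda>k. (cmod (a k))\<^sup>2) summable_on UNIV"

definition fourier_series :: "(int ^ 'd \<Rightarrow> complex) \<Rightarrow> (real ^ 'd) L2" where
  "fourier_series a = (\<Sum>\<^sub>\<infinity>k. a k *\<^sub>C trig k)"

definition bounded_spectrum :: "(int ^ 'd \<Rightarrow> complex) \<Rightarrow> bool" where
  "bounded_spectrum a \<longleftrightarrow> l2_sequence a \<and>
     (\<exists>C. AE \<omega> in lborel. \<omega> \<in> unit_cube \<longrightarrow> cmod (rep_L2 (fourier_series a) \<omega>) \<le> C)"

text \<open>Only meaningful for \<open>a\<close> of bounded spectrum.\<close>

definition Lambda_op :: "(int ^ 'd \<Rightarrow> complex) \<Rightarrow> (real ^ 'd) L2 \<Rightarrow> (real ^ 'd) L2" where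
  "Lambda_op a f = (THE g. AE \<omega> in lborel. \<omega> \<in> unit_cube \<longrightarrow>
     (\<forall>k. fiber g \<omega> k = rep_L2 (fourier_series a) \<omega> * fiber f \<omega> k))"

definition s_eigenspace ::
    "(real ^ 'd) L2 set \<Rightarrow> ((real ^ 'd) L2 \<Rightarrow> (real ^ 'd) L2) \<Rightarrow> (int ^ 'd \<Rightarrow> complex)
      \<Rightarrow> (real ^ 'd) L2 set" where
  "s_eigenspace V L a = {f \<in> V. L f = Lambda_op a f}"

definition s_eigenvalue ::
    "(real ^ 'd) L2 set \<Rightarrow> ((real ^ 'd) L2 \<Rightarrow> (real ^ 'd) L2) \<Rightarrow> (int ^ 'd \<Rightarrow> complex) \<Rightarrow> bool" where
  "s_eigenvalue V L a \<longleftrightarrow> bounded_spectrum a \<and> s_eigenspace V L a \<noteq> {0}"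

definition is_direct_sum :: "'b::comm_monoid_add set \<Rightarrow> 'i set \<Rightarrow> ('i \<Rightarrow> 'b set) \<Rightarrow> bool" where
  "is_direct_sum V I W \<longleftrightarrow> bij_betw (\<lambda>g. \<Sum>j\<in>I. g j) (Pi\<^sub>E I W) V"

text \<open>The tuple \<open>(a\<^sub>1, \<dots>, a\<^sub>m)\<close> is given by the values of \<open>a\<close> on \<open>{1..m}\<close>.\<close>

definition s_diagonalization ::
    "(real ^ 'd) L2 set \<Rightarrow> ((real ^ 'd) L2 \<Rightarrow> (real ^ 'd) L2) \<Rightarrow> nat
      \<Rightarrow> (nat \<Rightarrow> int ^ 'd \<Rightarrow> complex) \<Rightarrow> bool" where
  "s_diagonalization V L m a \<longleftrightarrow> m \<ge> 1 \<and>
     (\<forall>j\<in>{1..m}. s_eigenvalue V L (a j)) \<and>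
     is_direct_sum V {1..m} (\<lambda>j. s_eigenspace V L (a j))"

definition s_diagonalizable ::
    "(real ^ 'd) L2 set \<Rightarrow> ((real ^ 'd) L2 \<Rightarrow> (real ^ 'd) L2) \<Rightarrow> bool" where
  "s_diagonalizable V L \<longleftrightarrow> (\<exists>m a. s_diagonalization V L m a)"

end

theory Submission
  imports
    "Jordan_Normal_Form.Schur_Decomposition"
    "HOL-Probability.Characteristic_Functions"
    Defs
begin

text \<open>The Fourier transform turns translation by \<open>k\<close> into multiplication by the character
  \<open>lattice_char k\<close>.  The image \<open>U\<close> of \<open>V\<close> is a closed subspace that is invariant under these
  multiplications, hence under multiplication by every bounded periodic Borel function (a
  \<open>multiplier\<close>), and \<open>L\<close> becomes an operator that commutes with all multipliers.  Both extensions
  from characters to multipliers are instances of \<open>multiplier_induct\<close>.  An \<open>s\<close>-eigenvalue of \<open>L\<close>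
  is then a multiplier \<open>m\<close> for which \<open>L u = m u\<close> has a nonzero solution in \<open>U\<close>
  (\<open>s_eigenspace_symbol\<close>); conversely every multiplier is the Fourier series of a sequence of
  bounded spectrum (\<open>multiplier_is_fourier_series\<close>).

  Orthogonality of eigenspaces.  The operators \<open>L - m\<close> are normal, so \<open>L u = m u\<close> implies that
  the adjoint of \<open>L\<close> acts on \<open>u\<close> as the conjugate of \<open>m\<close>.  For \<open>f\<close> in the eigenspace of \<open>a\<close> and \<open>g\<close>
  in that of \<open>b\<close> this gives \<open>\<langle>h (a - b) f, g\<rangle> = 0\<close> for all multipliers \<open>h\<close>.  Dividing by \<open>a - b\<close>
  where it is not small shows that the part of \<open>f\<close> over \<open>a \<noteq> b\<close> is orthogonal to \<open>g\<close>; the part over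
  \<open>a = b\<close> lies in both eigenspaces, so it vanishes if they form a direct sum
  (\<open>eig_orthogonal\<close>).  In an orthogonal decomposition the components are the orthogonal
  projections, and applying \<open>L\<close> to the decomposition of \<open>f\<close> yields the formula.

  Existence of a diagonalization.  Fibrewise Gram--Schmidt orthonormalisation of the \<open>n\<close> generators
  (\<open>Gram_Schmidt\<close>) represents \<open>L\<close> by an \<open>n \<times> n\<close> matrix of multipliers.  The roots of its
  characteristic polynomial can be chosen measurably (\<open>measurable_roots\<close>), and by the
  Cayley--Hamilton theorem the product of the operators \<open>L - r\<close> over these roots \<open>r\<close> vanishes
  (\<open>eigenvalue_functions\<close>).  Repeated values are replaced by dummy constants, which makes the
  functions pointwise distinct.  The orthogonal sum of their eigenspaces is closed, and it contains
  \<open>u\<close> as soon as it contains \<open>L u - r u\<close>: where the differences of the eigenvalue functions are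
  bounded away from zero this is linear algebra together with the absence of generalised
  eigenvectors, and the general case follows by a limit (\<open>eig_sum_solve\<close>).  So the sum is all of
  \<open>U\<close>; the nonzero eigenspaces among the summands give the diagonalization.

  The analytic basis is Plancherel's theorem, which identifies \<open>fourier\<close> as an isometry, so that
  \<open>U\<close> is closed along with \<open>V\<close>, together with the fibre inner product \<open>br\<close>, whose integral over the
  cube is the inner product of \<open>L\<^sup>2\<close>.\<close>

section \<open>Representatives of square-integrable classes\<close>

lemma L2_rel_rep: "L2_rel (rep_L2 u) (rep_L2 u)"
  using Quotient3_rep_reflp[OF Quotient3_L2] by auto

lemma square_integrable_rep: "square_integrable (rep_L2 u)"
  using L2_rel_rep by (auto simp: L2_rel_def)

lemma rep_L2_borel [measurable]: "rep_L2 u \<in> borel_measurable borel"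
  using square_integrable_rep[of u] by (simp add: square_integrable_def)

lemma integrable_norm_rep: "integrable lborel (\<lambda>x. (cmod (rep_L2 u x))\<^sup>2)"
  using square_integrable_rep[of u] by (simp add: square_integrable_def)

lemma rep_abs_L2:
  assumes "square_integrable f"
  shows "AE x in lborel. rep_L2 (abs_L2 f) x = f x"
proof -
  have "L2_rel f f" using assms by (simp add: L2_rel_def)
  then have "L2_rel (rep_L2 (abs_L2 f)) f"
    using Quotient3_rel_rep[OF Quotient3_L2] rep_abs_rsp_left[OF Quotient3_L2] by blast
  then show ?thesis by (simp add: L2_rel_def)
qed

lemma L2_eqI:
  assumes "AE x in lborel. rep_L2 u x = rep_L2 v x"
  shows "u = v"
proof -
  have "L2_rel (rep_L2 u) (rep_L2 v)"
    unfolding L2_rel_def using assms square_integrable_rep by blast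
  then show ?thesis using Quotient3_rel_rep[OF Quotient3_L2] by blast
qed

lemma rep_plus: "AE x in lborel. rep_L2 (u + v) x = rep_L2 u x + rep_L2 v x"
proof -
  have "u + v = abs_L2 (\<lambda>x. rep_L2 u x + rep_L2 v x)"
    unfolding plus_L2_def by simp
  then show ?thesis
    using rep_abs_L2[OF square_integrable_add[OF square_integrable_rep square_integrable_rep]]
    by metis
qed

lemma rep_scaleC: "AE x in lborel. rep_L2 (c *\<^sub>C u) x = c * rep_L2 u x"
proof -
  have "c *\<^sub>C u = abs_L2 (\<lambda>x. c * rep_L2 u x)"
    unfolding scaleC_def by simp
  then show ?thesis
    using rep_abs_L2[OF square_integrable_cmult[OF square_integrable_rep]] by metis
qed

lemma rep_zero: "AE x in lborel. rep_L2 0 x = 0"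
  unfolding zero_L2_def by (rule rep_abs_L2[OF square_integrable_zero])

lemma rep_uminus: "AE x in lborel. rep_L2 (- u) x = - rep_L2 u x"
  unfolding uminus_L2_def using rep_scaleC[of "-1" u] by simp

lemma rep_diff: "AE x in lborel. rep_L2 (u - v) x = rep_L2 u x - rep_L2 v x"
  unfolding minus_L2_def using rep_plus[of u "- v"] rep_uminus[of v] by eventually_elim simp

lemma rep_sum:
  assumes "finite I"
  shows "AE x in lborel. rep_L2 (\<Sum>i\<in>I. u i) x = (\<Sum>i\<in>I. rep_L2 (u i) x)"
  using assms
proof (induction I)
  case empty then show ?case using rep_zero by simp
next
  case (insert i I)
  have "AE x in lborel. rep_L2 (\<Sum>i\<in>I. u i) x = (\<Sum>i\<in>I. rep_L2 (u i) x)"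
    by (rule insert.IH)
  then show ?case using rep_plus[of "u i" "\<Sum>i\<in>I. u i"]
    by eventually_elim (simp add: insert.hyps)
qed

lemma cinner_rep: "cinner u v = (\<integral>x. rep_L2 u x * cnj (rep_L2 v x) \<partial>lborel)"
  unfolding cinner_def by simp

lemma integrable_rep_cnj: "integrable lborel (\<lambda>x. rep_L2 u x * cnj (rep_L2 v x))"
  by (intro square_integrable_mult_cnj square_integrable_rep)

lemma norm_L2_sq: "(norm u)\<^sup>2 = (\<integral>x. (cmod (rep_L2 u x))\<^sup>2 \<partial>lborel)"
proof -
  have "(norm u)\<^sup>2 = Re (cinner u u)"
    by (simp add: power2_norm_eq_inner inner_L2_def)
  then show ?thesis
    by (simp add: cinner_rep Re_cinner_self[OF square_integrable_rep])
qed

lemma norm_L2_sq_nn: "ennreal ((norm u)\<^sup>2) = (\<integral>\<^sup>+x. ennreal ((cmod (rep_L2 u x))\<^sup>2) \<partial>lborel)"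
  unfolding norm_L2_sq by (rule nn_integral_eq_integral[symmetric, OF integrable_norm_rep]) simp

lemma norm_abs_L2_sq:
  assumes "square_integrable f"
  shows "(norm (abs_L2 f))\<^sup>2 = (\<integral>x. (cmod (f x))\<^sup>2 \<partial>lborel)"
  unfolding norm_L2_sq
proof (rule integral_cong_AE)
  show "AE x in lborel. (cmod (rep_L2 (abs_L2 f) x))\<^sup>2 = (cmod (f x))\<^sup>2"
    using rep_abs_L2[OF assms] by eventually_elim simp
qed (use assms in \<open>auto simp: square_integrable_def\<close>)

subsection \<open>The sesquilinear inner product\<close>

lemma cinner_self: "cinner u u = of_real ((norm u)\<^sup>2)"
proof (rule complex_eqI)
  show "Re (cinner u u) = Re (of_real ((norm u)\<^sup>2))"
    by (simp add: power2_norm_eq_inner inner_L2_def)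
  show "Im (cinner u u) = Im (of_real ((norm u)\<^sup>2))"
    using cinner_commute[of u u] by (metis Im_complex_of_real Reals_cnj_iff complex_is_Real_iff)
qed

lemma cinner_add_right: "cinner f (g + h) = cinner f g + cinner f h"
  unfolding cinner_commute[of f] by (simp add: cinner_add_left)

lemma cinner_scaleC_right: "cinner f (c *\<^sub>C g) = cnj c * cinner f g"
  unfolding cinner_commute[of f] by (simp add: cinner_scaleC_left)

lemma cinner_zero_left [simp]: "cinner 0 g = 0"
  using cinner_add_left[of 0 0 g] by simp

lemma cinner_zero_right [simp]: "cinner g 0 = 0"
  using cinner_add_right[of g 0 0] by simp

lemma cinner_minus_left: "cinner (- f) g = - cinner f g"
  unfolding uminus_L2_def cinner_scaleC_left by simp

lemma cinner_minus_right: "cinner f (- g) = - cinner f g"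
  unfolding uminus_L2_def cinner_scaleC_right by simp

lemma cinner_diff_left: "cinner (f - g) h = cinner f h - cinner g h"
  unfolding minus_L2_def cinner_add_left cinner_minus_left by simp

lemma cinner_diff_right: "cinner f (g - h) = cinner f g - cinner f h"
  unfolding minus_L2_def cinner_add_right cinner_minus_right by simp

lemma cinner_sum_left: "cinner (\<Sum>i\<in>I. f i) g = (\<Sum>i\<in>I. cinner (f i) g)"
  by (induction I rule: infinite_finite_induct) (auto simp: cinner_add_left)

lemma cinner_sum_right: "cinner g (\<Sum>i\<in>I. f i) = (\<Sum>i\<in>I. cinner g (f i))"
  by (induction I rule: infinite_finite_induct) (auto simp: cinner_add_right)

lemma norm_scaleC: "norm (c *\<^sub>C (u :: 'a::euclidean_space L2)) = cmod c * norm u"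
proof -
  have "cinner (c *\<^sub>C u) (c *\<^sub>C u) = (c * cnj c) * cinner u u"
    by (simp add: cinner_scaleC_left cinner_scaleC_right)
  then have "complex_of_real ((norm (c *\<^sub>C u))\<^sup>2) = of_real ((cmod c)\<^sup>2) * of_real ((norm u)\<^sup>2)"
    by (simp only: cinner_self complex_norm_square)
  then have "complex_of_real ((norm (c *\<^sub>C u))\<^sup>2) = of_real ((cmod c * norm u)\<^sup>2)"
    by (simp add: power_mult_distrib)
  then have "(norm (c *\<^sub>C u))\<^sup>2 = (cmod c * norm u)\<^sup>2" using of_real_eq_iff by blast
  then show ?thesis by (simp add: power2_eq_iff_nonneg)
qed

lemma cinner_Cauchy_Schwarz: "cmod (cinner f g) \<le> norm f * norm g"
proof (cases "cinner f g = 0")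
  case False
  define c where "c = cnj (cinner f g) / of_real (cmod (cinner f g))"
  have c: "cmod c = 1" using False by (simp add: c_def norm_divide)
  have "cinner (c *\<^sub>C f) g = of_real (cmod (cinner f g))"
    using False by (simp add: c_def cinner_scaleC_left field_simps flip: complex_norm_square)
       (simp add: power2_eq_square)
  then have "cmod (cinner f g) = inner (c *\<^sub>C f) g" by (simp add: inner_L2_def)
  also have "\<dots> \<le> norm (c *\<^sub>C f) * norm g" by (rule norm_cauchy_schwarz)
  finally show ?thesis by (simp add: norm_scaleC c)
qed simp

lemma bounded_bilinear_cinner: "bounded_bilinear (cinner :: 'a::euclidean_space L2 \<Rightarrow> _)"
proof
  show "\<exists>K. \<forall>a b :: 'a L2. norm (cinner a b) \<le> norm a * norm b * K"
    by (rule exI[of _ 1]) (simp add: cinner_Cauchy_Schwarz)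
qed (auto simp: cinner_add_left cinner_add_right scaleR_L2_def cinner_scaleC_left
    cinner_scaleC_right scaleR_conv_of_real)

lemma bounded_linear_scaleC: "bounded_linear (\<lambda>u :: 'a::euclidean_space L2. c *\<^sub>C u)"
  by (rule bounded_linear_intro[where K="cmod c"])
     (auto simp: scaleC_add_right scaleR_L2_def scaleC_scaleC norm_scaleC mult.commute)

lemma norm_pythagoras:
  assumes "cinner u v = 0"
  shows "(norm (u + v))\<^sup>2 = (norm u)\<^sup>2 + (norm v)\<^sup>2"
proof -
  have "inner u v = 0" using assms by (simp add: inner_L2_def)
  then show ?thesis by (simp add: power2_norm_eq_inner inner_add inner_commute)
qed

subsection \<open>Completeness\<close>

text \<open>The sum of \<open>2 ^ k * |d k x|\<^sup>2\<close> over \<open>k\<close> has finite integral, so it is finite almost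
  everywhere, and there \<open>d k x\<close> decays geometrically.\<close>

lemma AE_summable_of_fast_decay:
  fixes d :: "nat \<Rightarrow> 'a::euclidean_space L2"
  assumes d: "\<And>k. norm (d k) \<le> (1/2) ^ k"
  shows "AE x in lborel. summable (\<lambda>k. rep_L2 (d k) x)"
proof -
  have "(\<integral>\<^sup>+x. (\<Sum>k. ennreal (2 ^ k * (cmod (rep_L2 (d k) x))\<^sup>2)) \<partial>lborel)
     = (\<Sum>k. \<integral>\<^sup>+x. ennreal (2 ^ k * (cmod (rep_L2 (d k) x))\<^sup>2) \<partial>lborel)"
    by (rule nn_integral_suminf) simp
  also have "\<dots> = (\<Sum>k. ennreal (2 ^ k * (norm (d k))\<^sup>2))"
    by (simp add: ennreal_mult nn_integral_cmult norm_L2_sq_nn)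
  also have "\<dots> \<le> (\<Sum>k. ennreal ((1/2) ^ k))"
  proof (intro suminf_le ennreal_leI)
    fix k
    have "2 ^ k * (norm (d k))\<^sup>2 \<le> 2 ^ k * ((1/2) ^ k)\<^sup>2"
      by (intro mult_left_mono power_mono d) auto
    also have "\<dots> = (1/2 :: real) ^ k"
      by (simp add: power2_eq_square power_divide field_simps)
    finally show "2 ^ k * (norm (d k))\<^sup>2 \<le> (1/2) ^ k" .
  qed auto
  also have "\<dots> < \<infinity>"
    by (subst suminf_ennreal2) (auto intro!: summable_geometric)
  finally have "AE x in lborel. (\<Sum>k. ennreal (2 ^ k * (cmod (rep_L2 (d k) x))\<^sup>2)) \<noteq> \<infinity>"
    by (intro nn_integral_noteq_infinite) auto
  then show ?thesis
  proof eventually_elim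
    case (elim x)
    define S where "S = (\<Sum>k. ennreal (2 ^ k * (cmod (rep_L2 (d k) x))\<^sup>2))"
    define s where "s = enn2real S"
    have S: "S = ennreal s" "s \<ge> 0" using elim by (auto simp: S_def s_def less_top)
    \<comment> \<open>each single term \<open>2 ^ k * |d k x|\<^sup>2\<close> is at most the sum \<open>s\<close>\<close>
    have bd: "norm (rep_L2 (d k) x) \<le> sqrt s * (sqrt (1/2)) ^ k" for k
    proof -
      have "ennreal (2 ^ k * (cmod (rep_L2 (d k) x))\<^sup>2)
          = (\<Sum>i\<in>{k}. ennreal (2 ^ i * (cmod (rep_L2 (d i) x))\<^sup>2))" by simp
      also have "\<dots> \<le> S" unfolding S_def by (intro sum_le_suminf) auto
      finally have "2 ^ k * (cmod (rep_L2 (d k) x))\<^sup>2 \<le> s"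
        using S by simp
      then have "(cmod (rep_L2 (d k) x))\<^sup>2 \<le> s * (1/2) ^ k"
        by (simp add: field_simps)
      then have "cmod (rep_L2 (d k) x) \<le> sqrt (s * (1/2) ^ k)"
        by (rule real_le_rsqrt)
      then show ?thesis by (simp add: real_sqrt_mult real_sqrt_power)
    qed
    show ?case
    proof (rule summable_comparison_test)
      show "\<exists>N. \<forall>n\<ge>N. norm (rep_L2 (d n) x) \<le> sqrt s * (sqrt (1/2)) ^ n" using bd by blast
      show "summable (\<lambda>n. sqrt s * (sqrt (1/2)) ^ n)"
        by (intro summable_mult summable_geometric) (simp add: real_sqrt_divide)
    qed
  qed
qed

text \<open>Fatou's lemma turns almost everywhere convergence of a Cauchy sequence into norm
  convergence.\<close>

lemma L2_limit_of_AE_limit: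
  fixes u :: "nat \<Rightarrow> 'a::euclidean_space L2"
  assumes "Cauchy u" and [measurable]: "g \<in> borel_measurable borel"
    and lim: "AE x in lborel. (\<lambda>n. rep_L2 (u n) x) \<longlonglongrightarrow> g x"
  shows "square_integrable g" "u \<longlonglongrightarrow> abs_L2 g"
proof -
  have tail: "\<exists>N. \<forall>n\<ge>N. (\<integral>\<^sup>+x. ennreal ((cmod (rep_L2 (u n) x - g x))\<^sup>2) \<partial>lborel) \<le> ennreal (e\<^sup>2)"
    if "e > 0" for e
  proof -
    obtain N where N: "\<And>m n. m \<ge> N \<Longrightarrow> n \<ge> N \<Longrightarrow> dist (u m) (u n) < e"
      using \<open>Cauchy u\<close> \<open>e > 0\<close> unfolding Cauchy_def by blast
    have "(\<integral>\<^sup>+x. ennreal ((cmod (rep_L2 (u n) x - g x))\<^sup>2) \<partial>lborel) \<le> ennreal (e\<^sup>2)" if "n \<ge> N" for n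
    proof -
      have "(\<integral>\<^sup>+x. ennreal ((cmod (rep_L2 (u n) x - g x))\<^sup>2) \<partial>lborel)
         = (\<integral>\<^sup>+x. liminf (\<lambda>m. ennreal ((cmod (rep_L2 (u n) x - rep_L2 (u m) x))\<^sup>2)) \<partial>lborel)"
      proof (rule nn_integral_cong_AE, use lim in eventually_elim)
        case (elim x)
        have "(\<lambda>m. ennreal ((cmod (rep_L2 (u n) x - rep_L2 (u m) x))\<^sup>2))
            \<longlonglongrightarrow> ennreal ((cmod (rep_L2 (u n) x - g x))\<^sup>2)"
          by (intro tendsto_intros elim)
        then show ?case by (rule lim_imp_Liminf[OF trivial_limit_sequentially, symmetric])
      qed
      also have "\<dots> \<le> liminf (\<lambda>m. \<integral>\<^sup>+x. ennreal ((cmod (rep_L2 (u n) x - rep_L2 (u m) x))\<^sup>2) \<partial>lborel)"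
        by (rule nn_integral_liminf) measurable
      also have "\<dots> \<le> limsup (\<lambda>m. \<integral>\<^sup>+x. ennreal ((cmod (rep_L2 (u n) x - rep_L2 (u m) x))\<^sup>2) \<partial>lborel)"
        by (rule Liminf_le_Limsup) simp
      also have "\<dots> \<le> ennreal (e\<^sup>2)"
      proof (rule Limsup_bounded, rule eventually_sequentiallyI[of N])
        fix m assume "m \<ge> N"
        have "(\<integral>\<^sup>+x. ennreal ((cmod (rep_L2 (u n) x - rep_L2 (u m) x))\<^sup>2) \<partial>lborel)
           = ennreal ((norm (u n - u m))\<^sup>2)"
          unfolding norm_L2_sq_nn
          by (rule nn_integral_cong_AE, use rep_diff[of "u n" "u m"] in eventually_elim) simp
        also have "\<dots> \<le> ennreal (e\<^sup>2)"
          using N[OF \<open>n \<ge> N\<close> \<open>m \<ge> N\<close>] by (intro ennreal_leI power_mono) (auto simp: dist_norm)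
        finally show "(\<integral>\<^sup>+x. ennreal ((cmod (rep_L2 (u n) x - rep_L2 (u m) x))\<^sup>2) \<partial>lborel) \<le> ennreal (e\<^sup>2)" .
      qed
      finally show ?thesis .
    qed
    then show ?thesis by blast
  qed
  obtain N where N: "(\<integral>\<^sup>+x. ennreal ((cmod (rep_L2 (u N) x - g x))\<^sup>2) \<partial>lborel) \<le> ennreal (1\<^sup>2)"
    using tail[of 1] by auto
  have "square_integrable (\<lambda>x. rep_L2 (u N) x - g x)"
    unfolding square_integrable_def
    using order.strict_trans1[OF N] by (auto intro!: integrableI_bounded)
  then have "square_integrable (\<lambda>x. rep_L2 (u N) x + (- 1) * (rep_L2 (u N) x - g x))"
    by (intro square_integrable_add square_integrable_cmult square_integrable_rep)
  then show g: "square_integrable g" by simp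
  show "u \<longlonglongrightarrow> abs_L2 g"
  proof (rule metric_LIMSEQ_I)
    fix r :: real assume "r > 0"
    then obtain N where N: "\<And>n. n \<ge> N \<Longrightarrow>
        (\<integral>\<^sup>+x. ennreal ((cmod (rep_L2 (u n) x - g x))\<^sup>2) \<partial>lborel) \<le> ennreal ((r/2)\<^sup>2)"
      using tail[of "r/2"] by auto
    have "dist (u n) (abs_L2 g) < r" if "n \<ge> N" for n
    proof -
      have "ennreal ((norm (u n - abs_L2 g))\<^sup>2) = (\<integral>\<^sup>+x. ennreal ((cmod (rep_L2 (u n) x - g x))\<^sup>2) \<partial>lborel)"
        unfolding norm_L2_sq_nn
        by (rule nn_integral_cong_AE, use rep_diff[of "u n" "abs_L2 g"] rep_abs_L2[OF g] in eventually_elim) simp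
      also have "\<dots> \<le> ennreal ((r/2)\<^sup>2)" by (rule N[OF that])
      finally have "(norm (u n - abs_L2 g))\<^sup>2 \<le> (r/2)\<^sup>2" by simp
      then have "norm (u n - abs_L2 g) \<le> r/2"
        using \<open>r > 0\<close> by (simp add: power2_le_iff_abs_le)
      then show ?thesis using \<open>r > 0\<close> by (simp add: dist_norm)
    qed
    then show "\<exists>N. \<forall>n\<ge>N. dist (u n) (abs_L2 g) < r" by blast
  qed
qed

lemma Cauchy_L2_subseq_AE:
  fixes u :: "nat \<Rightarrow> 'a::euclidean_space L2"
  assumes "Cauchy u"
  obtains r g where "strict_mono r" "g \<in> borel_measurable borel"
    "AE x in lborel. (\<lambda>n. rep_L2 (u (r n)) x) \<longlonglongrightarrow> g x"
proof -
  have "\<exists>N. \<forall>m\<ge>N. \<forall>n\<ge>N. dist (u m) (u n) < (1/2) ^ k" for k :: nat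
    using assms unfolding Cauchy_def by simp
  then obtain M where M: "\<And>k m n. m \<ge> M k \<Longrightarrow> n \<ge> M k \<Longrightarrow> dist (u m) (u n) < (1/2) ^ k"
    by metis
  define r where "r = rec_nat (M 0) (\<lambda>k x. max (Suc x) (M (Suc k)))"
  have r_ge: "r k \<ge> M k" for k by (induction k) (auto simp: r_def)
  have r: "strict_mono r" by (simp add: strict_mono_Suc_iff r_def less_max_iff_disj)
  define d where "d k = u (r (Suc k)) - u (r k)" for k
  have "norm (d k) \<le> (1/2) ^ k" for k
    using M[of k "r (Suc k)" "r k"] r_ge[of k] strict_monoD[OF r, of k "Suc k"]
    by (simp add: d_def dist_norm)
  then have "AE x in lborel. summable (\<lambda>k. rep_L2 (d k) x)" by (rule AE_summable_of_fast_decay)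
  moreover have "AE x in lborel. \<forall>k. rep_L2 (d k) x = rep_L2 (u (r (Suc k))) x - rep_L2 (u (r k)) x"
    unfolding AE_all_countable d_def by (intro allI rep_diff)
  ultimately have "AE x in lborel. (\<lambda>n. rep_L2 (u (r n)) x) \<longlonglongrightarrow> lim (\<lambda>n. rep_L2 (u (r n)) x)"
  proof eventually_elim
    case (elim x)
    have tel: "(\<Sum>k<n. rep_L2 (d k) x) = rep_L2 (u (r n)) x - rep_L2 (u (r 0)) x" for n
      by (induction n) (auto simp: elim(2)[rule_format])
    have "(\<lambda>n. (rep_L2 (u (r n)) x - rep_L2 (u (r 0)) x) + rep_L2 (u (r 0)) x)
        \<longlonglongrightarrow> (\<Sum>k. rep_L2 (d k) x) + rep_L2 (u (r 0)) x"
      by (intro tendsto_add tendsto_const summable_LIMSEQ[OF elim(1), unfolded tel])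
    then have "(\<lambda>n. rep_L2 (u (r n)) x) \<longlonglongrightarrow> (\<Sum>k. rep_L2 (d k) x) + rep_L2 (u (r 0)) x" by simp
    then show ?case by (simp add: limI)
  qed
  moreover have "(\<lambda>x. lim (\<lambda>n. rep_L2 (u (r n)) x)) \<in> borel_measurable borel"
    by (rule borel_measurable_lim_metric) simp
  ultimately show ?thesis using that r by blast
qed

instance L2 :: (euclidean_space) complete_space
proof
  fix u :: "nat \<Rightarrow> 'a L2" assume u: "Cauchy u"
  obtain r g where r: "strict_mono r" and g: "g \<in> borel_measurable borel"
    "AE x in lborel. (\<lambda>n. rep_L2 (u (r n)) x) \<longlonglongrightarrow> g x"
    using Cauchy_L2_subseq_AE[OF u] .
  have "Cauchy (u \<circ> r)" by (rule Cauchy_subseq_Cauchy[OF u r])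
  then have "(u \<circ> r) \<longlonglongrightarrow> abs_L2 g"
    using L2_limit_of_AE_limit(2)[of "u \<circ> r" g] g by simp
  then show "convergent u"
    using Cauchy_converges_subseq[OF u r] by (auto simp: convergent_def comp_def)
qed

lemma L2_dominated_convergence:
  fixes u :: "nat \<Rightarrow> 'a::euclidean_space L2"
  assumes w: "integrable lborel w"
    and dom: "\<And>n. AE x in lborel. (cmod (rep_L2 (u n) x - rep_L2 v x))\<^sup>2 \<le> w x"
    and lim: "AE x in lborel. (\<lambda>n. rep_L2 (u n) x) \<longlonglongrightarrow> rep_L2 v x"
  shows "u \<longlonglongrightarrow> v"
proof -
  have "(\<lambda>n. \<integral>x. (cmod (rep_L2 (u n) x - rep_L2 v x))\<^sup>2 \<partial>lborel) \<longlonglongrightarrow> (\<integral>x. 0 \<partial>(lborel :: 'a measure))"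
  proof (rule integral_dominated_convergence)
    show "AE x in lborel. (\<lambda>n. (cmod (rep_L2 (u n) x - rep_L2 v x))\<^sup>2) \<longlonglongrightarrow> 0"
      using lim
    proof eventually_elim
      case (elim x)
      have "(\<lambda>n. (cmod (rep_L2 (u n) x - rep_L2 v x))\<^sup>2) \<longlonglongrightarrow> (cmod (rep_L2 v x - rep_L2 v x))\<^sup>2"
        by (intro tendsto_intros elim)
      then show ?case by simp
    qed
  qed (use w dom in auto)
  moreover have "(\<integral>x. (cmod (rep_L2 (u n) x - rep_L2 v x))\<^sup>2 \<partial>lborel) = (norm (u n - v))\<^sup>2" for n
    unfolding norm_L2_sq
    by (rule integral_cong_AE) (simp, simp, use rep_diff[of "u n" v] in eventually_elim, simp)
  ultimately have "(\<lambda>n. (norm (u n - v))\<^sup>2) \<longlonglongrightarrow> 0" by simp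
  then have "(\<lambda>n. sqrt ((norm (u n - v))\<^sup>2)) \<longlonglongrightarrow> sqrt 0" by (rule tendsto_real_sqrt)
  then have "(\<lambda>n. norm (u n - v)) \<longlonglongrightarrow> 0" by simp
  then have "(\<lambda>n. u n - v) \<longlonglongrightarrow> 0" by (rule tendsto_norm_zero_cancel)
  then show ?thesis by (rule LIM_zero_cancel)
qed

section \<open>Plancherel's theorem\<close>

definition wave :: "real \<Rightarrow> complex" where
  "wave t = exp (- 2 * of_real pi * \<i> * of_real t)"

lemma norm_wave [simp]: "cmod (wave t) = 1"
  unfolding wave_def norm_exp_eq_Re by simp

lemma wave_0 [simp]: "wave 0 = 1" by (simp add: wave_def)

lemma wave_add: "wave (s + t) = wave s * wave t"
  unfolding wave_def by (simp add: ring_distribs flip: exp_add)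

lemma cnj_wave: "cnj (wave t) = wave (- t)"
  unfolding wave_def by (simp add: exp_cnj)

lemma wave_sum: "finite I \<Longrightarrow> wave (\<Sum>i\<in>I. f i) = (\<Prod>i\<in>I. wave (f i))"
  by (induction I rule: finite_induct) (auto simp: wave_add)

lemma continuous_wave [continuous_intros]:
  "continuous_on S f \<Longrightarrow> continuous_on S (\<lambda>x. wave (f x))"
  unfolding wave_def by (intro continuous_intros)

lemma wave_borel [measurable]: "wave \<in> borel_measurable borel"
  by (intro borel_measurable_continuous_onI continuous_intros)

lemma fourier_integral_wave: "fourier_integral f \<omega> = (\<integral>x. f x * wave (\<omega> \<bullet> x) \<partial>lborel)"
  by (simp add: fourier_integral_def wave_def)

lemma integrable_times_unimodular:
  fixes f :: "'a \<Rightarrow> complex"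
  assumes "integrable M f" "g \<in> borel_measurable M" "\<And>x. cmod (g x) \<le> C"
  shows "integrable M (\<lambda>x. f x * g x)"
proof (rule Bochner_Integration.integrable_bound)
  show "integrable M (\<lambda>x. C *\<^sub>R f x)" using assms(1) by simp
  show "(\<lambda>x. f x * g x) \<in> borel_measurable M" using assms by simp
  show "AE x in M. norm (f x * g x) \<le> norm (C *\<^sub>R f x)"
  proof (rule AE_I2)
    fix x
    have "norm (f x * g x) \<le> norm (f x) * C" unfolding norm_mult by (intro mult_left_mono assms) simp
    also have "\<dots> \<le> norm (C *\<^sub>R f x)" by (simp add: mult.commute mult_right_mono)
    finally show "norm (f x * g x) \<le> norm (C *\<^sub>R f x)" .
  qed
qed

lemma integrable_times_wave:
  fixes f :: "'a \<Rightarrow> complex"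
  assumes "integrable M f" "g \<in> borel_measurable M"
  shows "integrable M (\<lambda>x. f x * wave (g x))"
  by (rule integrable_times_unimodular[where C=1]) (use assms in auto)

lemma fourier_integral_borel [measurable]:
  fixes f :: "'a::euclidean_space \<Rightarrow> complex"
  assumes [measurable]: "f \<in> borel_measurable borel"
  shows "fourier_integral f \<in> borel_measurable borel"
proof -
  have "(\<lambda>\<omega>. \<integral>x. f x * wave (\<omega> \<bullet> x) \<partial>lborel) \<in> borel_measurable borel" by measurable
  then show ?thesis by (simp add: fourier_integral_wave[abs_def])
qed

lemma norm_fourier_integral_le:
  "cmod (fourier_integral f \<omega>) \<le> (\<integral>x. cmod (f x) \<partial>lborel)"
proof -
  have "cmod (fourier_integral f \<omega>) \<le> (\<integral>x. cmod (f x * wave (\<omega> \<bullet> x)) \<partial>lborel)"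
    unfolding fourier_integral_wave by (rule integral_norm_bound)
  then show ?thesis by (simp add: norm_mult)
qed

subsection \<open>The Gaussian\<close>

lemma lborel_integral_Basis_prod:
  fixes h :: "'a::euclidean_space \<Rightarrow> real \<Rightarrow> complex"
  assumes "\<And>b. b \<in> Basis \<Longrightarrow> integrable lborel (h b)"
  shows "integrable lborel (\<lambda>x. \<Prod>b\<in>Basis. h b (x \<bullet> b))"
    and "(\<integral>x. (\<Prod>b\<in>Basis. h b (x \<bullet> b)) \<partial>lborel) = (\<Prod>b\<in>Basis. \<integral>x. h b x \<partial>lborel)"
proof -
  interpret product_sigma_finite "\<lambda>_::'a. lborel :: real measure" by standard
  define T where "T = (\<lambda>f. \<Sum>b\<in>Basis. f b *\<^sub>R b :: 'a)"
  have T: "T \<in> measurable (\<Pi>\<^sub>M b\<in>Basis. lborel) borel" unfolding T_def by measurable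
  have meas: "(\<lambda>x. \<Prod>b\<in>Basis. h b (x \<bullet> b)) \<in> borel_measurable borel"
    using assms by (intro borel_measurable_prod) (auto intro!: measurable_compose[where N=borel and g="h _"] dest: borel_measurable_integrable)
  have eq: "(\<Prod>b\<in>Basis. h b (T f \<bullet> b)) = (\<Prod>b\<in>Basis. h b (f b))" for f
    unfolding T_def by (intro prod.cong) auto
  show "integrable lborel (\<lambda>x. \<Prod>b\<in>Basis. h b (x \<bullet> b))"
    unfolding lborel_eq[where 'a='a] T_def[symmetric]
    by (subst integrable_distr_eq[OF T meas], unfold eq, rule product_integrable_prod) (use assms in auto)
  show "(\<integral>x. (\<Prod>b\<in>Basis. h b (x \<bullet> b)) \<partial>lborel) = (\<Prod>b\<in>Basis. \<integral>x. h b x \<partial>lborel)"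
    unfolding lborel_eq[where 'a='a] T_def[symmetric]
    by (subst integral_distr[OF T meas], unfold eq, rule product_integral_prod) (use assms in auto)
qed

text \<open>The characteristic function of the standard normal distribution, rescaled.\<close>

lemma gaussian_char_real:
  fixes u e :: real assumes e: "e > 0"
  shows "integrable lborel (\<lambda>t. complex_of_real (exp (- pi * e\<^sup>2 * t\<^sup>2)) * wave (t * u))"
    and "(\<integral>t. complex_of_real (exp (- pi * e\<^sup>2 * t\<^sup>2)) * wave (t * u) \<partial>lborel)
       = of_real (exp (- pi * u\<^sup>2 / e\<^sup>2) / e)"
proof -
  \<comment> \<open>the substitution \<open>x = c * t\<close> turns \<open>x\<^sup>2 / 2\<close> into \<open>pi * e\<^sup>2 * t\<^sup>2\<close>, and \<open>s * c = - 2 * pi * u\<close>\<close>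
  define c where "c = e * sqrt (2 * pi)"
  define s where "s = - (2 * pi * u) / c"
  have c: "c > 0" "c\<^sup>2 = e\<^sup>2 * (2 * pi)" using e by (auto simp: c_def power_mult_distrib)
  have sc: "s * c = - (2 * pi * u)" using c by (simp add: s_def)
  have dens: "std_normal_density (c * t) = exp (- pi * e\<^sup>2 * t\<^sup>2) / sqrt (2 * pi)" for t
    by (simp add: std_normal_density_def power_mult_distrib c(2) algebra_simps)
  have wave: "iexp (s * (c * t)) = wave (t * u)" for t
  proof -
    have *: "s * (c * t) = - (2 * pi * u) * t" using sc by (metis mult.assoc)
    show ?thesis unfolding wave_def * by (intro arg_cong[where f=exp]) (simp add: mult_ac)
  qed
  have int: "integrable lborel (\<lambda>x. std_normal_density x *\<^sub>R iexp (s * x))"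
    by (rule Bochner_Integration.integrable_bound[of _ std_normal_density])
       (auto simp: norm_mult)
  have int2: "integrable lborel (\<lambda>t. std_normal_density (c * t) *\<^sub>R iexp (s * (c * t)))"
    using lborel_integrable_real_affine[OF int, of c 0] c by simp
  have eq: "complex_of_real (exp (- pi * e\<^sup>2 * t\<^sup>2)) * wave (t * u)
      = of_real (sqrt (2 * pi)) * (std_normal_density (c * t) *\<^sub>R iexp (s * (c * t)))" for t
    unfolding wave dens by (simp add: scaleR_conv_of_real)
  show "integrable lborel (\<lambda>t. complex_of_real (exp (- pi * e\<^sup>2 * t\<^sup>2)) * wave (t * u))"
    unfolding eq by (intro integrable_mult_right int2)
  have "char std_normal_distribution s = (\<integral>x. std_normal_density x *\<^sub>R iexp (s * x) \<partial>lborel)"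
    unfolding char_def by (subst integral_density) auto
  also have "\<dots> = \<bar>c\<bar> *\<^sub>R (\<integral>t. std_normal_density (c * t) *\<^sub>R iexp (s * (c * t)) \<partial>lborel)"
    using lborel_integral_real_affine[of c "\<lambda>x. std_normal_density x *\<^sub>R iexp (s * x)" 0] c by simp
  finally have I: "of_real c * (\<integral>t. std_normal_density (c * t) *\<^sub>R iexp (s * (c * t)) \<partial>lborel)
      = of_real (exp (- s\<^sup>2 / 2))"
    using c by (simp add: char_std_normal_distribution scaleR_conv_of_real)
  have "s\<^sup>2 / 2 = pi * u\<^sup>2 / e\<^sup>2"
  proof -
    have "s\<^sup>2 = (2 * pi * u)\<^sup>2 / (e\<^sup>2 * (2 * pi))" by (simp add: s_def power_divide c(2))
    then show ?thesis using e by (simp add: power2_eq_square field_simps)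
  qed
  then have ex: "exp (- s\<^sup>2 / 2) = exp (- pi * u\<^sup>2 / e\<^sup>2)" by simp
  have "(\<integral>t. complex_of_real (exp (- pi * e\<^sup>2 * t\<^sup>2)) * wave (t * u) \<partial>lborel)
     = of_real (sqrt (2 * pi)) * (\<integral>t. std_normal_density (c * t) *\<^sub>R iexp (s * (c * t)) \<partial>lborel)"
    unfolding eq by (rule integral_mult_right_zero)
  also have "\<dots> = of_real (exp (- s\<^sup>2 / 2)) / of_real e"
    unfolding I[symmetric] using e by (simp add: c_def)
  finally show "(\<integral>t. complex_of_real (exp (- pi * e\<^sup>2 * t\<^sup>2)) * wave (t * u) \<partial>lborel)
       = of_real (exp (- pi * u\<^sup>2 / e\<^sup>2) / e)" by (simp only: ex of_real_divide)
qed

definition gauss :: "real \<Rightarrow> 'a::euclidean_space \<Rightarrow> real" where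
  "gauss e x = exp (- pi * e\<^sup>2 * (norm x)\<^sup>2)"

lemma gauss_borel [measurable]: "gauss e \<in> borel_measurable borel"
  unfolding gauss_def[abs_def] by measurable

lemma gauss_bounds: "0 < gauss e x" "gauss e x \<le> 1" "\<bar>gauss e x\<bar> \<le> 1"
  by (auto simp: gauss_def)

lemma norm_sq_Basis: "(norm (x::'a::euclidean_space))\<^sup>2 = (\<Sum>b\<in>Basis. (x \<bullet> b)\<^sup>2)"
  unfolding power2_norm_eq_inner euclidean_inner[of x x] by (simp add: power2_eq_square)

lemma gauss_fourier:
  fixes u :: "'a::euclidean_space" assumes e: "e > 0"
  shows "integrable lborel (\<lambda>\<omega>. complex_of_real (gauss e \<omega>) * wave (\<omega> \<bullet> u))"
    and "(\<integral>\<omega>. complex_of_real (gauss e \<omega>) * wave (\<omega> \<bullet> u) \<partial>lborel)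
       = of_real (gauss (1/e) u / e ^ DIM('a))"
proof -
  have prod: "complex_of_real (gauss e \<omega>) * wave (\<omega> \<bullet> u)
      = (\<Prod>b\<in>Basis. complex_of_real (exp (- pi * e\<^sup>2 * (\<omega> \<bullet> b)\<^sup>2)) * wave ((\<omega> \<bullet> b) * (u \<bullet> b)))" for \<omega> :: 'a
    unfolding gauss_def norm_sq_Basis euclidean_inner[of \<omega> u] sum_distrib_left
    by (simp add: exp_sum wave_sum prod.distrib)
  note R = gaussian_char_real[OF e]
  show "integrable lborel (\<lambda>\<omega>. complex_of_real (gauss e \<omega>) * wave (\<omega> \<bullet> u))"
    unfolding prod by (rule lborel_integral_Basis_prod) (rule R)
  have "(\<integral>\<omega>. complex_of_real (gauss e \<omega>) * wave (\<omega> \<bullet> u) \<partial>lborel)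
     = (\<Prod>b\<in>Basis. of_real (exp (- pi * (u \<bullet> b)\<^sup>2 / e\<^sup>2) / e))"
    unfolding prod by (subst lborel_integral_Basis_prod(2)) (rule R, simp only: R)
  also have "\<dots> = of_real (gauss (1/e) u / e ^ DIM('a))"
    unfolding gauss_def norm_sq_Basis
    by (simp add: prod_dividef exp_sum[symmetric] sum_distrib_left power_divide flip: of_real_prod)
  finally show "(\<integral>\<omega>. complex_of_real (gauss e \<omega>) * wave (\<omega> \<bullet> u) \<partial>lborel)
       = of_real (gauss (1/e) u / e ^ DIM('a))" .
qed

lemma integrable_gauss: "e > 0 \<Longrightarrow> integrable lborel (gauss e :: 'a::euclidean_space \<Rightarrow> real)"
  using gauss_fourier(1)[of e "0::'a"] by (simp add: complex_of_real_integrable_eq)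

lemma integral_gauss_1: "(\<integral>x. gauss 1 x \<partial>(lborel :: 'a::euclidean_space measure)) = 1"
proof -
  have "complex_of_real (\<integral>x. gauss 1 x \<partial>(lborel :: 'a measure)) = 1"
    using gauss_fourier(2)[of 1 "0::'a"] by (simp add: gauss_def)
  then show ?thesis by (simp only: of_real_eq_1_iff)
qed

subsection \<open>The multiplication formula\<close>

text \<open>Fubini's theorem for \<open>f x * h \<omega> * wave (\<omega> \<bullet> x)\<close>.\<close>

lemma fourier_multiplication_formula:
  fixes f h :: "'a::euclidean_space \<Rightarrow> complex"
  assumes f: "integrable lborel f" and h: "integrable lborel h"
  shows "(\<integral>\<omega>. fourier_integral f \<omega> * h \<omega> \<partial>lborel) = (\<integral>x. f x * fourier_integral h x \<partial>lborel)"
proof -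
  have [measurable]: "f \<in> borel_measurable borel" "h \<in> borel_measurable borel"
    using f h by (auto dest: borel_measurable_integrable)
  have "integrable (lborel \<Otimes>\<^sub>M lborel) (\<lambda>(x, \<omega>). f x * h \<omega> * wave (\<omega> \<bullet> x))"
  proof (rule lborel_pair.Fubini_integrable)
    have "(\<lambda>x. \<integral>y. norm (case (x, y) of (x, \<omega>) \<Rightarrow> f x * h \<omega> * wave (\<omega> \<bullet> x)) \<partial>lborel)
       = (\<lambda>x. norm (f x) * (\<integral>y. norm (h y) \<partial>lborel))"
      by (simp add: norm_mult)
    then show "integrable lborel (\<lambda>x. \<integral>y. norm (case (x, y) of (x, \<omega>) \<Rightarrow> f x * h \<omega> * wave (\<omega> \<bullet> x)) \<partial>lborel)"
      using f by simp
    show "AE x in lborel. integrable lborel (\<lambda>y. case (x, y) of (x, \<omega>) \<Rightarrow> f x * h \<omega> * wave (\<omega> \<bullet> x))"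
      using h by (auto intro!: AE_I2 integrable_times_wave)
  qed measurable
  from lborel_pair.Fubini_integral[OF this]
  have "(\<integral>\<omega>. \<integral>x. f x * h \<omega> * wave (\<omega> \<bullet> x) \<partial>lborel \<partial>lborel)
     = (\<integral>x. \<integral>\<omega>. f x * h \<omega> * wave (\<omega> \<bullet> x) \<partial>lborel \<partial>lborel)" .
  also have "(\<lambda>\<omega>. \<integral>x. f x * h \<omega> * wave (\<omega> \<bullet> x) \<partial>lborel) = (\<lambda>\<omega>. fourier_integral f \<omega> * h \<omega>)"
  proof
    fix \<omega>
    have "(\<integral>x. f x * h \<omega> * wave (\<omega> \<bullet> x) \<partial>lborel) = (\<integral>x. h \<omega> * (f x * wave (\<omega> \<bullet> x)) \<partial>lborel)"
      by (simp add: mult_ac)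
    then show "(\<integral>x. f x * h \<omega> * wave (\<omega> \<bullet> x) \<partial>lborel) = fourier_integral f \<omega> * h \<omega>"
      by (simp add: fourier_integral_wave)
  qed
  also have "(\<lambda>x. \<integral>\<omega>. f x * h \<omega> * wave (\<omega> \<bullet> x) \<partial>lborel) = (\<lambda>x. f x * fourier_integral h x)"
    by (simp add: fourier_integral_wave mult.assoc inner_commute)
  finally show ?thesis .
qed

subsection \<open>Density of continuous functions and continuity of translations\<close>

definition translate :: "'a::euclidean_space \<Rightarrow> 'a L2 \<Rightarrow> 'a L2" where
  "translate t u = abs_L2 (\<lambda>x. rep_L2 u (x - t))"

lemma rep_translate: "AE x in lborel. rep_L2 (translate t u) x = rep_L2 u (x - t)"
  unfolding translate_def by (intro rep_abs_L2 square_integrable_translate square_integrable_rep)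

lemma lborel_integral_translate:
  fixes f :: "'a::euclidean_space \<Rightarrow> 'b::{banach,second_countable_topology}"
  assumes [measurable]: "f \<in> borel_measurable borel"
  shows "(\<integral>x. f (x - t) \<partial>lborel) = (\<integral>x. f x \<partial>lborel)"
proof -
  have "(\<integral>x. f x \<partial>distr lborel borel ((+) (- t))) = (\<integral>x. f (- t + x) \<partial>lborel)"
    by (rule integral_distr) auto
  then show ?thesis by (simp add: lborel_distr_plus)
qed

lemma norm_translate: "norm (translate t u) = norm u"
proof -
  have "(norm (translate t u))\<^sup>2 = (\<integral>x. (cmod (rep_L2 u (x - t)))\<^sup>2 \<partial>lborel)"
    unfolding translate_def
    by (rule norm_abs_L2_sq) (intro square_integrable_translate square_integrable_rep)
  also have "\<dots> = (norm u)\<^sup>2"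
    unfolding norm_L2_sq by (rule lborel_integral_translate) simp
  finally show ?thesis by (simp add: power2_eq_iff_nonneg)
qed

lemma translate_diff: "translate t (u - v) = translate t u - translate t v"
  by (rule L2_eqI, use rep_translate[of t "u - v"] rep_translate[of t u] rep_translate[of t v]
      rep_diff[of "translate t u" "translate t v"] AE_lborel_translate[OF rep_diff[of u v], of t] in eventually_elim) simp

text \<open>Truncating both the values and the support makes a function bounded with bounded support, hence
  integrable.\<close>

lemma dense_truncation:
  fixes u :: "'a::euclidean_space L2"
  shows "\<exists>v. v \<longlonglongrightarrow> u \<and> (\<forall>k. AE x in lborel. rep_L2 (v k) x =
    (if cmod (rep_L2 u x) \<le> real k \<and> norm x \<le> real k then rep_L2 u x else 0))"
proof -
  define f where "f k x = (if cmod (rep_L2 u x) \<le> real k \<and> norm x \<le> real k then rep_L2 u x else 0)" for k x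
  have sq: "square_integrable (f k)" for k
    unfolding square_integrable_def
  proof
    show "integrable lborel (\<lambda>x. (cmod (f k x))\<^sup>2)"
      by (rule Bochner_Integration.integrable_bound[OF integrable_norm_rep[of u]]) (auto simp: f_def)
  qed (simp add: f_def[abs_def])
  note R = rep_abs_L2[OF sq]
  have "(\<lambda>k. abs_L2 (f k)) \<longlonglongrightarrow> u"
  proof (rule L2_dominated_convergence[OF integrable_norm_rep[of u]])
    fix n show "AE x in lborel. (cmod (rep_L2 (abs_L2 (f n)) x - rep_L2 u x))\<^sup>2 \<le> (cmod (rep_L2 u x))\<^sup>2"
      using R[of n] by eventually_elim (simp add: f_def)
  next
    have "AE x in lborel. \<forall>n. rep_L2 (abs_L2 (f n)) x = f n x"
      unfolding AE_all_countable using R by blast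
    then show "AE x in lborel. (\<lambda>n. rep_L2 (abs_L2 (f n)) x) \<longlonglongrightarrow> rep_L2 u x"
    proof eventually_elim
      case (elim x)
      obtain N where N: "max (cmod (rep_L2 u x)) (norm x) \<le> real N" using real_arch_simple by blast
      have "\<forall>\<^sub>F n in sequentially. rep_L2 (abs_L2 (f n)) x = rep_L2 u x"
        using eventually_ge_at_top[of N] by eventually_elim (use N elim in \<open>auto simp: f_def\<close>)
      then show ?case by (rule tendsto_eventually)
    qed
  qed
  with R show ?thesis unfolding f_def by blast
qed

definition cts_compact :: "('a::euclidean_space \<Rightarrow> complex) \<Rightarrow> bool" where
  "cts_compact g \<longleftrightarrow> continuous_on UNIV g \<and> (\<exists>C R. \<forall>x. cmod (g x) \<le> C \<and> (norm x > R \<longrightarrow> g x = 0))"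

lemma integrable_const_ball:
  "integrable lborel (\<lambda>x::'a::euclidean_space. if norm x \<le> R then c else 0 :: real)"
proof -
  have "integrable lborel (\<lambda>x::'a. indicator (cball 0 R) x *\<^sub>R c)"
    using emeasure_bounded_finite[OF bounded_cball[of "0::'a" R]]
    by (intro integrable_scaleR_left) simp
  moreover have "(\<lambda>x::'a. indicator (cball 0 R) x *\<^sub>R c) = (\<lambda>x. if norm x \<le> R then c else 0)"
    by (auto simp: fun_eq_iff indicator_def)
  ultimately show ?thesis by metis
qed

lemma cts_compact_square_integrable:
  assumes "cts_compact g" shows "square_integrable g"
proof -
  obtain C R where C: "\<And>x. cmod (g x) \<le> C" "\<And>x. norm x > R \<Longrightarrow> g x = 0"
    using assms unfolding cts_compact_def by blast
  have "C \<ge> 0" using C(1)[of 0] norm_ge_zero order_trans by blast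
  have meas: "g \<in> borel_measurable borel"
    using assms by (auto simp: cts_compact_def intro: borel_measurable_continuous_onI)
  have "integrable lborel (\<lambda>x. (cmod (g x))\<^sup>2)"
  proof (rule Bochner_Integration.integrable_bound[OF integrable_const_ball[of R "C\<^sup>2"]])
    show "AE x in lborel. norm ((cmod (g x))\<^sup>2) \<le> norm (if norm x \<le> R then C\<^sup>2 else 0)"
      using C \<open>C \<ge> 0\<close> by (auto intro!: AE_I2 power_mono)
  qed (use meas in simp)
  with meas show ?thesis by (simp add: square_integrable_def)
qed

text \<open>Every measurable function is an almost everywhere limit of continuous ones; clipping the
  values and multiplying by a cut-off makes the convergence dominated.\<close>

lemma dense_cts_compact:
  fixes u :: "'a::euclidean_space L2"
  assumes "e > 0"
  obtains g where "cts_compact g" "norm (u - abs_L2 g) < e"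
proof -
  obtain v where v: "v \<longlonglongrightarrow> u" "\<And>k. AE x in lborel. rep_L2 (v k) x =
    (if cmod (rep_L2 u x) \<le> real k \<and> norm x \<le> real k then rep_L2 u x else 0)"
    using dense_truncation[of u] by blast
  obtain k where k: "norm (v k - u) < e / 2"
    using metric_LIMSEQ_D[OF v(1), of "e/2"] assms by (auto simp: dist_norm)
  define f where "f x = (if cmod (rep_L2 u x) \<le> real k \<and> norm x \<le> real k then rep_L2 u x else 0)" for x
  have vf: "AE x in lborel. rep_L2 (v k) x = f x" unfolding f_def by (rule v(2))
  have "f \<in> borel_measurable lebesgue"
    by (rule measurable_completion) (simp add: f_def[abs_def])
  then have "f measurable_on UNIV" by (rule lebesgue_measurable_imp_measurable_on) simp
  then obtain N g where N: "negligible N" and g: "\<And>n. continuous_on UNIV (g n)"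
    and lim: "\<And>x. x \<notin> N \<Longrightarrow> (\<lambda>n. g n x) \<longlonglongrightarrow> f x"
    unfolding measurable_on_def by auto
  \<comment> \<open>\<open>c\<close> clips the values at \<open>k + 1\<close> and \<open>cut\<close> is a continuous cut-off to the ball of radius \<open>k + 1\<close>; neither changes \<open>f\<close>\<close>
  define c where "c z = z / of_real (max 1 (cmod z / (real k + 1)))" for z :: complex
  have c_cont: "continuous_on UNIV c"
    unfolding c_def by (intro continuous_intros) auto
  have c_le: "cmod (c z) \<le> real k + 1" for z
    by (simp add: c_def norm_divide max_def divide_simps)
  have c_id: "c z = z" if "cmod z \<le> real k" for z
    using that by (simp add: c_def max_def field_simps)
  define cut where "cut x = max 0 (min 1 (real k + 1 - norm x))" for x :: 'a
  have cut: "0 \<le> cut x" "cut x \<le> 1" "norm x \<le> real k \<Longrightarrow> cut x = 1" "norm x > real k + 1 \<Longrightarrow> cut x = 0" for x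
    by (auto simp: cut_def)
  define h where "h n x = of_real (cut x) * c (g n x)" for n x
  have h_le: "cmod (h n x) \<le> real k + 1" for n x
  proof -
    have "cmod (h n x) \<le> 1 * (real k + 1)"
      unfolding h_def norm_mult by (intro mult_mono c_le) (use cut in auto)
    then show ?thesis by simp
  qed
  have h: "cts_compact (h n)" for n
    unfolding cts_compact_def
  proof (intro conjI exI allI impI)
    show "continuous_on UNIV (h n)"
      unfolding h_def cut_def
      by (intro continuous_intros continuous_on_compose2[OF c_cont] g) auto
    show "cmod (h n x) \<le> real k + 1" for x by (rule h_le)
    show "norm x > real k + 1 \<Longrightarrow> h n x = 0" for x by (simp add: h_def cut(4))
  qed
  note H = rep_abs_L2[OF cts_compact_square_integrable[OF h]]
  have "(\<lambda>n. abs_L2 (h n)) \<longlonglongrightarrow> v k"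
  proof (rule L2_dominated_convergence[OF integrable_const_ball[of "real k + 1" "(2 * (real k + 1))\<^sup>2"]])
    fix n
    show "AE x in lborel. (cmod (rep_L2 (abs_L2 (h n)) x - rep_L2 (v k) x))\<^sup>2
        \<le> (if norm x \<le> real k + 1 then (2 * (real k + 1))\<^sup>2 else 0)"
      using H[of n] vf
    proof eventually_elim
      case (elim x)
      have fx: "cmod (f x) \<le> real k + 1" by (simp add: f_def)
      have "cmod (h n x - f x) \<le> (real k + 1) + (real k + 1)"
        by (rule order_trans[OF norm_triangle_ineq4 add_mono[OF h_le fx]])
      then have "cmod (h n x - f x) \<le> 2 * (real k + 1)" by simp
      moreover have "norm x > real k + 1 \<Longrightarrow> h n x - f x = 0"
        by (simp add: h_def cut(4) f_def)
      ultimately show ?case using elim by (auto intro!: power_mono)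
    qed
  next
    have "AE x in lborel. x \<notin> N"
      using N unfolding negligible_iff_null_sets by (metis AE_completion_iff AE_not_in)
    moreover have "AE x in lborel. \<forall>n. rep_L2 (abs_L2 (h n)) x = h n x"
      unfolding AE_all_countable using H by blast
    ultimately show "AE x in lborel. (\<lambda>n. rep_L2 (abs_L2 (h n)) x) \<longlonglongrightarrow> rep_L2 (v k) x"
      using vf
    proof eventually_elim
      case (elim x)
      have "(\<lambda>n. c (g n x)) \<longlonglongrightarrow> c (f x)"
        by (rule continuous_on_tendsto_compose[OF c_cont lim[OF elim(1)]]) auto
      then have "(\<lambda>n. h n x) \<longlonglongrightarrow> of_real (cut x) * c (f x)"
        unfolding h_def by (intro tendsto_intros)
      also have "of_real (cut x) * c (f x) = f x"
        by (auto simp: f_def c_id cut(3) c_def)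
      finally show ?case using elim by simp
    qed
  qed
  then obtain n where "norm (abs_L2 (h n) - v k) < e / 2"
    using metric_LIMSEQ_D[of "\<lambda>n. abs_L2 (h n)" "v k" "e/2"] assms by (auto simp: dist_norm)
  with k have "norm (u - abs_L2 (h n)) < e"
    using norm_triangle_ineq[of "u - v k" "v k - abs_L2 (h n)"]
    by (simp add: norm_minus_commute)
  with h show ?thesis using that by blast
qed

text \<open>Convergence is pointwise by continuity, and dominated because the supports of all translates lie in
  one ball.\<close>

lemma translate_cts_compact:
  assumes g: "cts_compact (g :: 'a::euclidean_space \<Rightarrow> complex)" and t: "t \<longlonglongrightarrow> 0"
  shows "(\<lambda>n. translate (t n) (abs_L2 g)) \<longlonglongrightarrow> abs_L2 g"
proof -
  obtain C R where C: "\<And>x. cmod (g x) \<le> C" "\<And>x. norm x > R \<Longrightarrow> g x = 0"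
    using g unfolding cts_compact_def by blast
  obtain T where T: "\<And>n. norm (t n) \<le> T"
    using convergent_imp_Bseq[of t] t by (auto simp: convergent_def Bseq_def)
  have G: "AE x in lborel. rep_L2 (abs_L2 g) x = g x"
    by (intro rep_abs_L2 cts_compact_square_integrable g)
  have Tg: "AE x in lborel. rep_L2 (translate (t n) (abs_L2 g)) x = g (x - t n)" for n
    using rep_translate[of "t n" "abs_L2 g"] AE_lborel_translate[OF G, of "t n"] by eventually_elim simp
  show ?thesis
  proof (rule L2_dominated_convergence[OF integrable_const_ball[of "R + T" "(2 * C)\<^sup>2"]])
    fix n
    show "AE x in lborel. (cmod (rep_L2 (translate (t n) (abs_L2 g)) x - rep_L2 (abs_L2 g) x))\<^sup>2
        \<le> (if norm x \<le> R + T then (2 * C)\<^sup>2 else 0)"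
      using G Tg[of n]
    proof eventually_elim
      case (elim x)
      have "cmod (g (x - t n) - g x) \<le> 2 * C"
        using norm_triangle_ineq4[of "g (x - t n)" "g x"] C(1)[of x] C(1)[of "x - t n"] by linarith
      moreover have "g (x - t n) - g x = 0" if "norm x > R + T"
      proof -
        have "norm x \<le> norm (x - t n) + norm (t n)" using norm_triangle_ineq[of "x - t n" "t n"] by simp
        moreover have "0 \<le> T" using T[of 0] norm_ge_zero order_trans by blast
        ultimately show ?thesis using that T[of n] C(2)[of x] C(2)[of "x - t n"] by auto
      qed
      moreover have "(cmod (g (x - t n) - g x))\<^sup>2 \<le> (2 * C)\<^sup>2"
        using calculation(1) by (intro power_mono) auto
      ultimately show ?case using elim by auto
    qed
  next
    have "AE x in lborel. \<forall>n. rep_L2 (translate (t n) (abs_L2 g)) x = g (x - t n)"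
      unfolding AE_all_countable using Tg by blast
    then show "AE x in lborel. (\<lambda>n. rep_L2 (translate (t n) (abs_L2 g)) x) \<longlonglongrightarrow> rep_L2 (abs_L2 g) x"
      using G
    proof eventually_elim
      case (elim x)
      have "(\<lambda>n. x - t n) \<longlonglongrightarrow> x - 0" by (intro tendsto_intros t)
      then have "(\<lambda>n. g (x - t n)) \<longlonglongrightarrow> g (x - 0)"
        using g by (intro continuous_on_tendsto_compose[of UNIV g]) (auto simp: cts_compact_def)
      then show ?case using elim by simp
    qed
  qed
qed

lemma translate_tendsto:
  fixes u :: "'a::euclidean_space L2"
  assumes t: "t \<longlonglongrightarrow> 0"
  shows "(\<lambda>n. translate (t n) u) \<longlonglongrightarrow> u"
proof (rule metric_LIMSEQ_I)
  fix e :: real assume "e > 0"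
  then obtain g where g: "cts_compact g" "norm (u - abs_L2 g) < e / 3"
    using dense_cts_compact[of "e/3" u] by auto
  obtain N where N: "\<And>n. n \<ge> N \<Longrightarrow> norm (translate (t n) (abs_L2 g) - abs_L2 g) < e / 3"
    using metric_LIMSEQ_D[OF translate_cts_compact[OF g(1) t], of "e/3"] \<open>e > 0\<close> by (auto simp: dist_norm)
  have "dist (translate (t n) u) u < e" if "n \<ge> N" for n
  proof -
    have "norm (translate (t n) u - translate (t n) (abs_L2 g)) < e / 3"
      using g(2) by (simp add: norm_translate flip: translate_diff)
    moreover have "norm (translate (t n) u - u) \<le> norm (translate (t n) u - translate (t n) (abs_L2 g))
        + norm (translate (t n) (abs_L2 g) - abs_L2 g) + norm (u - abs_L2 g)"
      by norm
    ultimately show ?thesis using N[OF that] g(2) by (simp add: dist_norm)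
  qed
  then show "\<exists>N. \<forall>n\<ge>N. dist (translate (t n) u) u < e" by blast
qed

lemma borel_measurable_cnj [measurable]:
  "f \<in> borel_measurable M \<Longrightarrow> (\<lambda>x. cnj (f x)) \<in> borel_measurable M"
  by (rule borel_measurable_continuous_on[of cnj]) (intro continuous_intros)

subsection \<open>Plancherel on integrable square-integrable functions\<close>

lemma cnj_fourier_integral:
  "cnj (fourier_integral f \<omega>) = (\<integral>x. cnj (f x) * wave (- (\<omega> \<bullet> x)) \<partial>lborel)"
  unfolding fourier_integral_wave by (simp add: cnj_wave flip: Bochner_Integration.integral_cnj)

lemma lborel_integral_scale:
  fixes f :: "'a::euclidean_space \<Rightarrow> complex"
  assumes [measurable]: "f \<in> borel_measurable borel" and e: "e > 0"
  shows "(\<integral>x. f x \<partial>lborel) = of_real (e ^ DIM('a)) * (\<integral>x. f (e *\<^sub>R x) \<partial>lborel)"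
proof -
  have "(\<integral>x. f x \<partial>lborel) = (\<integral>x. f x \<partial>density (distr lborel borel (\<lambda>x. 0 + e *\<^sub>R x)) (\<lambda>_. ennreal (\<bar>e\<bar> ^ DIM('a))))"
    using lborel_affine[of e "0::'a"] e by (simp add: ennreal_power)
  also have "\<dots> = (\<integral>x. (e ^ DIM('a)) *\<^sub>R f x \<partial>distr lborel borel (\<lambda>x. 0 + e *\<^sub>R x))"
    using e by (subst integral_density) auto
  also have "\<dots> = (\<integral>x. (e ^ DIM('a)) *\<^sub>R f (0 + e *\<^sub>R x) \<partial>lborel)"
    by (subst integral_distr) auto
  finally show ?thesis by (simp add: scaleR_conv_of_real)
qed

text \<open>The Gaussian factor makes all integrals absolutely convergent.  Fubini turns the
  regularised energy of the transform into a Gaussian average of the autocorrelation of \<open>f\<close>.\<close>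

lemma regularised_Plancherel:
  fixes f :: "'a::euclidean_space \<Rightarrow> complex"
  assumes f: "integrable lborel f" and e: "e > 0"
  shows "integrable lborel (\<lambda>\<omega>. (cmod (fourier_integral f \<omega>))\<^sup>2 * gauss e \<omega>)"
    and "complex_of_real (\<integral>\<omega>. (cmod (fourier_integral f \<omega>))\<^sup>2 * gauss e \<omega> \<partial>lborel)
      = (\<integral>v. of_real (gauss 1 v) * (\<integral>y. f (y + e *\<^sub>R v) * cnj (f y) \<partial>lborel) \<partial>lborel)"
proof -
  have fm [measurable]: "f \<in> borel_measurable borel" using f by (auto dest: borel_measurable_integrable)
  define C where "C = (\<integral>x. cmod (f x) \<partial>lborel)"
  have C: "cmod (fourier_integral f \<omega>) \<le> C" for \<omega> unfolding C_def by (rule norm_fourier_integral_le)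
  have C0: "0 \<le> C" unfolding C_def by simp
  have gi: "integrable lborel (\<lambda>\<omega>::'a. complex_of_real (gauss e \<omega>))"
    using integrable_gauss[OF e] by (simp only: complex_of_real_integrable_eq)
  define h where "h \<omega> = complex_of_real (gauss e \<omega>) * fourier_integral f \<omega>" for \<omega>
  have h: "integrable lborel h"
    unfolding h_def by (rule integrable_times_unimodular[OF gi _ C]) simp
  have hm [measurable]: "h \<in> borel_measurable borel" using h by (auto dest: borel_measurable_integrable)
  have hf: "h \<omega> * cnj (fourier_integral f \<omega>) = of_real ((cmod (fourier_integral f \<omega>))\<^sup>2 * gauss e \<omega>)" for \<omega>
    by (simp add: h_def mult.assoc mult.commute flip: complex_norm_square)
  have "integrable lborel (\<lambda>\<omega>. h \<omega> * cnj (fourier_integral f \<omega>))"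
    by (rule integrable_times_unimodular[OF h, where C=C]) (use C in auto)
  then show "integrable lborel (\<lambda>\<omega>. (cmod (fourier_integral f \<omega>))\<^sup>2 * gauss e \<omega>)"
    unfolding hf complex_of_real_integrable_eq .
  define G where "G x = complex_of_real (gauss (1/e) x / e ^ DIM('a))" for x :: 'a
  have Gm [measurable]: "G \<in> borel_measurable borel" unfolding G_def[abs_def] by measurable
  have G_le: "cmod (G x) \<le> 1 / e ^ DIM('a)" for x
    using e gauss_bounds(1,2)[of "1/e" x] by (simp add: G_def divide_right_mono less_imp_le norm_divide norm_power)
  have Gi: "integrable lborel G"
    unfolding G_def complex_of_real_integrable_eq using integrable_gauss[where 'a='a and e="1/e"] e by simp
  have inner: "(\<integral>\<omega>. h \<omega> * wave (- (y \<bullet> \<omega>)) \<partial>lborel) = (\<integral>z. f (y + z) * G z \<partial>lborel)" for y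
  proof -
    define k where "k \<omega> = complex_of_real (gauss e \<omega>) * wave (- (y \<bullet> \<omega>))" for \<omega>
    have k: "integrable lborel k"
      unfolding k_def by (rule integrable_times_wave[OF gi]) simp
    have kG: "fourier_integral k x = G (x - y)" for x
    proof -
      have "fourier_integral k x = (\<integral>\<omega>. complex_of_real (gauss e \<omega>) * wave (\<omega> \<bullet> (x - y)) \<partial>lborel)"
        unfolding fourier_integral_wave k_def
        by (intro Bochner_Integration.integral_cong refl)
           (simp add: inner_diff_right inner_commute mult.assoc flip: wave_add)
      then show ?thesis by (simp add: gauss_fourier(2)[OF e] G_def)
    qed
    have "(\<integral>\<omega>. h \<omega> * wave (- (y \<bullet> \<omega>)) \<partial>lborel) = (\<integral>\<omega>. fourier_integral f \<omega> * k \<omega> \<partial>lborel)"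
      by (simp add: h_def k_def mult_ac)
    also have "\<dots> = (\<integral>x. f x * fourier_integral k x \<partial>lborel)"
      by (rule fourier_multiplication_formula[OF f k])
    also have "\<dots> = (\<integral>x. f x * G (x - y) \<partial>lborel)"
      by (simp only: kG)
    also have "\<dots> = (\<integral>z. f (y + z) * G z \<partial>lborel)"
      using lborel_integral_translate[of "\<lambda>z. f (y + z) * G z" y] by simp
    finally show ?thesis .
  qed
  have "(\<integral>\<omega>. h \<omega> * cnj (fourier_integral f \<omega>) \<partial>lborel)
      = cnj (\<integral>\<omega>. fourier_integral f \<omega> * cnj (h \<omega>) \<partial>lborel)"
    by (simp add: mult.commute flip: Bochner_Integration.integral_cnj)
  also have "\<dots> = cnj (\<integral>x. f x * fourier_integral (\<lambda>\<omega>. cnj (h \<omega>)) x \<partial>lborel)"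
    using h by (subst fourier_multiplication_formula[OF f]) auto
  also have "\<dots> = (\<integral>y. cnj (f y) * (\<integral>\<omega>. h \<omega> * wave (- (y \<bullet> \<omega>)) \<partial>lborel) \<partial>lborel)"
    by (simp add: cnj_fourier_integral flip: Bochner_Integration.integral_cnj)
  also have "\<dots> = (\<integral>y. (\<integral>z. cnj (f y) * (f (y + z) * G z) \<partial>lborel) \<partial>lborel)"
    unfolding inner by simp
  also have "\<dots> = (\<integral>z. (\<integral>y. cnj (f y) * (f (y + z) * G z) \<partial>lborel) \<partial>lborel)"
  proof (rule lborel_pair.Fubini_integral[symmetric], rule lborel_pair.Fubini_integrable)
    have shifted: "integrable lborel (\<lambda>z. f (y + z))" for y
    proof -
      have "integrable (distr lborel borel ((+) y)) f" unfolding lborel_distr_plus by (rule f)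
      then show ?thesis by (subst (asm) integrable_distr_eq) auto
    qed
    show "integrable lborel (\<lambda>y. \<integral>z. norm (case (y, z) of (y, z) \<Rightarrow> cnj (f y) * (f (y + z) * G z)) \<partial>lborel)"
    proof (rule Bochner_Integration.integrable_bound)
      show "integrable lborel (\<lambda>y. cmod (f y) * (C / e ^ DIM('a)))" using f by simp
      show "AE y in lborel. norm (\<integral>z. norm (case (y, z) of (y, z) \<Rightarrow> cnj (f y) * (f (y + z) * G z)) \<partial>lborel)
         \<le> norm (cmod (f y) * (C / e ^ DIM('a)))"
      proof (rule AE_I2)
        fix y
        have "(\<integral>z. cmod (f (y + z)) * cmod (G z) \<partial>lborel) \<le> (\<integral>z. cmod (f (y + z)) * (1 / e ^ DIM('a)) \<partial>lborel)"
        proof (rule integral_mono)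
          show "integrable lborel (\<lambda>z. cmod (f (y + z)) * cmod (G z))"
            unfolding norm_mult[symmetric]
            by (intro integrable_norm integrable_times_unimodular[OF shifted _ G_le]) simp
          show "integrable lborel (\<lambda>z. cmod (f (y + z)) * (1 / e ^ DIM('a)))"
            by (intro integrable_mult_left integrable_norm shifted)
        qed (intro mult_left_mono G_le norm_ge_zero)
        also have "(\<integral>z. cmod (f (y + z)) * (1 / e ^ DIM('a)) \<partial>lborel) = C * (1 / e ^ DIM('a))"
          unfolding C_def using lborel_integral_translate[of "\<lambda>x. cmod (f x)" "- y"]
          by (simp add: add.commute)
        finally have *: "(\<integral>z. cmod (f (y + z)) * cmod (G z) \<partial>lborel) \<le> C / e ^ DIM('a)" by simp
        have "cmod (f y) * (\<integral>z. cmod (f (y + z)) * cmod (G z) \<partial>lborel) \<le> cmod (f y) * (C / e ^ DIM('a))"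
          by (intro mult_left_mono * norm_ge_zero)
        then show "norm (\<integral>z. norm (case (y, z) of (y, z) \<Rightarrow> cnj (f y) * (f (y + z) * G z)) \<partial>lborel)
            \<le> norm (cmod (f y) * (C / e ^ DIM('a)))"
          using e C0 by (simp add: norm_mult abs_mult)
      qed
    qed measurable
    show "AE y in lborel. integrable lborel (\<lambda>z. case (y, z) of (y, z) \<Rightarrow> cnj (f y) * (f (y + z) * G z))"
      using integrable_times_unimodular[OF shifted _ G_le] by (auto intro!: AE_I2)
  qed measurable
  also have "\<dots> = (\<integral>z. G z * (\<integral>y. f (y + z) * cnj (f y) \<partial>lborel) \<partial>lborel)"
    by (simp add: mult_ac flip: integral_mult_right_zero)
  also have "\<dots> = of_real (e ^ DIM('a)) * (\<integral>v. G (e *\<^sub>R v) * (\<integral>y. f (y + e *\<^sub>R v) * cnj (f y) \<partial>lborel) \<partial>lborel)"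
    by (rule lborel_integral_scale[OF _ e]) measurable
  also have "\<dots> = (\<integral>v. of_real (e ^ DIM('a)) * (G (e *\<^sub>R v) * (\<integral>y. f (y + e *\<^sub>R v) * cnj (f y) \<partial>lborel)) \<partial>lborel)"
    by simp
  also have "\<dots> = (\<integral>v. of_real (gauss 1 v) * (\<integral>y. f (y + e *\<^sub>R v) * cnj (f y) \<partial>lborel) \<partial>lborel)"
  proof (rule Bochner_Integration.integral_cong[OF refl])
    fix v :: 'a
    have "of_real (e ^ DIM('a)) * G (e *\<^sub>R v) = of_real (gauss 1 v)"
      using e by (simp add: G_def gauss_def power_mult_distrib power_divide)
    then show "of_real (e ^ DIM('a)) * (G (e *\<^sub>R v) * (\<integral>y. f (y + e *\<^sub>R v) * cnj (f y) \<partial>lborel))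
       = of_real (gauss 1 v) * (\<integral>y. f (y + e *\<^sub>R v) * cnj (f y) \<partial>lborel)"
      by (simp only: mult.assoc[symmetric])
  qed
  finally show "complex_of_real (\<integral>\<omega>. (cmod (fourier_integral f \<omega>))\<^sup>2 * gauss e \<omega> \<partial>lborel)
      = (\<integral>v. of_real (gauss 1 v) * (\<integral>y. f (y + e *\<^sub>R v) * cnj (f y) \<partial>lborel) \<partial>lborel)"
    unfolding hf integral_complex_of_real .
qed

lemma autocorrelation_translate:
  "(\<integral>y. rep_L2 u (y + t) * cnj (rep_L2 u y) \<partial>lborel) = cinner (translate (- t) u) u"
  unfolding cinner_rep
  by (rule integral_cong_AE) (simp, simp, use rep_translate[of "- t" u] in eventually_elim, simp)

text \<open>As the Gaussian widens, the regularised energy increases to the energy of the transform, while its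
  expression through the autocorrelation tends to the autocorrelation at \<open>0\<close>, by continuity of
  translations.\<close>

theorem Plancherel:
  fixes u :: "'a::euclidean_space L2"
  assumes u: "integrable lborel (rep_L2 u)"
  shows "square_integrable (fourier_integral (rep_L2 u))"
    and "(\<integral>\<omega>. (cmod (fourier_integral (rep_L2 u) \<omega>))\<^sup>2 \<partial>lborel) = (norm u)\<^sup>2"
proof -
  define F where "F = fourier_integral (rep_L2 u)"
  have Fm [measurable]: "F \<in> borel_measurable borel" unfolding F_def by simp
  define e where "e n = inverse (real (Suc n))" for n
  have e: "e n > 0" "e \<longlonglongrightarrow> 0" for n
    unfolding e_def[abs_def] using LIMSEQ_inverse_real_of_nat by auto
  define I where "I n = (\<integral>\<omega>. (cmod (F \<omega>))\<^sup>2 * gauss (e n) \<omega> \<partial>lborel)" for n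
  have In: "complex_of_real (I n) = (\<integral>v. of_real (gauss 1 v) * cinner (translate (- (e n *\<^sub>R v)) u) u \<partial>lborel)" for n
    unfolding I_def F_def regularised_Plancherel(2)[OF u e(1)] autocorrelation_translate ..
  have "(\<lambda>n. complex_of_real (I n)) \<longlonglongrightarrow> (\<integral>v. of_real (gauss 1 (v::'a)) * cinner u u \<partial>lborel)"
    unfolding In
  proof (rule integral_dominated_convergence[where w="\<lambda>v. gauss 1 v * (norm u)\<^sup>2"])
    show "integrable lborel (\<lambda>v::'a. gauss 1 v * (norm u)\<^sup>2)" using integrable_gauss[where 'a='a and e=1] by simp
    show "(\<lambda>v. of_real (gauss 1 v) * cinner (translate (- (e n *\<^sub>R v)) u) u) \<in> borel_measurable lborel" for n
      unfolding autocorrelation_translate[symmetric] by measurable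
    show "AE v in lborel. norm (of_real (gauss 1 v) * cinner (translate (- (e n *\<^sub>R v)) u) u) \<le> gauss 1 v * (norm u)\<^sup>2" for n
    proof (rule AE_I2)
      fix v :: 'a
      have "cmod (cinner (translate (- (e n *\<^sub>R v)) u) u) \<le> (norm u)\<^sup>2"
        using cinner_Cauchy_Schwarz[of "translate (- (e n *\<^sub>R v)) u" u]
        by (simp add: norm_translate power2_eq_square)
      then show "norm (of_real (gauss 1 v) * cinner (translate (- (e n *\<^sub>R v)) u) u) \<le> gauss 1 v * (norm u)\<^sup>2"
        using gauss_bounds(1)[of 1 v] by (simp add: norm_mult)
    qed
    show "AE v in lborel. (\<lambda>n. of_real (gauss 1 v) * cinner (translate (- (e n *\<^sub>R v)) u) u)
        \<longlonglongrightarrow> of_real (gauss 1 v) * cinner u u"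
    proof (rule AE_I2)
      fix v :: 'a
      have "(\<lambda>n. - (e n *\<^sub>R v)) \<longlonglongrightarrow> - (0 *\<^sub>R v)" by (intro tendsto_intros e)
      then have "(\<lambda>n. translate (- (e n *\<^sub>R v)) u) \<longlonglongrightarrow> u" by (intro translate_tendsto) simp
      then show "(\<lambda>n. of_real (gauss 1 v) * cinner (translate (- (e n *\<^sub>R v)) u) u)
        \<longlonglongrightarrow> of_real (gauss 1 v) * cinner u u"
        by (intro tendsto_mult tendsto_const bounded_bilinear.tendsto[OF bounded_bilinear_cinner])
    qed
  qed simp
  moreover have "(\<integral>v. of_real (gauss 1 (v::'a)) * cinner u u \<partial>lborel) = of_real ((norm u)\<^sup>2)"
  proof -
    have "(\<integral>v. of_real (gauss 1 (v::'a)) * cinner u u \<partial>lborel) = complex_of_real (\<integral>v. gauss 1 (v::'a) \<partial>lborel) * cinner u u"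
      by simp
    then show ?thesis by (simp add: integral_gauss_1 cinner_self)
  qed
  ultimately have lim: "I \<longlonglongrightarrow> (norm u)\<^sup>2" by (simp only: tendsto_of_real_iff)
  note M = integral_monotone_convergence_nonneg[where f="\<lambda>n \<omega>. (cmod (F \<omega>))\<^sup>2 * gauss (e n) \<omega>"
      and u="\<lambda>\<omega>. (cmod (F \<omega>))\<^sup>2" and M=lborel and x="(norm u)\<^sup>2"]
  have 1: "integrable lborel (\<lambda>\<omega>. (cmod (F \<omega>))\<^sup>2 * gauss (e n) \<omega>)" for n
    unfolding F_def by (rule regularised_Plancherel[OF u e(1)])
  have 2: "AE \<omega> in lborel. mono (\<lambda>n. (cmod (F \<omega>))\<^sup>2 * gauss (e n) \<omega>)"
  proof (intro AE_I2 monoI mult_left_mono)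
    fix \<omega> :: 'a and m n :: nat assume "m \<le> n"
    then have "e n \<le> e m" by (simp add: e_def field_simps)
    then have "(e n)\<^sup>2 \<le> (e m)\<^sup>2" using e(1)[of n] by (intro power_mono) auto
    then have "(e n)\<^sup>2 * (norm \<omega>)\<^sup>2 \<le> (e m)\<^sup>2 * (norm \<omega>)\<^sup>2" by (intro mult_right_mono) auto
    then show "gauss (e m) \<omega> \<le> gauss (e n) \<omega>" by (simp add: gauss_def mult.assoc)
  qed simp
  have 3: "AE \<omega> in lborel. (\<lambda>n. (cmod (F \<omega>))\<^sup>2 * gauss (e n) \<omega>) \<longlonglongrightarrow> (cmod (F \<omega>))\<^sup>2"
  proof (rule AE_I2)
    fix \<omega> :: 'a
    have "(\<lambda>n. (cmod (F \<omega>))\<^sup>2 * gauss (e n) \<omega>) \<longlonglongrightarrow> (cmod (F \<omega>))\<^sup>2 * exp (- pi * 0\<^sup>2 * (norm \<omega>)\<^sup>2)"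
      unfolding gauss_def by (intro tendsto_intros e)
    then show "(\<lambda>n. (cmod (F \<omega>))\<^sup>2 * gauss (e n) \<omega>) \<longlonglongrightarrow> (cmod (F \<omega>))\<^sup>2" by simp
  qed
  have 4: "AE \<omega> in lborel. 0 \<le> (cmod (F \<omega>))\<^sup>2 * gauss (e n) \<omega>" for n
    by (simp add: gauss_def)
  have "integrable lborel (\<lambda>\<omega>. (cmod (F \<omega>))\<^sup>2)"
    by (rule M(1)[OF 1 2 4 3 lim[unfolded I_def]]) simp
  then show "square_integrable (fourier_integral (rep_L2 u))"
    by (simp add: square_integrable_def flip: F_def)
  show "(\<integral>\<omega>. (cmod (fourier_integral (rep_L2 u) \<omega>))\<^sup>2 \<partial>lborel) = (norm u)\<^sup>2"
    unfolding F_def[symmetric] by (rule M(2)[OF 1 2 4 3 lim[unfolded I_def]]) simp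
qed

subsection \<open>The Fourier transform on square-integrable classes\<close>

definition int_L2 :: "'a::euclidean_space L2 set" where
  "int_L2 = {u. integrable lborel (rep_L2 u)}"

lemma fourier_integral_cong_AE:
  assumes "AE x in lborel. f x = g x" "f \<in> borel_measurable borel" "g \<in> borel_measurable borel"
  shows "fourier_integral f \<omega> = fourier_integral g \<omega>"
  unfolding fourier_integral_wave
  by (rule integral_cong_AE) (use assms in \<open>simp, simp, use assms(1) in eventually_elim, simp\<close>)

lemma int_L2_lincomb:
  assumes "u \<in> int_L2" "v \<in> int_L2"
  shows "c *\<^sub>C u + v \<in> int_L2"
    and "fourier_integral (rep_L2 (c *\<^sub>C u + v)) \<omega>
      = c * fourier_integral (rep_L2 u) \<omega> + fourier_integral (rep_L2 v) \<omega>"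
proof -
  have i: "integrable lborel (rep_L2 u)" "integrable lborel (rep_L2 v)"
    using assms by (auto simp: int_L2_def)
  have ae: "AE x in lborel. rep_L2 (c *\<^sub>C u + v) x = c * rep_L2 u x + rep_L2 v x"
    using rep_plus[of "c *\<^sub>C u" v] rep_scaleC[of c u] by eventually_elim simp
  have "integrable lborel (rep_L2 (c *\<^sub>C u + v)) \<longleftrightarrow> integrable lborel (\<lambda>x. c * rep_L2 u x + rep_L2 v x)"
    by (rule integrable_cong_AE) (use ae in auto)
  with i show "c *\<^sub>C u + v \<in> int_L2" by (simp add: int_L2_def)
  have "fourier_integral (rep_L2 (c *\<^sub>C u + v)) \<omega> = fourier_integral (\<lambda>x. c * rep_L2 u x + rep_L2 v x) \<omega>"
    by (rule fourier_integral_cong_AE[OF ae]) auto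
  also have "\<dots> = (\<integral>x. c * (rep_L2 u x * wave (\<omega> \<bullet> x)) + rep_L2 v x * wave (\<omega> \<bullet> x) \<partial>lborel)"
    unfolding fourier_integral_wave by (simp add: algebra_simps)
  also have "\<dots> = c * fourier_integral (rep_L2 u) \<omega> + fourier_integral (rep_L2 v) \<omega>"
    unfolding fourier_integral_wave using i
    by (subst Bochner_Integration.integral_add) (auto intro!: integrable_mult_right integrable_times_wave)
  finally show "fourier_integral (rep_L2 (c *\<^sub>C u + v)) \<omega>
      = c * fourier_integral (rep_L2 u) \<omega> + fourier_integral (rep_L2 v) \<omega>" .
qed

lemma dense_int_L2:
  fixes u :: "'a::euclidean_space L2"
  obtains v where "v \<longlonglongrightarrow> u" "\<And>k. v k \<in> int_L2"
proof -
  obtain v where v: "v \<longlonglongrightarrow> u" "\<And>k. AE x in lborel. rep_L2 (v k) x =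
    (if cmod (rep_L2 u x) \<le> real k \<and> norm x \<le> real k then rep_L2 u x else 0)"
    using dense_truncation[of u] by blast
  have "v k \<in> int_L2" for k
    unfolding int_L2_def mem_Collect_eq
  proof (rule Bochner_Integration.integrable_bound[OF integrable_const_ball[of "real k" "real k"]])
    show "AE x in lborel. norm (rep_L2 (v k) x) \<le> norm (if norm x \<le> real k then real k else 0)"
      using v(2)[of k] by eventually_elim auto
  qed simp
  with v(1) show ?thesis using that by blast
qed

definition fourier_L1 :: "'a::euclidean_space L2 \<Rightarrow> 'a L2" where
  "fourier_L1 u = abs_L2 (fourier_integral (rep_L2 u))"

lemma rep_fourier_L1:
  "u \<in> int_L2 \<Longrightarrow> AE \<omega> in lborel. rep_L2 (fourier_L1 u) \<omega> = fourier_integral (rep_L2 u) \<omega>"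
  unfolding fourier_L1_def by (rule rep_abs_L2, rule Plancherel) (simp add: int_L2_def)

lemma norm_fourier_L1: "u \<in> int_L2 \<Longrightarrow> norm (fourier_L1 u) = norm u"
proof -
  assume u: "u \<in> int_L2"
  have "(norm (fourier_L1 u))\<^sup>2 = (norm u)\<^sup>2"
    unfolding fourier_L1_def using u
    by (subst norm_abs_L2_sq) (auto simp: int_L2_def Plancherel)
  then show ?thesis by (simp add: power2_eq_iff_nonneg)
qed

lemma fourier_L1_lincomb:
  assumes "u \<in> int_L2" "v \<in> int_L2"
  shows "fourier_L1 (c *\<^sub>C u + v) = c *\<^sub>C fourier_L1 u + fourier_L1 v"
  by (rule L2_eqI, use rep_fourier_L1[OF assms(1)] rep_fourier_L1[OF assms(2)]
      rep_fourier_L1[OF int_L2_lincomb(1)[OF assms, of c]] rep_plus[of "c *\<^sub>C fourier_L1 u" "fourier_L1 v"]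
      rep_scaleC[of c "fourier_L1 u"] in eventually_elim) (simp add: int_L2_lincomb(2)[OF assms])

lemma minus_as_lincomb: "u - v = (- 1) *\<^sub>C v + (u :: 'a::euclidean_space L2)"
proof -
  have "u - v = u + (- 1) *\<^sub>C v" unfolding minus_L2_def uminus_L2_def ..
  then show ?thesis by (simp only: add.commute)
qed

lemma fourier_L1_diff:
  assumes "u \<in> int_L2" "v \<in> int_L2"
  shows "norm (fourier_L1 u - fourier_L1 v) = norm (u - v)"
  unfolding minus_as_lincomb fourier_L1_lincomb[OF assms(2,1), symmetric]
  by (rule norm_fourier_L1, rule int_L2_lincomb) (use assms in auto)

text \<open>The integral transform is a linear isometry on the dense subspace \<open>int_L2\<close>; its continuous
  extension is the unique function that satisfies the description of \<open>fourier\<close>.\<close>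

lemma fourier_characterisation:
  shows continuous_fourier: "continuous_on UNIV (fourier :: 'a::euclidean_space L2 \<Rightarrow> _)"
    and fourier_int_L2: "u \<in> int_L2 \<Longrightarrow> fourier u = fourier_L1 (u :: 'a L2)"
proof -
  have cl: "closure (int_L2 :: 'a L2 set) = UNIV"
  proof (rule UNIV_eq_I[symmetric])
    fix u :: "'a L2"
    obtain v where "v \<longlonglongrightarrow> u" "\<And>k. v k \<in> int_L2" using dense_int_L2 by blast
    then show "u \<in> closure int_L2" unfolding closure_sequential by blast
  qed
  have "uniformly_continuous_on int_L2 (fourier_L1 :: 'a L2 \<Rightarrow> _)"
    unfolding uniformly_continuous_on_def dist_norm by (metis fourier_L1_diff)
  then obtain G where G: "uniformly_continuous_on (closure int_L2) G"
      "\<And>u :: 'a L2. u \<in> int_L2 \<Longrightarrow> fourier_L1 u = G u"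
    by (rule uniformly_continuous_on_extension_on_closure) blast
  have Gc: "continuous_on UNIV G" using G(1) uniformly_continuous_imp_continuous unfolding cl by blast
  let ?P = "\<lambda>F :: 'a L2 \<Rightarrow> 'a L2. continuous_on UNIV F \<and>
     (\<forall>f. integrable lborel (rep_L2 f) \<longrightarrow>
        (AE \<omega> in lborel. rep_L2 (F f) \<omega> = fourier_integral (rep_L2 f) \<omega>))"
  have P_L1: "F u = fourier_L1 u" if "?P F" "u \<in> int_L2" for F u
  proof -
    have F: "AE \<omega> in lborel. rep_L2 (F u) \<omega> = fourier_integral (rep_L2 u) \<omega>"
      using that by (simp add: int_L2_def)
    show ?thesis by (rule L2_eqI, use rep_fourier_L1[OF that(2)] F in eventually_elim) simp
  qed
  have "?P G"
  proof (intro conjI Gc allI impI)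
    fix f :: "'a L2" assume "integrable lborel (rep_L2 f)"
    then have f: "f \<in> int_L2" by (simp add: int_L2_def)
    show "AE \<omega> in lborel. rep_L2 (G f) \<omega> = fourier_integral (rep_L2 f) \<omega>"
      using rep_fourier_L1[OF f] by (simp add: G(2)[OF f])
  qed
  moreover have "F = G" if "?P F" for F
  proof
    fix u :: "'a L2"
    obtain v where v: "v \<longlonglongrightarrow> u" "\<And>k. v k \<in> int_L2" using dense_int_L2 by blast
    have "(\<lambda>k. F (v k)) \<longlonglongrightarrow> F u" using that v(1)
      by (auto intro: continuous_on_tendsto_compose[of UNIV F])
    moreover have "(\<lambda>k. G (v k)) \<longlonglongrightarrow> G u"
      by (rule continuous_on_tendsto_compose[OF Gc v(1)]) auto
    moreover have "F (v k) = G (v k)" for k using P_L1[OF that v(2)] G(2)[OF v(2)] by simp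
    ultimately show "F u = G u" using LIMSEQ_unique by simp
  qed
  ultimately have "fourier = G" unfolding fourier_def by (intro the_equality)
  with Gc G(2) show "continuous_on UNIV (fourier :: 'a L2 \<Rightarrow> _)" "u \<in> int_L2 \<Longrightarrow> fourier u = fourier_L1 (u :: 'a L2)"
    by auto
qed

lemma fourier_tendsto: "v \<longlonglongrightarrow> u \<Longrightarrow> (\<lambda>k. fourier (v k)) \<longlonglongrightarrow> fourier u"
  by (rule continuous_on_tendsto_compose[OF continuous_fourier]) auto

lemma fourier_lincomb: "fourier (c *\<^sub>C u + v) = c *\<^sub>C fourier u + fourier v"
proof -
  obtain u' where u': "u' \<longlonglongrightarrow> u" "\<And>k. u' k \<in> int_L2" using dense_int_L2 by blast
  obtain v' where v': "v' \<longlonglongrightarrow> v" "\<And>k. v' k \<in> int_L2" using dense_int_L2 by blast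
  have eq: "fourier (c *\<^sub>C u' k + v' k) = c *\<^sub>C fourier (u' k) + fourier (v' k)" for k
    using u'(2)[of k] v'(2)[of k] by (simp add: fourier_int_L2 int_L2_lincomb(1) fourier_L1_lincomb)
  have "(\<lambda>k. fourier (c *\<^sub>C u' k + v' k)) \<longlonglongrightarrow> fourier (c *\<^sub>C u + v)"
    by (intro fourier_tendsto tendsto_add v' bounded_linear.tendsto[OF bounded_linear_scaleC] u')
  moreover have "(\<lambda>k. c *\<^sub>C fourier (u' k) + fourier (v' k)) \<longlonglongrightarrow> c *\<^sub>C fourier u + fourier v"
    by (intro tendsto_add fourier_tendsto v' bounded_linear.tendsto[OF bounded_linear_scaleC] u')
  ultimately show ?thesis unfolding eq using LIMSEQ_unique by blast
qed

lemma norm_fourier: "norm (fourier u) = norm u"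
proof -
  obtain v where v: "v \<longlonglongrightarrow> u" "\<And>k. v k \<in> int_L2" using dense_int_L2 by blast
  have "(\<lambda>k. norm (fourier (v k))) \<longlonglongrightarrow> norm (fourier u)" by (intro tendsto_norm fourier_tendsto v)
  moreover have "(\<lambda>k. norm (fourier (v k))) \<longlonglongrightarrow> norm u"
    using v by (simp add: fourier_int_L2 norm_fourier_L1 tendsto_norm)
  ultimately show ?thesis using LIMSEQ_unique by blast
qed

lemma fourier_0 [simp]: "fourier 0 = 0" using norm_fourier[of 0] by simp

lemma fourier_add: "fourier (u + v) = fourier u + fourier v"
  using fourier_lincomb[of 1 u v] by (simp add: scaleC_one)

lemma fourier_scaleC: "fourier (c *\<^sub>C u) = c *\<^sub>C fourier u"
  using fourier_lincomb[of c u 0] by simp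

lemma fourier_diff: "fourier (u - v) = fourier u - fourier v"
  unfolding minus_as_lincomb by (rule fourier_lincomb)

lemma fourier_sum: "fourier (\<Sum>i\<in>I. u i) = (\<Sum>i\<in>I. fourier (u i))"
  by (induction I rule: infinite_finite_induct) (auto simp: fourier_add)

lemma fourier_inject: "fourier u = fourier v \<longleftrightarrow> u = v"
proof
  assume "fourier u = fourier v"
  then have "norm (fourier (u - v)) = 0" by (simp add: fourier_diff)
  then show "u = v" by (simp add: norm_fourier)
qed simp

lemma polarisation:
  "4 * cinner u v = of_real ((norm (u + v))\<^sup>2) - of_real ((norm (u + (-1) *\<^sub>C v))\<^sup>2)
     + \<i> * of_real ((norm (u + \<i> *\<^sub>C v))\<^sup>2) - \<i> * of_real ((norm (u + (-\<i>) *\<^sub>C v))\<^sup>2)"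
  unfolding cinner_self[symmetric] cinner_add_left cinner_add_right cinner_scaleC_left cinner_scaleC_right
  by (simp add: algebra_simps)

lemma cinner_fourier: "cinner (fourier u) (fourier v) = cinner u v"
proof -
  have "4 * cinner (fourier u) (fourier v) = 4 * cinner u v"
    unfolding polarisation fourier_scaleC[symmetric] fourier_add[symmetric] norm_fourier ..
  then show ?thesis by simp
qed

lemma shift_eq_translate: "Defs.shift k u = translate (of_int_vec k) u"
  by (simp add: Defs.shift_def translate_def)

lemma translate_tendsto':
  assumes "v \<longlonglongrightarrow> u" shows "(\<lambda>n. translate t (v n)) \<longlonglongrightarrow> translate t u"
proof -
  have "(\<lambda>n. norm (v n - u)) \<longlonglongrightarrow> 0" by (rule tendsto_norm_zero, rule LIM_zero[OF assms])
  then have "(\<lambda>n. norm (translate t (v n) - translate t u)) \<longlonglongrightarrow> 0"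
    unfolding translate_diff[symmetric] norm_translate .
  then show ?thesis by (rule LIM_zero_cancel[OF tendsto_norm_zero_cancel])
qed

subsection \<open>Bounded multipliers\<close>

definition bounded_borel :: "('a::euclidean_space \<Rightarrow> complex) \<Rightarrow> bool" where
  "bounded_borel m \<longleftrightarrow> m \<in> borel_measurable borel \<and> (\<exists>C. \<forall>x. cmod (m x) \<le> C)"

definition mulL2 :: "('a::euclidean_space \<Rightarrow> complex) \<Rightarrow> 'a L2 \<Rightarrow> 'a L2" where
  "mulL2 m u = abs_L2 (\<lambda>x. m x * rep_L2 u x)"

lemma bounded_borelD [measurable_dest]: "bounded_borel m \<Longrightarrow> m \<in> borel_measurable borel"
  by (simp add: bounded_borel_def)

lemma bounded_borelE:
  assumes "bounded_borel m" obtains C where "C \<ge> 0" "\<And>x. cmod (m x) \<le> C"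
  using assms unfolding bounded_borel_def by (metis norm_ge_zero order_trans)

lemma bounded_borelI:
  "m \<in> borel_measurable borel \<Longrightarrow> (\<And>x. cmod (m x) \<le> C) \<Longrightarrow> bounded_borel m"
  unfolding bounded_borel_def by blast

lemma square_integrable_bounded_mult:
  assumes "f \<in> borel_measurable borel" "AE x in lborel. cmod (f x) \<le> C * cmod (rep_L2 u x)"
  shows "square_integrable f" "norm (abs_L2 f) \<le> \<bar>C\<bar> * norm u"
proof -
  have ae: "AE x in lborel. (cmod (f x))\<^sup>2 \<le> C\<^sup>2 * (cmod (rep_L2 u x))\<^sup>2"
    using assms(2) by eventually_elim (metis norm_ge_zero power_mono power_mult_distrib)
  have i: "integrable lborel (\<lambda>x. C\<^sup>2 * (cmod (rep_L2 u x))\<^sup>2)"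
    by (intro integrable_mult_right integrable_norm_rep)
  have "integrable lborel (\<lambda>x. (cmod (f x))\<^sup>2)"
    by (rule Bochner_Integration.integrable_bound[OF i]) (use assms(1) ae in auto)
  with assms(1) show f: "square_integrable f" by (simp add: square_integrable_def)
  have "(norm (abs_L2 f))\<^sup>2 \<le> (\<integral>x. C\<^sup>2 * (cmod (rep_L2 u x))\<^sup>2 \<partial>lborel)"
    unfolding norm_abs_L2_sq[OF f]
    by (rule integral_mono_AE[OF _ i ae]) (use f in \<open>simp add: square_integrable_def\<close>)
  also have "\<dots> = (\<bar>C\<bar> * norm u)\<^sup>2" by (simp add: norm_L2_sq power_mult_distrib)
  finally show "norm (abs_L2 f) \<le> \<bar>C\<bar> * norm u" by (rule power2_le_imp_le) simp
qed

lemma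
  assumes m: "bounded_borel m"
  shows rep_mulL2: "AE x in lborel. rep_L2 (mulL2 m u) x = m x * rep_L2 u x"
    and norm_mulL2_le: "(\<And>x. cmod (m x) \<le> C) \<Longrightarrow> norm (mulL2 m u) \<le> C * norm u"
proof -
  note [measurable] = bounded_borelD[OF m]
  obtain B where B: "\<And>x. cmod (m x) \<le> B" using m by (metis bounded_borelE)
  show "AE x in lborel. rep_L2 (mulL2 m u) x = m x * rep_L2 u x"
    unfolding mulL2_def
    by (intro rep_abs_L2 square_integrable_bounded_mult(1)[where C=B and u=u])
       (auto simp: norm_mult intro!: mult_right_mono B)
  assume C: "\<And>x. cmod (m x) \<le> C"
  have "norm (mulL2 m u) \<le> \<bar>C\<bar> * norm u"
    unfolding mulL2_def
    by (intro square_integrable_bounded_mult(2)) (auto simp: norm_mult intro!: mult_right_mono C)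
  moreover have "0 \<le> C" using C[of 0] norm_ge_zero order_trans by blast
  ultimately show "norm (mulL2 m u) \<le> C * norm u" by simp
qed

lemma mulL2_eqI:
  assumes "bounded_borel m" "AE x in lborel. m x * rep_L2 u x = rep_L2 v x"
  shows "mulL2 m u = v"
  by (rule L2_eqI, use rep_mulL2[OF assms(1), of u] assms(2) in eventually_elim) simp

lemma bounded_borel_const: "bounded_borel (\<lambda>x. c)"
  by (rule bounded_borelI[where C="cmod c"]) auto

lemma bounded_borel_add:
  assumes "bounded_borel m" "bounded_borel n" shows "bounded_borel (\<lambda>x. m x + n x)"
proof -
  obtain C where C: "C \<ge> 0" "\<And>x. cmod (m x) \<le> C" using assms(1) by (metis bounded_borelE)
  obtain D where D: "D \<ge> 0" "\<And>x. cmod (n x) \<le> D" using assms(2) by (metis bounded_borelE)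
  show ?thesis
    by (rule bounded_borelI[where C="C + D"])
       (use assms C D in \<open>auto simp: bounded_borel_def intro!: order_trans[OF norm_triangle_ineq add_mono]\<close>)
qed

lemma bounded_borel_diff:
  assumes "bounded_borel m" "bounded_borel n" shows "bounded_borel (\<lambda>x. m x - n x)"
proof -
  obtain C where C: "C \<ge> 0" "\<And>x. cmod (m x) \<le> C" using assms(1) by (metis bounded_borelE)
  obtain D where D: "D \<ge> 0" "\<And>x. cmod (n x) \<le> D" using assms(2) by (metis bounded_borelE)
  show ?thesis
    by (rule bounded_borelI[where C="C + D"])
       (use assms C D in \<open>auto simp: bounded_borel_def intro!: order_trans[OF norm_triangle_ineq4 add_mono]\<close>)
qed

lemma bounded_borel_mult:
  assumes "bounded_borel m" "bounded_borel n" shows "bounded_borel (\<lambda>x. m x * n x)"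
proof -
  obtain C where C: "C \<ge> 0" "\<And>x. cmod (m x) \<le> C" using assms(1) by (metis bounded_borelE)
  obtain D where D: "D \<ge> 0" "\<And>x. cmod (n x) \<le> D" using assms(2) by (metis bounded_borelE)
  show ?thesis
    by (rule bounded_borelI[where C="C * D"])
       (use assms C D in \<open>auto simp: norm_mult bounded_borel_def intro!: mult_mono\<close>)
qed

lemma bounded_borel_cnj: "bounded_borel m \<Longrightarrow> bounded_borel (\<lambda>x. cnj (m x))"
  unfolding bounded_borel_def by auto

lemma mulL2_add_right:
  assumes m: "bounded_borel m" shows "mulL2 m (u + v) = mulL2 m u + mulL2 m v"
  by (rule mulL2_eqI[OF m], use rep_plus[of u v] rep_plus[of "mulL2 m u" "mulL2 m v"]
      rep_mulL2[OF m, of u] rep_mulL2[OF m, of v] in eventually_elim) (simp add: ring_distribs)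

lemma mulL2_diff_right:
  assumes m: "bounded_borel m" shows "mulL2 m (u - v) = mulL2 m u - mulL2 m v"
  by (rule mulL2_eqI[OF m], use rep_diff[of u v] rep_diff[of "mulL2 m u" "mulL2 m v"]
      rep_mulL2[OF m, of u] rep_mulL2[OF m, of v] in eventually_elim) (simp add: ring_distribs)

lemma mulL2_scaleC_right:
  assumes m: "bounded_borel m" shows "mulL2 m (c *\<^sub>C u) = c *\<^sub>C mulL2 m u"
  by (rule mulL2_eqI[OF m], use rep_scaleC[of c u] rep_scaleC[of c "mulL2 m u"]
      rep_mulL2[OF m, of u] in eventually_elim) simp

lemma mulL2_zero_right: "bounded_borel m \<Longrightarrow> mulL2 m 0 = 0"
  using mulL2_diff_right[of m 0 0] by simp

lemma mulL2_sum_right: "bounded_borel m \<Longrightarrow> mulL2 m (\<Sum>i\<in>I. u i) = (\<Sum>i\<in>I. mulL2 m (u i))"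
  by (induction I rule: infinite_finite_induct) (auto simp: mulL2_add_right mulL2_zero_right)

lemma mulL2_add_left:
  assumes m: "bounded_borel m" and n: "bounded_borel n"
  shows "mulL2 (\<lambda>x. m x + n x) u = mulL2 m u + mulL2 n u"
  by (rule mulL2_eqI[OF bounded_borel_add[OF m n]], use rep_plus[of "mulL2 m u" "mulL2 n u"]
      rep_mulL2[OF m, of u] rep_mulL2[OF n, of u] in eventually_elim) (simp add: ring_distribs)

lemma mulL2_diff_left:
  assumes m: "bounded_borel m" and n: "bounded_borel n"
  shows "mulL2 (\<lambda>x. m x - n x) u = mulL2 m u - mulL2 n u"
  by (rule mulL2_eqI[OF bounded_borel_diff[OF m n]], use rep_diff[of "mulL2 m u" "mulL2 n u"]
      rep_mulL2[OF m, of u] rep_mulL2[OF n, of u] in eventually_elim) (simp add: ring_distribs)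

lemma mulL2_mulL2:
  assumes "bounded_borel m" "bounded_borel n"
  shows "mulL2 m (mulL2 n u) = mulL2 (\<lambda>x. m x * n x) u"
  by (rule mulL2_eqI[OF assms(1)], use rep_mulL2[OF assms(1), of "mulL2 n u"]
      rep_mulL2[OF assms(2), of u] rep_mulL2[OF bounded_borel_mult[OF assms], of u] in eventually_elim) simp

lemma mulL2_const: "mulL2 (\<lambda>x. c) u = c *\<^sub>C u"
  by (rule mulL2_eqI[OF bounded_borel_const], use rep_scaleC[of c u] in eventually_elim) simp

lemma mulL2_one: "mulL2 (\<lambda>x. 1) u = u"
  by (simp add: mulL2_const scaleC_one)

lemma bounded_linear_mulL2: "bounded_borel m \<Longrightarrow> bounded_linear (mulL2 m)"
proof -
  assume m: "bounded_borel m"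
  obtain C where C: "\<And>x. cmod (m x) \<le> C" using m by (metis bounded_borelE)
  show ?thesis
    by (rule bounded_linear_intro[where K=C])
       (use norm_mulL2_le[OF m C] in \<open>auto simp: mulL2_add_right[OF m] scaleR_L2_def
         mulL2_scaleC_right[OF m] mult.commute\<close>)
qed

lemma cinner_mulL2:
  assumes m: "bounded_borel m"
  shows "cinner (mulL2 m u) v = cinner u (mulL2 (\<lambda>x. cnj (m x)) v)"
proof -
  note [measurable] = bounded_borelD[OF m]
  show ?thesis
    unfolding cinner_rep
  proof (rule integral_cong_AE)
    show "AE x in lborel. rep_L2 (mulL2 m u) x * cnj (rep_L2 v x)
        = rep_L2 u x * cnj (rep_L2 (mulL2 (\<lambda>x. cnj (m x)) v) x)"
      using rep_mulL2[OF m, of u] rep_mulL2[OF bounded_borel_cnj[OF m], of v]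
      by eventually_elim simp
  qed auto
qed

lemma mulL2_tendsto:
  assumes m: "\<And>n. bounded_borel (m n)" "bounded_borel k"
    and C: "\<And>n x. cmod (m n x) \<le> C" and lim: "\<And>x. (\<lambda>n. m n x) \<longlonglongrightarrow> k x"
  shows "(\<lambda>n. mulL2 (m n) u) \<longlonglongrightarrow> mulL2 k u"
proof (rule L2_dominated_convergence)
  have k: "cmod (k x) \<le> C" for x
    using C by (intro LIMSEQ_le_const2[OF tendsto_norm[OF lim]]) blast
  show "integrable lborel (\<lambda>x. (2 * C)\<^sup>2 * (cmod (rep_L2 u x))\<^sup>2)"
    by (intro integrable_mult_right integrable_norm_rep)
  show "AE x in lborel. (cmod (rep_L2 (mulL2 (m n) u) x - rep_L2 (mulL2 k u) x))\<^sup>2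
      \<le> (2 * C)\<^sup>2 * (cmod (rep_L2 u x))\<^sup>2" for n
    using rep_mulL2[OF m(1)[of n], of u] rep_mulL2[OF m(2), of u]
  proof eventually_elim
    case (elim x)
    have "cmod (m n x - k x) \<le> C + C"
      by (rule order_trans[OF norm_triangle_ineq4 add_mono[OF C k]])
    then have "cmod (m n x - k x) * cmod (rep_L2 u x) \<le> (2 * C) * cmod (rep_L2 u x)"
      by (intro mult_right_mono) auto
    moreover have "cmod (m n x * rep_L2 u x - k x * rep_L2 u x) = cmod (m n x - k x) * cmod (rep_L2 u x)"
      by (simp add: norm_mult flip: left_diff_distrib)
    ultimately show ?case unfolding elim by (metis norm_ge_zero power_mono power_mult_distrib)
  qed
  have "AE x in lborel. \<forall>n. rep_L2 (mulL2 (m n) u) x = m n x * rep_L2 u x"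
    unfolding AE_all_countable using rep_mulL2[OF m(1)] by blast
  then show "AE x in lborel. (\<lambda>n. rep_L2 (mulL2 (m n) u) x) \<longlonglongrightarrow> rep_L2 (mulL2 k u) x"
    using rep_mulL2[OF m(2), of u]
  proof eventually_elim
    case (elim x)
    then show ?case by (simp add: tendsto_mult_right lim)
  qed
qed

definition lattice_char :: "int ^ 'd \<Rightarrow> real ^ 'd \<Rightarrow> complex" where
  "lattice_char k \<omega> = wave (\<omega> \<bullet> of_int_vec k)"

lemma bounded_borel_char: "bounded_borel (lattice_char k)"
  by (rule bounded_borelI[where C=1]) (auto simp: lattice_char_def[abs_def])

text \<open>For integrable functions this is a substitution in the integral; both sides are continuous.\<close>

lemma fourier_shift:
  fixes k :: "int ^ 'd"
  shows "fourier (Defs.shift k u) = mulL2 (lattice_char k) (fourier u)"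
proof -
  define t where "t = (of_int_vec k :: real ^ 'd)"
  have L1: "fourier (translate t v) = mulL2 (lattice_char k) (fourier v)" if v: "v \<in> int_L2" for v
  proof -
    have vi: "integrable lborel (rep_L2 v)" using v by (simp add: int_L2_def)
    have "integrable (distr lborel borel ((+) (- t))) (rep_L2 v)" unfolding lborel_distr_plus by (rule vi)
    then have i: "integrable lborel (\<lambda>x. rep_L2 v (x - t))"
      by (subst (asm) integrable_distr_eq) auto
    have ae: "AE x in lborel. rep_L2 (translate t v) x = rep_L2 v (x - t)" by (rule rep_translate)
    have "integrable lborel (rep_L2 (translate t v)) \<longleftrightarrow> integrable lborel (\<lambda>x. rep_L2 v (x - t))"
      by (rule integrable_cong_AE) (use ae in auto)
    with i have tv: "translate t v \<in> int_L2" by (simp add: int_L2_def)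
    have eq: "fourier_integral (rep_L2 (translate t v)) \<omega> = lattice_char k \<omega> * fourier_integral (rep_L2 v) \<omega>" for \<omega>
    proof -
      have "fourier_integral (rep_L2 (translate t v)) \<omega> = fourier_integral (\<lambda>x. rep_L2 v (x - t)) \<omega>"
        by (rule fourier_integral_cong_AE[OF ae]) auto
      also have "\<dots> = (\<integral>x. rep_L2 v (x - t) * wave (\<omega> \<bullet> (x - t + t)) \<partial>lborel)"
        by (simp add: fourier_integral_wave)
      also have "\<dots> = (\<integral>x. rep_L2 v x * wave (\<omega> \<bullet> (x + t)) \<partial>lborel)"
        by (rule lborel_integral_translate[of "\<lambda>x. rep_L2 v x * wave (\<omega> \<bullet> (x + t))"]) simp
      also have "\<dots> = (\<integral>x. lattice_char k \<omega> * (rep_L2 v x * wave (\<omega> \<bullet> x)) \<partial>lborel)"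
        by (simp add: lattice_char_def t_def inner_add_right wave_add mult_ac)
      finally show ?thesis by (simp add: fourier_integral_wave)
    qed
    have "mulL2 (lattice_char k) (fourier v) = fourier (translate t v)"
      by (rule mulL2_eqI[OF bounded_borel_char], use rep_fourier_L1[OF v] rep_fourier_L1[OF tv] in eventually_elim)
         (simp add: fourier_int_L2 v tv eq)
    then show ?thesis ..
  qed
  obtain v where v: "v \<longlonglongrightarrow> u" "\<And>k. v k \<in> int_L2" using dense_int_L2 by blast
  have "(\<lambda>n. fourier (translate t (v n))) \<longlonglongrightarrow> fourier (translate t u)"
    by (intro fourier_tendsto translate_tendsto' v)
  moreover have "(\<lambda>n. mulL2 (lattice_char k) (fourier (v n))) \<longlonglongrightarrow> mulL2 (lattice_char k) (fourier u)"
    by (intro bounded_linear.tendsto[OF bounded_linear_mulL2] bounded_borel_char fourier_tendsto v)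
  ultimately show ?thesis
    unfolding L1[OF v(2)] shift_eq_translate t_def[symmetric] using LIMSEQ_unique by blast
qed

section \<open>Bounded periodic multipliers\<close>

text \<open>Multipliers are genuine functions, periodic everywhere, so that pointwise constructions such as
  roots of polynomials apply to them directly.\<close>

definition multiplier :: "(real ^ 'd \<Rightarrow> complex) \<Rightarrow> bool" where
  "multiplier m \<longleftrightarrow> bounded_borel m \<and> (\<forall>\<omega> k. m (\<omega> + of_int_vec k) = m \<omega>)"

definition frac_vec :: "real ^ 'd \<Rightarrow> real ^ 'd" where
  "frac_vec \<omega> = (\<chi> i. frac (\<omega> $ i))"

definition floor_vec :: "real ^ 'd \<Rightarrow> int ^ 'd" where
  "floor_vec \<omega> = (\<chi> i. \<lfloor>\<omega> $ i\<rfloor>)"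

lemma of_int_vec_nth [simp]: "of_int_vec k $ i = real_of_int (k $ i)"
  by (simp add: of_int_vec_def)

lemma of_int_vec_add: "of_int_vec (k + l) = of_int_vec k + of_int_vec l"
  by (simp add: vec_eq_iff)

lemma of_int_vec_uminus: "of_int_vec (- k) = - of_int_vec k"
  by (simp add: vec_eq_iff)

lemma of_int_vec_0 [simp]: "of_int_vec 0 = 0"
  by (simp add: vec_eq_iff)

lemma frac_plus_floor: "frac_vec \<omega> + of_int_vec (floor_vec \<omega>) = \<omega>"
  by (simp add: vec_eq_iff frac_vec_def floor_vec_def frac_def)

lemma frac_vec_add [simp]: "frac_vec (\<omega> + of_int_vec k) = frac_vec \<omega>"
  by (simp add: vec_eq_iff frac_vec_def frac_def)

lemma frac_vec_cube [simp]: "frac_vec \<omega> \<in> unit_cube"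
  by (simp add: unit_cube_def frac_vec_def frac_lt_1)

lemma frac_vec_ident: "\<omega> \<in> unit_cube \<Longrightarrow> frac_vec \<omega> = \<omega>"
  by (simp add: unit_cube_def frac_vec_def vec_eq_iff frac_eq)

lemma borel_measurable_vecI:
  fixes f :: "'a \<Rightarrow> 'b::euclidean_space ^ 'n"
  assumes "\<And>i. (\<lambda>x. f x $ i) \<in> borel_measurable M"
  shows "f \<in> borel_measurable M"
proof (subst borel_measurable_euclidean_space, intro ballI)
  fix b :: "'b ^ 'n" assume "b \<in> Basis"
  then obtain i u where b: "b = axis i u" by (auto simp: Basis_vec_def)
  show "(\<lambda>x. f x \<bullet> b) \<in> borel_measurable M"
    unfolding b inner_axis using assms[of i] by measurable
qed

lemma borel_measurable_nth [measurable]: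
  fixes f :: "'a \<Rightarrow> 'b::euclidean_space ^ 'n"
  assumes "f \<in> borel_measurable M"
  shows "(\<lambda>x. f x $ i) \<in> borel_measurable M"
  by (rule borel_measurable_continuous_on[OF _ assms]) (intro continuous_intros)

lemma frac_borel [measurable]: "(frac :: real \<Rightarrow> real) \<in> borel_measurable borel"
  unfolding frac_def[abs_def] by measurable

lemma frac_vec_borel [measurable]: "frac_vec \<in> borel_measurable borel"
  unfolding frac_vec_def[abs_def] by (rule borel_measurable_vecI) simp

lemma unit_cube_borel [measurable]: "unit_cube \<in> sets borel"
  unfolding unit_cube_def by measurable

lemma multiplierD: "multiplier m \<Longrightarrow> bounded_borel m"
  by (simp add: multiplier_def)

lemma multiplier_borel [measurable_dest]: "multiplier m \<Longrightarrow> m \<in> borel_measurable borel"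
  by (simp add: multiplier_def bounded_borel_def)

lemma multiplier_periodic: "multiplier m \<Longrightarrow> m (\<omega> + of_int_vec k) = m \<omega>"
  by (simp add: multiplier_def)

lemma multiplier_frac: "multiplier m \<Longrightarrow> m (frac_vec \<omega>) = m \<omega>"
  using multiplier_periodic[of m "frac_vec \<omega>" "floor_vec \<omega>"] by (simp add: frac_plus_floor)

lemma multiplier_compose_frac:
  "f \<in> borel_measurable borel \<Longrightarrow> (\<And>\<omega>. cmod (f \<omega>) \<le> C) \<Longrightarrow> multiplier (\<lambda>\<omega>. f (frac_vec \<omega>))"
  unfolding multiplier_def by (auto intro!: bounded_borelI[where C=C])

lemma multiplier_const: "multiplier (\<lambda>\<omega>. c)"
  by (simp add: multiplier_def bounded_borel_const)

lemma multiplier_add: "multiplier m \<Longrightarrow> multiplier n \<Longrightarrow> multiplier (\<lambda>\<omega>. m \<omega> + n \<omega>)"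
  by (simp add: multiplier_def bounded_borel_add)

lemma multiplier_diff: "multiplier m \<Longrightarrow> multiplier n \<Longrightarrow> multiplier (\<lambda>\<omega>. m \<omega> - n \<omega>)"
  by (simp add: multiplier_def bounded_borel_diff)

lemma multiplier_mult: "multiplier m \<Longrightarrow> multiplier n \<Longrightarrow> multiplier (\<lambda>\<omega>. m \<omega> * n \<omega>)"
  by (simp add: multiplier_def bounded_borel_mult)

lemma multiplier_cnj: "multiplier m \<Longrightarrow> multiplier (\<lambda>\<omega>. cnj (m \<omega>))"
  by (simp add: multiplier_def bounded_borel_cnj)

lemma wave_cos_sin: "wave t = Complex (cos (2 * pi * t)) (- sin (2 * pi * t))"
proof -
  have "wave t = cis (- (2 * pi * t))"
    unfolding wave_def cis_conv_exp by (intro arg_cong[where f=exp]) simp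
  then show ?thesis by (simp add: cis.ctr)
qed

lemma wave_int [simp]: "wave (real_of_int n) = 1"
  by (simp add: wave_cos_sin complex_eq_iff)

lemma char_add: "lattice_char (k + l) \<omega> = lattice_char k \<omega> * lattice_char l \<omega>"
  by (simp add: lattice_char_def of_int_vec_add inner_add_right wave_add)

lemma char_0 [simp]: "lattice_char 0 \<omega> = 1"
  by (simp add: lattice_char_def)

lemma multiplier_char: "multiplier (lattice_char k)"
proof -
  have "of_int_vec l \<bullet> of_int_vec k = real_of_int (\<Sum>i\<in>UNIV. l $ i * k $ i)" for l k :: "int ^ 'a"
    by (simp add: inner_vec_def)
  then have "lattice_char k (\<omega> + of_int_vec l) = lattice_char k \<omega>" for \<omega> l
    unfolding lattice_char_def inner_add_left wave_add by (simp only: wave_int mult_1_right)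
  then show ?thesis by (simp add: multiplier_def bounded_borel_char)
qed

subsection \<open>Trigonometric polynomials generate all multipliers\<close>

inductive trig_poly :: "(real ^ 'd \<Rightarrow> complex) \<Rightarrow> bool" where
  trig_poly_char: "trig_poly (lattice_char k)"
| trig_poly_add: "trig_poly f \<Longrightarrow> trig_poly g \<Longrightarrow> trig_poly (\<lambda>\<omega>. f \<omega> + g \<omega>)"
| trig_poly_scale: "trig_poly f \<Longrightarrow> trig_poly (\<lambda>\<omega>. c * f \<omega>)"

lemma trig_poly_mult:
  assumes "trig_poly f" "trig_poly g" shows "trig_poly (\<lambda>\<omega>. f \<omega> * g \<omega>)"
  using assms(1)
proof induction
  case (trig_poly_char k)
  show ?case
    using assms(2)
  proof induction
    case (trig_poly_char l)
    show ?case using trig_poly.trig_poly_char[of "k + l"] by (simp add: char_add[abs_def])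
  next
    case (trig_poly_add f g)
    then show ?case by (simp add: distrib_left trig_poly.trig_poly_add)
  next
    case (trig_poly_scale f c)
    then show ?case using trig_poly.trig_poly_scale[of "\<lambda>\<omega>. lattice_char k \<omega> * f \<omega>" c] by (simp add: mult_ac)
  qed
next
  case (trig_poly_add f g)
  then show ?case by (simp add: distrib_right trig_poly.trig_poly_add)
next
  case (trig_poly_scale f c)
  then show ?case by (simp add: mult.assoc trig_poly.trig_poly_scale)
qed

lemma trig_poly_const: "trig_poly (\<lambda>\<omega>. c)"
  using trig_poly_scale[OF trig_poly_char[of 0], of c] by simp

lemma trig_poly_sum: "finite I \<Longrightarrow> (\<And>i. i \<in> I \<Longrightarrow> trig_poly (f i)) \<Longrightarrow> trig_poly (\<lambda>\<omega>. \<Sum>i\<in>I. f i \<omega>)"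
  by (induction I rule: finite_induct) (auto intro: trig_poly_const trig_poly_add)

lemma multiplier_trig_poly: "trig_poly f \<Longrightarrow> multiplier f"
  by (induction rule: trig_poly.induct)
     (auto intro: multiplier_char multiplier_add multiplier_mult multiplier_const)

text \<open>Periodic functions are functions on the torus, embedded into \<open>\<complex>\<^sup>d\<close> by \<open>torus\<close>.  The Borel
  map \<open>torus_inv\<close> recovers the representative in the unit cube.\<close>

definition torus :: "real ^ 'd \<Rightarrow> complex ^ 'd" where
  "torus \<omega> = (\<chi> i. wave (\<omega> $ i))"

definition wave_inv :: "complex \<Rightarrow> real" where
  "wave_inv z = (let a = arccos (max (-1) (min 1 (Re z))) / (2 * pi) in if Im z \<le> 0 then a else 1 - a)"

definition torus_inv :: "complex ^ 'd \<Rightarrow> real ^ 'd" where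
  "torus_inv z = (\<chi> i. wave_inv (z $ i))"

lemma wave_frac: "wave (frac t) = wave t"
  using wave_add[of "frac t" "real_of_int \<lfloor>t\<rfloor>"] by (simp add: frac_def)

lemma wave_inv: "wave_inv (wave t) = frac t"
proof -
  define s where "s = frac t"
  have s: "0 \<le> s" "s < 1" by (auto simp: s_def frac_lt_1)
  have clip: "max (-1) (min 1 (cos x)) = cos x" for x :: real by (simp add: max_absorb2 min_absorb2)
  have "wave_inv (wave s) = s"
  proof (cases "s \<le> 1/2")
    case True
    have "arccos (cos (2 * pi * s)) = 2 * pi * s" using s True by (intro arccos_cos) auto
    moreover have "sin (2 * pi * s) \<ge> 0" using s True by (intro sin_ge_zero) auto
    ultimately show ?thesis by (simp add: wave_inv_def wave_cos_sin clip Let_def)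
  next
    case False
    have "cos (2 * pi * s) = cos (2 * pi * (1 - s))"
      by (simp add: right_diff_distrib cos_diff)
    moreover have "arccos (cos (2 * pi * (1 - s))) = 2 * pi * (1 - s)"
      using s False by (intro arccos_cos) auto
    moreover have "sin (2 * pi * s) < 0"
    proof -
      have "pi < 2 * pi * s" "2 * pi * s < 2 * pi" using s False by auto
      then show ?thesis by (rule sin_lt_zero)
    qed
    ultimately show ?thesis by (simp add: wave_inv_def wave_cos_sin clip Let_def)
  qed
  then show ?thesis by (simp add: s_def wave_frac)
qed

lemma torus_inv: "torus_inv (torus \<omega>) = frac_vec \<omega>"
  by (simp add: torus_inv_def torus_def frac_vec_def wave_inv)

lemma wave_inv_borel [measurable]: "wave_inv \<in> borel_measurable borel"
proof -
  have "continuous_on UNIV (\<lambda>z. arccos (max (-1) (min 1 (Re z))))"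
    by (rule continuous_on_arccos) (auto intro!: continuous_intros)
  then have [measurable]: "(\<lambda>z. arccos (max (-1) (min 1 (Re z)))) \<in> borel_measurable borel"
    by (rule borel_measurable_continuous_onI)
  have "{z. Im z \<le> 0} = Im -` {..0} \<inter> space borel" by auto
  then have "{z. Im z \<le> 0} \<in> sets borel"
    by (metis (no_types) borel_measurable_Im measurable_ident_sets measurable_sets atMost_borel sets_eq_imp_space_eq)
  then show ?thesis unfolding wave_inv_def[abs_def] Let_def
    by (intro measurable_If) auto
qed

lemma torus_inv_borel [measurable]: "torus_inv \<in> borel_measurable borel"
  unfolding torus_inv_def[abs_def] by (rule borel_measurable_vecI) simp

lemma torus_borel [measurable]: "torus \<in> borel_measurable borel"
  unfolding torus_def[abs_def] by (rule borel_measurable_vecI) simp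

lemma torus_periodic [simp]: "torus (\<omega> + of_int_vec k) = torus \<omega>"
  by (simp add: torus_def vec_eq_iff wave_add)

lemma norm_torus_le: "norm (torus (\<omega> :: real ^ 'd)) \<le> CARD('d)"
  unfolding norm_vec_def using L2_set_le_sum[of UNIV "\<lambda>i. norm (torus \<omega> $ i)"]
  by (simp add: torus_def)

lemma trig_poly_wave: "trig_poly (\<lambda>\<omega>. wave (\<omega> $ i))"
proof -
  have "\<omega> \<bullet> of_int_vec (axis i 1) = \<omega> $ i" for \<omega> :: "real ^ 'a"
  proof -
    have "of_int_vec (axis i 1) = (axis i 1 :: real ^ 'a)" by (simp add: vec_eq_iff axis_def)
    then show ?thesis by (simp add: inner_axis)
  qed
  then show ?thesis using trig_poly_char[of "axis i 1"] by (simp add: lattice_char_def[abs_def])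
qed

lemma trig_poly_wave_uminus: "trig_poly (\<lambda>\<omega>. wave (- (\<omega> $ i)))"
proof -
  have "\<omega> \<bullet> of_int_vec (- axis i 1) = - \<omega> $ i" for \<omega> :: "real ^ 'a"
  proof -
    have "of_int_vec (axis i 1) = (axis i 1 :: real ^ 'a)" by (simp add: vec_eq_iff axis_def)
    then show ?thesis by (simp add: inner_axis of_int_vec_uminus)
  qed
  then show ?thesis using trig_poly_char[of "- axis i 1"] by (simp add: lattice_char_def[abs_def])
qed

lemma trig_poly_inner_torus:
  assumes "b \<in> Basis" shows "trig_poly (\<lambda>\<omega>. complex_of_real (torus \<omega> \<bullet> b))"
proof -
  obtain i u where b: "b = axis i u" "u \<in> {1, \<i>}"
    using assms by (auto simp: Basis_vec_def Basis_complex_def)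
  define w where "w \<omega> = wave (\<omega> $ i)" for \<omega> :: "real ^ 'a"
  have w: "trig_poly w" "trig_poly (\<lambda>\<omega>. cnj (w \<omega>))"
    unfolding w_def[abs_def] cnj_wave by (rule trig_poly_wave trig_poly_wave_uminus)+
  have "complex_of_real (torus \<omega> \<bullet> b) = (if u = 1 then 1/2 * w \<omega> + 1/2 * cnj (w \<omega>)
      else - \<i>/2 * w \<omega> + \<i>/2 * cnj (w \<omega>))" for \<omega>
    unfolding b(1) inner_axis using b(2)
    by (auto simp: torus_def w_def complex_eq_iff inner_complex_def)
  then show ?thesis
    using trig_poly_add[OF trig_poly_scale[OF w(1), of "1/2"] trig_poly_scale[OF w(2), of "1/2"]]
      trig_poly_add[OF trig_poly_scale[OF w(1), of "-\<i>/2"] trig_poly_scale[OF w(2), of "\<i>/2"]]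
    by (cases "u = 1") simp_all
qed

lemma trig_poly_real_polynomial:
  assumes "real_polynomial_function p"
  shows "trig_poly (\<lambda>\<omega>. complex_of_real (p (torus \<omega>)))"
  using assms
proof induction
  case (linear f)
  interpret f: bounded_linear f by fact
  have rep: "f z = (\<Sum>b\<in>Basis. (z \<bullet> b) * f b)" for z
  proof -
    have "f z = f (\<Sum>b\<in>Basis. (z \<bullet> b) *\<^sub>R b)" by (simp only: euclidean_representation)
    then show ?thesis by (simp add: f.sum f.scaleR)
  qed
  have eq: "(\<lambda>\<omega>. complex_of_real (f (torus \<omega>)))
      = (\<lambda>\<omega>. \<Sum>b\<in>Basis. complex_of_real (f b) * complex_of_real (torus \<omega> \<bullet> b))"
    by (rule ext, subst rep) (simp add: mult.commute)
  show ?case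
    unfolding eq by (intro trig_poly_sum trig_poly_scale trig_poly_inner_torus) auto
next
  case (const c)
  show ?case by (rule trig_poly_const)
next
  case (add f g)
  then show ?case by (simp add: trig_poly_add)
next
  case (mult f g)
  then show ?case by (simp add: trig_poly_mult)
qed

text \<open>By the Stone--Weierstrass theorem a class with these closure properties contains the continuous
  functions on the torus, hence the indicators of open sets, hence by Dynkin's lemma those of Borel
  sets, hence all bounded Borel functions.\<close>

theorem multiplier_induct [consumes 1, case_names lattice_char add scale lim]:
  fixes m :: "real ^ 'd \<Rightarrow> complex"
  assumes m: "multiplier m"
    and lattice_char: "\<And>k. P (lattice_char k)"
    and add: "\<And>f g. multiplier f \<Longrightarrow> multiplier g \<Longrightarrow> P f \<Longrightarrow> P g \<Longrightarrow> P (\<lambda>\<omega>. f \<omega> + g \<omega>)"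
    and scale: "\<And>f c. multiplier f \<Longrightarrow> P f \<Longrightarrow> P (\<lambda>\<omega>. c * f \<omega>)"
    and lim: "\<And>f g C. (\<And>n. multiplier (f n)) \<Longrightarrow> multiplier g \<Longrightarrow> (\<And>n. P (f n)) \<Longrightarrow>
      (\<And>n \<omega>. cmod (f n \<omega>) \<le> C) \<Longrightarrow> (\<And>\<omega>. (\<lambda>n. f n \<omega>) \<longlonglongrightarrow> g \<omega>) \<Longrightarrow> P g"
  shows "P m"
proof -
  have mt: "multiplier (\<lambda>\<omega>. F (torus \<omega>))"
    if "F \<in> borel_measurable borel" "\<And>z. cmod (F z) \<le> C" for F C
    unfolding multiplier_def using that by (auto intro!: bounded_borelI[where C=C])
  have tp: "P f" if "trig_poly f" for f
    using that by induction (auto intro: lattice_char add scale multiplier_trig_poly)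
  define Q where "Q F \<longleftrightarrow> P (\<lambda>\<omega>. F (torus \<omega>))" for F :: "complex ^ 'd \<Rightarrow> complex"
  have cont: "Q (\<lambda>z. complex_of_real (F z))"
    if F: "continuous_on UNIV F" and B: "\<And>z. \<bar>F z\<bar> \<le> B" for F :: "complex ^ 'd \<Rightarrow> real" and B
  proof -
    let ?K = "cball (0 :: complex ^ 'd) CARD('d)"
    have "\<exists>p. real_polynomial_function p \<and> (\<forall>z\<in>?K. \<bar>F z - p z\<bar> < inverse (real (Suc n)))" for n
      by (rule Stone_Weierstrass_real_polynomial_function[of ?K F "inverse (real (Suc n))"])
         (use F in \<open>auto intro: continuous_on_subset\<close>)
    then have "\<exists>p. \<forall>n. real_polynomial_function (p n) \<and> (\<forall>z\<in>?K. \<bar>F z - p n z\<bar> < inverse (real (Suc n)))"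
      by (intro choice allI)
    then obtain p where p: "\<And>n. real_polynomial_function (p n)"
      "\<And>n z. z \<in> ?K \<Longrightarrow> \<bar>F z - p n z\<bar> < inverse (real (Suc n))"
      by blast
    have pt: "\<bar>F (torus \<omega>) - p n (torus \<omega>)\<bar> < inverse (real (Suc n))" for n \<omega>
      by (rule p(2)) (simp add: norm_torus_le)
    show ?thesis
      unfolding Q_def
    proof (rule lim)
      show "multiplier (\<lambda>\<omega>. complex_of_real (p n (torus \<omega>)))" for n
        by (intro multiplier_trig_poly trig_poly_real_polynomial p)
      show "P (\<lambda>\<omega>. complex_of_real (p n (torus \<omega>)))" for n
        by (intro tp trig_poly_real_polynomial p)
      show "multiplier (\<lambda>\<omega>. complex_of_real (F (torus \<omega>)))"
      proof (rule mt)
        show "(\<lambda>z. complex_of_real (F z)) \<in> borel_measurable borel"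
          using borel_measurable_continuous_onI[OF F] by measurable
        show "cmod (complex_of_real (F z)) \<le> B" for z using B by simp
      qed
      show "cmod (complex_of_real (p n (torus \<omega>))) \<le> B + 1" for n \<omega>
      proof -
        have "inverse (real (Suc n)) \<le> 1" by (simp add: inverse_eq_divide)
        then show ?thesis using pt[of \<omega> n] B[of "torus \<omega>"] by (simp only: norm_of_real)
      qed
      show "(\<lambda>n. complex_of_real (p n (torus \<omega>))) \<longlonglongrightarrow> complex_of_real (F (torus \<omega>))" for \<omega>
      proof (rule tendsto_of_real, rule LIM_zero_cancel, rule Lim_null_comparison[OF _ LIMSEQ_inverse_real_of_nat])
        show "\<forall>\<^sub>F n in sequentially. norm (p n (torus \<omega>) - F (torus \<omega>)) \<le> inverse (real (Suc n))"
          using pt[of \<omega>] by (intro always_eventually allI) (simp add: abs_minus_commute less_imp_le)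
      qed
    qed
  qed
  have Q_lim: "Q G" if "\<And>n. F n \<in> borel_measurable borel" "G \<in> borel_measurable borel" "\<And>n. Q (F n)"
    "\<And>n z. cmod (F n z) \<le> C" "\<And>z. (\<lambda>n. F n z) \<longlonglongrightarrow> G z" for F G C
  proof -
    have "cmod (G z) \<le> C" for z
      using that(4) by (intro LIMSEQ_le_const2[OF tendsto_norm[OF that(5)]]) blast
    note mt[OF that(2) this]
    moreover have "multiplier (\<lambda>\<omega>. F n (torus \<omega>))" for n by (rule mt[OF that(1,4)])
    ultimately show ?thesis
      unfolding Q_def using that(3)[unfolded Q_def] that(4,5)
      by (rule_tac lim[where f="\<lambda>n \<omega>. F n (torus \<omega>)"])
  qed
  have mt': "multiplier (\<lambda>\<omega>. F (torus \<omega>))" if bb: "bounded_borel F" for F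
  proof -
    obtain C where "C \<ge> 0" "\<And>z. cmod (F z) \<le> C" using bb by (metis bounded_borelE)
    from mt[OF bounded_borelD[OF bb] this(2)] show ?thesis .
  qed
  have Q_add: "Q (\<lambda>z. F z + G z)" if "bounded_borel F" "bounded_borel G" "Q F" "Q G" for F G
    using that unfolding Q_def by (intro add mt')
  have Q_scale: "Q (\<lambda>z. c * F z)" if "bounded_borel F" "Q F" for F c
    using that unfolding Q_def by (intro scale mt')
  have Q_const: "Q (\<lambda>z. c)" for c
    unfolding Q_def by (intro tp trig_poly_const)
  have bb_sum: "bounded_borel (\<lambda>z. \<Sum>i\<in>I. F i z)" if "finite I" "\<And>i. i \<in> I \<Longrightarrow> bounded_borel (F i)"
    for I :: "'i set" and F :: "'i \<Rightarrow> complex ^ 'd \<Rightarrow> complex"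
    using that by (induction I rule: finite_induct) (auto intro: bounded_borel_const bounded_borel_add)
  have Q_sum: "Q (\<lambda>z. \<Sum>i\<in>I. F i z)" if "finite I" "\<And>i. i \<in> I \<Longrightarrow> bounded_borel (F i)" "\<And>i. i \<in> I \<Longrightarrow> Q (F i)"
    for I :: "'i set" and F :: "'i \<Rightarrow> complex ^ 'd \<Rightarrow> complex"
    using that by (induction I rule: finite_induct) (auto intro!: Q_const Q_add bb_sum)
  have bb_ind: "bounded_borel (indicator A :: complex ^ 'd \<Rightarrow> complex)" if "A \<in> sets borel" for A
    by (rule bounded_borelI[where C=1]) (use that in \<open>auto simp: indicator_def\<close>)
  have Q_ind: "Q (indicator A)" if "A \<in> sets borel" for A
  proof -
    have "Int_stable {S :: (complex ^ 'd) set. open S}" by (auto simp: Int_stable_def)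
    moreover have "{S :: (complex ^ 'd) set. open S} \<subseteq> Pow UNIV" by simp
    moreover have "A \<in> sigma_sets UNIV {S. open S}" using that by (simp add: sets_borel)
    ultimately show ?thesis
    proof (induction rule: sigma_sets_induct_disjoint)
      case (basic U)
      then have U: "open U" by simp
      show ?case
      proof (cases "U = UNIV")
        case True
        then show ?thesis using Q_const[of 1] by (simp add: indicator_def[abs_def])
      next
        case False
        show ?thesis
        proof (rule Q_lim)
          show "Q (\<lambda>z. complex_of_real (min 1 (real n * infdist z (- U))))" for n
          proof (rule cont)
            show "continuous_on UNIV (\<lambda>z. min 1 (real n * infdist z (- U)))" by (intro continuous_intros)
            show "\<bar>min 1 (real n * infdist z (- U))\<bar> \<le> 1" for z
              using infdist_nonneg[of z "- U"] by (simp add: min_def)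
          qed
          show "cmod (complex_of_real (min 1 (real n * infdist z (- U)))) \<le> 1" for n z
            using infdist_nonneg[of z "- U"] by (simp add: min_def)
          show "(\<lambda>n. complex_of_real (min 1 (real n * infdist z (- U)))) \<longlonglongrightarrow> indicator U z" for z
          proof (cases "z \<in> U")
            case True
            have "infdist z (- U) > 0"
              using True U False in_closed_iff_infdist_zero[of "- U" z] infdist_nonneg[of z "- U"]
              by (auto simp: less_le)
            then obtain N where N: "1 < real N * infdist z (- U)" using reals_Archimedean3 by blast
            have "\<forall>\<^sub>F n in sequentially. complex_of_real (min 1 (real n * infdist z (- U))) = indicator U z"
              using eventually_ge_at_top[of N]
            proof eventually_elim
              case (elim n)
              have "real N * infdist z (- U) \<le> real n * infdist z (- U)"
                using elim infdist_nonneg by (intro mult_right_mono) auto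
              then show ?case using N True by (simp add: min_def)
            qed
            then show ?thesis by (rule tendsto_eventually)
          qed simp
          show "(\<lambda>z. complex_of_real (min 1 (real n * infdist z (- U)))) \<in> borel_measurable borel" for n
            by (intro borel_measurable_continuous_onI continuous_intros)
          show "(indicator U :: _ \<Rightarrow> complex) \<in> borel_measurable borel"
            using U by (intro borel_measurable_indicator borel_open)
        qed
      qed
    next
      case empty
      show ?case using Q_const[of 0] by (simp add: indicator_def[abs_def])
    next
      case (compl A)
      then have A: "A \<in> sets borel" by (simp add: sets_borel)
      have "Q (\<lambda>z. 1 + (- 1) * indicator A z)"
        using compl(2) by (intro Q_add Q_scale Q_const bounded_borel_const bounded_borel_mult bb_ind A)
      moreover have "(\<lambda>z. 1 + (- 1) * indicator A z :: complex) = indicator (UNIV - A)"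
        by (auto simp: fun_eq_iff indicator_def)
      ultimately show ?case by simp
    next
      case (union A)
      then have A: "A i \<in> sets borel" for i by (auto simp: sets_borel)
      have eq: "(\<Sum>i<n. indicator (A i) z) = (indicator (\<Union>i<n. A i) z :: complex)" for n z
        using union(1) by (intro indicator_UN_disjoint[symmetric]) (auto intro: disjoint_family_on_mono)
      show ?case
      proof (rule Q_lim)
        show "Q (\<lambda>z. \<Sum>i<n. indicator (A i) z)" for n
          by (intro Q_sum bb_ind A union) auto
        show "cmod (\<Sum>i<n. indicator (A i) z) \<le> 1" for n z
          unfolding eq by (simp add: indicator_def)
        show "(\<lambda>n. \<Sum>i<n. indicator (A i) z) \<longlonglongrightarrow> (indicator (\<Union>i. A i) z :: complex)" for z
          unfolding eq by (rule LIMSEQ_indicator_UN)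
        show "(\<lambda>z. \<Sum>i<n. indicator (A i) z :: complex) \<in> borel_measurable borel" for n
          using A by measurable
        show "(indicator (\<Union>i. A i) :: _ \<Rightarrow> complex) \<in> borel_measurable borel"
          using A by measurable
      qed
    qed
  qed
  have Q_all: "Q F" if bb: "bounded_borel F" for F
  proof -
    obtain C where C: "C \<ge> 0" "\<And>z. cmod (F z) \<le> C" using bb by (metis bounded_borelE)
    have "F \<in> borel_measurable borel" using bb by (rule bounded_borelD)
    then obtain G where G: "\<And>n. simple_function borel (G n)" "\<And>z. (\<lambda>n. G n z) \<longlonglongrightarrow> F z"
      "\<And>n z. dist (G n z) 0 \<le> 2 * dist (F z) 0"
      using borel_measurable_implies_sequence_metric[of F borel 0] by (metis UNIV_I space_borel)
    show ?thesis
    proof (rule Q_lim)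
      show "Q (G n)" for n
      proof -
        have fin: "finite (range (G n))"
          using simple_functionD(1)[OF G(1)[of n]] by simp
        have sets: "G n -` {y} \<in> sets borel" for y
          using simple_functionD(2)[OF G(1)[of n], of "{y}"] by simp
        have "G n = (\<lambda>z. \<Sum>y\<in>range (G n). y * indicator (G n -` {y}) z)"
        proof
          fix z
          have "(\<Sum>y\<in>range (G n). y * indicator (G n -` {y}) z)
              = (\<Sum>y\<in>range (G n). if G n z = y then y else 0)"
            by (intro sum.cong) (auto simp: indicator_def)
          then show "G n z = (\<Sum>y\<in>range (G n). y * indicator (G n -` {y}) z)"
            using fin by (simp add: sum.delta')
        qed
        moreover have "Q (\<lambda>z. \<Sum>y\<in>range (G n). y * indicator (G n -` {y}) z)"
          using fin sets by (intro Q_sum Q_scale bounded_borel_mult bounded_borel_const bb_ind Q_ind) auto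
        ultimately show ?thesis by simp
      qed
      show "G n \<in> borel_measurable borel" for n using G(1) by (rule borel_measurable_simple_function)
      show "cmod (G n z) \<le> 2 * C" for n z using G(3)[of n z] C(2)[of z] by (simp add: dist_norm)
    qed (use G bb in \<open>auto simp: bounded_borel_def\<close>)
  qed
  have "Q (\<lambda>z. m (torus_inv z))"
    by (rule Q_all) (use multiplierD[OF m] in \<open>auto simp: bounded_borel_def intro: measurable_compose\<close>)
  then show ?thesis
    unfolding Q_def torus_inv multiplier_frac[OF m] .
qed

subsection \<open>Every multiplier is the Fourier series of a sequence\<close>

lemma emeasure_unit_cube: "emeasure lborel (unit_cube :: (real ^ 'd) set) < \<infinity>"
proof (rule emeasure_bounded_finite)
  show "bounded (unit_cube :: (real ^ 'd) set)"
    by (rule bounded_subset[of "cbox 0 1"]) (auto simp: unit_cube_def mem_box_cart less_imp_le)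
qed

lemma rep_trig:
  fixes k :: "int ^ 'd"
  shows "AE \<omega> in lborel. rep_L2 (trig k) \<omega> = (if \<omega> \<in> unit_cube then lattice_char k \<omega> else 0)"
  unfolding trig_def map_fun_apply id_apply lattice_char_def wave_def by (rule rep_abs_L2[OF square_integrable_trig])

lemma trig_eq_mulL2: "trig k = mulL2 (lattice_char k) (trig 0)"
  by (rule mulL2_eqI[OF bounded_borel_char, symmetric], use rep_trig[of k] rep_trig[of 0] in eventually_elim)
     simp

lemma integral_wave_period:
  fixes n :: int
  shows "integrable lborel (\<lambda>t. indicator {0..<1} t * wave (t * real_of_int n))"
    and "(\<integral>t. indicator {0..<1} t * wave (t * real_of_int n) \<partial>lborel) = (if n = 0 then 1 else 0)"
proof -
  have ind_eq: "(\<lambda>t. indicator {0..<1::real} t :: complex) = (\<lambda>t. complex_of_real (indicator {0..<1} t))"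
    by (auto simp: fun_eq_iff indicator_def)
  have ind: "integrable lborel (\<lambda>t. indicator {0..<1::real} t :: complex)"
    unfolding ind_eq complex_of_real_integrable_eq by (rule integrable_real_indicator) auto
  show i: "integrable lborel (\<lambda>t. indicator {0..<1} t * wave (t * real_of_int n))"
    by (rule integrable_times_wave[OF ind]) simp
  show "(\<integral>t. indicator {0..<1} t * wave (t * real_of_int n) \<partial>lborel) = (if n = 0 then 1 else 0)"
  proof (cases "n = 0")
    case True
    have "(\<integral>t. indicator {0..<1::real} t \<partial>lborel) = (1 :: complex)"
      unfolding ind_eq integral_complex_of_real by simp
    then show ?thesis using True by simp
  next
    case False
    define c where "c = - 2 * of_real pi * \<i> * complex_of_real (real_of_int n)"
    have c: "c \<noteq> 0" using False by (simp add: c_def)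
    have wave: "wave (t * real_of_int n) = exp (c * of_real t)" for t
      unfolding wave_def c_def by (intro arg_cong[where f=exp]) simp
    have "(\<integral>t. indicator {0..<1} t * wave (t * real_of_int n) \<partial>lborel)
       = (\<integral>t. indicator {0..1} t *\<^sub>R wave (t * real_of_int n) \<partial>lborel)"
    proof (rule integral_cong_AE)
      have "AE t in lborel. t \<noteq> (1::real)" by (rule AE_lborel_singleton)
      then show "AE t in lborel. indicator {0..<1} t * wave (t * real_of_int n) = indicator {0..1} t *\<^sub>R wave (t * real_of_int n)"
        by eventually_elim (auto simp: indicator_def)
    qed (auto)
    also have "\<dots> = exp (c * of_real 1) / c - exp (c * of_real 0) / c"
    proof (rule integral_FTC_Icc)
      show "((\<lambda>t. exp (c * of_real t) / c) has_vector_derivative wave (x * real_of_int n)) (at x within {0..1})" for x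
        unfolding wave using c
        by (auto intro!: derivative_eq_intros has_vector_derivative_real_field)
      show "continuous_on {0..1} (\<lambda>t. wave (t * real_of_int n))" by (intro continuous_intros)
    qed simp
    also have "exp (c * of_real 1) = 1"
      using wave[of 1] by simp
    finally show ?thesis using False by simp
  qed
qed

lemma inner_of_int_vec_axis: "of_int_vec k \<bullet> axis i 1 = real_of_int (k $ i)"
  by (simp add: inner_axis)

text \<open>The integrand is a product over the coordinates.\<close>

lemma integral_char_cube:
  fixes k :: "int ^ 'd"
  shows "(\<integral>\<omega>. (if \<omega> \<in> unit_cube then lattice_char k \<omega> else 0) \<partial>lborel) = (if k = 0 then 1 else 0)"
proof -
  define h where "h b t = indicator {0..<1} t * wave (t * (of_int_vec k \<bullet> b))" for b :: "real ^ 'd" and t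
  have hb: "h (axis i 1) = (\<lambda>t. indicator {0..<1} t * wave (t * real_of_int (k $ i)))" for i
    by (simp add: h_def[abs_def] inner_of_int_vec_axis)
  have Basis: "(Basis :: (real ^ 'd) set) = (\<lambda>i. axis i 1) ` UNIV"
    by (auto simp: Basis_vec_def)
  have inj: "inj (\<lambda>i. axis i (1::real) :: real ^ 'd)"
    by (auto simp: inj_def axis_eq_axis)
  have eq: "(if \<omega> \<in> unit_cube then lattice_char k \<omega> else 0) = (\<Prod>b\<in>Basis. h b (\<omega> \<bullet> b))" for \<omega>
  proof -
    have "(\<Prod>b\<in>Basis. h b (\<omega> \<bullet> b)) = (\<Prod>i\<in>UNIV. indicator {0..<1} (\<omega> $ i) * wave (\<omega> $ i * real_of_int (k $ i)))"
      unfolding Basis by (subst prod.reindex[OF inj]) (simp add: hb inner_axis)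
    also have "\<dots> = (\<Prod>i\<in>UNIV. indicator {0..<1} (\<omega> $ i)) * lattice_char k \<omega>"
      by (simp add: prod.distrib lattice_char_def inner_vec_def wave_sum)
    also have "(\<Prod>i\<in>UNIV. indicator {0..<1} (\<omega> $ i)) = (if \<omega> \<in> unit_cube then 1 else 0 :: complex)"
      by (auto simp: unit_cube_def indicator_def intro!: prod_zero)
    finally show ?thesis by simp
  qed
  have "(\<integral>\<omega>. (if \<omega> \<in> unit_cube then lattice_char k \<omega> else 0) \<partial>lborel) = (\<Prod>b\<in>Basis. \<integral>t. h b t \<partial>lborel)"
    unfolding eq by (rule lborel_integral_Basis_prod(2)) (auto simp: Basis hb integral_wave_period(1))
  also have "\<dots> = (\<Prod>i\<in>UNIV. if k $ i = 0 then 1 else 0)"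
    unfolding Basis by (subst prod.reindex[OF inj]) (simp add: hb integral_wave_period(2))
  also have "\<dots> = (if k = 0 then 1 else 0)"
    by (auto simp: vec_eq_iff intro!: prod_zero)
  finally show ?thesis .
qed

lemma cinner_trig: "cinner (trig k) (trig l) = (if k = l then 1 else 0)"
proof -
  have "cinner (trig k) (trig l) = (\<integral>\<omega>. (if \<omega> \<in> unit_cube then lattice_char (k - l) \<omega> else 0) \<partial>lborel)"
    unfolding cinner_rep
  proof (rule integral_cong_AE)
    show "AE \<omega> in lborel. rep_L2 (trig k) \<omega> * cnj (rep_L2 (trig l) \<omega>)
        = (if \<omega> \<in> unit_cube then lattice_char (k - l) \<omega> else 0)"
      using rep_trig[of k] rep_trig[of l]
    proof eventually_elim
      case (elim \<omega>)
      have "lattice_char (k - l) \<omega> = lattice_char k \<omega> * cnj (lattice_char l \<omega>)"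
        unfolding diff_conv_add_uminus char_add
        by (simp add: lattice_char_def of_int_vec_uminus cnj_wave)
      then show ?case using elim by simp
    qed
    show "(\<lambda>\<omega>. if \<omega> \<in> unit_cube then lattice_char (k - l) \<omega> else 0) \<in> borel_measurable lborel"
      using bounded_borelD[OF bounded_borel_char[of "k - l"]] by measurable
  qed simp
  then show ?thesis by (simp add: integral_char_cube)
qed

text \<open>The partial sums are best approximations from their spans; an approximation of \<open>u\<close> by a finite
  linear combination therefore bounds the error of all larger partial sums.\<close>

lemma orthonormal_expansion:
  fixes e :: "'i \<Rightarrow> 'a::euclidean_space L2"
  assumes on: "\<And>i j. cinner (e i) (e j) = (if i = j then 1 else 0)"
    and u: "u \<in> closure (L2.span (range e))"
  shows "((\<lambda>i. cinner u (e i) *\<^sub>C e i) has_sum u) UNIV"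
    and "(\<lambda>i. (cmod (cinner u (e i)))\<^sup>2) summable_on UNIV"
proof -
  define c where "c i = cinner u (e i)" for i
  define s where "s S = (\<Sum>i\<in>S. c i *\<^sub>C e i)" for S
  have lin: "cinner (\<Sum>i\<in>S. d i *\<^sub>C e i) (e j) = (if j \<in> S then d j else 0)" if "finite S" for S d j
    using that by (simp add: cinner_sum_left cinner_scaleC_left on if_distrib sum.delta' cong: if_cong)
  have orth: "cinner (u - s S) (\<Sum>i\<in>S. d i *\<^sub>C e i) = 0" if "finite S" for S d
    using that by (simp add: cinner_sum_right cinner_scaleC_right cinner_diff_left s_def lin c_def)
  have best: "norm (u - s S) \<le> norm (u - (\<Sum>i\<in>S. d i *\<^sub>C e i))" if "finite S" for S d
  proof -
    have eq: "u - (\<Sum>i\<in>S. d i *\<^sub>C e i) = (u - s S) + (\<Sum>i\<in>S. (c i - d i) *\<^sub>C e i)"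
      by (simp add: s_def L2.scale_left_diff_distrib sum_subtractf)
    have "(norm (u - (\<Sum>i\<in>S. d i *\<^sub>C e i)))\<^sup>2 = (norm (u - s S))\<^sup>2 + (norm (\<Sum>i\<in>S. (c i - d i) *\<^sub>C e i))\<^sup>2"
      unfolding eq by (rule norm_pythagoras[OF orth[OF that]])
    then have "(norm (u - s S))\<^sup>2 \<le> (norm (u - (\<Sum>i\<in>S. d i *\<^sub>C e i)))\<^sup>2" by simp
    then show ?thesis by (rule power2_le_imp_le) simp
  qed
  show "((\<lambda>i. cinner u (e i) *\<^sub>C e i) has_sum u) UNIV"
    unfolding has_sum_def
  proof (rule tendstoI)
    fix r :: real assume "r > 0"
    then obtain p where p: "p \<in> L2.span (range e)" "dist p u < r"
      using u by (auto simp: closure_approachable)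
    obtain T d where T: "finite T" "p = (\<Sum>i\<in>T. d i *\<^sub>C e i)"
    proof -
      have "\<exists>T d. finite T \<and> p = (\<Sum>i\<in>T. d i *\<^sub>C e i)"
        using p(1)
      proof (induction rule: L2.span_induct_alt)
        case base
        show ?case by (rule exI[of _ "{}"]) simp
      next
        case (step a x y)
        then obtain i T d where i: "x = e i" "finite T" "y = (\<Sum>i\<in>T. d i *\<^sub>C e i)" by auto
        have "(\<Sum>j\<in>insert i T. ((if j = i then a else 0) + (if j \<in> T then d j else 0)) *\<^sub>C e j)
          = (\<Sum>j\<in>insert i T. (if j = i then a *\<^sub>C e j else 0)) + (\<Sum>j\<in>insert i T. (if j \<in> T then d j *\<^sub>C e j else 0))"
          unfolding sum.distrib[symmetric] by (intro sum.cong) (auto simp: scaleC_add_left)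
        also have "(\<Sum>j\<in>insert i T. (if j \<in> T then d j *\<^sub>C e j else 0)) = (\<Sum>j\<in>T. d j *\<^sub>C e j)"
          using i(2) by (intro sum.mono_neutral_cong_right) auto
        finally have "a *\<^sub>C x + y = (\<Sum>j\<in>insert i T. ((if j = i then a else 0) + (if j \<in> T then d j else 0)) *\<^sub>C e j)"
          using i by simp
        then show ?case using i(2) by (intro exI[of _ "insert i T"] exI conjI) auto
      qed
      then show ?thesis using that by blast
    qed
    show "\<forall>\<^sub>F S in finite_subsets_at_top UNIV. dist (\<Sum>i\<in>S. cinner u (e i) *\<^sub>C e i) u < r"
      unfolding eventually_finite_subsets_at_top
    proof (intro exI[of _ T] conjI allI impI)
      fix S assume S: "finite S \<and> T \<subseteq> S \<and> S \<subseteq> UNIV"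
      have "p = (\<Sum>i\<in>S. (if i \<in> T then d i else 0) *\<^sub>C e i)"
        unfolding T(2) using S by (intro sum.mono_neutral_cong_left) auto
      then have "norm (u - s S) \<le> norm (u - p)" using best S by simp
      then show "dist (\<Sum>i\<in>S. cinner u (e i) *\<^sub>C e i) u < r"
        using p(2) by (simp add: s_def c_def dist_norm norm_minus_commute)
    qed (use T in auto)
  qed
  have bessel: "(\<Sum>i\<in>S. (cmod (c i))\<^sup>2) \<le> (norm u)\<^sup>2" if "finite S" for S
  proof -
    have "complex_of_real ((norm (s S))\<^sup>2) = of_real (\<Sum>i\<in>S. (cmod (c i))\<^sup>2)"
    proof -
      have "complex_of_real ((norm (s S))\<^sup>2) = (\<Sum>i\<in>S. cnj (c i) * cinner (s S) (e i))"
        unfolding cinner_self[symmetric]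
        by (subst (2) s_def) (simp add: cinner_sum_right cinner_scaleC_right)
      also have "\<dots> = (\<Sum>i\<in>S. cnj (c i) * c i)"
        using that by (intro sum.cong) (auto simp: s_def lin)
      finally show ?thesis by (simp add: mult.commute flip: complex_norm_square)
    qed
    then have ns: "(norm (s S))\<^sup>2 = (\<Sum>i\<in>S. (cmod (c i))\<^sup>2)" using of_real_eq_iff by blast
    have "(norm ((u - s S) + s S))\<^sup>2 = (norm (u - s S))\<^sup>2 + (norm (s S))\<^sup>2"
      by (rule norm_pythagoras) (use orth[OF that, of c] in \<open>simp add: s_def\<close>)
    then show ?thesis by (simp add: ns)
  qed
  show "(\<lambda>i. (cmod (cinner u (e i)))\<^sup>2) summable_on UNIV"
    by (rule nonneg_bdd_above_summable_on) (auto intro!: bdd_aboveI[where M="(norm u)\<^sup>2"] bessel simp flip: c_def)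
qed

lemma closure_L2_span:
  shows closure_span_add: "u \<in> closure (L2.span S) \<Longrightarrow> v \<in> closure (L2.span S) \<Longrightarrow> u + v \<in> closure (L2.span S)"
    and closure_span_scale: "u \<in> closure (L2.span S) \<Longrightarrow> c *\<^sub>C u \<in> closure (L2.span (S :: 'a::euclidean_space L2 set))"
proof -
  assume u: "u \<in> closure (L2.span S)"
  then obtain a where a: "\<And>n. a n \<in> L2.span S" "a \<longlonglongrightarrow> u" by (auto simp: closure_sequential)
  have "(\<lambda>n. c *\<^sub>C a n) \<longlonglongrightarrow> c *\<^sub>C u" by (rule bounded_linear.tendsto[OF bounded_linear_scaleC a(2)])
  with a(1) show "c *\<^sub>C u \<in> closure (L2.span S)"
    unfolding closure_sequential by (meson L2.span_scale)
  assume "v \<in> closure (L2.span S)"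
  then obtain b where b: "\<And>n. b n \<in> L2.span S" "b \<longlonglongrightarrow> v" by (auto simp: closure_sequential)
  have "(\<lambda>n. a n + b n) \<longlonglongrightarrow> u + v" by (intro tendsto_add a b)
  with a(1) b(1) show "u + v \<in> closure (L2.span S)"
    unfolding closure_sequential by (meson L2.span_add)
qed

text \<open>Products with \<open>trig 0\<close> restrict multipliers to the cube, and characters to the functions \<open>trig k\<close>.\<close>

lemma multiplier_in_closed_span_trig:
  fixes m :: "real ^ 'd \<Rightarrow> complex"
  assumes "multiplier m"
  shows "mulL2 m (trig 0) \<in> closure (L2.span (range trig))"
  using assms
proof (induction rule: multiplier_induct)
  case (lattice_char k)
  then show ?case
    using trig_eq_mulL2[of k] by (metis L2.span_base closure_subset rangeI subsetD)
next
  case (add f g)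
  then show ?case by (simp add: mulL2_add_left multiplierD closure_span_add)
next
  case (scale f c)
  have "mulL2 (\<lambda>\<omega>. c * f \<omega>) (trig 0) = c *\<^sub>C mulL2 f (trig 0)"
    using scale(1) by (simp add: multiplierD bounded_borel_const flip: mulL2_mulL2 mulL2_const)
  then show ?case using scale by (simp add: closure_span_scale)
next
  case (lim f g C)
  have "(\<lambda>n. mulL2 (f n) (trig 0)) \<longlonglongrightarrow> mulL2 g (trig 0)"
    by (rule mulL2_tendsto[where C=C]) (use lim in \<open>auto intro: multiplierD\<close>)
  then show ?case by (rule closed_sequentially[OF closed_closure lim.IH])
qed

lemma multiplier_is_fourier_series:
  fixes m :: "real ^ 'd \<Rightarrow> complex"
  assumes m: "multiplier m"
  obtains a where "bounded_spectrum a"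
    "AE \<omega> in lborel. \<omega> \<in> unit_cube \<longrightarrow> rep_L2 (fourier_series a) \<omega> = m \<omega>"
proof -
  define a where "a k = cinner (mulL2 m (trig 0)) (trig k)" for k
  note E = orthonormal_expansion[OF cinner_trig multiplier_in_closed_span_trig[OF m], folded a_def]
  have "fourier_series a = mulL2 m (trig 0)"
    unfolding fourier_series_def by (rule infsumI[OF E(1)])
  then have rep: "AE \<omega> in lborel. \<omega> \<in> unit_cube \<longrightarrow> rep_L2 (fourier_series a) \<omega> = m \<omega>"
    using rep_mulL2[OF multiplierD[OF m], of "trig 0"] rep_trig[of 0] by (simp, eventually_elim) simp
  obtain C where C: "\<And>\<omega>. cmod (m \<omega>) \<le> C" using bounded_borelE[OF multiplierD[OF m]] by metis
  have "AE \<omega> in lborel. \<omega> \<in> unit_cube \<longrightarrow> cmod (rep_L2 (fourier_series a) \<omega>) \<le> C"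
    using rep by eventually_elim (simp add: C)
  with E(2) have "bounded_spectrum a" unfolding bounded_spectrum_def l2_sequence_def by blast
  with rep show ?thesis using that by blast
qed

subsection \<open>Almost everywhere statements on the cube and on the whole space\<close>

lemma countable_int_vec: "countable (UNIV :: (int ^ 'd) set)"
proof -
  have "(UNIV :: (int ^ 'd) set) = range (\<lambda>f. \<chi> i. f i)"
    by (metis UNIV_eq_I rangeI vec_lambda_eta)
  moreover have "countable (UNIV :: ('d \<Rightarrow> int) set)" by simp
  ultimately show ?thesis by (metis countable_image)
qed

text \<open>Countably many translates of the cube cover the space.\<close>

lemma AE_cube_iff:
  "(AE \<omega> in lborel. \<omega> \<in> unit_cube \<longrightarrow> (\<forall>k. Q (\<omega> + of_int_vec k))) \<longleftrightarrow> (AE \<omega> in lborel. Q (\<omega> :: real ^ 'd))"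
proof
  assume Q: "AE \<omega> in lborel. Q (\<omega> :: real ^ 'd)"
  have "AE \<omega> in lborel. Q (\<omega> + of_int_vec k)" for k
    using AE_lborel_translate[OF Q, of "- of_int_vec k"] by simp
  then have "AE \<omega> in lborel. \<forall>k\<in>UNIV. Q (\<omega> + of_int_vec k)"
    by (subst AE_ball_countable[OF countable_int_vec]) blast
  then show "AE \<omega> in lborel. \<omega> \<in> unit_cube \<longrightarrow> (\<forall>k. Q (\<omega> + of_int_vec k))"
    by eventually_elim blast
next
  assume Q: "AE \<omega> in lborel. \<omega> \<in> unit_cube \<longrightarrow> (\<forall>k. Q (\<omega> + of_int_vec k :: real ^ 'd))"
  have "AE \<omega> in lborel. \<forall>l\<in>UNIV. \<omega> - of_int_vec l \<in> unit_cube \<longrightarrow> (\<forall>k. Q (\<omega> - of_int_vec l + of_int_vec k))"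
    by (subst AE_ball_countable[OF countable_int_vec]) (intro ballI AE_lborel_translate[OF Q])
  then show "AE \<omega> in lborel. Q \<omega>"
  proof eventually_elim
    case (elim \<omega>)
    have "\<omega> - of_int_vec (floor_vec \<omega>) = frac_vec \<omega>"
      using frac_plus_floor[of \<omega>] by (metis add_diff_cancel_right')
    then have "\<forall>k. Q (frac_vec \<omega> + of_int_vec k)" using elim by (metis UNIV_I frac_vec_cube)
    then show ?case by (metis frac_plus_floor)
  qed
qed

lemma AE_cube_periodic:
  assumes "AE \<omega> in lborel. \<omega> \<in> unit_cube \<longrightarrow> Q \<omega>"
  shows "AE \<omega> in lborel. Q (frac_vec (\<omega> :: real ^ 'd))"
proof -
  have "AE \<omega> in lborel. \<omega> \<in> unit_cube \<longrightarrow> (\<forall>k. Q (frac_vec (\<omega> + of_int_vec k)))"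
    using assms by eventually_elim (simp add: frac_vec_ident)
  then show ?thesis by (subst (asm) AE_cube_iff)
qed

text \<open>The symbol is cut off at its essential bound and extended periodically from the cube.\<close>

lemma bounded_spectrum_multiplier:
  fixes a :: "int ^ 'd \<Rightarrow> complex"
  assumes "bounded_spectrum a"
  obtains m where "multiplier m"
    "AE \<omega> in lborel. \<omega> \<in> unit_cube \<longrightarrow> rep_L2 (fourier_series a) \<omega> = m \<omega>"
proof -
  obtain C where C: "AE \<omega> in lborel. \<omega> \<in> unit_cube \<longrightarrow> cmod (rep_L2 (fourier_series a) \<omega>) \<le> C"
    using assms unfolding bounded_spectrum_def by blast
  define f where "f \<omega> = (if cmod (rep_L2 (fourier_series a) \<omega>) \<le> C then rep_L2 (fourier_series a) \<omega> else 0)" for \<omega>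
  have "multiplier (\<lambda>\<omega>. f (frac_vec \<omega>))"
    by (rule multiplier_compose_frac[where C="\<bar>C\<bar>"]) (auto simp: f_def[abs_def])
  moreover have "AE \<omega> in lborel. \<omega> \<in> unit_cube \<longrightarrow> rep_L2 (fourier_series a) \<omega> = f (frac_vec \<omega>)"
    using C by eventually_elim (simp add: f_def frac_vec_ident)
  ultimately show ?thesis using that by blast
qed

text \<open>As the translates of the cube cover the space, the fibre equation that defines \<open>Lambda_op\<close> says
  that the transform is multiplied by the symbol of \<open>a\<close>; injectivity of \<open>fourier\<close> makes the solution
  unique.\<close>

lemma Lambda_op_eq:
  fixes m :: "real ^ 'd \<Rightarrow> complex"
  assumes m: "multiplier m"
    and a: "AE \<omega> in lborel. \<omega> \<in> unit_cube \<longrightarrow> rep_L2 (fourier_series a) \<omega> = m \<omega>"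
    and g: "fourier g = mulL2 m (fourier f)"
  shows "Lambda_op a f = g"
proof -
  have iff: "(AE \<omega> in lborel. \<omega> \<in> unit_cube \<longrightarrow>
      (\<forall>k. fiber h \<omega> k = rep_L2 (fourier_series a) \<omega> * fiber f \<omega> k)) \<longleftrightarrow> h = g" for h
  proof -
    have "(AE \<omega> in lborel. \<omega> \<in> unit_cube \<longrightarrow>
        (\<forall>k. fiber h \<omega> k = rep_L2 (fourier_series a) \<omega> * fiber f \<omega> k))
      \<longleftrightarrow> (AE \<omega> in lborel. \<omega> \<in> unit_cube \<longrightarrow>
        (\<forall>k. rep_L2 (fourier h) (\<omega> + of_int_vec k) = m (\<omega> + of_int_vec k) * rep_L2 (fourier f) (\<omega> + of_int_vec k)))"
      (is "?A \<longleftrightarrow> ?B")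
    proof
      assume ?A then show ?B
        using a by eventually_elim (simp add: fiber_def multiplier_periodic[OF m])
    next
      assume ?B then show ?A
        using a by eventually_elim (simp add: fiber_def multiplier_periodic[OF m])
    qed
    also have "\<dots> \<longleftrightarrow> (AE \<omega> in lborel. rep_L2 (fourier h) \<omega> = m \<omega> * rep_L2 (fourier f) \<omega>)"
      by (rule AE_cube_iff)
    also have "\<dots> \<longleftrightarrow> fourier h = mulL2 m (fourier f)"
    proof
      assume A: "AE \<omega> in lborel. rep_L2 (fourier h) \<omega> = m \<omega> * rep_L2 (fourier f) \<omega>"
      have "mulL2 m (fourier f) = fourier h"
        by (rule mulL2_eqI[OF multiplierD[OF m]], use A in eventually_elim) simp
      then show "fourier h = mulL2 m (fourier f)" ..
    next
      assume "fourier h = mulL2 m (fourier f)"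
      then show "AE \<omega> in lborel. rep_L2 (fourier h) \<omega> = m \<omega> * rep_L2 (fourier f) \<omega>"
        using rep_mulL2[OF multiplierD[OF m]] by simp
    qed
    also have "\<dots> \<longleftrightarrow> h = g" by (simp add: g[symmetric] fourier_inject)
    finally show ?thesis .
  qed
  show ?thesis unfolding Lambda_op_def iff by simp
qed

section \<open>The fibre inner product\<close>

abbreviation lattice :: "(int ^ 'd) measure" where "lattice \<equiv> count_space UNIV"

definition cube_measure :: "(real ^ 'd) measure" where
  "cube_measure = density lborel (indicator unit_cube)"

lemma sets_cube_measure [simp, measurable_cong]: "sets cube_measure = sets borel"
  by (simp add: cube_measure_def)

lemma space_cube_measure [simp]: "space cube_measure = UNIV"
  by (simp add: cube_measure_def)

lemma AE_cube_measure: "(AE \<omega> in cube_measure. P \<omega>) \<longleftrightarrow> (AE \<omega> in lborel. \<omega> \<in> unit_cube \<longrightarrow> P \<omega>)"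
proof -
  have "(AE \<omega> in cube_measure. P \<omega>) \<longleftrightarrow> (AE \<omega> in lborel. 0 < (indicator unit_cube \<omega> :: ennreal) \<longrightarrow> P \<omega>)"
    unfolding cube_measure_def by (rule AE_density) simp
  also have "\<dots> \<longleftrightarrow> (AE \<omega> in lborel. \<omega> \<in> unit_cube \<longrightarrow> P \<omega>)"
    by (intro AE_cong) (auto simp: indicator_def)
  finally show ?thesis .
qed

lemma finite_cube_measure: "finite_measure cube_measure"
proof
  show "emeasure cube_measure (space cube_measure) \<noteq> \<infinity>"
    using emeasure_unit_cube by (simp add: cube_measure_def emeasure_density less_top)
qed

lemma sigma_finite_lattice: "sigma_finite_measure (lattice :: (int ^ 'd) measure)"
  by (rule sigma_finite_measure_count_space_countable[OF countable_int_vec])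

lemma measurable_pair_lattice:
  assumes "\<And>k. (\<lambda>\<omega>. f \<omega> k) \<in> measurable M N"
  shows "(\<lambda>p. f (fst p) (snd p)) \<in> measurable (M \<Otimes>\<^sub>M (lattice :: (int ^ 'd) measure)) N"
  by (rule measurable_compose_countable'[where f="\<lambda>k p. f (fst p) k" and g=snd and I=UNIV])
     (auto intro: measurable_compose[OF measurable_fst assms] countable_int_vec)

interpretation cube_lattice: pair_sigma_finite cube_measure "lattice :: (int ^ 'd) measure"
  using finite_measure.axioms(1)[OF finite_cube_measure] sigma_finite_lattice
  by (simp add: pair_sigma_finite_def)

interpretation lborel_lattice: pair_sigma_finite "lborel :: (real ^ 'd) measure" "lattice :: (int ^ 'd) measure"
  using sigma_finite_lattice sigma_finite_lborel by (simp add: pair_sigma_finite_def)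

lemma measurable_unfold:
  "(\<lambda>p. fst p + of_int_vec (snd p)) \<in> measurable (cube_measure \<Otimes>\<^sub>M lattice) borel"
  by (rule measurable_pair_lattice[where f="\<lambda>\<omega> k. \<omega> + of_int_vec k"]) measurable

text \<open>The cubes \<open>unit_cube + k\<close> tile the space.\<close>

lemma distr_unfold:
  "distr (cube_measure \<Otimes>\<^sub>M lattice) lborel (\<lambda>p. fst p + of_int_vec (snd p))
    = (lborel :: (real ^ 'd) measure)"
proof (rule measure_eqI)
  fix A :: "(real ^ 'd) set"
  assume "A \<in> sets (distr (cube_measure \<Otimes>\<^sub>M lattice) lborel (\<lambda>p. fst p + of_int_vec (snd p)))"
  then have A [measurable]: "A \<in> sets borel" by simp
  have set_eq: "{\<omega>. \<omega> + of_int_vec k \<in> A} \<in> sets borel" for k by measurable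
  have meas: "(\<lambda>p. fst p + of_int_vec (snd p)) \<in> measurable (cube_measure \<Otimes>\<^sub>M lattice) (lborel :: (real ^ 'd) measure)"
    using measurable_unfold by simp
  let ?B = "(\<lambda>p. fst p + of_int_vec (snd p)) -` A \<inter> space (cube_measure \<Otimes>\<^sub>M (lattice :: (int ^ 'd) measure))"
  have B: "?B \<in> sets (cube_measure \<Otimes>\<^sub>M lattice)"
    using measurable_sets[OF measurable_unfold A] .
  have sec: "(\<lambda>\<omega>. (\<omega>, k)) -` ?B = {\<omega>. \<omega> + of_int_vec k \<in> A}" for k
    by (auto simp: space_pair_measure)
  have trans: "(\<integral>\<^sup>+\<omega>. indicator unit_cube \<omega> * indicator {\<omega>. \<omega> + of_int_vec k \<in> A} \<omega> \<partial>lborel)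
     = (\<integral>\<^sup>+\<omega>. indicator unit_cube (\<omega> - of_int_vec k) * indicator A \<omega> \<partial>lborel)" for k :: "int ^ 'd"
  proof -
    have "(\<integral>\<^sup>+\<omega>. indicator unit_cube (\<omega> - of_int_vec k) * indicator A \<omega> \<partial>distr lborel borel ((+) (of_int_vec k)))
       = (\<integral>\<^sup>+\<omega>. indicator unit_cube (of_int_vec k + \<omega> - of_int_vec k) * indicator A (of_int_vec k + \<omega>) \<partial>lborel)"
      by (rule nn_integral_distr) measurable
    then show ?thesis unfolding lborel_distr_plus
      by (simp add: indicator_def add.commute)
  qed
  have tile: "(\<integral>\<^sup>+k. indicator unit_cube (\<omega> - of_int_vec k) \<partial>lattice) = (1 :: ennreal)" for \<omega> :: "real ^ 'd"
  proof -
    have "\<omega> - of_int_vec k \<in> unit_cube \<longleftrightarrow> k = floor_vec \<omega>" for k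
    proof
      assume "\<omega> - of_int_vec k \<in> unit_cube"
      then have "\<omega> - of_int_vec k = frac_vec \<omega>"
        using frac_vec_ident[of "\<omega> - of_int_vec k"] frac_vec_add[of "\<omega> - of_int_vec k" k] by simp
      then have "of_int_vec k = (of_int_vec (floor_vec \<omega>) :: real ^ 'd)"
        using frac_plus_floor[of \<omega>] by (metis add_diff_cancel_left' diff_add_cancel)
      then show "k = floor_vec \<omega>" by (simp add: vec_eq_iff)
    next
      assume "k = floor_vec \<omega>"
      then have "\<omega> - of_int_vec k = frac_vec \<omega>"
        using frac_plus_floor[of \<omega>] by (metis add_diff_cancel_right')
      then show "\<omega> - of_int_vec k \<in> unit_cube" by simp
    qed
    then have "(\<lambda>k. indicator unit_cube (\<omega> - of_int_vec k)) = (indicator {floor_vec \<omega>} :: _ \<Rightarrow> ennreal)"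
      by (auto simp: fun_eq_iff indicator_def)
    then show ?thesis by simp
  qed
  have "emeasure (distr (cube_measure \<Otimes>\<^sub>M lattice) lborel (\<lambda>p. fst p + of_int_vec (snd p))) A
      = emeasure (cube_measure \<Otimes>\<^sub>M lattice) ?B"
    by (rule emeasure_distr[OF meas]) simp
  also have "\<dots> = (\<integral>\<^sup>+k. emeasure cube_measure {\<omega>. \<omega> + of_int_vec k \<in> A} \<partial>lattice)"
    by (subst cube_lattice.emeasure_pair_measure_alt2[OF B]) (simp only: sec)
  also have "\<dots> = (\<integral>\<^sup>+k. \<integral>\<^sup>+\<omega>. indicator unit_cube (\<omega> - of_int_vec k) * indicator A \<omega> \<partial>lborel \<partial>lattice)"
    unfolding cube_measure_def trans[symmetric]
    by (intro nn_integral_cong) (subst emeasure_density, use set_eq in auto)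
  also have "\<dots> = (\<integral>\<^sup>+\<omega>. \<integral>\<^sup>+k. indicator unit_cube (\<omega> - of_int_vec k) * indicator A \<omega> \<partial>lattice \<partial>lborel)"
  proof (rule lborel_lattice.Fubini')
    show "(\<lambda>(\<omega>, k). indicator unit_cube (\<omega> - of_int_vec k) * indicator A \<omega> :: ennreal)
        \<in> borel_measurable (lborel \<Otimes>\<^sub>M lattice)"
      unfolding split_def
      by (rule measurable_pair_lattice[where f="\<lambda>\<omega> k. indicator unit_cube (\<omega> - of_int_vec k) * indicator A \<omega>"]) measurable
  qed
  also have "\<dots> = (\<integral>\<^sup>+\<omega>. indicator A \<omega> \<partial>lborel)"
    by (simp add: nn_integral_multc tile)
  also have "\<dots> = emeasure lborel A" by simp
  finally show "emeasure (distr (cube_measure \<Otimes>\<^sub>M lattice) lborel (\<lambda>p. fst p + of_int_vec (snd p))) A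
      = emeasure lborel A" .
qed simp

lemma unfold_nn_integral:
  assumes [measurable]: "h \<in> borel_measurable borel"
  shows "(\<integral>\<^sup>+\<omega>. h \<omega> \<partial>lborel) = (\<integral>\<^sup>+\<omega>. \<integral>\<^sup>+k. h (\<omega> + of_int_vec k) \<partial>lattice \<partial>cube_measure)"
proof -
  have meas: "(\<lambda>p. fst p + of_int_vec (snd p)) \<in> measurable (cube_measure \<Otimes>\<^sub>M lattice) lborel"
    using measurable_unfold by simp
  have "(\<integral>\<^sup>+\<omega>. h \<omega> \<partial>lborel) = (\<integral>\<^sup>+p. h (fst p + of_int_vec (snd p)) \<partial>(cube_measure \<Otimes>\<^sub>M lattice))"
    by (subst distr_unfold[symmetric], subst nn_integral_distr[OF meas]) auto
  also have "\<dots> = (\<integral>\<^sup>+\<omega>. \<integral>\<^sup>+k. h (\<omega> + of_int_vec k) \<partial>lattice \<partial>cube_measure)"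
    by (subst cube_lattice.M2.nn_integral_fst[symmetric]) (auto intro: measurable_compose[OF measurable_unfold])
  finally show ?thesis .
qed

lemma unfold_integral:
  fixes h :: "real ^ 'd \<Rightarrow> complex"
  assumes h: "integrable lborel h"
  shows "AE \<omega> in cube_measure. integrable lattice (\<lambda>k. h (\<omega> + of_int_vec k))"
    and "integrable cube_measure (\<lambda>\<omega>. \<integral>k. h (\<omega> + of_int_vec k) \<partial>lattice)"
    and "(\<integral>\<omega>. h \<omega> \<partial>lborel) = (\<integral>\<omega>. \<integral>k. h (\<omega> + of_int_vec k) \<partial>lattice \<partial>cube_measure)"
proof -
  have meas: "(\<lambda>p. fst p + of_int_vec (snd p)) \<in> measurable (cube_measure \<Otimes>\<^sub>M lattice) lborel"
    using measurable_unfold by simp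
  have hm: "h \<in> borel_measurable lborel" using h by auto
  have i: "integrable (cube_measure \<Otimes>\<^sub>M lattice) (\<lambda>p. h (fst p + of_int_vec (snd p)))"
    using h by (subst (asm) distr_unfold[symmetric], subst (asm) integrable_distr_eq[OF meas hm])
  show "AE \<omega> in cube_measure. integrable lattice (\<lambda>k. h (\<omega> + of_int_vec k))"
    using cube_lattice.AE_integrable_fst'[OF i] by simp
  show "integrable cube_measure (\<lambda>\<omega>. \<integral>k. h (\<omega> + of_int_vec k) \<partial>lattice)"
    using cube_lattice.integrable_fst'[OF i] by simp
  have "(\<integral>\<omega>. h \<omega> \<partial>lborel) = (\<integral>p. h (fst p + of_int_vec (snd p)) \<partial>(cube_measure \<Otimes>\<^sub>M lattice))"
    by (subst distr_unfold[symmetric], subst integral_distr[OF meas hm]) simp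
  also have "\<dots> = (\<integral>\<omega>. \<integral>k. h (\<omega> + of_int_vec k) \<partial>lattice \<partial>cube_measure)"
    using cube_lattice.integral_fst'[OF i] by simp
  finally show "(\<integral>\<omega>. h \<omega> \<partial>lborel) = (\<integral>\<omega>. \<integral>k. h (\<omega> + of_int_vec k) \<partial>lattice \<partial>cube_measure)" .
qed

text \<open>The fibre of \<open>u\<close> at \<open>\<omega>\<close> is taken at the representative of \<open>\<omega>\<close> in the cube, which makes it periodic
  in \<open>\<omega>\<close>; \<open>br\<close> is the inner product of two fibres in \<open>\<ell>\<^sup>2\<close> of the lattice.\<close>

definition fib :: "(real ^ 'd) L2 \<Rightarrow> real ^ 'd \<Rightarrow> int ^ 'd \<Rightarrow> complex" where
  "fib u \<omega> k = rep_L2 u (frac_vec \<omega> + of_int_vec k)"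

definition br :: "(real ^ 'd) L2 \<Rightarrow> (real ^ 'd) L2 \<Rightarrow> real ^ 'd \<Rightarrow> complex" where
  "br u v \<omega> = (\<integral>k. fib u \<omega> k * cnj (fib v \<omega> k) \<partial>lattice)"

lemma fib_periodic [simp]: "fib u (\<omega> + of_int_vec k) = fib u \<omega>"
  by (simp add: fib_def fun_eq_iff)

lemma br_periodic [simp]: "br u v (\<omega> + of_int_vec k) = br u v \<omega>"
  by (simp add: br_def)

lemma fib_borel [measurable]: "(\<lambda>\<omega>. fib u \<omega> k) \<in> borel_measurable borel"
  unfolding fib_def by measurable

lemma br_borel [measurable]: "br u v \<in> borel_measurable borel"
proof -
  have "(\<lambda>p. fib u (fst p) (snd p) * cnj (fib v (fst p) (snd p))) \<in> borel_measurable (borel \<Otimes>\<^sub>M lattice)"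
    by (rule measurable_pair_lattice[where f="\<lambda>\<omega> k. fib u \<omega> k * cnj (fib v \<omega> k)"]) measurable
  then have "(\<lambda>\<omega>. \<integral>k. fib u \<omega> k * cnj (fib v \<omega> k) \<partial>lattice) \<in> borel_measurable borel"
    by (intro sigma_finite_measure.borel_measurable_lebesgue_integral[OF sigma_finite_lattice]) (simp add: split_def)
  then show ?thesis by (simp add: br_def[abs_def])
qed

lemma AE_fib:
  assumes "AE \<omega> in lborel. Q \<omega>"
  shows "AE \<omega> in lborel. \<forall>k. Q (frac_vec \<omega> + of_int_vec k)"
  using assms by (intro AE_cube_periodic) (subst AE_cube_iff)

lemma AE_frac_of_cube:
  "(AE \<omega> in cube_measure. P \<omega>) \<Longrightarrow> AE \<omega> in lborel. P (frac_vec \<omega>)"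
  unfolding AE_cube_measure by (rule AE_cube_periodic)

lemma AE_cube_of_AE: "(AE \<omega> in lborel. P \<omega>) \<Longrightarrow> AE \<omega> in cube_measure. P \<omega>"
  unfolding AE_cube_measure by (auto elim: eventually_mono)

lemma fib_floor: "fib u \<omega> (floor_vec \<omega>) = rep_L2 u \<omega>"
  by (simp add: fib_def frac_plus_floor)

lemma AE_integrable_fib_mult:
  "AE \<omega> in lborel. integrable lattice (\<lambda>k. fib u \<omega> k * cnj (fib v \<omega> k))"
  using AE_frac_of_cube[OF unfold_integral(1)[OF integrable_rep_cnj[of u v]]]
  by (simp add: fib_def)

lemma AE_integrable_fib_sq:
  "AE \<omega> in lborel. integrable lattice (\<lambda>k. (cmod (fib u \<omega> k))\<^sup>2)"
  using AE_integrable_fib_mult[of u u]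
proof eventually_elim
  case (elim \<omega>)
  then have "integrable lattice (\<lambda>k. complex_of_real ((cmod (fib u \<omega> k))\<^sup>2))"
    by (simp only: complex_norm_square)
  then show ?case by (simp only: complex_of_real_integrable_eq)
qed

lemma br_self: "br u u \<omega> = of_real (\<integral>k. (cmod (fib u \<omega> k))\<^sup>2 \<partial>lattice)"
  unfolding br_def complex_norm_square[symmetric] integral_complex_of_real ..

lemma br_self_real: "br u u \<omega> = of_real (Re (br u u \<omega>))" "0 \<le> Re (br u u \<omega>)"
  by (simp_all add: br_self)

lemma br_cnj: "br v u \<omega> = cnj (br u v \<omega>)"
  unfolding br_def by (simp add: mult.commute flip: Bochner_Integration.integral_cnj)

lemma br_add_left: "AE \<omega> in lborel. br (u + v) w \<omega> = br u w \<omega> + br v w \<omega>"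
  using AE_fib[OF rep_plus[of u v]] AE_integrable_fib_mult[of u w] AE_integrable_fib_mult[of v w]
  by eventually_elim (simp add: br_def fib_def distrib_right)

lemma br_diff_left: "AE \<omega> in lborel. br (u - v) w \<omega> = br u w \<omega> - br v w \<omega>"
  using AE_fib[OF rep_diff[of u v]] AE_integrable_fib_mult[of u w] AE_integrable_fib_mult[of v w]
  by eventually_elim (simp add: br_def fib_def left_diff_distrib)

lemma br_zero_left: "AE \<omega> in lborel. br 0 w \<omega> = 0"
  using AE_fib[OF rep_zero] by eventually_elim (simp add: br_def fib_def)

lemma br_sum_left:
  assumes "finite I"
  shows "AE \<omega> in lborel. br (\<Sum>i\<in>I. u i) w \<omega> = (\<Sum>i\<in>I. br (u i) w \<omega>)"
  using assms
proof (induction I)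
  case empty
  show ?case using br_zero_left by simp
next
  case (insert i I)
  show ?case
    using br_add_left[of "u i" "\<Sum>i\<in>I. u i" w] insert.IH
    by eventually_elim (simp add: insert.hyps)
qed

text \<open>A periodic factor is constant along each fibre and leaves the sum over the lattice.  Unbounded
  factors occur in the Gram--Schmidt process.\<close>

lemma br_periodic_mult_left:
  assumes "AE \<omega> in lborel. rep_L2 w \<omega> = c \<omega> * rep_L2 u \<omega>"
    and c: "\<And>\<omega> k. c (\<omega> + of_int_vec k) = c \<omega>"
  shows "AE \<omega> in lborel. br w v \<omega> = c \<omega> * br u v \<omega>"
  using AE_fib[OF assms(1)]
proof eventually_elim
  case (elim \<omega>)
  have "fib w \<omega> k = c \<omega> * fib u \<omega> k" for k
    using elim c[of "frac_vec \<omega>"] c[of "frac_vec \<omega>" "floor_vec \<omega>"] by (simp add: fib_def frac_plus_floor)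
  then show ?case by (simp add: br_def mult.assoc)
qed

lemma br_mulL2_left:
  assumes m: "multiplier m"
  shows "AE \<omega> in lborel. br (mulL2 m u) v \<omega> = m \<omega> * br u v \<omega>"
  by (rule br_periodic_mult_left[OF rep_mulL2[OF multiplierD[OF m]] multiplier_periodic[OF m]])

lemma integrable_br: "integrable cube_measure (br u v)"
proof -
  have "integrable cube_measure (\<lambda>\<omega>. \<integral>k. rep_L2 u (\<omega> + of_int_vec k) * cnj (rep_L2 v (\<omega> + of_int_vec k)) \<partial>lattice)"
    by (rule unfold_integral(2)[OF integrable_rep_cnj[of u v]])
  moreover have "AE \<omega> in cube_measure. (\<integral>k. rep_L2 u (\<omega> + of_int_vec k) * cnj (rep_L2 v (\<omega> + of_int_vec k)) \<partial>lattice) = br u v \<omega>"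
    unfolding AE_cube_measure by (intro AE_I2) (simp add: br_def fib_def frac_vec_ident)
  ultimately show ?thesis
    by (subst integrable_cong_AE[symmetric]) auto
qed

lemma cinner_br: "cinner u v = (\<integral>\<omega>. br u v \<omega> \<partial>cube_measure)"
proof -
  have "cinner u v = (\<integral>\<omega>. \<integral>k. rep_L2 u (\<omega> + of_int_vec k) * cnj (rep_L2 v (\<omega> + of_int_vec k)) \<partial>lattice \<partial>cube_measure)"
    unfolding cinner_rep by (rule unfold_integral(3)[OF integrable_rep_cnj[of u v]])
  also have "\<dots> = (\<integral>\<omega>. br u v \<omega> \<partial>cube_measure)"
  proof (rule integral_cong_AE)
    show "(\<lambda>\<omega>. \<integral>k. rep_L2 u (\<omega> + of_int_vec k) * cnj (rep_L2 v (\<omega> + of_int_vec k)) \<partial>lattice) \<in> borel_measurable cube_measure"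
      using unfold_integral(2)[OF integrable_rep_cnj[of u v]] by auto
    show "AE \<omega> in cube_measure. (\<integral>k. rep_L2 u (\<omega> + of_int_vec k) * cnj (rep_L2 v (\<omega> + of_int_vec k)) \<partial>lattice) = br u v \<omega>"
      unfolding AE_cube_measure by (intro AE_I2) (simp add: br_def fib_def frac_vec_ident)
  qed simp
  finally show ?thesis .
qed

text \<open>Integrate \<open>2 |f g| \<le> t |f|\<^sup>2 + |g|\<^sup>2 / t\<close> and choose the best \<open>t\<close>.\<close>

lemma Cauchy_Schwarz_integral:
  fixes f g :: "'a \<Rightarrow> complex"
  assumes [measurable]: "f \<in> borel_measurable M" "g \<in> borel_measurable M"
    and f: "integrable M (\<lambda>x. (cmod (f x))\<^sup>2)" and g: "integrable M (\<lambda>x. (cmod (g x))\<^sup>2)"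
  shows "(cmod (\<integral>x. f x * cnj (g x) \<partial>M))\<^sup>2 \<le> (\<integral>x. (cmod (f x))\<^sup>2 \<partial>M) * (\<integral>x. (cmod (g x))\<^sup>2 \<partial>M)"
proof -
  define A where "A = (\<integral>x. (cmod (f x))\<^sup>2 \<partial>M)"
  define B where "B = (\<integral>x. (cmod (g x))\<^sup>2 \<partial>M)"
  define X where "X = cmod (\<integral>x. f x * cnj (g x) \<partial>M)"
  have nn: "A \<ge> 0" "B \<ge> 0" "X \<ge> 0" by (auto simp: A_def B_def X_def)
  have key: "2 * X \<le> t * A + B / t" if t: "t > 0" for t
  proof -
    have pt: "2 * cmod (f x * cnj (g x)) \<le> t * (cmod (f x))\<^sup>2 + (cmod (g x))\<^sup>2 / t" for x
    proof -
      have "0 \<le> (t * cmod (f x) - cmod (g x))\<^sup>2 / t" using t by simp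
      then show ?thesis using t by (simp add: norm_mult power2_eq_square field_simps)
    qed
    have i: "integrable M (\<lambda>x. t * (cmod (f x))\<^sup>2 + (cmod (g x))\<^sup>2 / t)" using f g by simp
    have "2 * X \<le> 2 * (\<integral>x. cmod (f x * cnj (g x)) \<partial>M)"
      unfolding X_def by (intro mult_left_mono integral_norm_bound) simp
    also have "\<dots> = (\<integral>x. 2 * cmod (f x * cnj (g x)) \<partial>M)" by simp
    also have "\<dots> \<le> (\<integral>x. t * (cmod (f x))\<^sup>2 + (cmod (g x))\<^sup>2 / t \<partial>M)"
    proof (rule integral_mono[OF _ i pt])
      show "integrable M (\<lambda>x. 2 * cmod (f x * cnj (g x)))"
      proof (rule Bochner_Integration.integrable_bound[OF i])
        show "AE x in M. norm (2 * cmod (f x * cnj (g x))) \<le> norm (t * (cmod (f x))\<^sup>2 + (cmod (g x))\<^sup>2 / t)"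
          using pt by (intro AE_I2) (simp add: order_trans[OF _ abs_ge_self])
      qed measurable
    qed
    also have "\<dots> = t * A + B / t" using f g by (simp add: A_def B_def)
    finally show ?thesis .
  qed
  have "X\<^sup>2 \<le> A * B"
  proof (cases "X = 0")
    case True
    then show ?thesis using nn by simp
  next
    case False
    then have X: "X > 0" using nn by simp
    show ?thesis
    proof (cases "A = 0")
      case True
      \<comment> \<open>for \<open>A = 0\<close> any large \<open>t\<close> gives a contradiction\<close>
      have "2 * X \<le> B / ((B + 1) / X)" using key[of "(B + 1) / X"] X nn True by simp
      also have "\<dots> \<le> X" using X nn by (simp add: field_simps)
      finally show ?thesis using X by simp
    next
      case False
      then have A: "A > 0" using nn by simp
      have "2 * X \<le> X + B * A / X" using key[of "X / A"] X A by simp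
      then show ?thesis using X by (simp add: field_simps power2_eq_square)
    qed
  qed
  then show ?thesis by (simp add: X_def A_def B_def)
qed

lemma br_Cauchy_Schwarz:
  "AE \<omega> in lborel. (cmod (br u v \<omega>))\<^sup>2 \<le> Re (br u u \<omega>) * Re (br v v \<omega>)"
  using AE_integrable_fib_sq[of u] AE_integrable_fib_sq[of v]
proof eventually_elim
  case (elim \<omega>)
  show ?case
    unfolding br_self Re_complex_of_real unfolding br_def
    by (rule Cauchy_Schwarz_integral) (use elim in auto)
qed

lemma nn_integral_br:
  assumes [measurable]: "c \<in> borel_measurable borel" and c: "\<And>\<omega> k. c (\<omega> + of_int_vec k) = c \<omega>"
  shows "(\<integral>\<^sup>+\<omega>. ennreal ((cmod (c \<omega> * rep_L2 u \<omega>))\<^sup>2) \<partial>lborel)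
    = (\<integral>\<^sup>+\<omega>. ennreal ((cmod (c \<omega>))\<^sup>2 * Re (br u u \<omega>)) \<partial>cube_measure)"
proof -
  have "(\<integral>\<^sup>+\<omega>. ennreal ((cmod (c \<omega> * rep_L2 u \<omega>))\<^sup>2) \<partial>lborel)
      = (\<integral>\<^sup>+\<omega>. \<integral>\<^sup>+k. ennreal ((cmod (c (\<omega> + of_int_vec k) * rep_L2 u (\<omega> + of_int_vec k)))\<^sup>2) \<partial>lattice \<partial>cube_measure)"
    by (rule unfold_nn_integral) measurable
  also have "\<dots> = (\<integral>\<^sup>+\<omega>. ennreal ((cmod (c \<omega>))\<^sup>2 * Re (br u u \<omega>)) \<partial>cube_measure)"
  proof (rule nn_integral_cong_AE)
    have cube: "AE \<omega> in cube_measure. \<omega> \<in> unit_cube"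
      unfolding AE_cube_measure by simp
    show "AE \<omega> in cube_measure. (\<integral>\<^sup>+k. ennreal ((cmod (c (\<omega> + of_int_vec k) * rep_L2 u (\<omega> + of_int_vec k)))\<^sup>2) \<partial>lattice)
        = ennreal ((cmod (c \<omega>))\<^sup>2 * Re (br u u \<omega>))"
      using AE_cube_of_AE[OF AE_integrable_fib_sq[of u]] cube
    proof eventually_elim
      case (elim \<omega>)
      have "(\<integral>\<^sup>+k. ennreal ((cmod (c (\<omega> + of_int_vec k) * rep_L2 u (\<omega> + of_int_vec k)))\<^sup>2) \<partial>lattice)
         = (\<integral>\<^sup>+k. ennreal ((cmod (c \<omega>))\<^sup>2) * ennreal ((cmod (fib u \<omega> k))\<^sup>2) \<partial>lattice)"
        using elim(2) by (simp add: c fib_def frac_vec_ident norm_mult power_mult_distrib ennreal_mult)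
      also have "\<dots> = ennreal ((cmod (c \<omega>))\<^sup>2) * ennreal (\<integral>k. (cmod (fib u \<omega> k))\<^sup>2 \<partial>lattice)"
        using elim(1) by (subst nn_integral_cmult) (auto simp: nn_integral_eq_integral)
      finally show ?case by (simp add: br_self ennreal_mult)
    qed
  qed
  finally show ?thesis .
qed

text \<open>Fibrewise, multiplication by \<open>c\<close> scales the norm of \<open>u\<close> by \<open>|c|\<close>; a bound on the cube therefore makes
  the product with an unbounded \<open>c\<close> square integrable.\<close>

lemma square_integrable_periodic_mult:
  assumes cm [measurable]: "c \<in> borel_measurable borel" and c: "\<And>\<omega> k. c (\<omega> + of_int_vec k) = c \<omega>"
    and bound: "AE \<omega> in lborel. (cmod (c \<omega>))\<^sup>2 * Re (br u u \<omega>) \<le> g \<omega>"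
    and g: "integrable cube_measure g"
  shows "square_integrable (\<lambda>\<omega>. c \<omega> * rep_L2 u \<omega>)"
    and "(norm (abs_L2 (\<lambda>\<omega>. c \<omega> * rep_L2 u \<omega>)))\<^sup>2 \<le> (\<integral>\<omega>. g \<omega> \<partial>cube_measure)"
proof -
  have g0: "AE \<omega> in cube_measure. 0 \<le> g \<omega>"
    using AE_cube_of_AE[OF bound]
    by eventually_elim (meson br_self_real(2) mult_nonneg_nonneg order_trans zero_le_power2)
  have "(\<integral>\<^sup>+\<omega>. ennreal ((cmod (c \<omega> * rep_L2 u \<omega>))\<^sup>2) \<partial>lborel) \<le> (\<integral>\<^sup>+\<omega>. ennreal (g \<omega>) \<partial>cube_measure)"
    unfolding nn_integral_br[OF cm c]
    by (rule nn_integral_mono_AE, use AE_cube_of_AE[OF bound] in eventually_elim) (rule ennreal_leI)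
  also have "\<dots> = ennreal (\<integral>\<omega>. g \<omega> \<partial>cube_measure)"
    by (rule nn_integral_eq_integral[OF g g0])
  finally have le: "(\<integral>\<^sup>+\<omega>. ennreal ((cmod (c \<omega> * rep_L2 u \<omega>))\<^sup>2) \<partial>lborel) \<le> ennreal (\<integral>\<omega>. g \<omega> \<partial>cube_measure)" .
  show sq: "square_integrable (\<lambda>\<omega>. c \<omega> * rep_L2 u \<omega>)"
    unfolding square_integrable_def using order.strict_trans1[OF le]
    by (auto intro!: integrableI_bounded)
  have "ennreal ((norm (abs_L2 (\<lambda>\<omega>. c \<omega> * rep_L2 u \<omega>)))\<^sup>2) = (\<integral>\<^sup>+\<omega>. ennreal ((cmod (c \<omega> * rep_L2 u \<omega>))\<^sup>2) \<partial>lborel)"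
    unfolding norm_L2_sq_nn
    by (rule nn_integral_cong_AE, use rep_abs_L2[OF sq] in eventually_elim) simp
  with le have "ennreal ((norm (abs_L2 (\<lambda>\<omega>. c \<omega> * rep_L2 u \<omega>)))\<^sup>2) \<le> ennreal (\<integral>\<omega>. g \<omega> \<partial>cube_measure)" by simp
  then show "(norm (abs_L2 (\<lambda>\<omega>. c \<omega> * rep_L2 u \<omega>)))\<^sup>2 \<le> (\<integral>\<omega>. g \<omega> \<partial>cube_measure)"
    using integral_nonneg_AE[OF g0] by simp
qed

lemma br_self_eq_0:
  "AE \<omega> in lborel. br u u \<omega> = 0 \<longrightarrow> rep_L2 u \<omega> = 0"
  using AE_integrable_fib_sq[of u]
proof eventually_elim
  case (elim \<omega>)
  show ?case
  proof
    assume "br u u \<omega> = 0"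
    then have "(\<integral>k. (cmod (fib u \<omega> k))\<^sup>2 \<partial>lattice) = 0" by (simp add: br_self)
    then have "AE k in lattice. (cmod (fib u \<omega> k))\<^sup>2 = 0"
      using elim by (subst (asm) integral_nonneg_eq_0_iff_AE) auto
    then have "fib u \<omega> (floor_vec \<omega>) = 0" by (simp add: AE_count_space)
    then show "rep_L2 u \<omega> = 0" by (simp add: fib_floor)
  qed
qed

section \<open>Gram--Schmidt orthonormalisation over periodic functions\<close>

definition periodic_borel :: "(real ^ 'd \<Rightarrow> complex) \<Rightarrow> bool" where
  "periodic_borel c \<longleftrightarrow> c \<in> borel_measurable borel \<and> (\<forall>\<omega> k. c (\<omega> + of_int_vec k) = c \<omega>)"

text \<open>The Fourier images of shift-invariant spaces.\<close>

definition mult_module :: "(real ^ 'd) L2 set \<Rightarrow> bool" where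
  "mult_module U \<longleftrightarrow> L2.subspace U \<and> closed U \<and> (\<forall>k. \<forall>u\<in>U. mulL2 (lattice_char k) u \<in> U)"

lemma periodic_borelD [measurable_dest]: "periodic_borel c \<Longrightarrow> c \<in> borel_measurable borel"
  by (simp add: periodic_borel_def)

lemma periodic_borel_shift: "periodic_borel c \<Longrightarrow> c (\<omega> + of_int_vec k) = c \<omega>"
  by (simp add: periodic_borel_def)

lemma periodic_borel_multiplier: "multiplier m \<Longrightarrow> periodic_borel m"
  by (simp add: periodic_borel_def multiplier_def bounded_borel_def)

lemma periodic_borel_br: "periodic_borel (br u v)"
  by (simp add: periodic_borel_def)

lemma multiplier_restrict:
  assumes m: "periodic_borel m" and c: "periodic_borel c"
    and B: "\<And>\<omega>. Q (c \<omega>) \<Longrightarrow> cmod (m \<omega>) \<le> B" and Q: "{z. Q z} \<in> sets borel"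
  shows "multiplier (\<lambda>\<omega>. if Q (c \<omega>) then m \<omega> else 0)"
proof -
  note [measurable] = periodic_borelD[OF m] periodic_borelD[OF c]
  have "{\<omega>. Q (c \<omega>)} = c -` {z. Q z} \<inter> space borel" by auto
  also have "\<dots> \<in> sets borel" using Q by measurable
  finally have [measurable]: "{\<omega>. Q (c \<omega>)} \<in> sets borel" .
  show ?thesis
    unfolding multiplier_def
  proof (intro conjI allI)
    show "bounded_borel (\<lambda>\<omega>. if Q (c \<omega>) then m \<omega> else 0)"
      by (rule bounded_borelI[where C="\<bar>B\<bar>"]) (use B in \<open>auto intro!: measurable_If simp: order_trans[OF _ abs_ge_self]\<close>)
  qed (simp add: periodic_borel_shift[OF m] periodic_borel_shift[OF c])
qed

lemma multiplier_truncate: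
  assumes c: "periodic_borel c"
  shows "multiplier (\<lambda>\<omega>. if cmod (c \<omega>) \<le> r then c \<omega> else 0)"
proof (rule multiplier_restrict[OF c c])
  have "closed {z :: complex. cmod z \<le> r}" by (intro closed_Collect_le continuous_intros)
  then show "{z. cmod z \<le> r} \<in> sets borel" by (rule borel_closed)
qed

lemma module_multiplier:
  assumes U: "mult_module U" and m: "multiplier m" and u: "u \<in> U"
  shows "mulL2 m u \<in> U"
  using m
proof (induction rule: multiplier_induct)
  case (lattice_char k)
  then show ?case using U u by (simp add: mult_module_def)
next
  case (add f g)
  then show ?case using U by (simp add: mulL2_add_left multiplierD mult_module_def L2.subspace_add)
next
  case (scale f c)
  have "mulL2 (\<lambda>\<omega>. c * f \<omega>) u = c *\<^sub>C mulL2 f u"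
    using scale(1) by (simp add: multiplierD bounded_borel_const flip: mulL2_mulL2 mulL2_const)
  then show ?case using scale U by (simp add: mult_module_def L2.subspace_scale)
next
  case (lim f g C)
  have conv: "(\<lambda>n. mulL2 (f n) u) \<longlonglongrightarrow> mulL2 g u"
    by (rule mulL2_tendsto[where C=C]) (use lim in \<open>auto intro: multiplierD\<close>)
  have cl: "closed U" using U by (simp add: mult_module_def)
  show ?case by (rule closed_sequentially[OF cl lim.IH conv])
qed

text \<open>The products with the cut-offs of \<open>c\<close> lie in \<open>U\<close> and converge to \<open>w\<close>, dominated by \<open>w\<close> itself.\<close>

lemma module_periodic_mult:
  assumes U: "mult_module U" and u: "u \<in> U" and c: "periodic_borel c"
    and w: "AE \<omega> in lborel. rep_L2 w \<omega> = c \<omega> * rep_L2 u \<omega>"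
  shows "w \<in> U"
proof -
  define m where "m n \<omega> = (if cmod (c \<omega>) \<le> real n then c \<omega> else 0)" for n \<omega>
  have m: "multiplier (m n)" for n unfolding m_def[abs_def] by (rule multiplier_truncate[OF c])
  note R = rep_mulL2[OF multiplierD[OF m]]
  have conv: "(\<lambda>n. mulL2 (m n) u) \<longlonglongrightarrow> w"
  proof (rule L2_dominated_convergence[OF integrable_norm_rep[of w]])
    show "AE \<omega> in lborel. (cmod (rep_L2 (mulL2 (m n) u) \<omega> - rep_L2 w \<omega>))\<^sup>2 \<le> (cmod (rep_L2 w \<omega>))\<^sup>2" for n
      using R[of n u] w by eventually_elim (auto simp: m_def)
    have "AE \<omega> in lborel. \<forall>n. rep_L2 (mulL2 (m n) u) \<omega> = m n \<omega> * rep_L2 u \<omega>"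
      unfolding AE_all_countable using R by blast
    then show "AE \<omega> in lborel. (\<lambda>n. rep_L2 (mulL2 (m n) u) \<omega>) \<longlonglongrightarrow> rep_L2 w \<omega>"
      using w
    proof eventually_elim
      case (elim \<omega>)
      obtain N where N: "cmod (c \<omega>) \<le> real N" using real_arch_simple by blast
      have "\<forall>\<^sub>F n in sequentially. rep_L2 (mulL2 (m n) u) \<omega> = rep_L2 w \<omega>"
        using eventually_ge_at_top[of N] by eventually_elim (use N elim in \<open>auto simp: m_def\<close>)
      then show ?case by (rule tendsto_eventually)
    qed
  qed
  have cl: "closed U" using U by (simp add: mult_module_def)
  show ?thesis by (rule closed_sequentially[OF cl module_multiplier[OF U m u] conv])
qed

text \<open>The value \<open>0\<close> is admitted because the fibres of a generator may vanish on a set of positive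
  measure.\<close>

definition normalised :: "(real ^ 'd) L2 \<Rightarrow> bool" where
  "normalised e \<longleftrightarrow> (AE \<omega> in lborel. br e e \<omega> = 0 \<or> br e e \<omega> = 1)"

text \<open>The component of \<open>u\<close> along \<open>e\<close> in every fibre.\<close>

definition fibre_proj :: "(real ^ 'd) L2 \<Rightarrow> (real ^ 'd) L2 \<Rightarrow> (real ^ 'd) L2" where
  "fibre_proj e u = abs_L2 (\<lambda>\<omega>. br u e \<omega> * rep_L2 e \<omega>)"

lemma
  assumes e: "normalised e"
  shows rep_fibre_proj: "AE \<omega> in lborel. rep_L2 (fibre_proj e u) \<omega> = br u e \<omega> * rep_L2 e \<omega>"
    and norm_fibre_proj: "norm (fibre_proj e u) \<le> norm u"
proof -
  have bound: "AE \<omega> in lborel. (cmod (br u e \<omega>))\<^sup>2 * Re (br e e \<omega>) \<le> Re (br u u \<omega>)"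
    using e[unfolded normalised_def] br_Cauchy_Schwarz[of u e]
  proof eventually_elim
    case (elim \<omega>)
    then show ?case using br_self_real(2)[of u \<omega>] by auto
  qed
  have g: "integrable cube_measure (\<lambda>\<omega>. Re (br u u \<omega>))" by (intro integrable_Re integrable_br)
  note S = square_integrable_periodic_mult[OF br_borel br_periodic bound g]
  show "AE \<omega> in lborel. rep_L2 (fibre_proj e u) \<omega> = br u e \<omega> * rep_L2 e \<omega>"
    unfolding fibre_proj_def by (rule rep_abs_L2[OF S(1)])
  have "(\<integral>\<omega>. Re (br u u \<omega>) \<partial>cube_measure) = Re (cinner u u)"
    by (simp add: cinner_br integrable_br)
  then have "(norm (fibre_proj e u))\<^sup>2 \<le> (norm u)\<^sup>2"
    using S(2) by (simp add: fibre_proj_def cinner_self)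
  then show "norm (fibre_proj e u) \<le> norm u" by (rule power2_le_imp_le) simp
qed

lemma fibre_proj_mulL2:
  assumes e: "normalised e" and m: "multiplier m"
  shows "fibre_proj e (mulL2 m u) = mulL2 m (fibre_proj e u)"
  by (rule mulL2_eqI[OF multiplierD[OF m], symmetric], use rep_fibre_proj[OF e, of u]
      rep_fibre_proj[OF e, of "mulL2 m u"] br_mulL2_left[OF m, of u e] in eventually_elim) simp

lemma fibre_proj_add:
  assumes e: "normalised e"
  shows "fibre_proj e (u + v) = fibre_proj e u + fibre_proj e v"
  by (rule L2_eqI, use rep_fibre_proj[OF e, of u] rep_fibre_proj[OF e, of v] rep_fibre_proj[OF e, of "u + v"]
      br_add_left[of u v e] rep_plus[of "fibre_proj e u" "fibre_proj e v"] in eventually_elim)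
     (simp add: distrib_right)

lemma fibre_proj_scaleC: "normalised e \<Longrightarrow> fibre_proj e (c *\<^sub>C u) = c *\<^sub>C fibre_proj e u"
  using fibre_proj_mulL2[OF _ multiplier_const, of e c u] by (simp add: mulL2_const)

lemma bounded_linear_fibre_proj: "normalised e \<Longrightarrow> bounded_linear (fibre_proj e)"
  by (rule bounded_linear_intro[where K=1])
     (auto simp: fibre_proj_add scaleR_L2_def fibre_proj_scaleC norm_fibre_proj)

definition fibre_orthonormal :: "nat \<Rightarrow> (nat \<Rightarrow> (real ^ 'd) L2) \<Rightarrow> bool" where
  "fibre_orthonormal n e \<longleftrightarrow> (\<forall>i<n. normalised (e i)) \<and>
    (\<forall>i<n. \<forall>j<n. i \<noteq> j \<longrightarrow> (AE \<omega> in lborel. br (e i) (e j) \<omega> = 0))"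

definition fibre_expansion :: "nat \<Rightarrow> (nat \<Rightarrow> (real ^ 'd) L2) \<Rightarrow> (real ^ 'd) L2 \<Rightarrow> (real ^ 'd) L2" where
  "fibre_expansion n e u = (\<Sum>i<n. fibre_proj (e i) u)"

lemma rep_fibre_expansion:
  assumes "fibre_orthonormal n e"
  shows "AE \<omega> in lborel. rep_L2 (fibre_expansion n e u) \<omega> = (\<Sum>i<n. br u (e i) \<omega> * rep_L2 (e i) \<omega>)"
proof -
  have "AE \<omega> in lborel. \<forall>i\<in>{..<n}. rep_L2 (fibre_proj (e i) u) \<omega> = br u (e i) \<omega> * rep_L2 (e i) \<omega>"
    using assms by (subst AE_ball_countable) (auto intro!: rep_fibre_proj simp: fibre_orthonormal_def)
  moreover have "AE \<omega> in lborel. rep_L2 (fibre_expansion n e u) \<omega> = (\<Sum>i<n. rep_L2 (fibre_proj (e i) u) \<omega>)"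
    unfolding fibre_expansion_def by (rule rep_sum) simp
  ultimately show ?thesis by eventually_elim simp
qed

lemma br_fibre_proj:
  assumes "normalised e"
  shows "AE \<omega> in lborel. br (fibre_proj e u) v \<omega> = br u e \<omega> * br e v \<omega>"
  by (rule br_periodic_mult_left[OF rep_fibre_proj[OF assms]]) simp

lemma br_fibre_expansion:
  assumes "fibre_orthonormal n e"
  shows "AE \<omega> in lborel. br (fibre_expansion n e u) v \<omega> = (\<Sum>i<n. br u (e i) \<omega> * br (e i) v \<omega>)"
proof -
  have "AE \<omega> in lborel. \<forall>i\<in>{..<n}. br (fibre_proj (e i) u) v \<omega> = br u (e i) \<omega> * br (e i) v \<omega>"
    using assms by (subst AE_ball_countable) (auto intro!: br_fibre_proj simp: fibre_orthonormal_def)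
  moreover have "AE \<omega> in lborel. br (fibre_expansion n e u) v \<omega> = (\<Sum>i<n. br (fibre_proj (e i) u) v \<omega>)"
    unfolding fibre_expansion_def by (rule br_sum_left) simp
  ultimately show ?thesis by eventually_elim simp
qed

text \<open>Where \<open>br e e\<close> vanishes, so does \<open>br u e\<close> by the Cauchy--Schwarz inequality.\<close>

lemma br_normalised:
  assumes "normalised e"
  shows "AE \<omega> in lborel. br u e \<omega> * br e e \<omega> = br u e \<omega>"
  using assms[unfolded normalised_def] br_Cauchy_Schwarz[of u e]
  by eventually_elim auto

text \<open>The new generator is \<open>d / \<surd>(br d d)\<close> where \<open>br d d\<close> does not
  vanish; the unbounded factor is harmless because the result has fibre norm at most one.\<close>

lemma Gram_Schmidt_step:
  assumes U: "mult_module U" and e: "fibre_orthonormal n e" "\<And>i. i < n \<Longrightarrow> e i \<in> U" and f: "f \<in> U"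
  obtains w where "w \<in> U" "fibre_orthonormal (Suc n) (e(n := w))"
    "fibre_expansion (Suc n) (e(n := w)) f = f"
    "\<And>g. fibre_expansion n e g = g \<Longrightarrow> fibre_expansion (Suc n) (e(n := w)) g = g"
proof -
  have sub: "L2.subspace U" using U by (simp add: mult_module_def)
  have norm_e: "normalised (e i)" if "i < n" for i using e(1) that by (simp add: fibre_orthonormal_def)
  define p where "p = fibre_expansion n e f"
  have "fibre_proj (e i) f \<in> U" if "i < n" for i
    by (rule module_periodic_mult[OF U e(2)[OF that] periodic_borel_br rep_fibre_proj[OF norm_e[OF that]]])
  then have p: "p \<in> U" unfolding p_def fibre_expansion_def by (intro L2.subspace_sum[OF sub]) auto
  define d where "d = f - p"
  have d: "d \<in> U" unfolding d_def by (rule L2.subspace_diff[OF sub f p])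
  have d_orth: "AE \<omega> in lborel. br d (e j) \<omega> = 0" if j: "j < n" for j
  proof -
    have "AE \<omega> in lborel. \<forall>i\<in>{..<n}. i \<noteq> j \<longrightarrow> br (e i) (e j) \<omega> = 0"
      using e(1) j by (subst AE_ball_countable) (auto simp: fibre_orthonormal_def)
    moreover note br_fibre_expansion[OF e(1), of f "e j", folded p_def] br_diff_left[of f p "e j", folded d_def]
      br_normalised[OF norm_e[OF j], of f]
    ultimately show ?thesis
    proof eventually_elim
      case (elim \<omega>)
      have "(\<Sum>i<n. br f (e i) \<omega> * br (e i) (e j) \<omega>) = (\<Sum>i\<in>{j}. br f (e i) \<omega> * br (e i) (e j) \<omega>)"
        by (rule sum.mono_neutral_right) (use elim j in auto)
      then show ?case using elim by simp
    qed
  qed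
  \<comment> \<open>the factor that normalises \<open>d\<close> in every fibre where it does not vanish\<close>
  define c where "c \<omega> = (if br d d \<omega> = 0 then 0 else complex_of_real (1 / sqrt (Re (br d d \<omega>))))" for \<omega>
  have c_sq: "c \<omega> * cnj (c \<omega> * br d d \<omega>) = (if br d d \<omega> = 0 then 0 else 1)" for \<omega>
  proof (cases "br d d \<omega> = 0")
    case False
    have re: "br d d \<omega> = of_real (Re (br d d \<omega>))" by (rule br_self_real)
    then have pos: "Re (br d d \<omega>) > 0" using False br_self_real(2)[of d \<omega>] by (metis less_le of_real_0)
    define r where "r = Re (br d d \<omega>)"
    have cr: "c \<omega> = of_real (1 / sqrt r)" using False by (simp add: c_def r_def)
    have "c \<omega> * cnj (c \<omega> * br d d \<omega>) = of_real (1 / sqrt r * (1 / sqrt r * r))"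
      unfolding cr re[folded r_def]
      by (simp only: complex_cnj_mult complex_cnj_complex_of_real of_real_mult)
    also have "1 / sqrt r * (1 / sqrt r * r) = 1" using pos unfolding r_def[symmetric]
      by (simp add: field_simps flip: power2_eq_square)
    finally show ?thesis using False by simp
  qed (simp add: c_def)
  have c: "periodic_borel c"
    unfolding periodic_borel_def
  proof
    have [measurable]: "br d d \<in> borel_measurable borel" by simp
    show "c \<in> borel_measurable borel" unfolding c_def[abs_def] by measurable
  qed (simp add: c_def)
  have bound: "AE \<omega> in lborel. (cmod (c \<omega>))\<^sup>2 * Re (br d d \<omega>) \<le> 1"
  proof (rule AE_I2)
    fix \<omega>
    have "complex_of_real ((cmod (c \<omega>))\<^sup>2 * Re (br d d \<omega>)) = c \<omega> * cnj (c \<omega> * br d d \<omega>)"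
      using br_self_real(1)[of d \<omega>]
      by (metis (no_types, lifting) complex_cnj_complex_of_real complex_cnj_mult complex_norm_square mult.assoc of_real_mult)
    then have "complex_of_real ((cmod (c \<omega>))\<^sup>2 * Re (br d d \<omega>)) = of_real (if br d d \<omega> = 0 then 0 else 1)"
      unfolding c_sq by simp
    then show "(cmod (c \<omega>))\<^sup>2 * Re (br d d \<omega>) \<le> 1" unfolding of_real_eq_iff by simp
  qed
  define w where "w = abs_L2 (\<lambda>\<omega>. c \<omega> * rep_L2 d \<omega>)"
  have w: "AE \<omega> in lborel. rep_L2 w \<omega> = c \<omega> * rep_L2 d \<omega>"
    unfolding w_def
    by (rule rep_abs_L2, rule square_integrable_periodic_mult(1)[OF periodic_borelD[OF c] periodic_borel_shift[OF c] bound])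
       (rule finite_measure.integrable_const[OF finite_cube_measure])
  have wU: "w \<in> U" by (rule module_periodic_mult[OF U d c w])
  have br_w: "AE \<omega> in lborel. br w v \<omega> = c \<omega> * br d v \<omega>" for v
    by (rule br_periodic_mult_left[OF w periodic_borel_shift[OF c]])
  have br_w': "AE \<omega> in lborel. br v w \<omega> = cnj (c \<omega> * br d v \<omega>)" for v
    using br_w[of v] by eventually_elim (subst br_cnj, simp)
  have ww: "AE \<omega> in lborel. br w w \<omega> = (if br d d \<omega> = 0 then 0 else 1)"
    using br_w[of w] br_w'[of d] by eventually_elim (simp only: c_sq)
  then have norm_w: "normalised w"
    unfolding normalised_def by eventually_elim simp
  have ew: "AE \<omega> in lborel. br (e i) w \<omega> = 0" if "i < n" for i
    using br_w'[of "e i"] d_orth[OF that] by eventually_elim simp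
  have we: "AE \<omega> in lborel. br w (e i) \<omega> = 0" if "i < n" for i
    using br_w[of "e i"] d_orth[OF that] by eventually_elim simp
  have ortho: "fibre_orthonormal (Suc n) (e(n := w))"
    using e(1) norm_w ew we by (auto simp: fibre_orthonormal_def less_Suc_eq)
  have expand: "fibre_expansion (Suc n) (e(n := w)) g = fibre_expansion n e g + fibre_proj w g" for g
    by (simp add: fibre_expansion_def)
  have ew_all: "AE \<omega> in lborel. \<forall>i\<in>{..<n}. br (e i) w \<omega> = 0"
    using ew by (subst AE_ball_countable) auto
  have exp_w: "AE \<omega> in lborel. br (fibre_expansion n e g) w \<omega> = 0" for g
    using br_fibre_expansion[OF e(1), of g w] ew_all by eventually_elim simp
  have "fibre_proj w f = d"
  proof (rule L2_eqI, use rep_fibre_proj[OF norm_w, of f] exp_w[of f, folded p_def] br_w'[of d]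
      br_diff_left[of f p w, folded d_def] w br_self_eq_0[of d] in eventually_elim)
    fix \<omega>
    assume a: "rep_L2 (fibre_proj w f) \<omega> = br f w \<omega> * rep_L2 w \<omega>" "br p w \<omega> = 0"
      "br d w \<omega> = cnj (c \<omega> * br d d \<omega>)" "br d w \<omega> = br f w \<omega> - br p w \<omega>"
      "rep_L2 w \<omega> = c \<omega> * rep_L2 d \<omega>" "br d d \<omega> = 0 \<longrightarrow> rep_L2 d \<omega> = 0"
    have "rep_L2 (fibre_proj w f) \<omega> = (c \<omega> * cnj (c \<omega> * br d d \<omega>)) * rep_L2 d \<omega>"
      using a by (simp add: mult_ac)
    then show "rep_L2 (fibre_proj w f) \<omega> = rep_L2 d \<omega>" using a(6) unfolding c_sq by simp
  qed
  then have fin_f: "fibre_expansion (Suc n) (e(n := w)) f = f"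
    unfolding expand p_def[symmetric] d_def by simp
  have fin_g: "fibre_expansion (Suc n) (e(n := w)) g = g" if g: "fibre_expansion n e g = g" for g
  proof -
    have "fibre_proj w g = 0"
      by (rule L2_eqI, use rep_fibre_proj[OF norm_w, of g] exp_w[of g] rep_zero in eventually_elim) (simp add: g)
    then show ?thesis unfolding expand by (simp add: g)
  qed
  show ?thesis using that wU ortho fin_f fin_g by blast
qed

lemma Gram_Schmidt:
  assumes U: "mult_module U" and f: "\<And>i. i < n \<Longrightarrow> f i \<in> U"
  obtains e where "\<And>i. i < n \<Longrightarrow> e i \<in> U" "fibre_orthonormal n e"
    "\<And>i. i < n \<Longrightarrow> fibre_expansion n e (f i) = f i"
proof -
  have "\<exists>e. (\<forall>i<n. e i \<in> U) \<and> fibre_orthonormal n e \<and> (\<forall>i<n. fibre_expansion n e (f i) = f i)"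
    using f
  proof (induction n)
    case 0
    show ?case by (simp add: fibre_orthonormal_def)
  next
    case (Suc n)
    then obtain e where e: "\<forall>i<n. e i \<in> U" "fibre_orthonormal n e" "\<forall>i<n. fibre_expansion n e (f i) = f i"
      by (metis less_SucI)
    obtain w where w: "w \<in> U" "fibre_orthonormal (Suc n) (e(n := w))"
      "fibre_expansion (Suc n) (e(n := w)) (f n) = f n"
      "\<And>g. fibre_expansion n e g = g \<Longrightarrow> fibre_expansion (Suc n) (e(n := w)) g = g"
      using Gram_Schmidt_step[OF U e(2), of "f n"] e(1) Suc.prems by blast
    show ?case
    proof (intro exI[of _ "e(n := w)"] conjI allI impI w(2))
      fix i assume "i < Suc n"
      then consider "i < n" | "i = n" by linarith
      note cases = this
      show "(e(n := w)) i \<in> U" using cases e(1) w(1) by cases auto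
      show "fibre_expansion (Suc n) (e(n := w)) (f i) = f i"
        using cases
      proof cases
        case 1
        then show ?thesis using e(3) w(4) by blast
      qed (use w(3) in blast)
    qed
  qed
  then show ?thesis using that by blast
qed

text \<open>The elements that agree with their expansion form a closed subspace that is invariant under
  multipliers.\<close>

lemma Gram_Schmidt_closure:
  assumes e: "fibre_orthonormal n e"
    and gen: "\<And>i. i < N \<Longrightarrow> fibre_expansion n e (f i) = f i"
    and U: "U \<subseteq> closure (L2.span {mulL2 (lattice_char k) (f i) | k i. i < N})" and u: "u \<in> U"
  shows "fibre_expansion n e u = u"
proof -
  have norm_e: "normalised (e i)" if "i < n" for i using e that by (simp add: fibre_orthonormal_def)
  have bl: "bounded_linear (fibre_expansion n e)"
    unfolding fibre_expansion_def[abs_def] using norm_e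
    by (intro bounded_linear_sum) (auto intro: bounded_linear_fibre_proj)
  define S where "S = {u. fibre_expansion n e u = u}"
  have "closed S"
    unfolding S_def by (intro closed_Collect_eq bounded_linear.continuous_on[OF bl] continuous_on_id)
  have "fibre_expansion n e (c *\<^sub>C v) = c *\<^sub>C fibre_expansion n e v" for c v
    unfolding fibre_expansion_def L2.scale_sum_right
    by (intro sum.cong) (auto simp: fibre_proj_scaleC norm_e)
  then have "L2.subspace S"
    using linear_0[OF bounded_linear.linear[OF bl]] linear_add[OF bounded_linear.linear[OF bl]]
    unfolding L2.subspace_def S_def by auto
  moreover have "mulL2 (lattice_char k) (f i) \<in> S" if "i < N" for k i
  proof -
    have "fibre_expansion n e (mulL2 (lattice_char k) (f i)) = mulL2 (lattice_char k) (fibre_expansion n e (f i))"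
      unfolding fibre_expansion_def mulL2_sum_right[OF bounded_borel_char]
      by (intro sum.cong) (auto simp: fibre_proj_mulL2 norm_e multiplier_char)
    then show ?thesis using gen[OF that] by (simp add: S_def)
  qed
  ultimately have "L2.span {mulL2 (lattice_char k) (f i) | k i. i < N} \<subseteq> S"
    by (intro L2.span_minimal) auto
  then have "closure (L2.span {mulL2 (lattice_char k) (f i) | k i. i < N}) \<subseteq> S"
    using \<open>closed S\<close> by (rule closure_minimal)
  then show ?thesis using U u by (auto simp: S_def)
qed

section \<open>Measurable eigenvalues of a matrix-valued function\<close>

text \<open>Coordinate functions on \<open>nat\<close> serve as vectors and matrices, since the size \<open>n\<close> is the number of
  generators; \<open>shifted_apply n A e\<close> is the action of \<open>A - e I\<close>.\<close>

definition coord_mat :: "nat \<Rightarrow> (nat \<Rightarrow> nat \<Rightarrow> complex) \<Rightarrow> complex mat" where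
  "coord_mat n A = Matrix.mat n n (\<lambda>(i, j). A i j)"

lemma coord_mat_carrier [simp]: "coord_mat n A \<in> carrier_mat n n"
  by (simp add: coord_mat_def)

definition cpoly :: "nat \<Rightarrow> (nat \<Rightarrow> nat \<Rightarrow> complex) \<Rightarrow> complex poly" where
  "cpoly n A = char_poly (coord_mat n A)"

definition shifted_apply :: "nat \<Rightarrow> (nat \<Rightarrow> nat \<Rightarrow> complex) \<Rightarrow> complex \<Rightarrow> (nat \<Rightarrow> complex) \<Rightarrow> nat \<Rightarrow> complex" where
  "shifted_apply n A e c i = (\<Sum>j<n. A i j * c j) - e * c i"

lemma degree_cpoly: "degree (cpoly n A) = n" "coeff (cpoly n A) n = 1"
  using degree_monic_char_poly[OF coord_mat_carrier[of n A]] by (auto simp: cpoly_def)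

text \<open>Compare both sides of \<open>A v = z v\<close> at an entry of \<open>v\<close> of largest modulus.\<close>

lemma cpoly_root_bound:
  assumes "poly (cpoly n A) z = 0" and K: "\<And>i j. i < n \<Longrightarrow> j < n \<Longrightarrow> cmod (A i j) \<le> K"
  shows "cmod z \<le> real n * K"
proof -
  have "eigenvalue (coord_mat n A) z"
    using assms(1) by (simp add: eigenvalue_root_char_poly[OF coord_mat_carrier] cpoly_def)
  then obtain v where v: "v \<in> carrier_vec n" "v \<noteq> 0\<^sub>v n" "coord_mat n A *\<^sub>v v = z \<cdot>\<^sub>v v"
    unfolding eigenvalue_def eigenvector_def by (auto simp: coord_mat_def)
  have n: "n > 0"
  proof (rule ccontr)
    assume "\<not> n > 0"
    then show False using v(1,2) by auto
  qed
  define B where "B = Max ((\<lambda>i. cmod (vec_index v i)) ` {..<n})"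
  have B_ge: "cmod (vec_index v i) \<le> B" if "i < n" for i
    unfolding B_def using that by (intro Max_ge) auto
  have "B \<in> (\<lambda>i. cmod (vec_index v i)) ` {..<n}"
    unfolding B_def using n by (intro Max_in) auto
  then obtain i where i: "i < n" "cmod (vec_index v i) = B" by auto
  have "B \<noteq> 0"
  proof
    assume "B = 0"
    then have "v = 0\<^sub>v n" using B_ge v(1) by (intro eq_vecI) auto
    then show False using v(2) by simp
  qed
  then have B: "B > 0" using i(2) by (metis norm_ge_zero less_le)
  have "z * vec_index v i = vec_index (coord_mat n A *\<^sub>v v) i"
    using v i(1) by simp
  also have "\<dots> = (\<Sum>j<n. A i j * vec_index v j)"
    using v(1) i(1) by (simp add: coord_mat_def scalar_prod_def lessThan_atLeast0)
  finally have "cmod z * B = cmod (\<Sum>j<n. A i j * vec_index v j)"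
    using i(2) by (metis norm_mult)
  also have "\<dots> \<le> (\<Sum>j<n. cmod (A i j * vec_index v j))" by (rule norm_sum)
  also have "\<dots> \<le> (\<Sum>j<n. K * B)"
  proof (rule sum_mono)
    fix j assume "j \<in> {..<n}"
    then show "cmod (A i j * vec_index v j) \<le> K * B"
      unfolding norm_mult using K[OF i(1)] B_ge[of j] order_trans[OF norm_ge_zero K[OF i(1) i(1)]]
      by (intro mult_mono) auto
  qed
  finally have "cmod z * B \<le> (real n * K) * B" by simp
  then show ?thesis using B by (simp only: mult_le_cancel_right_pos)
qed

text \<open>For an upper triangular matrix the factor \<open>B - B\<^sub>k\<^sub>k\<close> maps vectors supported on the
  coordinates \<open>\<le> k\<close> to vectors supported on the coordinates \<open>< k\<close>; Schur's decomposition reduces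
  the Cayley--Hamilton theorem to this case.\<close>

lemma triangular_annihilates:
  fixes B :: "complex mat"
  assumes B: "B \<in> carrier_mat n n" "upper_triangular B"
    and es: "\<And>i. i < n \<Longrightarrow> es ! i = B $$ (i, i)" "length es = n"
  shows "k \<le> n \<Longrightarrow> v \<in> carrier_vec n \<Longrightarrow> (\<And>i. k \<le> i \<Longrightarrow> i < n \<Longrightarrow> vec_index v i = 0) \<Longrightarrow>
    foldr (\<lambda>e v. B *\<^sub>v v - e \<cdot>\<^sub>v v) (take k es) v = 0\<^sub>v n"
proof (induction k arbitrary: v)
  case 0
  then have "v = 0\<^sub>v n" by (intro eq_vecI) auto
  then show ?case by simp
next
  case (Suc k)
  then have k: "k < n" by simp
  define w where "w = B *\<^sub>v v - es ! k \<cdot>\<^sub>v v"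
  have w: "w \<in> carrier_vec n" using B(1) Suc.prems(2) by (auto simp: w_def)
  have "vec_index w i = 0" if i: "k \<le> i" "i < n" for i
  proof -
    have "vec_index w i = (\<Sum>j\<in>{0..<n}. B $$ (i, j) * vec_index v j) - es ! k * vec_index v i"
      using B(1) Suc.prems(2) i by (simp add: w_def scalar_prod_def)
    also have "(\<Sum>j\<in>{0..<n}. B $$ (i, j) * vec_index v j) = (\<Sum>j\<in>{0..<n}. if j = k then B $$ (i, k) * vec_index v k else 0)"
    proof (rule sum.cong[OF refl])
      fix j assume j: "j \<in> {0..<n}"
      show "B $$ (i, j) * vec_index v j = (if j = k then B $$ (i, k) * vec_index v k else 0)"
      proof (cases "j < k")
        case True
        then show ?thesis using B i unfolding upper_triangular_def by auto
      next
        case False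
        then show ?thesis using Suc.prems(3)[of j] j by auto
      qed
    qed
    also have "\<dots> = B $$ (i, k) * vec_index v k" using k by simp
    finally have wi: "vec_index w i = B $$ (i, k) * vec_index v k - es ! k * vec_index v i" .
    show ?thesis
    proof (cases "i = k")
      case True
      then show ?thesis using wi es(1)[OF k] by simp
    next
      case False
      then have "k < i" using i by simp
      then show ?thesis using wi Suc.prems(3)[of i] B i unfolding upper_triangular_def by auto
    qed
  qed
  then have "foldr (\<lambda>e v. B *\<^sub>v v - e \<cdot>\<^sub>v v) (take k es) w = 0\<^sub>v n"
    using Suc.IH[OF _ w] k by simp
  moreover have "take (Suc k) es = take k es @ [es ! k]"
    using k es(2) by (simp add: take_Suc_conv_app_nth)
  ultimately show ?case by (simp add: w_def)
qed

theorem Cayley_Hamilton_factored: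
  assumes c: "cpoly n A = (\<Prod>e\<leftarrow>es. [:- e, 1:])" and i: "i < n"
  shows "foldr (shifted_apply n A) es c i = 0"
proof -
  let ?A = "coord_mat n A"
  obtain B P Q where BPQ: "schur_decomposition ?A es = (B, P, Q)" by (metis prod_cases3)
  have S: "similar_mat_wit ?A B P Q" "upper_triangular B" "diag_mat B = es"
    using schur_decomposition[OF coord_mat_carrier c[unfolded cpoly_def] BPQ] by auto
  have dim: "dim_row ?A = n" by (simp add: coord_mat_def)
  have car: "B \<in> carrier_mat n n" "P \<in> carrier_mat n n" "Q \<in> carrier_mat n n"
    and PQ: "P * Q = 1\<^sub>m n" "Q * P = 1\<^sub>m n" and AB: "?A = P * B * Q"
    using S(1) unfolding similar_mat_wit_def Let_def dim by auto
  have es: "length es = n" "\<And>i. i < n \<Longrightarrow> es ! i = B $$ (i, i)"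
    using S(3) car(1) by (auto simp: diag_mat_def)
  let ?fB = "\<lambda>e v. B *\<^sub>v v - e \<cdot>\<^sub>v v" and ?fA = "\<lambda>e v. ?A *\<^sub>v v - e \<cdot>\<^sub>v v"
  have fB_car: "foldr ?fB xs x \<in> carrier_vec n" if "x \<in> carrier_vec n" for xs x
    using that car(1) by (induction xs) auto
  have step: "?fA e (P *\<^sub>v y) = P *\<^sub>v ?fB e y" if y: "y \<in> carrier_vec n" for e y
  proof -
    have "?A *\<^sub>v (P *\<^sub>v y) = P *\<^sub>v (B *\<^sub>v ((Q * P) *\<^sub>v y))"
      unfolding AB using car y by (simp add: assoc_mult_mat_vec[of _ n n _ n])
    also have "(Q * P) *\<^sub>v y = y" using y by (simp add: PQ)
    finally have 1: "?A *\<^sub>v (P *\<^sub>v y) = P *\<^sub>v (B *\<^sub>v y)" .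
    have "e \<cdot>\<^sub>v (P *\<^sub>v y) = P *\<^sub>v (e \<cdot>\<^sub>v y)"
      using mult_mat_vec[OF car(2) y, of e] by simp
    then show ?thesis unfolding 1
      using mult_minus_distrib_mat_vec[OF car(2), of "B *\<^sub>v y" "e \<cdot>\<^sub>v y"] car y by simp
  qed
  have fold: "foldr ?fA xs (P *\<^sub>v x) = P *\<^sub>v foldr ?fB xs x" if "x \<in> carrier_vec n" for xs x
    using that by (induction xs) (auto simp: step fB_car)
  define v where "v = Matrix.vec n c"
  have v: "v \<in> carrier_vec n" by (simp add: v_def)
  have Qv: "Q *\<^sub>v v \<in> carrier_vec n" using car v by simp
  have "v = P *\<^sub>v (Q *\<^sub>v v)"
    using car v by (simp add: PQ flip: assoc_mult_mat_vec[of _ n n _ n])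
  then have "foldr ?fA es v = P *\<^sub>v foldr ?fB es (Q *\<^sub>v v)"
    using fold[OF Qv, of es] by simp
  also have "foldr ?fB es (Q *\<^sub>v v) = 0\<^sub>v n"
    using triangular_annihilates[OF car(1) S(2) es(2,1) order_refl Qv] es(1) by simp
  also have "P *\<^sub>v 0\<^sub>v n = 0\<^sub>v n" using car(2) by (intro eq_vecI) auto
  finally have zero: "foldr ?fA es v = 0\<^sub>v n" .
  have "foldr ?fA xs v = Matrix.vec n (foldr (shifted_apply n A) xs c)" for xs
  proof (induction xs)
    case Nil
    show ?case by (simp add: v_def)
  next
    case (Cons e xs)
    show ?case
      unfolding foldr_Cons o_apply Cons.IH
      by (intro eq_vecI) (auto simp: coord_mat_def scalar_prod_def shifted_apply_def lessThan_atLeast0)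
  qed
  then have "Matrix.vec n (foldr (shifted_apply n A) es c) = 0\<^sub>v n" using zero by simp
  then show ?thesis using i by (metis index_vec index_zero_vec(1))
qed

subsection \<open>Polynomials with measurable coefficients\<close>

definition meas_poly :: "'a measure \<Rightarrow> ('a \<Rightarrow> complex poly) \<Rightarrow> bool" where
  "meas_poly M p \<longleftrightarrow> (\<forall>k. (\<lambda>\<omega>. coeff (p \<omega>) k) \<in> borel_measurable M)"

lemma meas_polyD: "meas_poly M p \<Longrightarrow> (\<lambda>\<omega>. coeff (p \<omega>) k) \<in> borel_measurable M"
  by (simp add: meas_poly_def)

lemma meas_poly_const: "meas_poly M (\<lambda>\<omega>. c)"
  by (simp add: meas_poly_def)

lemma meas_poly_add: "meas_poly M p \<Longrightarrow> meas_poly M q \<Longrightarrow> meas_poly M (\<lambda>\<omega>. p \<omega> + q \<omega>)"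
  unfolding meas_poly_def coeff_add by (intro allI borel_measurable_add) auto

lemma meas_poly_mult: "meas_poly M p \<Longrightarrow> meas_poly M q \<Longrightarrow> meas_poly M (\<lambda>\<omega>. p \<omega> * q \<omega>)"
  unfolding meas_poly_def coeff_mult by (intro allI borel_measurable_sum borel_measurable_times) auto

lemma meas_poly_sum: "(\<And>i. i \<in> I \<Longrightarrow> meas_poly M (p i)) \<Longrightarrow> meas_poly M (\<lambda>\<omega>. \<Sum>i\<in>I. p i \<omega>)"
  unfolding meas_poly_def coeff_sum by (intro allI borel_measurable_sum) auto

lemma meas_poly_prod: "(\<And>i. i \<in> I \<Longrightarrow> meas_poly M (p i)) \<Longrightarrow> meas_poly M (\<lambda>\<omega>. \<Prod>i\<in>I. p i \<omega>)"
  by (induction I rule: infinite_finite_induct) (auto intro: meas_poly_const meas_poly_mult)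

lemma meas_poly_cpoly:
  assumes "\<And>i j. (\<lambda>\<omega>. A \<omega> i j) \<in> borel_measurable M"
  shows "meas_poly M (\<lambda>\<omega>. cpoly n (A \<omega>))"
proof -
  have entry: "meas_poly M (\<lambda>\<omega>. char_poly_matrix (coord_mat n (A \<omega>)) $$ (i, j))" if "i < n" "j < n" for i j
  proof -
    have "char_poly_matrix (coord_mat n (A \<omega>)) $$ (i, j) = (if i = j then [:0, 1:] else 0) + [: - A \<omega> i j :]" for \<omega>
      using that by (simp add: char_poly_matrix_def coord_mat_def)
    moreover have "meas_poly M (\<lambda>\<omega>. [: - A \<omega> i j :])"
      unfolding meas_poly_def coeff_pCons
    proof
      fix k show "(\<lambda>\<omega>. case k of 0 \<Rightarrow> - A \<omega> i j | Suc x \<Rightarrow> coeff 0 x) \<in> borel_measurable M"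
        using assms by (cases k) auto
    qed
    ultimately show ?thesis by (simp only:) (intro meas_poly_add meas_poly_const)
  qed
  have "cpoly n (A \<omega>) = (\<Sum>p\<in>{p. p permutes {0..<n}}. signof p *
      (\<Prod>i\<in>{0..<n}. char_poly_matrix (coord_mat n (A \<omega>)) $$ (i, p i)))" for \<omega>
  proof -
    have "char_poly_matrix (coord_mat n (A \<omega>)) \<in> carrier_mat n n" by simp
    then show ?thesis unfolding cpoly_def char_poly_def Determinant.det_def by (simp only: carrier_matD refl if_True)
  qed
  moreover have "meas_poly M (\<lambda>\<omega>. \<Sum>p\<in>{p. p permutes {0..<n}}. signof p *
      (\<Prod>i\<in>{0..<n}. char_poly_matrix (coord_mat n (A \<omega>)) $$ (i, p i)))"
  proof (intro meas_poly_sum meas_poly_mult meas_poly_const meas_poly_prod entry)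
    fix p i assume p: "p \<in> {p. p permutes {0..<n}}" and i: "i \<in> {0..<n}"
    show "i < n" using i by simp
    show "p i < n" using p i permutes_in_image[of p "{0..<n}" i] by simp
  qed
  ultimately show ?thesis by (simp only:)
qed

lemma poly_eval_measurable:
  assumes p: "meas_poly M p" and deg: "\<And>\<omega>. degree (p \<omega>) = n" and g: "g \<in> borel_measurable M"
  shows "(\<lambda>\<omega>. poly (p \<omega>) (g \<omega>)) \<in> borel_measurable M"
  unfolding poly_altdef deg
  by (intro borel_measurable_sum borel_measurable_times borel_measurable_power meas_polyD[OF p] g)

text \<open>Compactness turns the existence of a zero into countably many conditions.\<close>

lemma sets_exists_zero:
  fixes f :: "'a \<Rightarrow> 'b::euclidean_space \<Rightarrow> complex"
  assumes D: "compact D" and meas: "\<And>z. (\<lambda>\<omega>. f \<omega> z) \<in> borel_measurable M"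
    and cont: "\<And>\<omega>. continuous_on D (f \<omega>)"
  shows "{\<omega>\<in>space M. \<exists>z\<in>D. f \<omega> z = 0} \<in> sets M"
proof -
  obtain C where C: "countable C" "C \<subseteq> D" "D \<subseteq> closure C" using separable[of D] by blast
  have "(\<exists>z\<in>D. f \<omega> z = 0) \<longleftrightarrow> (\<forall>k::nat. \<exists>z\<in>C. cmod (f \<omega> z) < inverse (real (Suc k)))" for \<omega>
  proof
    assume "\<exists>z\<in>D. f \<omega> z = 0"
    then obtain z where z: "z \<in> D" "f \<omega> z = 0" by blast
    show "\<forall>k::nat. \<exists>z\<in>C. cmod (f \<omega> z) < inverse (real (Suc k))"
    proof
      fix k :: nat
      have "inverse (real (Suc k)) > 0" by simp
      then obtain d where d: "d > 0" "\<And>y. y \<in> D \<Longrightarrow> dist y z < d \<Longrightarrow> dist (f \<omega> y) (f \<omega> z) < inverse (real (Suc k))"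
        using cont[of \<omega>] z(1) unfolding continuous_on_iff by metis
      obtain y where "y \<in> C" "dist y z < d"
        using C(3) z(1) d(1) by (meson closure_approachable subsetD)
      then show "\<exists>z\<in>C. cmod (f \<omega> z) < inverse (real (Suc k))"
        using d(2)[of y] C(2) z(2) by (auto simp: dist_norm)
    qed
  next
    assume *: "\<forall>k::nat. \<exists>z\<in>C. cmod (f \<omega> z) < inverse (real (Suc k))"
    then have "D \<noteq> {}" using C(2) by blast
    moreover have "continuous_on D (\<lambda>z. cmod (f \<omega> z))" by (intro continuous_on_norm cont)
    ultimately obtain z where z: "z \<in> D" "\<And>y. y \<in> D \<Longrightarrow> cmod (f \<omega> z) \<le> cmod (f \<omega> y)"
      using continuous_attains_inf[OF D] by blast
    have "f \<omega> z = 0"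
    proof (rule ccontr)
      assume "f \<omega> z \<noteq> 0"
      then obtain k where "inverse (real (Suc k)) < cmod (f \<omega> z)"
        using reals_Archimedean[of "cmod (f \<omega> z)"] by auto
      moreover obtain y where "y \<in> C" "cmod (f \<omega> y) < inverse (real (Suc k))" using * by blast
      ultimately show False using z(2)[of y] C(2) by force
    qed
    with z(1) show "\<exists>z\<in>D. f \<omega> z = 0" by blast
  qed
  then have "{\<omega>\<in>space M. \<exists>z\<in>D. f \<omega> z = 0}
      = {\<omega>\<in>space M. \<forall>k::nat. \<exists>z\<in>C. cmod (f \<omega> z) < inverse (real (Suc k))}" by simp
  also have "\<dots> \<in> sets M"
  proof (rule sets.sets_Collect_countable_All, rule sets.sets_Collect_countable_Ex'[OF _ C(1)])
    fix k z
    note [measurable] = meas[of z]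
    show "{\<omega>\<in>space M. cmod (f \<omega> z) < inverse (real (Suc k))} \<in> sets M" by measurable
  qed
  finally show ?thesis .
qed

lemma measurable_Max:
  fixes S :: "'a \<Rightarrow> real set"
  assumes S: "\<And>\<omega>. finite (S \<omega>)" "\<And>\<omega>. S \<omega> \<noteq> {}"
    and meas: "\<And>q. {\<omega>\<in>space M. \<exists>y\<in>S \<omega>. q \<le> y} \<in> sets M"
  shows "(\<lambda>\<omega>. Max (S \<omega>)) \<in> borel_measurable M"
  unfolding borel_measurable_iff_ge using meas by (simp add: Max_ge_iff[OF S])

text \<open>The root chosen is the lexicographically largest one, first by real and then by imaginary part.\<close>

lemma measurable_root:
  assumes p: "meas_poly M p" and deg: "\<And>\<omega>. degree (p \<omega>) = n" and n: "n > 0"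
  obtains r where "r \<in> borel_measurable M" "\<And>\<omega>. poly (p \<omega>) (r \<omega>) = 0"
proof -
  note eval = poly_eval_measurable[OF p deg]
  have p0: "p \<omega> \<noteq> 0" for \<omega> using deg[of \<omega>] n by auto
  define Z where "Z \<omega> = {z. poly (p \<omega>) z = 0}" for \<omega>
  have Z: "finite (Z \<omega>)" "Z \<omega> \<noteq> {}" for \<omega>
  proof -
    show "finite (Z \<omega>)" unfolding Z_def by (rule poly_roots_finite[OF p0])
    show "Z \<omega> \<noteq> {}"
      using fundamental_theorem_of_algebra[of "p \<omega>"] deg[of \<omega>] n by (auto simp: Z_def constant_degree)
  qed
  define \<rho> where "\<rho> \<omega> = Max (Re ` Z \<omega>)" for \<omega>
  have \<rho>: "\<rho> \<in> borel_measurable M"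
    unfolding \<rho>_def
  proof (rule measurable_Max)
    fix q :: real
    let ?D = "\<lambda>N::nat. {z. q \<le> Re z} \<inter> cball 0 (real N)"
    have "(\<exists>y\<in>Re ` Z \<omega>. q \<le> y) \<longleftrightarrow> (\<exists>N. \<exists>z\<in>?D N. poly (p \<omega>) z = 0)" for \<omega>
    proof
      assume "\<exists>y\<in>Re ` Z \<omega>. q \<le> y"
      then obtain z where z: "poly (p \<omega>) z = 0" "q \<le> Re z" by (auto simp: Z_def)
      obtain N where "cmod z \<le> real N" using real_arch_simple by blast
      then have "z \<in> ?D N" using z by auto
      then show "\<exists>N. \<exists>z\<in>?D N. poly (p \<omega>) z = 0" using z(1) by blast
    qed (auto simp: Z_def)
    then have "{\<omega>\<in>space M. \<exists>y\<in>Re ` Z \<omega>. q \<le> y} = (\<Union>N. {\<omega>\<in>space M. \<exists>z\<in>?D N. poly (p \<omega>) z = 0})"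
      by auto
    also have "\<dots> \<in> sets M"
    proof (intro sets.countable_UN subsetI, clarify)
      fix N
      have "compact (?D N)"
        by (intro closed_Int_compact closed_Collect_le continuous_intros compact_cball)
      then show "{\<omega>\<in>space M. \<exists>z\<in>?D N. poly (p \<omega>) z = 0} \<in> sets M"
        by (rule sets_exists_zero) (auto intro!: eval continuous_intros)
    qed
    finally show "{\<omega>\<in>space M. \<exists>y\<in>Re ` Z \<omega>. q \<le> y} \<in> sets M" .
  qed (use Z in auto)
  define Y where "Y \<omega> = {y. poly (p \<omega>) (Complex (\<rho> \<omega>) y) = 0}" for \<omega>
  have Y: "finite (Y \<omega>)" "Y \<omega> \<noteq> {}" for \<omega>
  proof -
    have "Complex (\<rho> \<omega>) ` Y \<omega> \<subseteq> Z \<omega>" by (auto simp: Y_def Z_def)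
    then have "finite (Complex (\<rho> \<omega>) ` Y \<omega>)" using Z(1) finite_subset by blast
    then show "finite (Y \<omega>)" by (rule finite_imageD) (auto simp: inj_on_def)
    have "\<rho> \<omega> \<in> Re ` Z \<omega>" unfolding \<rho>_def using Z by (intro Max_in) auto
    then obtain z where z: "z \<in> Z \<omega>" "\<rho> \<omega> = Re z" by blast
    then have "Im z \<in> Y \<omega>" by (simp add: Y_def Z_def)
    then show "Y \<omega> \<noteq> {}" by blast
  qed
  define \<tau> where "\<tau> \<omega> = Max (Y \<omega>)" for \<omega>
  have \<tau>: "\<tau> \<in> borel_measurable M"
    unfolding \<tau>_def
  proof (rule measurable_Max)
    fix q :: real
    have "(\<exists>y\<in>Y \<omega>. q \<le> y) \<longleftrightarrow> (\<exists>N::nat. \<exists>y\<in>{q..q + real N}. poly (p \<omega>) (Complex (\<rho> \<omega>) y) = 0)" for \<omega>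
    proof
      assume "\<exists>y\<in>Y \<omega>. q \<le> y"
      then obtain y where y: "y \<in> Y \<omega>" "q \<le> y" by blast
      obtain N where "y - q \<le> real N" using real_arch_simple by blast
      then have "y \<in> {q..q + real N}" using y by auto
      then show "\<exists>N::nat. \<exists>y\<in>{q..q + real N}. poly (p \<omega>) (Complex (\<rho> \<omega>) y) = 0"
        using y(1) unfolding Y_def by blast
    qed (auto simp: Y_def)
    then have "{\<omega>\<in>space M. \<exists>y\<in>Y \<omega>. q \<le> y}
        = (\<Union>N. {\<omega>\<in>space M. \<exists>y\<in>{q..q + real N}. poly (p \<omega>) (Complex (\<rho> \<omega>) y) = 0})"
      by auto
    also have "\<dots> \<in> sets M"
    proof (intro sets.countable_UN subsetI, clarify)
      fix N :: nat
      have C: "Complex a y = of_real a + \<i> * of_real y" for a y by (simp add: complex_eq_iff)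
      show "{\<omega>\<in>space M. \<exists>y\<in>{q..q + real N}. poly (p \<omega>) (Complex (\<rho> \<omega>) y) = 0} \<in> sets M"
        unfolding C
        by (rule sets_exists_zero) (use \<rho> in \<open>auto intro!: eval continuous_intros\<close>)
    qed
    finally show "{\<omega>\<in>space M. \<exists>y\<in>Y \<omega>. q \<le> y} \<in> sets M" .
  qed (use Y in auto)
  define r where "r \<omega> = complex_of_real (\<rho> \<omega>) + \<i> * complex_of_real (\<tau> \<omega>)" for \<omega>
  have "r \<in> borel_measurable M"
    unfolding r_def[abs_def] using \<rho> \<tau> by measurable
  moreover have "poly (p \<omega>) (r \<omega>) = 0" for \<omega>
  proof -
    have "\<tau> \<omega> \<in> Y \<omega>" unfolding \<tau>_def using Y by (intro Max_in) auto
    moreover have "r \<omega> = Complex (\<rho> \<omega>) (\<tau> \<omega>)" by (simp add: r_def complex_eq_iff)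
    ultimately show ?thesis by (simp add: Y_def)
  qed
  ultimately show ?thesis using that by blast
qed

text \<open>Splitting off a measurable root leaves measurable coefficients, as those of the quotient
  are given by the recursion of synthetic division.\<close>

lemma measurable_roots:
  assumes "meas_poly M p" "\<And>\<omega>. degree (p \<omega>) = n" "\<And>\<omega>. coeff (p \<omega>) n = 1"
  shows "\<exists>r. (\<forall>i<n. r i \<in> borel_measurable M) \<and> (\<forall>\<omega>. p \<omega> = (\<Prod>i\<leftarrow>[0..<n]. [:- r i \<omega>, 1:]))"
  using assms
proof (induction n arbitrary: p)
  case 0
  have "p \<omega> = 1" for \<omega>
    using 0(2,3)[of \<omega>] by (metis degree_eq_zeroE coeff_pCons_0 one_pCons)
  then show ?case by simp
next
  case (Suc n)
  obtain s where s: "s \<in> borel_measurable M" "\<And>\<omega>. poly (p \<omega>) (s \<omega>) = 0"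
    using measurable_root[OF Suc.prems(1,2)] by blast
  define q where "q \<omega> = synthetic_div (p \<omega>) (s \<omega>)" for \<omega>
  have fact: "p \<omega> = [:- s \<omega>, 1:] * q \<omega>" for \<omega>
    using synthetic_div_correct'[of "s \<omega>" "p \<omega>"] s(2) by (simp add: q_def)
  have p0: "p \<omega> \<noteq> 0" for \<omega> using Suc.prems(3)[of \<omega>] by auto
  have q0: "q \<omega> \<noteq> 0" for \<omega> using p0[of \<omega>] fact[of \<omega>] by auto
  have degq: "degree (q \<omega>) = n" for \<omega>
  proof -
    have "degree (p \<omega>) = 1 + degree (q \<omega>)"
      unfolding fact[of \<omega>] by (subst degree_mult_eq) (use q0 in auto)
    then show ?thesis using Suc.prems(2)[of \<omega>] by simp
  qed
  have rec: "coeff (q \<omega>) i = coeff (p \<omega>) (Suc i) + s \<omega> * coeff (q \<omega>) (Suc i)" for \<omega> i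
    unfolding fact[of \<omega>] by (simp add: coeff_pCons)
  have leadq: "coeff (q \<omega>) n = 1" for \<omega>
    using rec[of \<omega> n] Suc.prems(3)[of \<omega>] degq[of \<omega>] by (simp add: coeff_eq_0)
  note pm = Suc.prems(1)
  have "meas_poly M q"
    unfolding meas_poly_def
  proof
    fix k
    have "k \<ge> Suc n - d \<Longrightarrow> (\<lambda>\<omega>. coeff (q \<omega>) k) \<in> borel_measurable M" for d
    proof (induction d arbitrary: k)
      case 0
      then have "coeff (q \<omega>) k = 0" for \<omega> using degq[of \<omega>] by (intro coeff_eq_0) simp
      then show ?case by simp
    next
      case (Suc d)
      have "(\<lambda>\<omega>. coeff (q \<omega>) (Suc k)) \<in> borel_measurable M" using Suc.prems by (intro Suc.IH) simp
      then have "(\<lambda>\<omega>. coeff (p \<omega>) (Suc k) + s \<omega> * coeff (q \<omega>) (Suc k)) \<in> borel_measurable M"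
        by (intro borel_measurable_add borel_measurable_times meas_polyD[OF pm] s(1))
      then show ?case by (subst rec)
    qed
    from this[of "Suc n"] show "(\<lambda>\<omega>. coeff (q \<omega>) k) \<in> borel_measurable M" by simp
  qed
  from Suc.IH[OF this degq leadq] obtain r where r: "\<forall>i<n. r i \<in> borel_measurable M"
    "\<forall>\<omega>. q \<omega> = (\<Prod>i\<leftarrow>[0..<n]. [:- r i \<omega>, 1:])" by blast
  define r' where "r' = r(n := s)"
  have "(\<Prod>i\<leftarrow>[0..<Suc n]. [:- r' i \<omega>, 1:]) = (\<Prod>i\<leftarrow>[0..<n]. [:- r i \<omega>, 1:]) * [:- s \<omega>, 1:]" for \<omega>
  proof -
    have eq: "map (\<lambda>i. [:- r' i \<omega>, 1:]) [0..<n] = map (\<lambda>i. [:- r i \<omega>, 1:]) [0..<n]"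
      by (rule map_cong) (auto simp: r'_def)
    have "r' n = s" by (simp add: r'_def)
    then show ?thesis by (simp only: upt_Suc_append[OF le0] map_append eq prod_list.append list.map prod_list.Cons prod_list.Nil mult_1_right)
  qed
  then have "p \<omega> = (\<Prod>i\<leftarrow>[0..<Suc n]. [:- r' i \<omega>, 1:])" for \<omega>
    using fact[of \<omega>] r(2) by (simp only: mult.commute)
  moreover have "\<forall>i<Suc n. r' i \<in> borel_measurable M"
    using r(1) s(1) by (auto simp: r'_def less_Suc_eq)
  ultimately show ?case by blast
qed

section \<open>Normal operators on multiplier modules\<close>

text \<open>The Fourier transform of the situation of the theorem: \<open>U\<close> is the image of the space, \<open>M\<close> the
  adjoint of \<open>L\<close>.\<close>

locale normal_op =
  fixes U :: "(real ^ 'd) L2 set" and L M :: "(real ^ 'd) L2 \<Rightarrow> (real ^ 'd) L2"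
  assumes U: "mult_module U"
    and bounded: "bounded_operator_on U L"
    and commutes_char: "\<And>k u. u \<in> U \<Longrightarrow> L (mulL2 (lattice_char k) u) = mulL2 (lattice_char k) (L u)"
    and adjoint: "is_adjoint_on U L M"
    and normal: "\<And>u. u \<in> U \<Longrightarrow> L (M u) = M (L u)"
begin

lemma subspace: "L2.subspace U" and closed_U: "closed U"
  using U by (auto simp: mult_module_def)

lemmas U_add = L2.subspace_add[OF subspace] and U_diff = L2.subspace_diff[OF subspace]
  and U_scale = L2.subspace_scale[OF subspace] and U_0 = L2.subspace_0[OF subspace]
  and U_sum = L2.subspace_sum[OF subspace] and U_mult = module_multiplier[OF U]

lemma L_in: "u \<in> U \<Longrightarrow> L u \<in> U" and M_in: "u \<in> U \<Longrightarrow> M u \<in> U"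
  and L_add: "u \<in> U \<Longrightarrow> v \<in> U \<Longrightarrow> L (u + v) = L u + L v"
  and L_scale: "u \<in> U \<Longrightarrow> L (c *\<^sub>C u) = c *\<^sub>C L u"
  using bounded adjoint by (auto simp: bounded_operator_on_def is_adjoint_on_def)

lemma L_0 [simp]: "L 0 = 0"
  using L_scale[OF U_0, of 0] by simp

lemma L_diff: "u \<in> U \<Longrightarrow> v \<in> U \<Longrightarrow> L (u - v) = L u - L v"
  unfolding minus_as_lincomb by (simp only: L_add L_scale U_scale)

lemma L_sum: "(\<And>i. i \<in> I \<Longrightarrow> u i \<in> U) \<Longrightarrow> L (\<Sum>i\<in>I. u i) = (\<Sum>i\<in>I. L (u i))"
  by (induction I rule: infinite_finite_induct) (auto simp: L_add U_sum)

lemma L_bounded: obtains K where "K \<ge> 0" "\<And>u. u \<in> U \<Longrightarrow> norm (L u) \<le> K * norm u"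
proof -
  obtain K where K: "\<And>u. u \<in> U \<Longrightarrow> norm (L u) \<le> K * norm u"
    using bounded unfolding bounded_operator_on_def by blast
  have "norm (L u) \<le> \<bar>K\<bar> * norm u" if "u \<in> U" for u
    using K[OF that] by (meson abs_ge_self mult_right_mono norm_ge_zero order_trans)
  then show ?thesis using that abs_ge_zero by blast
qed

lemma L_tendsto:
  assumes "\<And>n. u n \<in> U" "v \<in> U" "u \<longlonglongrightarrow> v" shows "(\<lambda>n. L (u n)) \<longlonglongrightarrow> L v"
proof -
  obtain K where K: "\<And>u. u \<in> U \<Longrightarrow> norm (L u) \<le> K * norm u" using L_bounded by metis
  have "(\<lambda>n. K * norm (u n - v)) \<longlonglongrightarrow> K * 0"
    by (intro tendsto_intros tendsto_norm_zero LIM_zero assms(3))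
  then have 0: "(\<lambda>n. K * norm (u n - v)) \<longlonglongrightarrow> 0" by simp
  have "(\<lambda>n. L (u n) - L v) \<longlonglongrightarrow> 0"
  proof (rule Lim_null_comparison[OF _ 0], rule always_eventually, rule allI)
    fix n show "norm (L (u n) - L v) \<le> K * norm (u n - v)"
      using K[OF U_diff[OF assms(1)[of n] assms(2)]] by (simp add: L_diff assms)
  qed
  then show ?thesis by (rule LIM_zero_cancel)
qed

text \<open>Both sides depend linearly on \<open>m\<close> and are continuous under bounded pointwise convergence, as \<open>L\<close> is
  bounded.\<close>

lemma commutes:
  assumes m: "multiplier m" and u: "u \<in> U"
  shows "L (mulL2 m u) = mulL2 m (L u)"
  using m
proof (induction rule: multiplier_induct)
  case (lattice_char k)
  show ?case by (rule commutes_char[OF u])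
next
  case (add f g)
  then show ?case using u by (simp add: mulL2_add_left multiplierD L_add U_mult)
next
  case (scale f c)
  have "mulL2 (\<lambda>\<omega>. c * f \<omega>) v = c *\<^sub>C mulL2 f v" for v
    using scale(1) by (simp add: multiplierD bounded_borel_const flip: mulL2_mulL2 mulL2_const)
  then show ?case using scale u by (simp add: L_scale U_mult)
next
  case (lim f g C)
  have conv: "(\<lambda>n. mulL2 (f n) v) \<longlonglongrightarrow> mulL2 g v" for v
    by (rule mulL2_tendsto[where C=C]) (use lim in \<open>auto intro: multiplierD\<close>)
  have "(\<lambda>n. L (mulL2 (f n) u)) \<longlonglongrightarrow> L (mulL2 g u)"
    by (rule L_tendsto[OF U_mult[OF lim(1) u] U_mult[OF lim(2) u] conv])
  then have 1: "(\<lambda>n. mulL2 (f n) (L u)) \<longlonglongrightarrow> L (mulL2 g u)" unfolding lim.IH .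
  show ?case by (rule LIMSEQ_unique[OF 1 conv])
qed

lemma adj: "u \<in> U \<Longrightarrow> v \<in> U \<Longrightarrow> cinner (L u) v = cinner u (M v)"
  using adjoint by (simp add: is_adjoint_on_def)

lemma adj': "u \<in> U \<Longrightarrow> v \<in> U \<Longrightarrow> cinner u (L v) = cinner (M u) v"
  using adj[of v u] by (subst (1 2) cinner_commute) simp

text \<open>The adjoint of multiplication by \<open>m\<close> is multiplication by the conjugate of \<open>m\<close>, with which \<open>L\<close>
  commutes.\<close>

lemma M_commutes:
  assumes m: "multiplier m" and u: "u \<in> U"
  shows "M (mulL2 m u) = mulL2 m (M u)"
proof -
  define d where "d = M (mulL2 m u) - mulL2 m (M u)"
  have d: "d \<in> U" unfolding d_def by (intro U_diff M_in U_mult m u)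
  note bm = multiplierD[OF m] and cm = multiplier_cnj[OF m]
  have "cinner g (M (mulL2 m u)) = cinner g (mulL2 m (M u))" if g: "g \<in> U" for g
  proof -
    have "cinner g (M (mulL2 m u)) = cinner (L g) (mulL2 m u)" by (rule adj[symmetric]) (intro g U_mult m u)+
    also have "\<dots> = cinner (L (mulL2 (\<lambda>\<omega>. cnj (m \<omega>)) g)) u"
      using cinner_mulL2[OF multiplierD[OF cm], of "L g" u] by (simp add: commutes[OF cm g])
    also have "\<dots> = cinner (mulL2 (\<lambda>\<omega>. cnj (m \<omega>)) g) (M u)" by (rule adj) (intro U_mult cm g u)+
    also have "\<dots> = cinner g (mulL2 m (M u))"
      using cinner_mulL2[OF multiplierD[OF cm], of g "M u"] by simp
    finally show ?thesis .
  qed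
  from this[OF d] have "cinner d d = 0" unfolding d_def by (simp add: cinner_diff_right)
  then show ?thesis by (simp add: cinner_self d_def)
qed

definition eig :: "(real ^ 'd \<Rightarrow> complex) \<Rightarrow> (real ^ 'd) L2 set" where
  "eig m = {u \<in> U. L u = mulL2 m u}"

text \<open>\<open>L - m\<close> is normal as well, so it has the same kernel as its adjoint.\<close>

lemma eig_adjoint:
  assumes m: "multiplier m" and u: "u \<in> eig m"
  shows "M u = mulL2 (\<lambda>\<omega>. cnj (m \<omega>)) u"
proof -
  let ?m = "mulL2 m" and ?c = "mulL2 (\<lambda>\<omega>. cnj (m \<omega>))"
  have uU: "u \<in> U" and Lu: "L u = ?m u" using u by (auto simp: eig_def)
  note cm = multiplier_cnj[OF m]
  have sw: "cinner (?m x) y = cinner x (?c y)" "cinner (?c x) y = cinner x (?m y)" for x y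
    using cinner_mulL2[OF multiplierD[OF m]] cinner_mulL2[OF multiplierD[OF cm]] by simp_all
  have 1: "cinner (M u) (M u) = cinner (L u) (L u)"
    by (simp add: adj adj' L_in M_in uU normal flip: normal)
  have 2: "cinner (M u) (?c u) = cinner (?m u) (L u)"
  proof -
    have "cinner (M u) (?c u) = cinner (?m (M u)) u" by (simp add: sw)
    also have "\<dots> = cinner (M (?m u)) u" by (simp add: M_commutes m uU)
    also have "\<dots> = cinner (?m u) (L u)" by (rule adj'[symmetric]) (intro U_mult m uU)+
    finally show ?thesis .
  qed
  have 3: "cinner (?c u) (M u) = cinner (L u) (?m u)"
    using 2 by (subst (1 2) cinner_commute) simp
  have 4: "cinner (?c u) (?c u) = cinner (?m u) (?m u)"
    unfolding sw using multiplierD[OF m] multiplierD[OF cm] by (simp add: mulL2_mulL2 mult.commute)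
  have "cinner (M u - ?c u) (M u - ?c u) = cinner (L u - ?m u) (L u - ?m u)"
    by (simp add: cinner_diff_left cinner_diff_right 1 2 3 4)
  also have "\<dots> = 0" by (simp add: Lu)
  finally show ?thesis by (simp add: cinner_self)
qed

lemma eig_sub: "u \<in> eig m \<Longrightarrow> u \<in> U"
  by (simp add: eig_def)

lemma eig_mult: "multiplier m \<Longrightarrow> multiplier h \<Longrightarrow> u \<in> eig m \<Longrightarrow> mulL2 h u \<in> eig m"
  by (simp add: eig_def U_mult commutes mulL2_mulL2 multiplierD mult.commute)

lemma eig_subspace: "multiplier m \<Longrightarrow> L2.subspace (eig m)"
  unfolding L2.subspace_def eig_def
  by (auto simp: U_0 U_add U_scale L_add L_scale mulL2_add_right mulL2_scaleC_right mulL2_zero_right multiplierD)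

lemma eig_closed:
  assumes m: "multiplier m" shows "closed (eig m)"
proof (rule closed_sequential_limits[THEN iffD2], intro allI impI, elim conjE)
  fix x l assume x: "\<forall>n. x n \<in> eig m" and l: "x \<longlonglongrightarrow> l"
  have xU: "x n \<in> U" for n using x eig_sub by blast
  have lU: "l \<in> U" by (rule closed_sequentially[OF closed_U xU l])
  have "(\<lambda>n. L (x n)) \<longlonglongrightarrow> L l" by (rule L_tendsto[OF xU lU l])
  moreover have "L (x n) = mulL2 m (x n)" for n using x by (simp add: eig_def)
  ultimately have 1: "(\<lambda>n. mulL2 m (x n)) \<longlonglongrightarrow> L l" by simp
  have 2: "(\<lambda>n. mulL2 m (x n)) \<longlonglongrightarrow> mulL2 m l"
    by (rule bounded_linear.tendsto[OF bounded_linear_mulL2[OF multiplierD[OF m]] l])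
  show "l \<in> eig m" using LIMSEQ_unique[OF 1 2] lU by (simp add: eig_def)
qed

text \<open>The vector \<open>v = (L - m) u\<close> is annihilated by the adjoint of \<open>L - m\<close>, so \<open>v\<close> is orthogonal to
  the range of \<open>L - m\<close> and in particular to itself.\<close>

lemma eig_square:
  assumes m: "multiplier m" and u: "u \<in> U" and v: "L u - mulL2 m u \<in> eig m"
  shows "u \<in> eig m"
proof -
  define v where "v = L u - mulL2 m u"
  note cm = multiplier_cnj[OF m]
  have vU: "v \<in> U" and Mv: "M v = mulL2 (\<lambda>\<omega>. cnj (m \<omega>)) v"
    using v eig_sub eig_adjoint[OF m v] by (auto simp: v_def)
  have "cinner v v = cinner (L u) v - cinner (mulL2 m u) v"
    by (simp add: v_def cinner_diff_left)
  also have "cinner (L u) v = cinner u (mulL2 (\<lambda>\<omega>. cnj (m \<omega>)) v)"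
    by (simp add: adj u vU Mv)
  also have "cinner (mulL2 m u) v = cinner u (mulL2 (\<lambda>\<omega>. cnj (m \<omega>)) v)"
    by (rule cinner_mulL2[OF multiplierD[OF m]])
  finally have "v = 0" by (simp add: cinner_self)
  then show ?thesis using u by (simp add: v_def eig_def)
qed

text \<open>The function \<open>a - b\<close> can be divided out away from its zeros, and on its zero set the two
  eigenspaces meet.\<close>

lemma eig_orthogonal:
  assumes a: "multiplier a" and b: "multiplier b" and triv: "eig a \<inter> eig b = {0}"
    and f: "f \<in> eig a" and g: "g \<in> eig b"
  shows "cinner f g = 0"
proof -
  define D where "D \<omega> = a \<omega> - b \<omega>" for \<omega>
  have Dm: "multiplier D" unfolding D_def[abs_def] by (rule multiplier_diff[OF a b])
  have Dp: "periodic_borel D" by (rule periodic_borel_multiplier[OF Dm])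
  have diff: "cinner (mulL2 D f') g = 0" if f': "f' \<in> eig a" for f'
  proof -
    have "cinner (mulL2 a f') g = cinner (L f') g" using f' by (simp add: eig_def)
    also have "\<dots> = cinner f' (M g)" by (rule adj) (use f' g eig_sub in auto)
    also have "\<dots> = cinner (mulL2 b f') g"
      using cinner_mulL2[OF multiplierD[OF b], of f' g] by (simp add: eig_adjoint[OF b g])
    finally show ?thesis
      unfolding D_def[abs_def] using a b by (simp add: mulL2_diff_left multiplierD cinner_diff_left)
  qed
  \<comment> \<open>\<open>Q n\<close> marks the values of \<open>a - b\<close> that admit a bounded inverse\<close>
  define Q where "Q n z \<longleftrightarrow> inverse (real (Suc n)) \<le> cmod z" for n z
  have Qs: "{z. Q n z} \<in> sets borel" for n
  proof -
    have "closed {z. Q n z}" unfolding Q_def by (intro closed_Collect_le continuous_intros)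
    then show ?thesis by (rule borel_closed)
  qed
  have hm: "multiplier (\<lambda>\<omega>. if Q n (D \<omega>) then inverse (D \<omega>) else 0)" for n
  proof (rule multiplier_restrict[OF _ Dp _ Qs])
    show "periodic_borel (\<lambda>\<omega>. inverse (D \<omega>))"
      using Dp by (auto simp: periodic_borel_def)
    fix \<omega> assume "Q n (D \<omega>)"
    then show "cmod (inverse (D \<omega>)) \<le> real (Suc n)"
      unfolding Q_def norm_inverse by (metis inverse_inverse_eq inverse_positive_iff_positive le_imp_inverse_le of_nat_0_less_iff zero_less_Suc)
  qed
  have qm: "multiplier (\<lambda>\<omega>. if Q n (D \<omega>) then 1 else 0)" for n
    by (rule multiplier_restrict[OF periodic_borel_multiplier[OF multiplier_const] Dp _ Qs, where B=1]) simp
  have Q_zero: "cinner (mulL2 (\<lambda>\<omega>. if Q n (D \<omega>) then 1 else 0) f) g = 0" for n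
  proof -
    have "mulL2 D (mulL2 (\<lambda>\<omega>. if Q n (D \<omega>) then inverse (D \<omega>) else 0) f)
        = mulL2 (\<lambda>\<omega>. if Q n (D \<omega>) then 1 else 0) f"
    proof -
      have "D \<omega> * (if Q n (D \<omega>) then inverse (D \<omega>) else 0) = (if Q n (D \<omega>) then 1 else 0)" for \<omega>
      proof (cases "Q n (D \<omega>)")
        case True
        have "0 < inverse (real (Suc n))" by simp
        also have "\<dots> \<le> cmod (D \<omega>)" using True by (simp only: Q_def)
        finally show ?thesis using True by simp
      qed simp
      then show ?thesis using hm[of n] Dm by (simp add: mulL2_mulL2 multiplierD)
    qed
    then show ?thesis using diff[OF eig_mult[OF a hm[of n] f]] by simp
  qed
  have nzm: "multiplier (\<lambda>\<omega>. if D \<omega> \<noteq> 0 then 1 else 0)"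
    by (rule multiplier_restrict[OF periodic_borel_multiplier[OF multiplier_const] Dp, where B=1]) auto
  have "(\<lambda>n. mulL2 (\<lambda>\<omega>. if Q n (D \<omega>) then 1 else 0) f) \<longlonglongrightarrow> mulL2 (\<lambda>\<omega>. if D \<omega> \<noteq> 0 then 1 else 0) f"
  proof (rule mulL2_tendsto[where C=1])
    show "(\<lambda>n. if Q n (D \<omega>) then 1 else 0 :: complex) \<longlonglongrightarrow> (if D \<omega> \<noteq> 0 then 1 else 0)" for \<omega>
    proof (cases "D \<omega> = 0")
      case False
      then obtain N where N: "inverse (real (Suc N)) < cmod (D \<omega>)"
        using reals_Archimedean[of "cmod (D \<omega>)"] by auto
      have "\<forall>\<^sub>F n in sequentially. (if Q n (D \<omega>) then 1 else 0 :: complex) = (if D \<omega> \<noteq> 0 then 1 else 0)"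
        using eventually_ge_at_top[of N]
      proof eventually_elim
        case (elim n)
        have "inverse (real (Suc n)) \<le> inverse (real (Suc N))" using elim by (simp add: field_simps)
        then have "inverse (real (Suc n)) \<le> cmod (D \<omega>)" using N by linarith
        then show ?case using False by (simp only: Q_def if_True simp_thms)
      qed
      then show ?thesis by (rule tendsto_eventually)
    qed (simp add: Q_def)
  qed (use qm nzm multiplierD in auto)
  then have "(\<lambda>n. cinner (mulL2 (\<lambda>\<omega>. if Q n (D \<omega>) then 1 else 0) f) g)
      \<longlonglongrightarrow> cinner (mulL2 (\<lambda>\<omega>. if D \<omega> \<noteq> 0 then 1 else 0) f) g"
    by (rule bounded_bilinear.tendsto[OF bounded_bilinear_cinner _ tendsto_const])
  then have 1: "cinner (mulL2 (\<lambda>\<omega>. if D \<omega> \<noteq> 0 then 1 else 0) f) g = 0"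
    unfolding Q_zero by (simp add: LIMSEQ_const_iff)
  have zm: "multiplier (\<lambda>\<omega>. if D \<omega> = 0 then 1 else 0)"
    by (rule multiplier_restrict[OF periodic_borel_multiplier[OF multiplier_const] Dp, where B=1]) auto
  \<comment> \<open>the part of \<open>f\<close> over \<open>a = b\<close> lies in both eigenspaces\<close>
  define f0 where "f0 = mulL2 (\<lambda>\<omega>. if D \<omega> = 0 then 1 else 0) f"
  have f0a: "f0 \<in> eig a" unfolding f0_def by (rule eig_mult[OF a zm f])
  have "mulL2 a f0 = mulL2 b f0"
  proof -
    have "(\<lambda>\<omega>. a \<omega> * (if D \<omega> = 0 then 1 else 0)) = (\<lambda>\<omega>. b \<omega> * (if D \<omega> = 0 then 1 else 0))"
      by (auto simp: D_def fun_eq_iff)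
    then show ?thesis unfolding f0_def using a b zm by (simp add: mulL2_mulL2 multiplierD)
  qed
  then have "f0 \<in> eig b" using f0a by (simp add: eig_def)
  then have "f0 = 0" using f0a triv by blast
  moreover have "f = f0 + mulL2 (\<lambda>\<omega>. if D \<omega> \<noteq> 0 then 1 else 0) f"
  proof -
    have "(\<lambda>\<omega>. (if D \<omega> = 0 then 1 else 0) + (if D \<omega> \<noteq> 0 then 1 else 0) :: complex) = (\<lambda>\<omega>. 1)"
      by auto
    then show ?thesis
      unfolding f0_def using mulL2_add_left[OF multiplierD[OF zm] multiplierD[OF nzm], of f]
      by (simp add: mulL2_one)
  qed
  ultimately show ?thesis using 1 by simp
qed

subsection \<open>The sum of the eigenspaces of pointwise distinct multipliers\<close>

definition eig_sum :: "nat \<Rightarrow> (nat \<Rightarrow> real ^ 'd \<Rightarrow> complex) \<Rightarrow> (real ^ 'd) L2 set" where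
  "eig_sum N m = {\<Sum>j<N. v j | v. \<forall>j<N. v j \<in> eig (m j)}"

context
  fixes N :: nat and m :: "nat \<Rightarrow> real ^ 'd \<Rightarrow> complex"
  assumes m: "\<And>j. j < N \<Longrightarrow> multiplier (m j)"
    and distinct: "\<And>i j \<omega>. i < N \<Longrightarrow> j < N \<Longrightarrow> i \<noteq> j \<Longrightarrow> m i \<omega> \<noteq> m j \<omega>"
begin

lemma eig_Int_distinct:
  assumes "i < N" "j < N" "i \<noteq> j" shows "eig (m i) \<inter> eig (m j) = {0}"
proof -
  have "u = 0" if "u \<in> eig (m i)" "u \<in> eig (m j)" for u
  proof -
    have eq: "mulL2 (m i) u = mulL2 (m j) u" using that by (simp add: eig_def)
    show ?thesis
    proof (rule L2_eqI, use rep_mulL2[OF multiplierD[OF m[OF assms(1)]], of u]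
        rep_mulL2[OF multiplierD[OF m[OF assms(2)]], of u] rep_zero in eventually_elim)
      fix \<omega> assume ae: "rep_L2 (mulL2 (m i) u) \<omega> = m i \<omega> * rep_L2 u \<omega>"
        "rep_L2 (mulL2 (m j) u) \<omega> = m j \<omega> * rep_L2 u \<omega>" and z: "rep_L2 (0 :: (real ^ 'd) L2) \<omega> = 0"
      have "(m i \<omega> - m j \<omega>) * rep_L2 u \<omega> = rep_L2 (mulL2 (m i) u) \<omega> - rep_L2 (mulL2 (m j) u) \<omega>"
        by (simp only: left_diff_distrib ae)
      also have "\<dots> = 0" by (simp only: eq diff_self)
      finally have "(m i \<omega> - m j \<omega>) * rep_L2 u \<omega> = 0" .
      with z show "rep_L2 u \<omega> = rep_L2 0 \<omega>" using distinct[OF assms, of \<omega>] by auto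
    qed
  qed
  then show ?thesis using L2.subspace_0[OF eig_subspace[OF m]] assms by blast
qed

lemma eig_orth: "i < N \<Longrightarrow> j < N \<Longrightarrow> i \<noteq> j \<Longrightarrow> u \<in> eig (m i) \<Longrightarrow> v \<in> eig (m j) \<Longrightarrow> cinner u v = 0"
  by (rule eig_orthogonal[OF m m eig_Int_distinct])

lemma eig_sumI: "(\<And>j. j < N \<Longrightarrow> v j \<in> eig (m j)) \<Longrightarrow> (\<Sum>j<N. v j) \<in> eig_sum N m"
  unfolding eig_sum_def by blast

lemma eig_in_sum:
  assumes "i < N" "u \<in> eig (m i)" shows "u \<in> eig_sum N m"
proof -
  have "(\<Sum>j<N. if j = i then u else 0) \<in> eig_sum N m"
    by (rule eig_sumI) (use assms m in \<open>auto intro: L2.subspace_0[OF eig_subspace]\<close>)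
  then show ?thesis using assms(1) by simp
qed

lemma eig_sum_subspace: "L2.subspace (eig_sum N m)"
  unfolding L2.subspace_def
proof (intro conjI ballI allI)
  have "(\<Sum>j<N. 0) \<in> eig_sum N m"
    by (rule eig_sumI) (use m in \<open>auto intro: L2.subspace_0[OF eig_subspace]\<close>)
  then show "0 \<in> eig_sum N m" by simp
next
  fix u v assume "u \<in> eig_sum N m" "v \<in> eig_sum N m"
  then obtain f g where f: "u = (\<Sum>j<N. f j)" "\<forall>j<N. f j \<in> eig (m j)"
    and g: "v = (\<Sum>j<N. g j)" "\<forall>j<N. g j \<in> eig (m j)" unfolding eig_sum_def by blast
  have "(\<Sum>j<N. f j + g j) \<in> eig_sum N m"
    by (rule eig_sumI) (use f(2) g(2) m in \<open>auto intro: L2.subspace_add[OF eig_subspace]\<close>)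
  then show "u + v \<in> eig_sum N m" by (simp add: f g sum.distrib)
next
  fix c u assume "u \<in> eig_sum N m"
  then obtain f where f: "u = (\<Sum>j<N. f j)" "\<forall>j<N. f j \<in> eig (m j)" unfolding eig_sum_def by blast
  have "(\<Sum>j<N. c *\<^sub>C f j) \<in> eig_sum N m"
    by (rule eig_sumI) (use f(2) m in \<open>auto intro: L2.subspace_scale[OF eig_subspace]\<close>)
  then show "c *\<^sub>C u \<in> eig_sum N m" by (simp add: f L2.scale_sum_right)
qed

lemma eig_sum_mult:
  assumes h: "multiplier h" and u: "u \<in> eig_sum N m" shows "mulL2 h u \<in> eig_sum N m"
proof -
  obtain f where f: "u = (\<Sum>j<N. f j)" "\<forall>j<N. f j \<in> eig (m j)" using u unfolding eig_sum_def by blast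
  have "(\<Sum>j<N. mulL2 h (f j)) \<in> eig_sum N m"
    by (rule eig_sumI) (use f(2) m h in \<open>auto intro: eig_mult\<close>)
  then show ?thesis by (simp add: f mulL2_sum_right multiplierD[OF h])
qed

text \<open>By orthogonality each summand of a Cauchy sequence is Cauchy.\<close>

lemma eig_sum_closed: "closed (eig_sum N m)"
proof (rule closed_sequential_limits[THEN iffD2], intro allI impI, elim conjE)
  fix x l assume x: "\<forall>n. x n \<in> eig_sum N m" and l: "x \<longlonglongrightarrow> l"
  have "\<forall>n. \<exists>v. x n = (\<Sum>j<N. v j) \<and> (\<forall>j<N. v j \<in> eig (m j))"
    using x unfolding eig_sum_def by blast
  then obtain v where v: "\<And>n. x n = (\<Sum>j<N. v n j)" "\<And>n j. j < N \<Longrightarrow> v n j \<in> eig (m j)"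
    by metis
  have le: "norm (v n i - v k i) \<le> norm (x n - x k)" if i: "i < N" for n k i
  proof -
    define w where "w j = v n j - v k j" for j
    have w: "w j \<in> eig (m j)" if "j < N" for j
      unfolding w_def using that v(2) by (intro L2.subspace_diff[OF eig_subspace[OF m]])
    have "x n - x k = (\<Sum>j<N. w j)" by (simp add: v(1) w_def sum_subtractf)
    then have "x n - x k = w i + (\<Sum>j\<in>{..<N} - {i}. w j)"
      using i by (simp add: sum.remove)
    moreover have "cinner (w i) (\<Sum>j\<in>{..<N} - {i}. w j) = 0"
      unfolding cinner_sum_right using i w by (intro sum.neutral) (auto intro: eig_orth)
    ultimately have "(norm (x n - x k))\<^sup>2 = (norm (w i))\<^sup>2 + (norm (\<Sum>j\<in>{..<N} - {i}. w j))\<^sup>2"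
      using norm_pythagoras by simp
    then have "(norm (w i))\<^sup>2 \<le> (norm (x n - x k))\<^sup>2" by simp
    then show ?thesis unfolding w_def by (rule power2_le_imp_le) simp
  qed
  have "\<exists>y. (\<lambda>n. v n j) \<longlonglongrightarrow> y" if j: "j < N" for j
  proof -
    have "Cauchy x" using l LIMSEQ_imp_Cauchy by blast
    then have "Cauchy (\<lambda>n. v n j)"
      unfolding Cauchy_def dist_norm using le[OF j] by (meson order.strict_trans1)
    then show ?thesis by (simp add: Cauchy_convergent_iff convergent_def)
  qed
  then obtain y where y: "\<And>j. j < N \<Longrightarrow> (\<lambda>n. v n j) \<longlonglongrightarrow> y j" by metis
  have "y j \<in> eig (m j)" if "j < N" for j
    by (rule closed_sequentially[OF eig_closed[OF m[OF that]] v(2)[OF that] y[OF that]])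
  then have "(\<Sum>j<N. y j) \<in> eig_sum N m" by (rule eig_sumI)
  moreover have "(\<lambda>n. \<Sum>j<N. v n j) \<longlonglongrightarrow> (\<Sum>j<N. y j)"
    by (intro tendsto_sum y) simp
  then have "x \<longlonglongrightarrow> (\<Sum>j<N. y j)" unfolding v(1)[symmetric] .
  then have "l = (\<Sum>j<N. y j)" by (rule LIMSEQ_unique[OF l])
  ultimately show "l \<in> eig_sum N m" by simp
qed

text \<open>Where \<open>m i\<close> stays away from \<open>m j\<close> the equation \<open>(L - m j) w = v\<close> can be solved within the
  eigenspaces for every \<open>v\<close> in \<open>eig_sum N m\<close> up to a term in \<open>eig (m j)\<close>.\<close>

lemma eig_sum_solve_separated:
  assumes j: "j < N" and w: "w \<in> U" and v: "L w - mulL2 (m j) w \<in> eig_sum N m"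
    and h: "\<And>i. i < N \<Longrightarrow> i \<noteq> j \<Longrightarrow> multiplier (h i)"
    and q: "multiplier q" "mulL2 q w = w" "\<And>i \<omega>. i < N \<Longrightarrow> i \<noteq> j \<Longrightarrow> (m i \<omega> - m j \<omega>) * h i \<omega> = q \<omega>"
  shows "w \<in> eig_sum N m"
proof -
  obtain f where f: "L w - mulL2 (m j) w = (\<Sum>i<N. f i)" "\<And>i. i < N \<Longrightarrow> f i \<in> eig (m i)"
    using v unfolding eig_sum_def by blast
  have mj: "multiplier (m j)" by (rule m[OF j])
  define g where "g i = mulL2 (h i) (f i)" for i
  have g: "g i \<in> eig (m i)" if "i < N" "i \<noteq> j" for i
    unfolding g_def by (rule eig_mult[OF m[OF that(1)] h[OF that] f(2)[OF that(1)]])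
  have Lg: "L (g i) - mulL2 (m j) (g i) = mulL2 q (f i)" if i: "i < N" "i \<noteq> j" for i
  proof -
    have "L (g i) - mulL2 (m j) (g i) = mulL2 (m i) (g i) - mulL2 (m j) (g i)"
      using g[OF i] by (simp add: eig_def)
    also have "\<dots> = mulL2 (\<lambda>\<omega>. m i \<omega> - m j \<omega>) (g i)"
      by (simp add: mulL2_diff_left multiplierD m i j)
    also have "\<dots> = mulL2 (\<lambda>\<omega>. (m i \<omega> - m j \<omega>) * h i \<omega>) (f i)"
      unfolding g_def by (rule mulL2_mulL2) (intro multiplierD multiplier_diff m h i mj)+
    finally show ?thesis by (simp add: q(3)[OF i])
  qed
  define G where "G = (\<Sum>i\<in>{..<N} - {j}. g i)"
  have gU: "g i \<in> U" if "i \<in> {..<N} - {j}" for i using g[of i] that eig_sub by auto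
  have GU: "G \<in> U" unfolding G_def by (intro U_sum gU)
  have "L w - mulL2 (m j) w = mulL2 q (L w - mulL2 (m j) w)"
  proof -
    have "mulL2 q (mulL2 (m j) w) = mulL2 (m j) (mulL2 q w)"
      using q(1) mj by (simp add: mulL2_mulL2 multiplierD mult.commute)
    moreover have "mulL2 q (L w) = L (mulL2 q w)" by (rule commutes[OF q(1) w, symmetric])
    ultimately show ?thesis using q(1,2) by (simp add: mulL2_diff_right multiplierD)
  qed
  also have "\<dots> = (\<Sum>i<N. mulL2 q (f i))"
    unfolding f(1) by (simp add: mulL2_sum_right multiplierD q(1))
  finally have Lw: "L w - mulL2 (m j) w = mulL2 q (f j) + (\<Sum>i\<in>{..<N} - {j}. mulL2 q (f i))"
    using j by (simp add: sum.remove)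
  have "L G - mulL2 (m j) G = (\<Sum>i\<in>{..<N} - {j}. L (g i) - mulL2 (m j) (g i))"
    using L_sum[of "{..<N} - {j}" g, OF gU] unfolding G_def
    by (simp add: mulL2_sum_right multiplierD mj sum_subtractf)
  also have "\<dots> = (\<Sum>i\<in>{..<N} - {j}. mulL2 q (f i))"
    by (intro sum.cong) (auto simp: Lg)
  finally have LG: "L G - mulL2 (m j) G = (\<Sum>i\<in>{..<N} - {j}. mulL2 q (f i))" .
  have "L (w - G) - mulL2 (m j) (w - G) = (L w - mulL2 (m j) w) - (L G - mulL2 (m j) G)"
    using mj by (simp add: L_diff w GU mulL2_diff_right multiplierD)
  also have "\<dots> = mulL2 q (f j)" unfolding Lw LG by simp
  finally have "L (w - G) - mulL2 (m j) (w - G) \<in> eig (m j)"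
    using eig_mult[OF mj q(1) f(2)[OF j]] by simp
  then have "w - G \<in> eig (m j)" by (rule eig_square[OF mj U_diff[OF w GU]])
  then have "w - G \<in> eig_sum N m" by (rule eig_in_sum[OF j])
  moreover have "G \<in> eig_sum N m"
    unfolding G_def using g by (intro L2.subspace_sum[OF eig_sum_subspace]) (auto intro: eig_in_sum)
  ultimately have "(w - G) + G \<in> eig_sum N m" by (rule L2.subspace_add[OF eig_sum_subspace])
  then show ?thesis by simp
qed

end

end

lemma multiplier_prod: "finite I \<Longrightarrow> (\<And>i. i \<in> I \<Longrightarrow> multiplier (f i)) \<Longrightarrow> multiplier (\<lambda>\<omega>. \<Prod>i\<in>I. f i \<omega>)"
  by (induction I rule: finite_induct) (auto intro: multiplier_const multiplier_mult)

lemma bounded_borel_sum: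
  "finite I \<Longrightarrow> (\<And>i. i \<in> I \<Longrightarrow> bounded_borel (f i)) \<Longrightarrow> bounded_borel (\<lambda>\<omega>. \<Sum>i\<in>I. f i \<omega>)"
  by (induction I rule: finite_induct) (auto intro: bounded_borel_const bounded_borel_add)

lemma mulL2_sum_left:
  assumes "finite I" "\<And>i. i \<in> I \<Longrightarrow> bounded_borel (f i)"
  shows "mulL2 (\<lambda>\<omega>. \<Sum>i\<in>I. f i \<omega>) u = (\<Sum>i\<in>I. mulL2 (f i) u)"
  using assms
proof (induction I rule: finite_induct)
  case empty
  have "mulL2 (\<lambda>\<omega>. 0) u = 0" unfolding mulL2_const by simp
  then show ?case by simp
next
  case (insert i I)
  then show ?case by (simp add: mulL2_add_left bounded_borel_sum)
qed

lemma multiplier_indicator: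
  assumes "periodic_borel c" "{z. Q z} \<in> sets borel"
  shows "multiplier (\<lambda>\<omega>. if Q (c \<omega>) then 1 else 0)"
  by (rule multiplier_restrict[OF periodic_borel_multiplier[OF multiplier_const] assms(1) _ assms(2), where B=1]) simp

lemma borel_norm_ge: "{z :: complex. r \<le> cmod z} \<in> sets borel"
  by (intro borel_closed closed_Collect_le continuous_intros)

lemma borel_norm_le: "{z :: complex. cmod z \<le> r} \<in> sets borel"
  by (intro borel_closed closed_Collect_le continuous_intros)

context normal_op
begin

context
  fixes N :: nat and m :: "nat \<Rightarrow> real ^ 'd \<Rightarrow> complex"
  assumes m: "\<And>j. j < N \<Longrightarrow> multiplier (m j)"
    and distinct: "\<And>i j \<omega>. i < N \<Longrightarrow> j < N \<Longrightarrow> i \<noteq> j \<Longrightarrow> m i \<omega> \<noteq> m j \<omega>"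
begin

text \<open>The product \<open>q k\<close> of indicators restricts to the set where all \<open>m i\<close> differ from \<open>m j\<close> by at least
  \<open>1 / (k + 1)\<close>.  As the functions are pointwise distinct, \<open>q k\<close> tends to \<open>1\<close>, and the sum of the
  eigenspaces is closed.\<close>

lemma eig_sum_solve:
  assumes j: "j < N" and w: "w \<in> U" and v: "L w - mulL2 (m j) w \<in> eig_sum N m"
  shows "w \<in> eig_sum N m"
proof -
  define D where "D i \<omega> = m i \<omega> - m j \<omega>" for i \<omega>
  have Dm: "multiplier (D i)" if "i < N" for i
    unfolding D_def[abs_def] by (rule multiplier_diff[OF m[OF that] m[OF j]])
  have Dp: "periodic_borel (D i)" if "i < N" for i by (rule periodic_borel_multiplier[OF Dm[OF that]])
  define q where "q k \<omega> = (\<Prod>i\<in>{..<N} - {j}. if inverse (real (Suc k)) \<le> cmod (D i \<omega>) then 1 else 0 :: complex)" for k \<omega>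
  have qm: "multiplier (q k)" for k
    unfolding q_def[abs_def] by (intro multiplier_prod multiplier_indicator Dp borel_norm_ge) auto
  define h where "h k i \<omega> = q k \<omega> * (if inverse (real (Suc k)) \<le> cmod (D i \<omega>) then inverse (D i \<omega>) else 0)" for k i \<omega>
  have hm: "multiplier (h k i)" if i: "i < N" for k i
    unfolding h_def[abs_def]
  proof (intro multiplier_mult qm multiplier_restrict[OF _ Dp[OF i] _ borel_norm_ge])
    show "periodic_borel (\<lambda>\<omega>. inverse (D i \<omega>))"
      using Dp[OF i] by (auto simp: periodic_borel_def)
    fix \<omega> assume "inverse (real (Suc k)) \<le> cmod (D i \<omega>)"
    then show "cmod (inverse (D i \<omega>)) \<le> real (Suc k)"
      unfolding norm_inverse by (metis inverse_inverse_eq inverse_positive_iff_positive le_imp_inverse_le of_nat_0_less_iff zero_less_Suc)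
  qed
  have hD: "(m i \<omega> - m j \<omega>) * h k i \<omega> = q k \<omega>" if i: "i < N" "i \<noteq> j" for i k \<omega>
  proof (cases "inverse (real (Suc k)) \<le> cmod (D i \<omega>)")
    case True
    have "0 < inverse (real (Suc k))" by simp
    also note True
    finally have "D i \<omega> \<noteq> 0" by simp
    then show ?thesis using True by (simp add: h_def D_def)
  next
    case False
    then have "q k \<omega> = 0" unfolding q_def using i by (intro prod_zero) auto
    then show ?thesis by (simp add: h_def)
  qed
  have qq: "q k \<omega> * q k \<omega> = q k \<omega>" for k \<omega>
    unfolding q_def prod.distrib[symmetric] by (intro prod.cong) auto
  have pieces: "mulL2 (q k) w \<in> eig_sum N m" for k
  proof (rule eig_sum_solve_separated[where h="h k" and q="q k" and m=m and j=j and N=N])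
    show "mulL2 (q k) w \<in> U" by (rule U_mult[OF qm w])
    show "mulL2 (q k) (mulL2 (q k) w) = mulL2 (q k) w"
      by (simp add: mulL2_mulL2 multiplierD[OF qm] qq)
    have "L (mulL2 (q k) w) - mulL2 (m j) (mulL2 (q k) w) = mulL2 (q k) (L w - mulL2 (m j) w)"
      using qm[of k] m[OF j] by (simp add: commutes w mulL2_diff_right multiplierD mulL2_mulL2 mult.commute)
    then show "L (mulL2 (q k) w) - mulL2 (m j) (mulL2 (q k) w) \<in> eig_sum N m"
      using eig_sum_mult[OF m distinct qm v] by simp
    show "multiplier (q k)" by (rule qm)
  qed (use m distinct j hm hD in auto)
  have "(\<lambda>k. mulL2 (q k) w) \<longlonglongrightarrow> mulL2 (\<lambda>\<omega>. 1) w"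
  proof (rule mulL2_tendsto[where C=1])
    show "cmod (q k \<omega>) \<le> 1" for k \<omega>
      unfolding q_def prod_norm[symmetric] by (intro prod_le_1) auto
    show "(\<lambda>k. q k \<omega>) \<longlonglongrightarrow> 1" for \<omega>
    proof -
      have "(\<lambda>k. if inverse (real (Suc k)) \<le> cmod (D i \<omega>) then 1 else 0 :: complex) \<longlonglongrightarrow> 1"
        if i: "i \<in> {..<N} - {j}" for i
      proof -
        have "cmod (D i \<omega>) > 0" using i distinct[of i j \<omega>] j by (simp add: D_def)
        then obtain K where K: "inverse (real (Suc K)) < cmod (D i \<omega>)" using reals_Archimedean by blast
        have "\<forall>\<^sub>F k in sequentially. (if inverse (real (Suc k)) \<le> cmod (D i \<omega>) then 1 else 0 :: complex) = 1"
          using eventually_ge_at_top[of K]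
        proof eventually_elim
          case (elim k)
          have "inverse (real (Suc k)) \<le> inverse (real (Suc K))" using elim by (simp add: field_simps)
          then have "inverse (real (Suc k)) \<le> cmod (D i \<omega>)" using K by linarith
          then show ?case by (simp only: if_True)
        qed
        then show ?thesis by (rule tendsto_eventually)
      qed
      then have "(\<lambda>k. q k \<omega>) \<longlonglongrightarrow> (\<Prod>i\<in>{..<N} - {j}. 1)"
        unfolding q_def by (rule tendsto_prod)
      then show ?thesis by simp
    qed
  qed (use multiplierD[OF qm] bounded_borel_const in auto)
  from closed_sequentially[OF eig_sum_closed[OF m distinct] pieces this]
  show ?thesis by (simp add: mulL2_one)
qed

text \<open>The sets where \<open>r = m j\<close> partition the space, and on each of them \<open>r\<close> can be replaced by \<open>m j\<close>.\<close>

lemma eig_sum_step: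
  assumes r: "multiplier r" "\<And>\<omega>. \<exists>j<N. r \<omega> = m j \<omega>"
    and u: "u \<in> U" and v: "L u - mulL2 r u \<in> eig_sum N m"
  shows "u \<in> eig_sum N m"
proof -
  define g where "g j \<omega> = (if r \<omega> - m j \<omega> = 0 then 1 else 0 :: complex)" for j \<omega>
  have gm: "multiplier (g j)" if "j < N" for j
    unfolding g_def[abs_def]
    by (rule multiplier_indicator[where c="\<lambda>\<omega>. r \<omega> - m j \<omega>"])
       (auto intro: periodic_borel_multiplier multiplier_diff r m that)
  have piece: "mulL2 (g j) u \<in> eig_sum N m" if j: "j < N" for j
  proof (rule eig_sum_solve[OF j U_mult[OF gm[OF j] u]])
    have "(\<lambda>\<omega>. m j \<omega> * g j \<omega>) = (\<lambda>\<omega>. g j \<omega> * r \<omega>)"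
      by (auto simp: g_def fun_eq_iff)
    then have "mulL2 (m j) (mulL2 (g j) u) = mulL2 (g j) (mulL2 r u)"
      using gm[OF j] m[OF j] r(1) by (simp add: mulL2_mulL2 multiplierD)
    then have "L (mulL2 (g j) u) - mulL2 (m j) (mulL2 (g j) u) = mulL2 (g j) (L u - mulL2 r u)"
      using gm[OF j] by (simp add: commutes u mulL2_diff_right multiplierD)
    then show "L (mulL2 (g j) u) - mulL2 (m j) (mulL2 (g j) u) \<in> eig_sum N m"
      using eig_sum_mult[OF m distinct gm[OF j] v] by simp
  qed
  have "(\<Sum>j<N. g j \<omega>) = 1" for \<omega>
  proof -
    obtain j where j: "j < N" "r \<omega> = m j \<omega>" using r(2) by blast
    have "(\<Sum>i<N. g i \<omega>) = (\<Sum>i<N. if i = j then 1 else 0)"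
      by (intro sum.cong) (use j distinct in \<open>auto simp: g_def\<close>)
    then show ?thesis using j(1) by simp
  qed
  then have "u = mulL2 (\<lambda>\<omega>. \<Sum>j<N. g j \<omega>) u" by (simp add: mulL2_one)
  also have "\<dots> = (\<Sum>j<N. mulL2 (g j) u)"
    by (rule mulL2_sum_left) (auto intro: multiplierD gm)
  also have "\<dots> \<in> eig_sum N m"
    by (rule L2.subspace_sum[OF eig_sum_subspace[OF m distinct]]) (auto intro: piece)
  finally show ?thesis .
qed

end

subsection \<open>Coordinates\<close>

lemma norm_mulL2_indicator:
  assumes \<chi>: "multiplier (\<lambda>\<omega>. of_real (c \<omega>))" and c: "\<And>\<omega>. c \<omega> = 0 \<or> c \<omega> = 1"
  shows "integrable cube_measure (\<lambda>\<omega>. c \<omega> * Re (br v v \<omega>))"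
    and "(norm (mulL2 (\<lambda>\<omega>. of_real (c \<omega>)) v))\<^sup>2 = (\<integral>\<omega>. c \<omega> * Re (br v v \<omega>) \<partial>cube_measure)"
proof -
  let ?m = "\<lambda>\<omega>. complex_of_real (c \<omega>)"
  have ae: "AE \<omega> in cube_measure. br (mulL2 ?m v) (mulL2 ?m v) \<omega> = of_real (c \<omega> * Re (br v v \<omega>))"
  proof (rule AE_cube_of_AE, use br_mulL2_left[OF \<chi>, of v "mulL2 ?m v"] br_mulL2_left[OF \<chi>, of v v] in eventually_elim)
    fix \<omega>
    assume 1: "br (mulL2 ?m v) (mulL2 ?m v) \<omega> = ?m \<omega> * br v (mulL2 ?m v) \<omega>"
      and 2: "br (mulL2 ?m v) v \<omega> = ?m \<omega> * br v v \<omega>"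
    have "br v (mulL2 ?m v) \<omega> = ?m \<omega> * cnj (br v v \<omega>)"
      by (subst br_cnj) (simp add: 2)
    also have "cnj (br v v \<omega>) = of_real (Re (br v v \<omega>))"
      by (subst br_self_real(1)) simp
    finally show "br (mulL2 ?m v) (mulL2 ?m v) \<omega> = of_real (c \<omega> * Re (br v v \<omega>))"
      using 1 c[of \<omega>] by auto
  qed
  have cm: "(\<lambda>\<omega>. complex_of_real (c \<omega> * Re (br v v \<omega>))) \<in> borel_measurable cube_measure"
  proof -
    have [measurable]: "?m \<in> borel_measurable borel" by (rule multiplier_borel[OF \<chi>])
    have "(\<lambda>\<omega>. ?m \<omega> * of_real (Re (br v v \<omega>))) \<in> borel_measurable borel" by measurable
    then show ?thesis by simp
  qed
  have "integrable cube_measure (\<lambda>\<omega>. complex_of_real (c \<omega> * Re (br v v \<omega>)))"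
    using integrable_br[of "mulL2 ?m v" "mulL2 ?m v"] by (subst integrable_cong_AE[OF cm _ AE_symmetric[OF ae]]) auto
  then show "integrable cube_measure (\<lambda>\<omega>. c \<omega> * Re (br v v \<omega>))" by (simp only: complex_of_real_integrable_eq)
  have "complex_of_real ((norm (mulL2 ?m v))\<^sup>2) = (\<integral>\<omega>. br (mulL2 ?m v) (mulL2 ?m v) \<omega> \<partial>cube_measure)"
    unfolding cinner_self[symmetric] by (rule cinner_br)
  also have "\<dots> = (\<integral>\<omega>. complex_of_real (c \<omega> * Re (br v v \<omega>)) \<partial>cube_measure)"
    by (rule integral_cong_AE[OF _ cm ae]) simp
  also have "\<dots> = of_real (\<integral>\<omega>. c \<omega> * Re (br v v \<omega>) \<partial>cube_measure)" by (rule integral_complex_of_real)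
  finally show "(norm (mulL2 ?m v))\<^sup>2 = (\<integral>\<omega>. c \<omega> * Re (br v v \<omega>) \<partial>cube_measure)"
    by (simp only: of_real_eq_iff)
qed

text \<open>Otherwise the operator bound would fail on the part of \<open>u\<close>
  that lives on the offending periodic set.\<close>

lemma fibre_bounded:
  assumes K: "K \<ge> 0" "\<And>u. u \<in> U \<Longrightarrow> norm (L u) \<le> K * norm u" and u: "u \<in> U"
  shows "AE \<omega> in lborel. Re (br (L u) (L u) \<omega>) \<le> K\<^sup>2 * Re (br u u \<omega>)"
proof -
  define d where "d \<omega> = Re (br (L u) (L u) \<omega>) - K\<^sup>2 * Re (br u u \<omega>)" for \<omega>
  define c where "c \<omega> = (if d \<omega> > 0 then 1 else 0 :: real)" for \<omega>
  have d_per: "d (\<omega> + of_int_vec k) = d \<omega>" for \<omega> k by (simp add: d_def)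
  have [measurable]: "d \<in> borel_measurable borel" unfolding d_def[abs_def] by measurable
  have \<chi>: "multiplier (\<lambda>\<omega>. complex_of_real (c \<omega>))"
    unfolding multiplier_def
  proof (intro conjI allI)
    have "(\<lambda>\<omega>. complex_of_real (c \<omega>)) \<in> borel_measurable borel" unfolding c_def by measurable
    then show "bounded_borel (\<lambda>\<omega>. complex_of_real (c \<omega>))" by (rule bounded_borelI[where C=1]) (simp add: c_def)
  qed (simp add: c_def d_per)
  have c01: "c \<omega> = 0 \<or> c \<omega> = 1" for \<omega> by (simp add: c_def)
  note I = norm_mulL2_indicator[OF \<chi> c01]
  have "(norm (mulL2 (\<lambda>\<omega>. of_real (c \<omega>)) (L u)))\<^sup>2 \<le> (K * norm (mulL2 (\<lambda>\<omega>. of_real (c \<omega>)) u))\<^sup>2"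
    using K(2)[OF U_mult[OF \<chi> u]] by (intro power_mono) (simp_all add: commutes[OF \<chi> u])
  then have le: "(\<integral>\<omega>. c \<omega> * Re (br (L u) (L u) \<omega>) \<partial>cube_measure) \<le> K\<^sup>2 * (\<integral>\<omega>. c \<omega> * Re (br u u \<omega>) \<partial>cube_measure)"
    by (simp add: power_mult_distrib I(2))
  have eq: "c \<omega> * d \<omega> = c \<omega> * Re (br (L u) (L u) \<omega>) - K\<^sup>2 * (c \<omega> * Re (br u u \<omega>))" for \<omega>
    by (simp add: d_def algebra_simps)
  have int: "integrable cube_measure (\<lambda>\<omega>. c \<omega> * d \<omega>)"
    unfolding eq by (intro Bochner_Integration.integrable_diff integrable_mult_right I(1))
  have "(\<integral>\<omega>. c \<omega> * d \<omega> \<partial>cube_measure) \<le> 0"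
    unfolding eq using le by (subst Bochner_Integration.integral_diff) (auto intro: I(1))
  have nn: "0 \<le> c \<omega> * d \<omega>" for \<omega> by (simp add: c_def)
  have "0 \<le> (\<integral>\<omega>. c \<omega> * d \<omega> \<partial>cube_measure)"
    by (rule Bochner_Integration.integral_nonneg) (rule nn)
  with \<open>(\<integral>\<omega>. c \<omega> * d \<omega> \<partial>cube_measure) \<le> 0\<close>
  have "(\<integral>\<omega>. c \<omega> * d \<omega> \<partial>cube_measure) = 0" by (rule antisym)
  then have "AE \<omega> in cube_measure. c \<omega> * d \<omega> = 0"
    using integral_nonneg_eq_0_iff_AE[OF int] nn by auto
  then have "AE \<omega> in cube_measure. d \<omega> \<le> 0"
    by eventually_elim (auto simp: c_def split: if_splits)
  then have "AE \<omega> in lborel. d (frac_vec \<omega>) \<le> 0" by (rule AE_frac_of_cube)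
  then show ?thesis
  proof eventually_elim
    case (elim \<omega>)
    have "d (frac_vec \<omega>) = d \<omega>" using d_per[of "frac_vec \<omega>" "floor_vec \<omega>"] by (simp add: frac_plus_floor)
    then show ?case using elim by (simp add: d_def)
  qed
qed

context
  fixes n :: nat and e :: "nat \<Rightarrow> (real ^ 'd) L2" and K :: real
  assumes ortho: "fibre_orthonormal n e" and eU: "\<And>i. i < n \<Longrightarrow> e i \<in> U"
    and expand: "\<And>u. u \<in> U \<Longrightarrow> fibre_expansion n e u = u"
    and K: "K \<ge> 0" "\<And>u. u \<in> U \<Longrightarrow> norm (L u) \<le> K * norm u"
begin

text \<open>The cut-off at \<open>K\<close> makes the entries bounded everywhere.  By \<open>fibre_bounded\<close> it changes them on a
  null set only.\<close>

definition op_mat :: "real ^ 'd \<Rightarrow> nat \<Rightarrow> nat \<Rightarrow> complex" where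
  "op_mat \<omega> i j = (if cmod (br (L (e j)) (e i) \<omega>) \<le> K then br (L (e j)) (e i) \<omega> else 0)"

definition represents :: "(nat \<Rightarrow> real ^ 'd \<Rightarrow> complex) \<Rightarrow> (real ^ 'd) L2 \<Rightarrow> bool" where
  "represents c u \<longleftrightarrow> (\<forall>i<n. periodic_borel (c i)) \<and>
    (AE \<omega> in lborel. rep_L2 u \<omega> = (\<Sum>i<n. c i \<omega> * rep_L2 (e i) \<omega>))"

lemma op_mat_multiplier: "multiplier (\<lambda>\<omega>. op_mat \<omega> i j)"
  unfolding op_mat_def by (rule multiplier_truncate[OF periodic_borel_br])

lemma op_mat_bound: "cmod (op_mat \<omega> i j) \<le> K"
  using K(1) by (simp add: op_mat_def)

lemma represents_br: "u \<in> U \<Longrightarrow> represents (\<lambda>i. br u (e i)) u"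
  using rep_fibre_expansion[OF ortho, of u] expand[of u] by (simp add: represents_def periodic_borel_br)

lemma rep_L_basis:
  assumes j: "j < n"
  shows "AE \<omega> in lborel. rep_L2 (L (e j)) \<omega> = (\<Sum>i<n. op_mat \<omega> i j * rep_L2 (e i) \<omega>)"
proof -
  have entry: "AE \<omega> in lborel. op_mat \<omega> i j = br (L (e j)) (e i) \<omega>" if i: "i < n" for i
  proof -
    have norms: "normalised (e i)" "normalised (e j)" using ortho i j by (auto simp: fibre_orthonormal_def)
    have "AE \<omega> in lborel. Re (br (L (e j)) (L (e j)) \<omega>) \<le> K\<^sup>2 * Re (br (e j) (e j) \<omega>)"
      by (rule fibre_bounded[OF K(1) _ eU[OF j]]) (rule K(2))
    with br_Cauchy_Schwarz[of "L (e j)" "e i"] show ?thesis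
      using
        norms(1)[unfolded normalised_def] norms(2)[unfolded normalised_def]
    proof eventually_elim
      case (elim \<omega>)
      have 1: "0 \<le> Re (br (e i) (e i) \<omega>)" "Re (br (e i) (e i) \<omega>) \<le> 1" using elim(3) by auto
      have "K\<^sup>2 * Re (br (e j) (e j) \<omega>) \<le> K\<^sup>2 * 1"
        using elim(4) by (intro mult_left_mono) auto
      with elim(2) have 2: "Re (br (L (e j)) (L (e j)) \<omega>) \<le> K\<^sup>2" by simp
      have "(cmod (br (L (e j)) (e i) \<omega>))\<^sup>2 \<le> K\<^sup>2 * 1"
        by (rule order_trans[OF elim(1)]) (intro mult_mono 1 2, auto)
      then have "cmod (br (L (e j)) (e i) \<omega>) \<le> K" using K(1) by (simp add: power2_le_iff_abs_le)
      then show ?case by (simp add: op_mat_def)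
    qed
  qed
  have "AE \<omega> in lborel. \<forall>i\<in>{..<n}. op_mat \<omega> i j = br (L (e j)) (e i) \<omega>"
    using entry by (subst AE_ball_countable) auto
  then show ?thesis
    using represents_br[OF L_in[OF eU[OF j]], unfolded represents_def, THEN conjunct2]
    by eventually_elim simp
qed

text \<open>The coefficients may be unbounded; they are cut off, and the cut-off tends to infinity.\<close>

lemma rep_L:
  assumes u: "u \<in> U" and c: "represents c u"
  shows "AE \<omega> in lborel. rep_L2 (L u) \<omega> = (\<Sum>j<n. c j \<omega> * rep_L2 (L (e j)) \<omega>)"
proof -
  have cp: "periodic_borel (c j)" if "j < n" for j using c that by (simp add: represents_def)
  have cu: "AE \<omega> in lborel. rep_L2 u \<omega> = (\<Sum>i<n. c i \<omega> * rep_L2 (e i) \<omega>)"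
    using c by (simp add: represents_def)
  define x where "x k \<omega> = (\<Prod>j<n. if cmod (c j \<omega>) \<le> real k then 1 else 0 :: complex)" for k :: nat and \<omega>
  define y where "y k j \<omega> = x k \<omega> * (if cmod (c j \<omega>) \<le> real k then c j \<omega> else 0)" for k :: nat and j \<omega>
  have xm: "multiplier (x k)" for k
    unfolding x_def[abs_def] by (intro multiplier_prod multiplier_indicator cp borel_norm_le) auto
  have ym: "multiplier (y k j)" if "j < n" for k j
    unfolding y_def[abs_def] by (intro multiplier_mult xm multiplier_truncate cp that)
  have y: "y k j \<omega> = x k \<omega> * c j \<omega>" if "j < n" for k j \<omega>
  proof (cases "cmod (c j \<omega>) \<le> real k")
    case False
    then have "x k \<omega> = 0" unfolding x_def using that by (intro prod_zero) auto
    then show ?thesis by (simp add: y_def)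
  qed (simp add: y_def)
  have step: "AE \<omega> in lborel. x k \<omega> * rep_L2 (L u) \<omega> = (\<Sum>j<n. x k \<omega> * c j \<omega> * rep_L2 (L (e j)) \<omega>)" for k
  proof -
    have sums: "AE \<omega> in lborel. rep_L2 (\<Sum>j<n. mulL2 (y k j) (f j)) \<omega> = (\<Sum>j<n. x k \<omega> * c j \<omega> * rep_L2 (f j) \<omega>)" for f
    proof -
      have "AE \<omega> in lborel. \<forall>j\<in>{..<n}. rep_L2 (mulL2 (y k j) (f j)) \<omega> = y k j \<omega> * rep_L2 (f j) \<omega>"
        by (subst AE_ball_countable) (auto intro: rep_mulL2 multiplierD ym)
      moreover have "AE \<omega> in lborel. rep_L2 (\<Sum>j<n. mulL2 (y k j) (f j)) \<omega> = (\<Sum>j<n. rep_L2 (mulL2 (y k j) (f j)) \<omega>)"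
        by (rule rep_sum) simp
      ultimately show ?thesis by eventually_elim (simp add: y)
    qed
    have "mulL2 (x k) u = (\<Sum>j<n. mulL2 (y k j) (e j))"
      by (rule mulL2_eqI[OF multiplierD[OF xm]], use cu sums[of e] in eventually_elim)
         (simp add: sum_distrib_left mult.assoc)
    then have "L (mulL2 (x k) u) = L (\<Sum>j<n. mulL2 (y k j) (e j))" by simp
    also have "\<dots> = (\<Sum>j<n. L (mulL2 (y k j) (e j)))"
      by (rule L_sum) (auto intro: U_mult ym eU)
    also have "\<dots> = (\<Sum>j<n. mulL2 (y k j) (L (e j)))"
      by (intro sum.cong) (auto intro: commutes ym eU)
    finally have eqL: "mulL2 (x k) (L u) = (\<Sum>j<n. mulL2 (y k j) (L (e j)))"
      by (simp add: commutes[OF xm u])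
    show ?thesis
      using sums[of "\<lambda>j. L (e j)"] rep_mulL2[OF multiplierD[OF xm[of k]], of "L u", unfolded eqL]
      by eventually_elim simp
  qed
  have "AE \<omega> in lborel. \<forall>k. x k \<omega> * rep_L2 (L u) \<omega> = (\<Sum>j<n. x k \<omega> * c j \<omega> * rep_L2 (L (e j)) \<omega>)"
    unfolding AE_all_countable using step by blast
  then show ?thesis
  proof eventually_elim
    case (elim \<omega>)
    obtain k where k: "(\<Sum>j<n. cmod (c j \<omega>)) \<le> real k" using real_arch_simple by blast
    have "cmod (c j \<omega>) \<le> real k" if "j < n" for j
      using member_le_sum[of j "{..<n}" "\<lambda>j. cmod (c j \<omega>)"] that k by auto
    then have "x k \<omega> = 1" unfolding x_def by (intro prod.neutral) auto
    then show ?case using elim[rule_format, of k] by simp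
  qed
qed

text \<open>In coordinates, \<open>L - r\<close> acts on each fibre by the matrix of \<open>L\<close> minus the scalar \<open>r \<omega>\<close>.\<close>

lemma represents_step:
  assumes u: "u \<in> U" and c: "represents c u" and r: "multiplier r"
  shows "represents (\<lambda>i \<omega>. shifted_apply n (op_mat \<omega>) (r \<omega>) (\<lambda>j. c j \<omega>) i) (L u - mulL2 r u)"
  unfolding represents_def
proof (intro conjI allI impI)
  have cp: "periodic_borel (c j)" if "j < n" for j using c that by (simp add: represents_def)
  fix i assume i: "i < n"
  have op: "periodic_borel (\<lambda>\<omega>. op_mat \<omega> i j)" for j
    by (rule periodic_borel_multiplier[OF op_mat_multiplier])
  have rp: "periodic_borel r" by (rule periodic_borel_multiplier[OF r])
  show "periodic_borel (\<lambda>\<omega>. shifted_apply n (op_mat \<omega>) (r \<omega>) (\<lambda>j. c j \<omega>) i)"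
    unfolding periodic_borel_def shifted_apply_def
  proof (intro conjI allI)
    show "(\<lambda>\<omega>. (\<Sum>j<n. op_mat \<omega> i j * c j \<omega>) - r \<omega> * c i \<omega>) \<in> borel_measurable borel"
      using op cp rp i unfolding periodic_borel_def
      by (intro borel_measurable_diff borel_measurable_sum borel_measurable_times) auto
    fix \<omega> and k :: "int ^ 'd"
    show "(\<Sum>j<n. op_mat (\<omega> + of_int_vec k) i j * c j (\<omega> + of_int_vec k)) - r (\<omega> + of_int_vec k) * c i (\<omega> + of_int_vec k)
       = (\<Sum>j<n. op_mat \<omega> i j * c j \<omega>) - r \<omega> * c i \<omega>"
      by (simp add: periodic_borel_shift[OF op] periodic_borel_shift[OF cp] periodic_borel_shift[OF rp] i)
  qed
next
  have "AE \<omega> in lborel. \<forall>j\<in>{..<n}. rep_L2 (L (e j)) \<omega> = (\<Sum>i<n. op_mat \<omega> i j * rep_L2 (e i) \<omega>)"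
    using rep_L_basis by (subst AE_ball_countable) auto
  moreover have "AE \<omega> in lborel. rep_L2 u \<omega> = (\<Sum>i<n. c i \<omega> * rep_L2 (e i) \<omega>)"
    using c by (simp add: represents_def)
  moreover note rep_L[OF u c] rep_mulL2[OF multiplierD[OF r], of u] rep_diff[of "L u" "mulL2 r u"]
  ultimately show "AE \<omega> in lborel. rep_L2 (L u - mulL2 r u) \<omega>
      = (\<Sum>i<n. shifted_apply n (op_mat \<omega>) (r \<omega>) (\<lambda>j. c j \<omega>) i * rep_L2 (e i) \<omega>)"
  proof eventually_elim
    case (elim \<omega>)
    have "(\<Sum>j<n. c j \<omega> * rep_L2 (L (e j)) \<omega>) = (\<Sum>j<n. \<Sum>i<n. op_mat \<omega> i j * c j \<omega> * rep_L2 (e i) \<omega>)"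
      using elim(1) by (intro sum.cong) (auto simp: sum_distrib_left mult_ac)
    also have "\<dots> = (\<Sum>i<n. \<Sum>j<n. op_mat \<omega> i j * c j \<omega> * rep_L2 (e i) \<omega>)" by (rule sum.swap)
    finally show ?case
      using elim by (simp add: shifted_apply_def left_diff_distrib sum_subtractf sum_distrib_right sum_distrib_left mult.assoc)
  qed
qed

lemma fold_in_U:
  "(\<And>i. i \<in> set is \<Longrightarrow> multiplier (R i)) \<Longrightarrow> u \<in> U \<Longrightarrow> foldr (\<lambda>i v. L v - mulL2 (R i) v) is u \<in> U"
  by (induction "is") (auto intro!: U_diff L_in U_mult)

lemma represents_fold:
  assumes "\<And>i. i \<in> set is \<Longrightarrow> multiplier (R i)" and u: "u \<in> U" and c: "represents c u"
  shows "represents (\<lambda>i \<omega>. foldr (shifted_apply n (op_mat \<omega>)) (map (\<lambda>i. R i \<omega>) is) (\<lambda>j. c j \<omega>) i)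
    (foldr (\<lambda>i v. L v - mulL2 (R i) v) is u)"
  using assms(1)
proof (induction "is")
  case Nil
  then show ?case using c by simp
next
  case (Cons a "is")
  have ih: "represents (\<lambda>i \<omega>. foldr (shifted_apply n (op_mat \<omega>)) (map (\<lambda>i. R i \<omega>) is) (\<lambda>j. c j \<omega>) i)
    (foldr (\<lambda>i v. L v - mulL2 (R i) v) is u)"
    by (rule Cons.IH) (simp add: Cons.prems)
  have "foldr (\<lambda>i v. L v - mulL2 (R i) v) is u \<in> U"
    by (rule fold_in_U[OF _ u]) (simp add: Cons.prems)
  from represents_step[OF this ih Cons.prems[of a]] show ?case by simp
qed

text \<open>The roots are chosen measurably on the cube and extended periodically; the Cayley--Hamilton theorem
  in every fibre makes all coordinates of the product vanish.\<close>

lemma eigenvalue_functions: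
  obtains R where "\<And>i. i < n \<Longrightarrow> multiplier (R i)" "\<And>i \<omega>. i < n \<Longrightarrow> cmod (R i \<omega>) \<le> real n * K"
    "\<And>u. u \<in> U \<Longrightarrow> foldr (\<lambda>i v. L v - mulL2 (R i) v) [0..<n] u = 0"
proof -
  define p where "p \<omega> = cpoly n (op_mat \<omega>)" for \<omega>
  have mp: "meas_poly borel p"
    unfolding p_def[abs_def] by (intro meas_poly_cpoly multiplier_borel op_mat_multiplier)
  have deg: "degree (p \<omega>) = n" "coeff (p \<omega>) n = 1" for \<omega>
    unfolding p_def by (rule degree_cpoly)+
  obtain r where r: "\<And>i. i < n \<Longrightarrow> r i \<in> borel_measurable borel"
    "\<And>\<omega>. p \<omega> = (\<Prod>i\<leftarrow>[0..<n]. [:- r i \<omega>, 1:])"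
    using measurable_roots[OF mp deg] by blast
  have bound: "cmod (r i \<omega>) \<le> real n * K" if i: "i < n" for i \<omega>
  proof (rule cpoly_root_bound[where A="op_mat \<omega>"])
    have "poly (p \<omega>) (r i \<omega>) = 0"
      unfolding r(2) poly_prod_list prod_list_zero_iff using i by (auto simp: image_iff intro!: bexI[of _ i])
    then show "poly (cpoly n (op_mat \<omega>)) (r i \<omega>) = 0" by (simp add: p_def)
  qed (rule op_mat_bound)
  define R where "R i \<omega> = r i (frac_vec \<omega>)" for i \<omega>
  have Rm: "multiplier (R i)" if "i < n" for i
    unfolding R_def[abs_def] by (rule multiplier_compose_frac[OF r(1)[OF that] bound[OF that]])
  have "foldr (\<lambda>i v. L v - mulL2 (R i) v) [0..<n] u = 0" if u: "u \<in> U" for u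
  proof -
    have "op_mat (frac_vec \<omega>) = op_mat \<omega>" for \<omega>
      using multiplier_frac[OF op_mat_multiplier] by (intro ext)
    then have fac: "cpoly n (op_mat \<omega>) = (\<Prod>e\<leftarrow>map (\<lambda>i. R i \<omega>) [0..<n]. [:- e, 1:])" for \<omega>
      using r(2)[of "frac_vec \<omega>"] by (simp add: p_def R_def comp_def)
    have "represents (\<lambda>i \<omega>. foldr (shifted_apply n (op_mat \<omega>)) (map (\<lambda>i. R i \<omega>) [0..<n]) (\<lambda>j. br u (e j) \<omega>) i)
      (foldr (\<lambda>i v. L v - mulL2 (R i) v) [0..<n] u)"
      by (rule represents_fold[OF _ u represents_br[OF u]]) (simp add: Rm)
    then have ae: "AE \<omega> in lborel. rep_L2 (foldr (\<lambda>i v. L v - mulL2 (R i) v) [0..<n] u) \<omega> = 0"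
      unfolding represents_def using Cayley_Hamilton_factored[OF fac] by simp
    show ?thesis
      by (rule L2_eqI, use rep_zero ae in eventually_elim) simp
  qed
  with Rm bound show ?thesis using that[of R] by (simp add: R_def)
qed

text \<open>Repeated values are replaced by distinct constants outside the range of the eigenvalues, so
  that the functions become pointwise distinct while every old value is still attained.\<close>

lemma distinct_eigenvalue_functions:
  obtains m where "\<And>j. j < n \<Longrightarrow> multiplier (m j)"
    "\<And>i j \<omega>. i < n \<Longrightarrow> j < n \<Longrightarrow> i \<noteq> j \<Longrightarrow> m i \<omega> \<noteq> m j \<omega>" "U \<subseteq> eig_sum n m"
proof -
  obtain R where R: "\<And>i. i < n \<Longrightarrow> multiplier (R i)" "\<And>i \<omega>. i < n \<Longrightarrow> cmod (R i \<omega>) \<le> real n * K"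
    "\<And>u. u \<in> U \<Longrightarrow> foldr (\<lambda>i v. L v - mulL2 (R i) v) [0..<n] u = 0"
    using eigenvalue_functions by blast
  \<comment> \<open>all eigenvalue functions are bounded by \<open>real n * K\<close>, so the constants \<open>C + j\<close> are never attained\<close>
  define C where "C = real n * K + 1"
  have C: "C > 0" using K(1) by (simp add: C_def add_nonneg_pos)
  define m where "m j \<omega> = (if \<exists>i<j. R i \<omega> = R j \<omega> then complex_of_real (C + real j) else R j \<omega>)" for j \<omega>
  have m_rep: "m j \<omega> = complex_of_real (C + real j)" if "\<exists>i<j. R i \<omega> = R j \<omega>" for j \<omega>
    unfolding m_def using that by (rule if_P)
  have m_new: "m j \<omega> = R j \<omega>" if "\<not> (\<exists>i<j. R i \<omega> = R j \<omega>)" for j \<omega>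
    unfolding m_def using that by (rule if_not_P)
  have mm: "multiplier (m j)" if j: "j < n" for j
    unfolding multiplier_def
  proof (intro conjI allI)
    have "{\<omega>\<in>space borel. \<exists>i<j. R i \<omega> = R j \<omega>} = (\<Union>i\<in>{..<j}. {\<omega>. R i \<omega> = R j \<omega>})" by auto
    also have "\<dots> \<in> sets borel"
    proof (intro sets.finite_UN)
      fix i assume "i \<in> {..<j}"
      then have i: "i < n" using j by simp
      have [measurable]: "R i \<in> borel_measurable borel" "R j \<in> borel_measurable borel"
        using R(1)[OF i] R(1)[OF j] by (auto intro: multiplier_borel)
      have "{\<omega>\<in>space borel. R i \<omega> = R j \<omega>} \<in> sets borel" by measurable
      then show "{\<omega>. R i \<omega> = R j \<omega>} \<in> sets borel" by simp
    qed simp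
    finally have S: "{\<omega>\<in>space borel. \<exists>i<j. R i \<omega> = R j \<omega>} \<in> sets borel" .
    show "bounded_borel (m j)"
    proof (rule bounded_borelI[where C="C + real j"])
      show "m j \<in> borel_measurable borel"
        unfolding m_def[abs_def]
      proof (rule measurable_If)
        show "R j \<in> borel_measurable borel" by (rule multiplier_borel[OF R(1)[OF j]])
        show "{\<omega> \<in> space borel. \<exists>i<j. R i \<omega> = R j \<omega>} \<in> sets borel" by (rule S)
      qed (rule borel_measurable_const)
      show "cmod (m j \<omega>) \<le> C + real j" for \<omega>
      proof (cases "\<exists>i<j. R i \<omega> = R j \<omega>")
        case True
        then have "m j \<omega> = complex_of_real (C + real j)" by (rule m_rep)
        then show ?thesis using C by (simp only: norm_of_real)
      next
        case False
        then have "m j \<omega> = R j \<omega>" by (rule m_new)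
        then show ?thesis using R(2)[OF j, of \<omega>] C by (simp add: C_def)
      qed
    qed
    show "m j (\<omega> + of_int_vec k) = m j \<omega>" for \<omega> k
    proof -
      have "R i (\<omega> + of_int_vec k) = R i \<omega>" if "i < n" for i by (rule multiplier_periodic[OF R(1)[OF that]])
      then have iff: "(\<exists>i<j. R i (\<omega> + of_int_vec k) = R j (\<omega> + of_int_vec k)) \<longleftrightarrow> (\<exists>i<j. R i \<omega> = R j \<omega>)"
        using j by (intro ex_cong1 conj_cong refl) simp
      show ?thesis
      proof (cases "\<exists>i<j. R i \<omega> = R j \<omega>")
        case True
        have "m j (\<omega> + of_int_vec k) = complex_of_real (C + real j)"
          by (rule m_rep) (rule iffD2[OF iff True])
        then show ?thesis by (simp only: m_rep[OF True])
      next
        case False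
        have "m j (\<omega> + of_int_vec k) = R j (\<omega> + of_int_vec k)"
          by (rule m_new) (use iff False in blast)
        then show ?thesis by (simp only: m_new[OF False] multiplier_periodic[OF R(1)[OF j]])
      qed
    qed
  qed
  have far: "complex_of_real (C + real k) \<noteq> R i \<omega>" if "i < n" for i k \<omega>
  proof
    assume eq: "complex_of_real (C + real k) = R i \<omega>"
    have "cmod (complex_of_real (C + real k)) = \<bar>C + real k\<bar>" by (rule norm_of_real)
    then have "C + real k = cmod (complex_of_real (C + real k))" using C by linarith
    also have "\<dots> \<le> real n * K" unfolding eq by (rule R(2)[OF that])
    finally show False by (simp add: C_def)
  qed
  have distinct: "m i \<omega> \<noteq> m j \<omega>" if "i < j" "j < n" for i j \<omega>
  proof -
    have i: "i < n" using that by simp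
    show ?thesis
    proof (cases "\<exists>k<i. R k \<omega> = R i \<omega>")
      case True
      then have "m i \<omega> = complex_of_real (C + real i)" by (rule m_rep)
      moreover have "m j \<omega> = complex_of_real (C + real j) \<or> m j \<omega> = R j \<omega>"
        using m_rep m_new by blast
      ultimately show ?thesis using far[OF that(2), of i \<omega>] that(1) by auto
    next
      case False
      then have mi: "m i \<omega> = R i \<omega>" by (rule m_new)
      show ?thesis
      proof (cases "\<exists>k<j. R k \<omega> = R j \<omega>")
        case True
        then have "m j \<omega> = complex_of_real (C + real j)" by (rule m_rep)
        then show ?thesis using far[OF i, of j \<omega>] mi by auto
      next
        case False
        then have "m j \<omega> = R j \<omega>" by (rule m_new)
        then show ?thesis using False that(1) mi by auto
      qed
    qed
  qed
  then have distinct': "m i \<omega> \<noteq> m j \<omega>" if "i < n" "j < n" "i \<noteq> j" for i j \<omega>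
    using that by (metis linorder_neqE_nat)
  have attained: "\<exists>j<n. R i \<omega> = m j \<omega>" if "i < n" for i \<omega>
  proof -
    \<comment> \<open>the first index with the same value keeps that value\<close>
    define j where "j = (LEAST j. R j \<omega> = R i \<omega>)"
    have j: "R j \<omega> = R i \<omega>" unfolding j_def by (rule LeastI[of "\<lambda>j. R j \<omega> = R i \<omega>" i]) simp
    have "j \<le> i" unfolding j_def by (rule Least_le) simp
    moreover have "\<not> (\<exists>k<j. R k \<omega> = R j \<omega>)"
    proof
      assume "\<exists>k<j. R k \<omega> = R j \<omega>"
      then obtain k where k: "k < j" "R k \<omega> = R i \<omega>" unfolding j by blast
      from not_less_Least[OF k(1)[unfolded j_def]] k(2) show False by (rule notE)
    qed
    then have "m j \<omega> = R j \<omega>" by (rule m_new)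
    ultimately show ?thesis using that j by (intro exI[of _ j]) auto
  qed
  have solve_list: "u \<in> eig_sum n m"
    if "set js \<subseteq> {..<n}" "u \<in> U" "foldr (\<lambda>i v. L v - mulL2 (R i) v) js u \<in> eig_sum n m" for js u
    using that
  proof (induction js)
    case Nil
    then show ?case by simp
  next
    case (Cons a js)
    have a: "a < n" using Cons.prems(1) by simp
    have inU: "foldr (\<lambda>i v. L v - mulL2 (R i) v) js u \<in> U"
      by (rule fold_in_U[OF R(1) Cons.prems(2)]) (use Cons.prems(1) in auto)
    have last: "L (foldr (\<lambda>i v. L v - mulL2 (R i) v) js u) - mulL2 (R a) (foldr (\<lambda>i v. L v - mulL2 (R i) v) js u)
        \<in> eig_sum n m"
      using Cons.prems(3) by simp
    have solved: "foldr (\<lambda>i v. L v - mulL2 (R i) v) js u \<in> eig_sum n m"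
      by (rule eig_sum_step[OF mm distinct' R(1)[OF a] attained[OF a] inU last])
    from Cons.IH[OF _ Cons.prems(2) solved] Cons.prems(1) show ?case by simp
  qed
  have "U \<subseteq> eig_sum n m"
  proof
    fix u assume u: "u \<in> U"
    show "u \<in> eig_sum n m"
    proof (rule solve_list[OF _ u])
      show "foldr (\<lambda>i v. L v - mulL2 (R i) v) [0..<n] u \<in> eig_sum n m"
        unfolding R(3)[OF u] by (rule L2.subspace_0[OF eig_sum_subspace[OF mm distinct']])
    qed auto
  qed
  with mm distinct' show ?thesis using that by blast
qed

end

end

section \<open>Transfer to shift-preserving operators\<close>

text \<open>The operator on the Fourier image that corresponds to \<open>L\<close>.\<close>

definition fourier_op :: "(real ^ 'd) L2 set \<Rightarrow> ((real ^ 'd) L2 \<Rightarrow> (real ^ 'd) L2) \<Rightarrow> (real ^ 'd) L2 \<Rightarrow> (real ^ 'd) L2" where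
  "fourier_op V L u = fourier (L (the_inv_into V fourier u))"

lemma fourier_op_fourier: "f \<in> V \<Longrightarrow> fourier_op V L (fourier f) = fourier (L f)"
  unfolding fourier_op_def by (subst the_inv_into_f_f) (auto simp: inj_on_def fourier_inject)

lemma closed_fourier_image:
  assumes V: "closed V" shows "closed (fourier ` V)"
proof (rule closed_sequential_limits[THEN iffD2], intro allI impI, elim conjE)
  fix x l assume x: "\<forall>n. x n \<in> fourier ` V" and l: "x \<longlonglongrightarrow> l"
  then have "\<forall>n. \<exists>v. v \<in> V \<and> x n = fourier v" by blast
  then obtain v where v: "\<And>n. v n \<in> V" "\<And>n. x n = fourier (v n)" by metis
  have "Cauchy x" using l LIMSEQ_imp_Cauchy by blast
  moreover have "dist (x i) (x j) = dist (v i) (v j)" for i j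
    by (simp add: dist_norm v(2) norm_fourier flip: fourier_diff)
  ultimately have "Cauchy v" by (simp add: Cauchy_def)
  then obtain y where y: "v \<longlonglongrightarrow> y" by (auto simp: Cauchy_convergent_iff convergent_def)
  have "y \<in> V" by (rule closed_sequentially[OF V v(1) y])
  moreover have "x \<longlonglongrightarrow> fourier y" using fourier_tendsto[OF y] by (simp only: v(2)[symmetric])
  then have "l = fourier y" by (rule LIMSEQ_unique[OF l])
  ultimately show "l \<in> fourier ` V" by blast
qed

lemma mult_module_fourier_image:
  assumes "shift_invariant V" shows "mult_module (fourier ` V)"
  unfolding mult_module_def
proof (intro conjI allI ballI)
  have V: "L2.subspace V" "closed V" "\<And>f k. f \<in> V \<Longrightarrow> Defs.shift k f \<in> V"
    using assms by (auto simp: shift_invariant_def)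
  show "closed (fourier ` V)" by (rule closed_fourier_image[OF V(2)])
  show "L2.subspace (fourier ` V)"
    unfolding L2.subspace_def
  proof (intro conjI ballI allI)
    show "0 \<in> fourier ` V" using L2.subspace_0[OF V(1)] by (metis fourier_0 imageI)
    show "u + v \<in> fourier ` V" if "u \<in> fourier ` V" "v \<in> fourier ` V" for u v
      using that L2.subspace_add[OF V(1)] by (auto simp flip: fourier_add)
    show "c *\<^sub>C u \<in> fourier ` V" if "u \<in> fourier ` V" for c u
      using that L2.subspace_scale[OF V(1)] by (auto simp flip: fourier_scaleC)
  qed
  show "mulL2 (lattice_char k) u \<in> fourier ` V" if "u \<in> fourier ` V" for k u
    using that V(3) by (auto simp flip: fourier_shift)
qed

lemma bounded_operator_fourier_op:
  assumes V: "L2.subspace V" and L: "bounded_operator_on V L"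
  shows "bounded_operator_on (fourier ` V) (fourier_op V L)"
proof -
  note add = L2.subspace_add[OF V] and scale = L2.subspace_scale[OF V]
  obtain K where K: "\<forall>f\<in>V. norm (L f) \<le> K * norm f" using L by (auto simp: bounded_operator_on_def)
  have L': "\<And>f. f \<in> V \<Longrightarrow> L f \<in> V" "\<And>f g. f \<in> V \<Longrightarrow> g \<in> V \<Longrightarrow> L (f + g) = L f + L g"
    "\<And>c f. f \<in> V \<Longrightarrow> L (c *\<^sub>C f) = c *\<^sub>C L f"
    using L by (auto simp: bounded_operator_on_def)
  show ?thesis
    unfolding bounded_operator_on_def
  proof (intro conjI ballI allI)
    show "fourier_op V L u \<in> fourier ` V" if "u \<in> fourier ` V" for u
      using that L'(1) by (auto simp: fourier_op_fourier)
    show "fourier_op V L (u + v) = fourier_op V L u + fourier_op V L v"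
      if "u \<in> fourier ` V" "v \<in> fourier ` V" for u v
      using that by (auto simp: fourier_op_fourier add L'(2) simp flip: fourier_add)
    show "fourier_op V L (c *\<^sub>C u) = c *\<^sub>C fourier_op V L u" if "u \<in> fourier ` V" for c u
      using that by (auto simp: fourier_op_fourier scale L'(3) simp flip: fourier_scaleC)
    show "\<exists>K. \<forall>u\<in>fourier ` V. norm (fourier_op V L u) \<le> K * norm u"
      using K by (intro exI[of _ K]) (auto simp: fourier_op_fourier norm_fourier)
  qed
qed

lemma normal_op_fourier:
  assumes V: "shift_invariant V" and L: "shift_preserving V L" and N: "normal_on V L"
  obtains M where "normal_op (fourier ` V) (fourier_op V L) M"
proof -
  have sub: "L2.subspace V" and sh: "\<And>f k. f \<in> V \<Longrightarrow> Defs.shift k f \<in> V"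
    using V by (auto simp: shift_invariant_def)
  have Lb: "bounded_operator_on V L" and Ls: "\<And>f k. f \<in> V \<Longrightarrow> L (Defs.shift k f) = Defs.shift k (L f)"
    using L by (auto simp: shift_preserving_def)
  obtain M where M: "is_adjoint_on V L M" "\<And>f. f \<in> V \<Longrightarrow> L (M f) = M (L f)"
    using N by (auto simp: normal_on_def)
  have Mb: "bounded_operator_on V M" using M(1) by (simp add: is_adjoint_on_def)
  have LV: "L f \<in> V" "M f \<in> V" if "f \<in> V" for f using Lb Mb that by (auto simp: bounded_operator_on_def)
  have "normal_op (fourier ` V) (fourier_op V L) (fourier_op V M)"
  proof
    show "mult_module (fourier ` V)" by (rule mult_module_fourier_image[OF V])
    show "bounded_operator_on (fourier ` V) (fourier_op V L)" by (rule bounded_operator_fourier_op[OF sub Lb])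
    show "fourier_op V L (mulL2 (lattice_char k) u) = mulL2 (lattice_char k) (fourier_op V L u)" if "u \<in> fourier ` V" for k u
      using that by (auto simp: fourier_op_fourier sh Ls simp flip: fourier_shift)
    show "is_adjoint_on (fourier ` V) (fourier_op V L) (fourier_op V M)"
      unfolding is_adjoint_on_def
      using bounded_operator_fourier_op[OF sub Mb] M(1)
      by (auto simp: fourier_op_fourier cinner_fourier is_adjoint_on_def)
    show "fourier_op V L (fourier_op V M u) = fourier_op V M (fourier_op V L u)" if "u \<in> fourier ` V" for u
      using that by (auto simp: fourier_op_fourier LV M(2))
  qed
  then show ?thesis using that by blast
qed

lemma finitely_generated_fourier_image:
  fixes V :: "(real ^ 'd) L2 set"
  assumes "finitely_generated V"
  obtains n :: nat and f where "\<And>i. i < n \<Longrightarrow> f i \<in> fourier ` V"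
    "fourier ` V \<subseteq> closure (L2.span {mulL2 (lattice_char k) (f i) | k i. i < n})"
proof -
  obtain \<Phi> where \<Phi>: "finite \<Phi>" "V = closure (L2.span {Defs.shift k \<phi> | k \<phi>. \<phi> \<in> \<Phi>})"
    using assms unfolding finitely_generated_def by blast
  obtain g where g: "bij_betw g {0..<card \<Phi>} \<Phi>" using ex_bij_betw_nat_finite[OF \<Phi>(1)] by blast
  define n where "n = card \<Phi>"
  define f where "f i = fourier (g i)" for i
  let ?G = "{Defs.shift k \<phi> | k \<phi>. \<phi> \<in> \<Phi>}" and ?H = "{mulL2 (lattice_char k) (f i) | k i. i < n}"
  have "f i \<in> fourier ` V" if "i < n" for i
  proof -
    have "g i \<in> \<Phi>" using bij_betwE[OF g] that by (simp add: n_def)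
    then have "Defs.shift 0 (g i) \<in> ?G" by blast
    then have "Defs.shift 0 (g i) \<in> V"
      unfolding \<Phi>(2) by (intro subsetD[OF closure_subset] L2.span_base)
    moreover have "fourier (Defs.shift 0 (g i)) = f i"
      unfolding fourier_shift f_def char_0[abs_def] by (rule mulL2_one)
    ultimately show ?thesis by (metis imageI)
  qed
  moreover have "fourier ` V \<subseteq> closure (L2.span ?H)"
  proof
    fix u assume "u \<in> fourier ` V"
    then obtain v where v: "v \<in> V" "u = fourier v" by blast
    then obtain x where x: "\<And>k. x k \<in> L2.span ?G" "x \<longlonglongrightarrow> v"
      unfolding \<Phi>(2) closure_sequential by blast
    have "fourier y \<in> L2.span ?H" if "y \<in> L2.span ?G" for y
      using that
    proof (induction rule: L2.span_induct_alt)
      case base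
      show ?case by (simp add: L2.span_zero)
    next
      case (step c a b)
      then obtain k \<phi> where a: "a = Defs.shift k \<phi>" "\<phi> \<in> \<Phi>" by blast
      have "\<phi> \<in> g ` {0..<n}" using a(2) bij_betw_imp_surj_on[OF g] by (simp add: n_def)
      then obtain i where i: "i < n" "\<phi> = g i" by auto
      have "fourier a \<in> ?H" unfolding a(1) fourier_shift i(2) f_def[symmetric] using i(1) by blast
      then have "c *\<^sub>C fourier a + fourier b \<in> L2.span ?H"
        by (intro L2.span_add L2.span_scale step.IH L2.span_base)
      then show ?case by (simp only: fourier_lincomb)
    qed
    then have "\<And>k. fourier (x k) \<in> L2.span ?H" using x(1) by blast
    then show "u \<in> closure (L2.span ?H)"
      unfolding closure_sequential v(2)
      by (intro exI[of _ "\<lambda>k. fourier (x k)"] conjI allI fourier_tendsto[OF x(2)])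
  qed
  ultimately show ?thesis using that by blast
qed

lemma eigenspace_decomposition:
  fixes V :: "(real ^ 'd) L2 set"
  assumes op: "normal_op (fourier ` V) L M" and fg: "finitely_generated V"
  obtains n m where "\<And>j. j < n \<Longrightarrow> multiplier (m j)"
    "\<And>i j \<omega>. i < n \<Longrightarrow> j < n \<Longrightarrow> i \<noteq> j \<Longrightarrow> m i \<omega> \<noteq> m j \<omega>"
    "fourier ` V \<subseteq> normal_op.eig_sum (fourier ` V) L n m"
proof -
  interpret normal_op "fourier ` V" L M by (rule op)
  obtain n :: nat and f where f: "\<And>i. i < n \<Longrightarrow> f i \<in> fourier ` V"
    "fourier ` V \<subseteq> closure (L2.span {mulL2 (lattice_char k) (f i) | k i. i < n})"
    by (rule finitely_generated_fourier_image[OF fg]) (rule that)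
  obtain e where e: "\<And>i. i < n \<Longrightarrow> e i \<in> fourier ` V" "fibre_orthonormal n e"
    "\<And>i. i < n \<Longrightarrow> fibre_expansion n e (f i) = f i"
    by (rule Gram_Schmidt[where n=n and f=f, OF U f(1)]) (assumption, rule that)
  have expand: "fibre_expansion n e u = u" if "u \<in> fourier ` V" for u
    by (rule Gram_Schmidt_closure[OF e(2,3) f(2) that])
  obtain K where K: "K \<ge> 0" "\<And>u. u \<in> fourier ` V \<Longrightarrow> norm (L u) \<le> K * norm u"
    using L_bounded by blast
  show ?thesis
    by (rule distinct_eigenvalue_functions[where n=n and e=e and K=K]; (fact e expand K)?) (rule that)
qed

text \<open>\<open>Lambda_op a\<close> maps \<open>V\<close> to itself, because the image of \<open>V\<close> is invariant under the symbol of \<open>a\<close>.\<close>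

lemma s_eigenspace_symbol:
  fixes V :: "(real ^ 'd) L2 set"
  assumes V: "shift_invariant V" and op: "normal_op (fourier ` V) (fourier_op V L) M"
    and m: "multiplier m" "AE \<omega> in lborel. \<omega> \<in> unit_cube \<longrightarrow> rep_L2 (fourier_series a) \<omega> = m \<omega>"
  shows "s_eigenspace V L a = {f\<in>V. fourier f \<in> normal_op.eig (fourier ` V) (fourier_op V L) m}"
proof -
  interpret normal_op "fourier ` V" "fourier_op V L" M by (rule op)
  have "L f = Lambda_op a f \<longleftrightarrow> fourier f \<in> eig m" if f: "f \<in> V" for f
  proof -
    have "mulL2 m (fourier f) \<in> fourier ` V" by (rule U_mult[OF m(1)]) (use f in blast)
    then obtain g where g: "fourier g = mulL2 m (fourier f)" by (metis imageE)
    have "Lambda_op a f = g" by (rule Lambda_op_eq[OF m g])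
    then have "L f = Lambda_op a f \<longleftrightarrow> fourier (L f) = mulL2 m (fourier f)"
      by (simp add: fourier_inject flip: g)
    then show ?thesis using f by (simp add: eig_def fourier_op_fourier)
  qed
  then show ?thesis unfolding s_eigenspace_def by blast
qed

lemma s_eigenspace_properties:
  fixes V :: "(real ^ 'd) L2 set"
  assumes V: "shift_invariant V" and op: "normal_op (fourier ` V) (fourier_op V L) M"
    and a: "bounded_spectrum a"
  shows "L2.subspace (s_eigenspace V L a)"
    and "bounded_spectrum b \<Longrightarrow> s_eigenspace V L a \<inter> s_eigenspace V L b = {0} \<Longrightarrow>
      f \<in> s_eigenspace V L a \<Longrightarrow> g \<in> s_eigenspace V L b \<Longrightarrow> cinner f g = 0"
proof -
  interpret normal_op "fourier ` V" "fourier_op V L" M by (rule op)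
  obtain m where m: "multiplier m" "AE \<omega> in lborel. \<omega> \<in> unit_cube \<longrightarrow> rep_L2 (fourier_series a) \<omega> = m \<omega>"
    using bounded_spectrum_multiplier[OF a] by blast
  note A = s_eigenspace_symbol[OF V op m]
  have sub: "L2.subspace V" using V by (simp add: shift_invariant_def)
  note es = eig_subspace[OF m(1)]
  show "L2.subspace (s_eigenspace V L a)"
    unfolding A L2.subspace_def
    using L2.subspace_0[OF sub] L2.subspace_add[OF sub] L2.subspace_scale[OF sub]
      L2.subspace_0[OF es] L2.subspace_add[OF es] L2.subspace_scale[OF es]
    by (auto simp: fourier_add fourier_scaleC)
  assume b: "bounded_spectrum b" and triv: "s_eigenspace V L a \<inter> s_eigenspace V L b = {0}"
    and f: "f \<in> s_eigenspace V L a" and g: "g \<in> s_eigenspace V L b"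
  obtain m' where m': "multiplier m'" "AE \<omega> in lborel. \<omega> \<in> unit_cube \<longrightarrow> rep_L2 (fourier_series b) \<omega> = m' \<omega>"
    using bounded_spectrum_multiplier[OF b] by blast
  note B = s_eigenspace_symbol[OF V op m']
  have "eig m \<inter> eig m' = {0}"
  proof (intro equalityI subsetI)
    fix u assume u: "u \<in> eig m \<inter> eig m'"
    then obtain h where h: "h \<in> V" "u = fourier h" using eig_sub[of u m] by blast
    then have "h \<in> s_eigenspace V L a \<inter> s_eigenspace V L b" using u unfolding A B by blast
    then show "u \<in> {0}" using triv h(2) by simp
  qed (use L2.subspace_0[OF es] L2.subspace_0[OF eig_subspace[OF m'(1)]] in auto)
  then have "cinner (fourier f) (fourier g) = 0"
    using f g unfolding A B by (intro eig_orthogonal[OF m(1) m'(1)]) auto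
  then show "cinner f g = 0" by (simp add: cinner_fourier)
qed

lemma orthogonal_sum_zero:
  assumes "finite I" "\<And>i j. i \<in> I \<Longrightarrow> j \<in> I \<Longrightarrow> i \<noteq> j \<Longrightarrow> cinner (d i) (d j) = 0"
    and "(\<Sum>i\<in>I. d i) = 0" "j \<in> I"
  shows "d j = 0"
proof -
  have "0 = cinner (\<Sum>i\<in>I. d i) (d j)" by (simp add: assms(3))
  also have "\<dots> = (\<Sum>i\<in>I. if i = j then cinner (d j) (d j) else 0)"
    unfolding cinner_sum_left using assms(2,4) by (intro sum.cong) auto
  also have "\<dots> = cinner (d j) (d j)" using assms(1,4) by simp
  finally show ?thesis by (simp add: cinner_self)
qed

text \<open>Of the eigenspaces of the distinct eigenvalue functions the nonzero ones are kept and numbered by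
  \<open>{1..card J}\<close>; there is at least one because \<open>V\<close> is not zero.\<close>

theorem normal_s_diagonalizable:
  fixes V :: "(real ^ 'd) L2 set"
  assumes V: "shift_invariant V" and fg: "finitely_generated V" and V0: "V \<noteq> {0}"
    and op: "normal_op (fourier ` V) (fourier_op V L) M"
  shows "s_diagonalizable V L"
proof -
  interpret normal_op "fourier ` V" "fourier_op V L" M by (rule op)
  have sub: "L2.subspace V" using V by (simp add: shift_invariant_def)
  obtain n m where m: "\<And>j. j < n \<Longrightarrow> multiplier (m j)"
    and distinct: "\<And>i j \<omega>. i < n \<Longrightarrow> j < n \<Longrightarrow> i \<noteq> j \<Longrightarrow> m i \<omega> \<noteq> m j \<omega>"
    and sum: "fourier ` V \<subseteq> eig_sum n m"
    using eigenspace_decomposition[OF op fg] by blast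
  have "\<forall>j. \<exists>a. j < n \<longrightarrow> bounded_spectrum a \<and>
      (AE \<omega> in lborel. \<omega> \<in> unit_cube \<longrightarrow> rep_L2 (fourier_series a) \<omega> = m j \<omega>)"
  proof
    fix j
    show "\<exists>a. j < n \<longrightarrow> bounded_spectrum a \<and>
      (AE \<omega> in lborel. \<omega> \<in> unit_cube \<longrightarrow> rep_L2 (fourier_series a) \<omega> = m j \<omega>)"
    proof (cases "j < n")
      case True
      obtain a where "bounded_spectrum a" "AE \<omega> in lborel. \<omega> \<in> unit_cube \<longrightarrow> rep_L2 (fourier_series a) \<omega> = m j \<omega>"
        using multiplier_is_fourier_series[OF m[OF True]] .
      then show ?thesis by blast
    qed simp
  qed
  then have "\<exists>s. \<forall>j. j < n \<longrightarrow> bounded_spectrum (s j) \<and>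
      (AE \<omega> in lborel. \<omega> \<in> unit_cube \<longrightarrow> rep_L2 (fourier_series (s j)) \<omega> = m j \<omega>)"
    by (rule choice)
  then obtain s where s: "\<And>j. j < n \<Longrightarrow> bounded_spectrum (s j)"
    "\<And>j. j < n \<Longrightarrow> AE \<omega> in lborel. \<omega> \<in> unit_cube \<longrightarrow> rep_L2 (fourier_series (s j)) \<omega> = m j \<omega>"
    by blast
  have W: "s_eigenspace V L (s j) = {f\<in>V. fourier f \<in> eig (m j)}" if "j < n" for j
    by (rule s_eigenspace_symbol[OF V op m[OF that] s(2)[OF that]])
  define J where "J = {j. j < n \<and> eig (m j) \<noteq> {0}}"
  have J: "finite J" by (simp add: J_def)
  obtain b where b: "bij_betw b {1..card J} J" using ex_bij_betw_nat_finite_1[OF J] by blast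
  have bJ: "b i < n" "eig (m (b i)) \<noteq> {0}" if "i \<in> {1..card J}" for i
    using bij_betw_apply[OF b that] by (simp_all add: J_def)
  have b_inj: "b i \<noteq> b j" if "i \<in> {1..card J}" "j \<in> {1..card J}" "i \<noteq> j" for i j
    using inj_onD[OF bij_betw_imp_inj_on[OF b] _ that(1,2)] that(3) by blast
  have decomp: "\<exists>v. (\<forall>i\<in>{1..card J}. v i \<in> s_eigenspace V L (s (b i))) \<and> f = (\<Sum>i\<in>{1..card J}. v i)"
    if f: "f \<in> V" for f
  proof -
    have "fourier f \<in> eig_sum n m" using sum f by blast
    then obtain w where w: "fourier f = (\<Sum>j<n. w j)" "\<And>j. j < n \<Longrightarrow> w j \<in> eig (m j)"
      unfolding eig_sum_def by blast
    have "\<forall>j. \<exists>v. j < n \<longrightarrow> v \<in> V \<and> w j = fourier v"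
      using w(2) eig_sub by blast
    then obtain v where v: "\<And>j. j < n \<Longrightarrow> v j \<in> V" "\<And>j. j < n \<Longrightarrow> w j = fourier (v j)" by metis
    have "(\<Sum>j<n. w j) = (\<Sum>j\<in>J. w j)"
      by (rule sum.mono_neutral_right) (use w(2) in \<open>auto simp: J_def\<close>)
    also have "\<dots> = (\<Sum>i\<in>{1..card J}. w (b i))"
      using sum.reindex_bij_betw[OF b, of w] by simp
    also have "\<dots> = (\<Sum>i\<in>{1..card J}. fourier (v (b i)))"
      by (intro sum.cong refl v(2) bJ)
    finally have "fourier f = fourier (\<Sum>i\<in>{1..card J}. v (b i))" by (simp only: w(1) fourier_sum)
    then have "f = (\<Sum>i\<in>{1..card J}. v (b i))" by (simp only: fourier_inject)
    moreover have "v (b i) \<in> s_eigenspace V L (s (b i))" if "i \<in> {1..card J}" for i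
      using bJ(1)[OF that] v w(2) by (simp add: W)
    ultimately show ?thesis by (intro exI[of _ "\<lambda>i. v (b i)"]) simp
  qed
  have "s_diagonalization V L (card J) (\<lambda>i. s (b i))"
    unfolding s_diagonalization_def
  proof (intro conjI ballI)
    show "1 \<le> card J"
    proof (rule ccontr)
      assume "\<not> 1 \<le> card J"
      then have "{1..card J} = {}" by simp
      then have "V \<subseteq> {0}" using decomp by fastforce
      then show False using V0 L2.subspace_0[OF sub] by blast
    qed
    fix i assume i: "i \<in> {1..card J}"
    have "s_eigenspace V L (s (b i)) \<noteq> {0}"
    proof -
      obtain u where u: "u \<in> eig (m (b i))" "u \<noteq> 0"
        using bJ[OF i] L2.subspace_0[OF eig_subspace[OF m]] by blast
      then obtain f where f: "f \<in> V" "u = fourier f" using eig_sub by blast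
      then have "f \<in> s_eigenspace V L (s (b i))" "f \<noteq> 0" using u bJ(1)[OF i] by (auto simp: W)
      then show ?thesis by blast
    qed
    then show "s_eigenvalue V L (s (b i))"
      using s(1)[OF bJ(1)[OF i]] by (simp add: s_eigenvalue_def)
  next
    let ?I = "{1..card J}" and ?W = "\<lambda>i. s_eigenspace V L (s (b i))"
    have subW: "L2.subspace (?W i)" if "i \<in> ?I" for i
      by (rule s_eigenspace_properties(1)[OF V op s(1)[OF bJ(1)[OF that]]])
    have orth: "cinner f g = 0" if ij: "i \<in> ?I" "j \<in> ?I" "i \<noteq> j" and fg: "f \<in> ?W i" "g \<in> ?W j" for i j f g
    proof -
      have "cinner (fourier f) (fourier g) = 0"
        by (rule eig_orth[OF m distinct bJ(1)[OF ij(1)] bJ(1)[OF ij(2)] b_inj[OF ij]])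
           (use fg bJ(1)[OF ij(1)] bJ(1)[OF ij(2)] in \<open>auto simp: W\<close>)
      then show ?thesis by (simp add: cinner_fourier)
    qed
    show "is_direct_sum V ?I ?W"
      unfolding is_direct_sum_def bij_betw_def
    proof
      show "inj_on (\<lambda>g. \<Sum>j\<in>?I. g j) (Pi\<^sub>E ?I ?W)"
      proof (rule inj_onI)
        fix g h assume g: "g \<in> Pi\<^sub>E ?I ?W" and h: "h \<in> Pi\<^sub>E ?I ?W"
          and eq: "(\<Sum>j\<in>?I. g j) = (\<Sum>j\<in>?I. h j)"
        have gh: "g i - h i \<in> ?W i" if "i \<in> ?I" for i
          by (rule L2.subspace_diff[OF subW[OF that] PiE_mem[OF g that] PiE_mem[OF h that]])
        have "g j - h j = 0" if "j \<in> ?I" for j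
        proof (rule orthogonal_sum_zero[of ?I "\<lambda>j. g j - h j" j])
          show "(\<Sum>i\<in>?I. g i - h i) = 0" using eq by (simp add: sum_subtractf)
          fix i j assume ij: "i \<in> ?I" "j \<in> ?I" "i \<noteq> j"
          show "cinner (g i - h i) (g j - h j) = 0"
            by (rule orth[OF ij gh[OF ij(1)] gh[OF ij(2)]])
        qed (use that in auto)
        then show "g = h" by (intro PiE_ext[OF g h]) auto
      qed
      show "(\<lambda>g. \<Sum>j\<in>?I. g j) ` Pi\<^sub>E ?I ?W = V"
      proof (intro equalityI subsetI)
        fix f assume "f \<in> (\<lambda>g. \<Sum>j\<in>?I. g j) ` Pi\<^sub>E ?I ?W"
        then obtain g where g: "g \<in> Pi\<^sub>E ?I ?W" "f = (\<Sum>j\<in>?I. g j)" by blast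
        have "g j \<in> V" if "j \<in> ?I" for j
          using PiE_mem[OF g(1) that] by (simp add: s_eigenspace_def)
        then show "f \<in> V" unfolding g(2) by (rule L2.subspace_sum[OF sub])
      next
        fix f assume "f \<in> V"
        then obtain v where v: "\<forall>i\<in>?I. v i \<in> ?W i" "f = (\<Sum>i\<in>?I. v i)" using decomp by blast
        have "restrict v ?I \<in> Pi\<^sub>E ?I ?W" using v(1) by auto
        moreover have "f = (\<Sum>j\<in>?I. restrict v ?I j)" using v(2) by simp
        ultimately show "f \<in> (\<lambda>g. \<Sum>j\<in>?I. g j) ` Pi\<^sub>E ?I ?W" by blast
      qed
    qed
  qed
  then show ?thesis unfolding s_diagonalizable_def by blast
qed

theorem theorem6p16:
  fixes V :: "(real ^ 'd) L2 set"
    and L :: "(real ^ 'd) L2 \<Rightarrow> (real ^ 'd) L2"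
  assumes "shift_invariant V" and "finitely_generated V" and "V \<noteq> {0}"
    and "shift_preserving V L"
    and "normal_on V L"
  shows "s_diagonalizable V L \<and>
    (\<forall>m a. s_diagonalization V L m a \<longrightarrow>
      (\<forall>f\<in>V. L f = (\<Sum>j=1..m. Lambda_op (a j) (orth_proj (s_eigenspace V L (a j)) f))))"
proof (intro conjI allI impI ballI)
  obtain M where op: "normal_op (fourier ` V) (fourier_op V L) M"
    using normal_op_fourier[OF assms(1,4,5)] by blast
  show "s_diagonalizable V L" by (rule normal_s_diagonalizable[OF assms(1,2,3) op])
  fix m a f
  assume diag: "s_diagonalization V L m a" and f: "f \<in> V"
  let ?I = "{1..m}" and ?W = "\<lambda>j. s_eigenspace V L (a j)"
  have bs: "bounded_spectrum (a j)" if "j \<in> ?I" for j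
    using diag that by (simp add: s_diagonalization_def s_eigenvalue_def)
  have bij: "bij_betw (\<lambda>g. \<Sum>j\<in>?I. g j) (Pi\<^sub>E ?I ?W) V"
    using diag by (simp add: s_diagonalization_def is_direct_sum_def)
  have sub: "L2.subspace (?W j)" if "j \<in> ?I" for j
    by (rule s_eigenspace_properties(1)[OF assms(1) op bs[OF that]])
  have triv: "?W i \<inter> ?W j = {0}" if ij: "i \<in> ?I" "j \<in> ?I" "i \<noteq> j" for i j
  proof (intro equalityI subsetI)
    fix h assume h: "h \<in> ?W i \<inter> ?W j"
    \<comment> \<open>an element \<open>h\<close> of two summands has two representations, one concentrated in each\<close>
    define single where "single k = restrict (\<lambda>l. if l = k then h else 0) ?I" for k
    have mem: "single k \<in> Pi\<^sub>E ?I ?W" and sum: "(\<Sum>l\<in>?I. single k l) = h" if "k \<in> {i, j}" for k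
    proof -
      show "single k \<in> Pi\<^sub>E ?I ?W"
        unfolding single_def using h that L2.subspace_0[OF sub] by (intro restrict_PiE_iff[THEN iffD2]) auto
      have "(\<Sum>l\<in>?I. single k l) = (\<Sum>l\<in>?I. if l = k then h else 0)" by (simp add: single_def)
      also have "\<dots> = h" using that ij by auto
      finally show "(\<Sum>l\<in>?I. single k l) = h" .
    qed
    have "single i = single j"
      by (rule inj_onD[OF bij_betw_imp_inj_on[OF bij]]) (use mem sum in auto)
    then have "single i i = single j i" by simp
    then show "h \<in> {0}" using ij by (simp add: single_def)
  qed (use L2.subspace_0[OF sub[OF ij(1)]] L2.subspace_0[OF sub[OF ij(2)]] in auto)
  have orth: "cinner u v = 0" if "i \<in> ?I" "j \<in> ?I" "i \<noteq> j" "u \<in> ?W i" "v \<in> ?W j" for i j u v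
    by (rule s_eigenspace_properties(2)[OF assms(1) op bs[OF that(1)] bs[OF that(2)] triv[OF that(1-3)] that(4,5)])
  have "f \<in> (\<lambda>g. \<Sum>j\<in>?I. g j) ` Pi\<^sub>E ?I ?W" using bij f by (simp add: bij_betw_def)
  then obtain g where g: "g \<in> Pi\<^sub>E ?I ?W" "f = (\<Sum>j\<in>?I. g j)" by blast
  have gW: "g j \<in> ?W j" if "j \<in> ?I" for j using g(1) that by (rule PiE_mem)
  \<comment> \<open>the summand \<open>g j\<close> has the defining property of the orthogonal projection\<close>
  have perp: "cinner (f - g j) h = 0" if j: "j \<in> ?I" and h: "h \<in> ?W j" for j h
  proof -
    have "f - g j = (\<Sum>i\<in>?I - {j}. g i)" unfolding g(2) using j by (simp add: sum.remove)
    moreover have "cinner (g i) h = 0" if "i \<in> ?I - {j}" for i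
      using that by (intro orth[OF _ j _ gW h]) auto
    ultimately show ?thesis by (simp only: cinner_sum_left) (rule sum.neutral, blast)
  qed
  have proj: "orth_proj (?W j) f = g j" if j: "j \<in> ?I" for j
    unfolding orth_proj_def
  proof (rule the_equality, intro conjI ballI)
    show "g j \<in> ?W j" by (rule gW[OF j])
    show "cinner (f - g j) h = 0" if "h \<in> ?W j" for h by (rule perp[OF j that])
  next
    fix k assume k: "k \<in> ?W j \<and> (\<forall>h\<in>?W j. cinner (f - k) h = 0)"
    have d: "g j - k \<in> ?W j" by (rule L2.subspace_diff[OF sub[OF j] gW[OF j]]) (use k in simp)
    have "cinner (g j - k) (g j - k) = cinner (f - k) (g j - k) - cinner (f - g j) (g j - k)"
      by (simp add: cinner_diff_left)
    also have "\<dots> = 0" using k d perp[OF j d] by simp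
    finally show "k = g j" by (simp add: cinner_self)
  qed
  have V: "L2.subspace V" using assms(1) by (simp add: shift_invariant_def)
  have Lb: "\<And>u v. u \<in> V \<Longrightarrow> v \<in> V \<Longrightarrow> L (u + v) = L u + L v" "\<And>c u. u \<in> V \<Longrightarrow> L (c *\<^sub>C u) = c *\<^sub>C L u"
    using assms(4) by (auto simp: shift_preserving_def bounded_operator_on_def)
  have L0: "L 0 = 0" using Lb(2)[OF L2.subspace_0[OF V], of 0] by simp
  have Lsum: "L (\<Sum>i\<in>A. g i) = (\<Sum>i\<in>A. L (g i))" if "finite A" "A \<subseteq> ?I" for A
    using that
  proof (induction A rule: finite_induct)
    case (insert i A)
    have gV: "g k \<in> V" if "k \<in> ?I" for k using gW[OF that] by (simp add: s_eigenspace_def)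
    then have "(\<Sum>i\<in>A. g i) \<in> V" using insert.prems by (intro L2.subspace_sum[OF V]) auto
    then show ?case using insert gV by (simp add: Lb(1))
  qed (simp add: L0)
  have "L f = (\<Sum>j\<in>?I. L (g j))" unfolding g(2) by (rule Lsum) auto
  also have "\<dots> = (\<Sum>j\<in>?I. Lambda_op (a j) (orth_proj (?W j) f))"
  proof (rule sum.cong[OF refl])
    fix j assume j: "j \<in> ?I"
    have "L (g j) = Lambda_op (a j) (g j)" using gW[OF j] by (simp add: s_eigenspace_def)
    then show "L (g j) = Lambda_op (a j) (orth_proj (?W j) f)" by (simp only: proj[OF j])
  qed
  finally show "L f = (\<Sum>j=1..m. Lambda_op (a j) (orth_proj (?W j) f))" .
qed

end
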